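(* Fix an integer $M\ge1$ and let $S_n$ be the number of swaps (as defined in the context) used by Yaroslavskiy's dual-pivot Quicksort with Insertionsort threshold $M$ on a uniformly random permutation of $\{1,\dots,n\}$. Then \[ \frac{S_n-\mathbb{E}[S_n]}{n}\longrightarrow S^*\qquad(n\to\infty), \] in distribution and with convergence of second moments, where the law of $S^*$ is the unique solution, among distributions with $\mathbb{E}[X]=0$ and $\mathbb{E}[X^2]<\infty$, of \[ X\overset{d}{=}D_1+(D_1+D_2)D_3+\sum_{j=1}^3\Bigl(D_jX^{(j)}+\tfrac35D_j\ln D_j\Bigr), \] with $(D_1,D_2,D_3),X^{(1)},X^{(2)},X^{(3)}$ independent and each $X^{(j)}$ distributed as $X$. Moreover $\mathrm{Var}(S_n)\sim\sigma_S^2n^2$ with $\sigma_S^2=\tfrac{7}{10}-\tfrac{3}{50}\pi^2=0.10782\ldots$.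
   Context: $(D_1,D_2,D_3)=(U_{(1)},U_{(2)}-U_{(1)},1-U_{(2)})$ for the order statistics $U_{(1)}\le U_{(2)}$ of two independent uniform $[0,1]$ variables (uniform distribution on the standard 2-simplex). Convention: $x\ln x=0$ for $x=0$. Yaroslavskiy's dual-pivot Quicksort with threshold $M$: procedure $\mathrm{QS}(A,\mathit{left},\mathit{right})$, initial call $\mathrm{QS}(A,1,n)$: (1) if $\mathit{right}-\mathit{left}<M$, run InsertionSort on $A[\mathit{left}..\mathit{right}]$ and return; (2) else (partitioning step) if $A[\mathit{left}]>A[\mathit{right}]$ set $p\gets A[\mathit{right}],q\gets A[\mathit{left}]$, else $p\gets A[\mathit{left}],q\gets A[\mathit{right}]$; set $\ell\gets\mathit{left}+1$, $g\gets\mathit{right}-1$, $k\gets\ell$; (3) while $k\le g$: if $A[k]<p$ then swap $A[k],A[\ell]$, $\ell\gets\ell+1$; else if $A[k]\ge q$ then {while ($A[g]>q$ and $k<g$) do $g\gets g-1$; if $A[g]\ge p$ swap $A[k],A[g]$, else swap $A[k],A[g]$, swap $A[k],A[\ell]$, $\ell\gets\ell+1$; $g\gets g-1$}; $k\gets k+1$; (4) $\ell\gets\ell-1$, $g\gets g+1$, $A[\mathit{left}]\gets A[\ell]$, $A[\ell]\gets p$, $A[\mathit{right}]\gets A[g]$, $A[g]\gets q$; (5) recursively call QS on $(\mathit{left},\ell-1)$, $(\ell+1,g-1)$, $(g+1,\mathit{right})$. InsertionSort is standard straight insertion sort (using shifts, no swaps). Swap count: every swap executed in step (3) counts one, plus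 two swaps per partitioning step for step (4); nothing else is counted. *)

theory Defs
  imports "HOL-Probability.Probability" "HOL-Library.Landau_Symbols"
begin

text \<open>
  Arrays are total functions on integer indices; only the cells in the range being sorted matter.
  Integers rather than naturals are used so that \<open>right - left\<close> is not truncated for the
  empty ranges on which Quicksort is called recursively.
\<close>

type_synonym 'a array = "int \<Rightarrow> 'a"

definition swap_cells :: "'a array \<Rightarrow> int \<Rightarrow> int \<Rightarrow> 'a array" where
  "swap_cells A i j = A(i := A j, j := A i)"

text \<open>
  Straight insertion: the entries above \<open>x\<close> are shifted one cell to the right, starting at
  cell \<open>j\<close> and going down, but not below \<open>left\<close>.
\<close>

function shift_insert :: "int \<Rightarrow> 'a::linorder \<Rightarrow> int \<Rightarrow> 'a array \<Rightarrow> 'a array" where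
  "shift_insert left x j A =
     (if left \<le> j \<and> A j > x then shift_insert left x (j - 1) (A(j + 1 := A j))
      else A(j + 1 := x))"
  by auto
termination by (relation "Wellfounded.measure (\<lambda>(left, x, j, A). nat (j + 1 - left))") auto

declare shift_insert.simps [simp del]

definition insertion_sort :: "'a::linorder array \<Rightarrow> int \<Rightarrow> int \<Rightarrow> 'a array" where
  "insertion_sort A left right =
     fold (\<lambda>i B. shift_insert left (B i) (i - 1) B) [left + 1..right] A"

text \<open>The inner while loop, moving \<open>g\<close> to the left.\<close>

function scan_left :: "'a::linorder array \<Rightarrow> 'a \<Rightarrow> int \<Rightarrow> int \<Rightarrow> int" where
  "scan_left A q k g = (if A g > q \<and> k < g then scan_left A q k (g - 1) else g)"
  by auto
termination by (relation "Wellfounded.measure (\<lambda>(A, q, k, g). nat (g - k))") auto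

declare scan_left.simps [simp del]

lemma scan_left_le: "scan_left A q k g \<le> g"
  by (induction A q k g rule: scan_left.induct) (subst scan_left.simps, auto)

lemma scan_left_ge: "k \<le> g \<Longrightarrow> k \<le> scan_left A q k g"
  by (induction A q k g rule: scan_left.induct) (subst scan_left.simps, auto)

text \<open>
  The outer while loop; the last argument \<open>s\<close> is the running number of executed swaps.
  The result consists of the array, \<open>l\<close>, \<open>g\<close> and the number of swaps.
\<close>

function partition_loop ::
  "'a::linorder \<Rightarrow> 'a \<Rightarrow> 'a array \<Rightarrow> int \<Rightarrow> int \<Rightarrow> int \<Rightarrow> nat \<Rightarrow> 'a array \<times> int \<times> int \<times> nat" where
  "partition_loop p q A l k g s =
     (if k \<le> g then
        if A k < p then partition_loop p q (swap_cells A k l) (l + 1) (k + 1) g (s + 1)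
        else if A k \<ge> q then
          (let g' = scan_left A q k g in
             if A g' \<ge> p then partition_loop p q (swap_cells A k g') l (k + 1) (g' - 1) (s + 1)
             else partition_loop p q (swap_cells (swap_cells A k g') k l)
                    (l + 1) (k + 1) (g' - 1) (s + 2))
        else partition_loop p q A l (k + 1) g s
      else (A, l, g, s))"
  by auto
termination
proof (relation "Wellfounded.measure (\<lambda>(p, q, A, l, k, g, s). nat (g + 1 - k))", goal_cases)
  case (3 p q A l k g s x)
  then show ?case using scan_left_le[of A q k g] by auto
next
  case (4 p q A l k g s x)
  then show ?case using scan_left_le[of A q k g] by auto
qed auto

declare partition_loop.simps [simp del]

text \<open>
  One partitioning step: the array, the final positions of the two pivots, and the number of
  swaps, including the two swaps that are charged for moving the pivots to their positions.
\<close>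

definition yaroslavskiy_partition ::
  "'a::linorder array \<Rightarrow> int \<Rightarrow> int \<Rightarrow> 'a array \<times> int \<times> int \<times> nat" where
  "yaroslavskiy_partition A left right =
     (let (p, q) = (if A left > A right then (A right, A left) else (A left, A right));
          (B, l0, g0, s) = partition_loop p q A (left + 1) (left + 1) (right - 1) 0;
          l = l0 - 1;
          g = g0 + 1;
          B1 = B(left := B l);
          B2 = B1(l := p);
          B3 = B2(right := B2 g);
          B4 = B3(g := q)
      in (B4, l, g, s + 2))"

lemma partition_loop_bounds:
  assumes "partition_loop p q A l k g s = (B, l', g', s')"
    and "left < l" "l \<le> k" "k = left + 1 \<or> k \<le> right" "g < right" "left \<le> g + 1"
  shows "left < l' \<and> (l' = left + 1 \<or> l' \<le> right) \<and> g' < right \<and> left \<le> g' + 1"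
  using assms
proof (induction p q A l k g s rule: partition_loop.induct)
  case (1 p q A l k g s)
  show ?case
  proof (cases "k \<le> g")
    case False
    then show ?thesis using "1.prems" by (subst (asm) partition_loop.simps) auto
  next
    case True
    define h where "h = scan_left A q k g"
    have h: "k \<le> h" "h \<le> g"
      using True scan_left_le[of A q k g] scan_left_ge[of k g A q] by (auto simp: h_def)
    consider (small) "A k < p"
      | (one) "\<not> A k < p" "A k \<ge> q" "A h \<ge> p"
      | (two) "\<not> A k < p" "A k \<ge> q" "\<not> A h \<ge> p"
      | (medium) "\<not> A k < p" "\<not> A k \<ge> q"
      by blast
    then show ?thesis
    proof cases
      case small
      show ?thesis
      proof (rule "1.IH"(1))
        show "partition_loop p q (swap_cells A k l) (l + 1) (k + 1) g (s + 1) = (B, l', g', s')"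
          using "1.prems"(1) True small by (subst (asm) partition_loop.simps) simp
      qed (use True small "1.prems" in auto)
    next
      case one
      show ?thesis
      proof (rule "1.IH"(2)[OF _ _ _ h_def])
        show "partition_loop p q (swap_cells A k h) l (k + 1) (h - 1) (s + 1) = (B, l', g', s')"
          using "1.prems"(1) True one by (subst (asm) partition_loop.simps) (simp add: h_def Let_def)
      qed (use True one "1.prems" h in auto)
    next
      case two
      show ?thesis
      proof (rule "1.IH"(3)[OF _ _ _ h_def])
        show "partition_loop p q (swap_cells (swap_cells A k h) k l) (l + 1) (k + 1) (h - 1) (s + 2)
                = (B, l', g', s')"
          using "1.prems"(1) True two by (subst (asm) partition_loop.simps) (simp add: h_def Let_def)
      qed (use True two "1.prems" h in auto)
    next
      case medium
      show ?thesis
      proof (rule "1.IH"(4))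
        show "partition_loop p q A l (k + 1) g s = (B, l', g', s')"
          using "1.prems"(1) True medium by (subst (asm) partition_loop.simps) simp
      qed (use True medium "1.prems" in auto)
    qed
  qed
qed

lemma yaroslavskiy_partition_bounds:
  assumes "yaroslavskiy_partition A left right = (B, l, g, s)" "left \<le> right"
  shows "left \<le> l" "l \<le> right" "left \<le> g" "g \<le> right"
proof -
  define p where "p = (if A left > A right then A right else A left)"
  define q where "q = (if A left > A right then A left else A right)"
  obtain B' l' g' s' where
    loop: "partition_loop p q A (left + 1) (left + 1) (right - 1) 0 = (B', l', g', s')"
    by (metis prod_cases4)
  have "l = l' - 1" "g = g' + 1"
    using assms(1) loop
    by (auto simp: yaroslavskiy_partition_def p_def q_def Let_def split: if_splits)
  moreover have "left < l' \<and> (l' = left + 1 \<or> l' \<le> right) \<and> g' < right \<and> left \<le> g' + 1"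
    by (rule partition_loop_bounds[OF loop]) (use assms(2) in auto)
  ultimately show "left \<le> l" "l \<le> right" "left \<le> g" "g \<le> right" using assms(2) by auto
qed

text \<open>The sorted array together with the number of swaps; Insertionsort contributes none.\<close>

function dual_pivot_qs ::
  "nat \<Rightarrow> 'a::linorder array \<Rightarrow> int \<Rightarrow> int \<Rightarrow> 'a array \<times> nat" where
  "dual_pivot_qs M A left right =
     (if right - left < int M then (insertion_sort A left right, 0)
      else
        let (B, l, g, s) = yaroslavskiy_partition A left right;
            (B1, s1) = dual_pivot_qs M B left (l - 1);
            (B2, s2) = dual_pivot_qs M B1 (l + 1) (g - 1);
            (B3, s3) = dual_pivot_qs M B2 (g + 1) right
        in (B3, s + s1 + s2 + s3))"
  by auto
termination
proof (relation "Wellfounded.measure (\<lambda>(M, A, left, right). nat (right + 1 - left))", goal_cases)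
  case 1
  show ?case by simp
next
  case (2 M A left right x B y l z g s)
  then show ?case using yaroslavskiy_partition_bounds[of A left right B l g s] by auto
next
  case (3 M A left right x B y l z g s)
  then show ?case using yaroslavskiy_partition_bounds[of A left right B l g s] by auto
next
  case (4 M A left right x B y l z g s)
  then show ?case using yaroslavskiy_partition_bounds[of A left right B l g s] by auto
qed

declare dual_pivot_qs.simps [simp del]

text \<open>A permutation \<open>\<pi>\<close> is the array with the entry \<open>\<pi> i\<close> in cell \<open>i\<close>.\<close>

definition random_perm :: "nat \<Rightarrow> (int \<Rightarrow> int) pmf" where
  "random_perm n = pmf_of_set {\<pi>. \<pi> permutes {1..int n}}"

definition swap_count :: "nat \<Rightarrow> nat \<Rightarrow> (int \<Rightarrow> int) \<Rightarrow> real" where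
  "swap_count M n \<pi> = real (snd (dual_pivot_qs M \<pi> 1 (int n)))"

definition spacings_law :: "(real \<times> real \<times> real) measure" where
  "spacings_law =
     distr (uniform_measure lborel {0..1} \<Otimes>\<^sub>M uniform_measure lborel {0..1}) borel
       (\<lambda>(u, v). (min u v, max u v - min u v, 1 - max u v))"

text \<open>
  The law of the right-hand side of the recursive distributional equation if the
  \<open>X_j\<close> have law \<open>\<mu>\<close>; independence is expressed by the product measure. The convention
  \<open>0 * ln 0 = 0\<close> holds in HOL for any value of \<open>ln 0\<close>.
\<close>

definition rde_rhs_law :: "real measure \<Rightarrow> real measure" where
  "rde_rhs_law \<mu> =
     distr (spacings_law \<Otimes>\<^sub>M (\<mu> \<Otimes>\<^sub>M (\<mu> \<Otimes>\<^sub>M \<mu>))) borel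
       (\<lambda>((d1, d2, d3), (x1, x2, x3)).
          d1 + (d1 + d2) * d3
          + (d1 * x1 + 3/5 * (d1 * ln d1))
          + (d2 * x2 + 3/5 * (d2 * ln d2))
          + (d3 * x3 + 3/5 * (d3 * ln d3)))"

definition rde_solution :: "real measure \<Rightarrow> bool" where
  "rde_solution \<mu> \<longleftrightarrow>
     real_distribution \<mu> \<and> integrable \<mu> (\<lambda>x. x\<^sup>2) \<and> (LINT x|\<mu>. x) = 0 \<and> \<mu> = rde_rhs_law \<mu>"

end

(*
  Conditionally on the pivots the three subarrays are independent uniformly random permutations,
  and the number of swaps of the partitioning step is concentrated, with mean square error O(n),
  around I_1 + (I_1 + I_2) I_3 / (n - 2), where I_1, I_2, I_3 are the block sizes.  The recurrence
  for the mean then gives E S_n = 3/5 n ln n + c n + o(n), so that (S_n - E S_n) / n satisfies a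
  distributional recurrence whose toll converges to
  T = D_1 + (D_1 + D_2) D_3 + 3/5 sum_j D_j ln D_j.

  Everything else is the contraction E (D_1^2 + D_2^2 + D_3^2) = 1/2.  For the variance it yields
  the limit 2 E T^2; this integral is computed in the coordinates w = U_(2), s = U_(1) / U_(2),
  which split T into a function of w plus w times a function of s, and reduces to zeta(2).  For
  the characteristic functions it acts on the distance |phi(t) - psi(t)| / t^2, which shows both
  their convergence and the uniqueness of the centred square integrable fixed point.
*)

theory Submission
  imports Defs "HOL-Real_Asymp.Real_Asymp"
begin

section \<open>The partitioning step\<close>

text \<open>Randomness preservation is not immediate from the algorithm. It rests on the fact that a
  partitioning step inspects entries only by comparing them with the two pivots, so relabelling the
  values inside a block commutes with it even though the relabelling need not be monotone.

  The coefficient 3/5 is forced: the mean toll is about n/2 and E (sum_j D_j ln D_j) = -5/6, so E T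
  = 0 holds for no other factor. The linear coefficient c of the mean stays unknown; it drops out of
  the toll because the spacings add up to 1.

  The distance |phi(t) - psi(t)| / t^2 is finite because the laws are centred with bounded second
  moments. No fixed point is constructed beforehand: the characteristic functions of the scaled
  counts form Cauchy sequences, tightness makes their limit a law, and that law solves the equation.
  Convergence of second moments does not go through uniform integrability; the limit of the
  variances and the second moment of a fixed point are both evaluated, and the numbers
  agree.\<close>

lemma swap_cells_eq_transpose: "swap_cells A i j = A \<circ> Transposition.transpose i j"
  by (auto simp: swap_cells_def Transposition.transpose_def fun_eq_iff)

lemma scan_left_stop:
  "k \<le> g \<Longrightarrow> scan_left A q k g = k \<or> A (scan_left A q k g) \<le> q"
  by (induction A q k g rule: scan_left.induct) (subst (1 2) scan_left.simps, auto)

lemma scan_left_skipped: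
  "scan_left A q k g < i \<Longrightarrow> i \<le> g \<Longrightarrow> q < A i"
proof (induction A q k g rule: scan_left.induct)
  case (1 A q k g)
  show ?case
  proof (cases "A g > q \<and> k < g")
    case True
    then show ?thesis using 1 by (cases "i = g") (auto simp: scan_left.simps[of A q k g])
  next
    case False
    then show ?thesis using 1(2,3) by (subst (asm) scan_left.simps) (auto split: if_splits)
  qed
qed

lemma scan_left_cong:
  assumes "\<And>i. k \<le> i \<Longrightarrow> i \<le> g \<Longrightarrow> (q' < A' (i + d) \<longleftrightarrow> q < A i)" "k \<le> g"
  shows "scan_left A' q' (k + d) (g + d) = scan_left A q k g + d"
  using assms
proof (induction A q k g rule: scan_left.induct)
  case (1 A q k g)
  show ?case
  proof (cases "A g > q \<and> k < g")
    case True
    have "scan_left A' q' (k + d) (g - 1 + d) = scan_left A q k (g - 1) + d"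
      by (rule 1(1)) (use True 1(2) in auto)
    moreover have "scan_left A' q' (k + d) (g + d) = scan_left A' q' (k + d) (g - 1 + d)"
      using True 1(2)[of g] by (subst scan_left.simps) (auto simp: algebra_simps)
    moreover have "scan_left A q k g = scan_left A q k (g - 1)"
      using True by (subst scan_left.simps) auto
    ultimately show ?thesis by simp
  next
    case False
    then show ?thesis using 1(2)[of g] 1(3) by (subst (1 2) scan_left.simps) auto
  qed
qed

text \<open>
  \<open>partition_loop\<close> does not return the final index \<open>k\<close>, on which the number of swaps depends.
\<close>

inductive partition_run ::
  "'a::linorder \<Rightarrow> 'a \<Rightarrow> 'a array \<Rightarrow> int \<Rightarrow> int \<Rightarrow> int \<Rightarrow> nat \<Rightarrow>
   'a array \<Rightarrow> int \<Rightarrow> int \<Rightarrow> int \<Rightarrow> nat \<Rightarrow> bool" for p q where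
  stop: "g < k \<Longrightarrow> partition_run p q A l k g s A l k g s"
| small: "k \<le> g \<Longrightarrow> A k < p \<Longrightarrow>
    partition_run p q (swap_cells A k l) (l + 1) (k + 1) g (s + 1) B l' k' g' s' \<Longrightarrow>
    partition_run p q A l k g s B l' k' g' s'"
| large1: "k \<le> g \<Longrightarrow> \<not> A k < p \<Longrightarrow> q \<le> A k \<Longrightarrow> h = scan_left A q k g \<Longrightarrow> p \<le> A h \<Longrightarrow>
    partition_run p q (swap_cells A k h) l (k + 1) (h - 1) (s + 1) B l' k' g' s' \<Longrightarrow>
    partition_run p q A l k g s B l' k' g' s'"
| large2: "k \<le> g \<Longrightarrow> \<not> A k < p \<Longrightarrow> q \<le> A k \<Longrightarrow> h = scan_left A q k g \<Longrightarrow> \<not> p \<le> A h \<Longrightarrow>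
    partition_run p q (swap_cells (swap_cells A k h) k l) (l + 1) (k + 1) (h - 1) (s + 2) B l' k' g' s' \<Longrightarrow>
    partition_run p q A l k g s B l' k' g' s'"
| medium: "k \<le> g \<Longrightarrow> \<not> A k < p \<Longrightarrow> \<not> q \<le> A k \<Longrightarrow>
    partition_run p q A l (k + 1) g s B l' k' g' s' \<Longrightarrow>
    partition_run p q A l k g s B l' k' g' s'"

lemma partition_run_imp_loop:
  "partition_run p q A l k g s B l' k' g' s' \<Longrightarrow> partition_loop p q A l k g s = (B, l', g', s')"
  by (induction rule: partition_run.induct)
     (subst partition_loop.simps, auto simp: Let_def)+

lemma partition_loop_imp_run:
  "partition_loop p q A l k g s = (B, l', g', s') \<Longrightarrow>
    \<exists>k'. partition_run p q A l k g s B l' k' g' s'"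
proof (induction p q A l k g s rule: partition_loop.induct)
  case (1 p q A l k g s)
  define h where "h = scan_left A q k g"
  note prems = "1.prems"[unfolded partition_loop.simps[of p q A l k g s] Let_def, folded h_def]
  show ?case
  proof (cases "k \<le> g")
    case False
    then show ?thesis using prems by (auto intro!: exI[of _ k] partition_run.stop)
  next
    case k: True
    consider (small) "A k < p"
      | (one) "\<not> A k < p" "A k \<ge> q" "A h \<ge> p"
      | (two) "\<not> A k < p" "A k \<ge> q" "\<not> A h \<ge> p"
      | (medium) "\<not> A k < p" "\<not> A k \<ge> q"
      by blast
    then show ?thesis
    proof cases
      case small
      have "\<exists>k'. partition_run p q (swap_cells A k l) (l + 1) (k + 1) g (s + 1) B l' k' g' s'"
        by (rule "1.IH"(1)[OF k small]) (use prems k small in simp)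
      then show ?thesis by (blast intro: partition_run.small k small)
    next
      case one
      have "\<exists>k'. partition_run p q (swap_cells A k h) l (k + 1) (h - 1) (s + 1) B l' k' g' s'"
        by (rule "1.IH"(2)[OF k one(1,2) h_def one(3)]) (use prems k one in simp)
      then show ?thesis by (blast intro: partition_run.large1[OF k one(1,2) h_def one(3)])
    next
      case two
      have "\<exists>k'. partition_run p q (swap_cells (swap_cells A k h) k l) (l + 1) (k + 1) (h - 1) (s + 2) B l' k' g' s'"
        by (rule "1.IH"(3)[OF k two(1,2) h_def two(3)]) (use prems k two in simp)
      then show ?thesis by (blast intro: partition_run.large2[OF k two(1,2) h_def two(3)])
    next
      case medium
      have "\<exists>k'. partition_run p q A l (k + 1) g s B l' k' g' s'"
        by (rule "1.IH"(4)[OF k medium]) (use prems k medium in simp)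
      then obtain k' where "partition_run p q A l (k + 1) g s B l' k' g' s'" by blast
      with k medium have "partition_run p q A l k g s B l' k' g' s'" by (rule partition_run.medium)
      then show ?thesis by blast
    qed
  qed
qed

section \<open>Effect of the partitioning loop on the array, and its swaps\<close>

lemma partition_run_permutes:
  assumes "partition_run p q A l k g s B l' k' g' s'" "L \<le> l" "l \<le> k" "g \<le> R"
  shows "\<exists>\<rho>. \<rho> permutes {L..R} \<and> B = A \<circ> \<rho>"
  using assms
proof (induction rule: partition_run.induct)
  case (stop g k A l s)
  show ?case by (intro exI[of _ id] conjI permutes_id) simp
next
  case (small k g A l s B l' k' g' s')
  have "\<exists>\<rho>. \<rho> permutes {L..R} \<and> B = swap_cells A k l \<circ> \<rho>"
    by (rule small.IH) (use small.prems small.hyps(1) in auto)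
  then obtain \<rho> where "\<rho> permutes {L..R}" "B = swap_cells A k l \<circ> \<rho>" by blast
  moreover have "Transposition.transpose k l permutes {L..R}" using small by (intro permutes_swap_id) auto
  ultimately show ?case
    by (auto simp: swap_cells_eq_transpose comp_assoc
        intro!: exI[of _ "Transposition.transpose k l \<circ> \<rho>"] permutes_compose)
next
  case (large1 k g A h l s B l' k' g' s')
  have h: "k \<le> h" "h \<le> g" using large1 scan_left_le scan_left_ge by auto
  have "\<exists>\<rho>. \<rho> permutes {L..R} \<and> B = swap_cells A k h \<circ> \<rho>"
    by (rule large1.IH) (use large1.prems large1.hyps(1) h in auto)
  then obtain \<rho> where "\<rho> permutes {L..R}" "B = swap_cells A k h \<circ> \<rho>" by blast
  moreover have "Transposition.transpose k h permutes {L..R}" using large1 h by (intro permutes_swap_id) auto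
  ultimately show ?case
    by (auto simp: swap_cells_eq_transpose comp_assoc
        intro!: exI[of _ "Transposition.transpose k h \<circ> \<rho>"] permutes_compose)
next
  case (large2 k g A h l s B l' k' g' s')
  have h: "k \<le> h" "h \<le> g" using large2 scan_left_le scan_left_ge by auto
  have "\<exists>\<rho>. \<rho> permutes {L..R} \<and> B = swap_cells (swap_cells A k h) k l \<circ> \<rho>"
    by (rule large2.IH) (use large2.prems large2.hyps(1) h in auto)
  then obtain \<rho> where "\<rho> permutes {L..R}" "B = swap_cells (swap_cells A k h) k l \<circ> \<rho>" by blast
  moreover have "Transposition.transpose k h permutes {L..R}" using large2 h by (intro permutes_swap_id) auto
  moreover have "Transposition.transpose k l permutes {L..R}" using large2 h by (intro permutes_swap_id) auto
  ultimately show ?case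
    by (auto simp: swap_cells_eq_transpose comp_assoc
        intro!: exI[of _ "Transposition.transpose k h \<circ> (Transposition.transpose k l \<circ> \<rho>)"] permutes_compose)
next
  case (medium k g A l s B l' k' g' s')
  then show ?case by auto
qed

text \<open>Entries are inspected only through comparisons with the pivots, so two runs stay in step
  as long as \<open>f\<close> respects these comparisons; the order among the other entries may be
  destroyed. This weak hypothesis is essential, since \<open>f\<close> will later permute the values
  inside each block. The shift \<open>d\<close> moves the run to another range of cells.\<close>

lemma partition_run_simulation:
  assumes "partition_run p q A l k g s B l' k' g' s'"
    and "\<And>x. x \<in> V \<Longrightarrow> (f x < p' \<longleftrightarrow> x < p) \<and> (f x < q' \<longleftrightarrow> x < q) \<and> (q' < f x \<longleftrightarrow> q < x)"
    and "\<And>i. L \<le> i \<Longrightarrow> i \<le> R \<Longrightarrow> A i \<in> V \<and> A' (i + d) = f (A i)"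
    and "L \<le> l" "l \<le> k" "g \<le> R"
  shows "\<exists>B'. partition_run p' q' A' (l + d) (k + d) (g + d) s B' (l' + d) (k' + d) (g' + d) s' \<and>
            (\<forall>i. L \<le> i \<longrightarrow> i \<le> R \<longrightarrow> B' (i + d) = f (B i))"
  using assms(1,3-)
proof (induction arbitrary: A' rule: partition_run.induct)
  case (stop g k A l s)
  then show ?case by (intro exI[of _ A']) (auto intro: partition_run.stop)
next
  case (small k g A l s B l' k' g' s')
  have A: "A i \<in> V" "A' (i + d) = f (A i)" if "L \<le> i" "i \<le> R" for i
    using small.prems(1)[OF that] by auto
  have cmp: "A' (k + d) < p'" using small A[of k] assms(2) by auto
  have "\<exists>B'. partition_run p' q' (swap_cells A' (k + d) (l + d)) (l + 1 + d) (k + 1 + d) (g + d) (s + 1)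
          B' (l' + d) (k' + d) (g' + d) s' \<and> (\<forall>i. L \<le> i \<longrightarrow> i \<le> R \<longrightarrow> B' (i + d) = f (B i))"
    by (rule small.IH) (use small A in \<open>auto simp: swap_cells_def\<close>)
  then obtain B' where
    B': "\<forall>i. L \<le> i \<longrightarrow> i \<le> R \<longrightarrow> B' (i + d) = f (B i)"
    and run: "partition_run p' q' (swap_cells A' (k + d) (l + d)) (l + 1 + d) (k + 1 + d) (g + d) (s + 1) B' (l' + d) (k' + d) (g' + d) s'" by blast
  have "partition_run p' q' A' (l + d) (k + d) (g + d) s B' (l' + d) (k' + d) (g' + d) s'"
    by (rule partition_run.small) (use run cmp small.hyps(1) in \<open>simp_all add: algebra_simps\<close>)
  then show ?case using B' by blast
next
  case (large1 k g A h l s B l' k' g' s')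
  have h: "k \<le> h" "h \<le> g" using large1 scan_left_le scan_left_ge by auto
  have A: "A i \<in> V" "A' (i + d) = f (A i)" if "L \<le> i" "i \<le> R" for i
    using large1.prems(1)[OF that] by auto
  have h': "h + d = scan_left A' q' (k + d) (g + d)"
    unfolding \<open>h = scan_left A q k g\<close>
    by (rule scan_left_cong[symmetric]) (use large1 A assms(2) in auto)
  have cmp: "\<not> A' (k + d) < p'" "q' \<le> A' (k + d)" "p' \<le> A' (h + d)"
    using large1 h A[of k] A[of h] assms(2)[of "A k"] assms(2)[of "A h"] by (auto simp: not_less[symmetric])
  have "\<exists>B'. partition_run p' q' (swap_cells A' (k + d) (h + d)) (l + d) (k + 1 + d) (h - 1 + d) (s + 1)
          B' (l' + d) (k' + d) (g' + d) s' \<and> (\<forall>i. L \<le> i \<longrightarrow> i \<le> R \<longrightarrow> B' (i + d) = f (B i))"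
    by (rule large1.IH) (use large1.prems large1.hyps(1) h A in \<open>auto simp: swap_cells_def\<close>)
  then obtain B' where
    B': "\<forall>i. L \<le> i \<longrightarrow> i \<le> R \<longrightarrow> B' (i + d) = f (B i)"
    and run: "partition_run p' q' (swap_cells A' (k + d) (h + d)) (l + d) (k + 1 + d) (h - 1 + d) (s + 1) B' (l' + d) (k' + d) (g' + d) s'" by blast
  have "partition_run p' q' A' (l + d) (k + d) (g + d) s B' (l' + d) (k' + d) (g' + d) s'"
    by (rule partition_run.large1[OF _ _ _ h']) (use run cmp large1.hyps(1) in \<open>simp_all add: algebra_simps\<close>)
  then show ?case using B' by blast
next
  case (large2 k g A h l s B l' k' g' s')
  have h: "k \<le> h" "h \<le> g" using large2 scan_left_le scan_left_ge by auto
  have A: "A i \<in> V" "A' (i + d) = f (A i)" if "L \<le> i" "i \<le> R" for i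
    using large2.prems(1)[OF that] by auto
  have h': "h + d = scan_left A' q' (k + d) (g + d)"
    unfolding \<open>h = scan_left A q k g\<close>
    by (rule scan_left_cong[symmetric]) (use large2 A assms(2) in auto)
  have cmp: "\<not> A' (k + d) < p'" "q' \<le> A' (k + d)" "\<not> p' \<le> A' (h + d)"
    using large2 h A[of k] A[of h] assms(2)[of "A k"] assms(2)[of "A h"] by (auto simp: not_less[symmetric])
  have "\<exists>B'. partition_run p' q' (swap_cells (swap_cells A' (k + d) (h + d)) (k + d) (l + d))
          (l + 1 + d) (k + 1 + d) (h - 1 + d) (s + 2)
          B' (l' + d) (k' + d) (g' + d) s' \<and> (\<forall>i. L \<le> i \<longrightarrow> i \<le> R \<longrightarrow> B' (i + d) = f (B i))"
    by (rule large2.IH) (use large2.prems large2.hyps(1) h A in \<open>auto simp: swap_cells_def\<close>)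
  then obtain B' where
    B': "\<forall>i. L \<le> i \<longrightarrow> i \<le> R \<longrightarrow> B' (i + d) = f (B i)"
    and run: "partition_run p' q' (swap_cells (swap_cells A' (k + d) (h + d)) (k + d) (l + d)) (l + 1 + d) (k + 1 + d) (h - 1 + d) (s + 2) B' (l' + d) (k' + d) (g' + d) s'" by blast
  have "partition_run p' q' A' (l + d) (k + d) (g + d) s B' (l' + d) (k' + d) (g' + d) s'"
    by (rule partition_run.large2[OF _ _ _ h']) (use run cmp large2.hyps(1) in \<open>simp_all add: algebra_simps\<close>)
  then show ?case using B' by blast
next
  case (medium k g A l s B l' k' g' s')
  have A: "A i \<in> V" "A' (i + d) = f (A i)" if "L \<le> i" "i \<le> R" for i
    using medium.prems(1)[OF that] by auto
  have cmp: "\<not> A' (k + d) < p'" "\<not> q' \<le> A' (k + d)"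
    using medium A[of k] assms(2)[of "A k"] by (auto simp: not_less[symmetric])
  have "\<exists>B'. partition_run p' q' A' (l + d) (k + 1 + d) (g + d) s
          B' (l' + d) (k' + d) (g' + d) s' \<and> (\<forall>i. L \<le> i \<longrightarrow> i \<le> R \<longrightarrow> B' (i + d) = f (B i))"
    by (rule medium.IH) (use medium A in auto)
  then obtain B' where
    B': "\<forall>i. L \<le> i \<longrightarrow> i \<le> R \<longrightarrow> B' (i + d) = f (B i)"
    and run: "partition_run p' q' A' (l + d) (k + 1 + d) (g + d) s B' (l' + d) (k' + d) (g' + d) s'" by blast
  have "partition_run p' q' A' (l + d) (k + d) (g + d) s B' (l' + d) (k' + d) (g' + d) s'"
    by (rule partition_run.medium) (use run cmp medium.hyps(1) in \<open>simp_all add: algebra_simps\<close>)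
  then show ?case using B' by blast
qed

text \<open>This is the loop invariant for the three classes of entries. The clause on medium cells
  stops at \<open>g\<close> because \<open>k\<close> can overshoot: if the scan stops at
  \<open>k\<close> itself on a large entry, \<open>g\<close> becomes \<open>k - 1\<close> while
  \<open>k\<close> advances, so the loop may end with \<open>k = g + 2\<close>.\<close>

lemma partition_run_sorted_classes:
  assumes "partition_run p q A l k g s B l' k' g' s'" "p \<le> q"
    and "\<And>i. L \<le> i \<Longrightarrow> i < l \<Longrightarrow> A i < p"
    and "\<And>i. l \<le> i \<Longrightarrow> i < k \<Longrightarrow> i \<le> g \<Longrightarrow> p \<le> A i \<and> A i < q"
    and "\<And>i. g < i \<Longrightarrow> i \<le> R \<Longrightarrow> q \<le> A i"
    and "\<And>i. L \<le> i \<Longrightarrow> i \<le> R \<Longrightarrow> A i \<noteq> q"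
    and "L \<le> l" "l \<le> k" "l \<le> g + 1" "k \<le> g + 2" "g \<le> R"
  shows "(\<forall>i. L \<le> i \<longrightarrow> i < l' \<longrightarrow> B i < p) \<and> (\<forall>i. l' \<le> i \<longrightarrow> i \<le> g' \<longrightarrow> p \<le> B i \<and> B i < q) \<and>
    (\<forall>i. g' < i \<longrightarrow> i \<le> R \<longrightarrow> q \<le> B i) \<and> L \<le> l' \<and> l' \<le> g' + 1 \<and> g' \<le> R \<and>
    g' < k' \<and> k' \<le> g' + 2"
  using assms
proof (induction rule: partition_run.induct)
  case (stop g k A l s)
  then show ?case by auto
next
  case (small k g A l s B l' k' g' s')
  have 1: "swap_cells A k l i < p" if "L \<le> i" "i < l + 1" for i
    using that small.prems(2)[of i] small.hyps small.prems(7) by (auto simp: swap_cells_def)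
  have 2: "p \<le> swap_cells A k l i \<and> swap_cells A k l i < q" if "l + 1 \<le> i" "i < k + 1" "i \<le> g" for i
    using that small.prems(3)[of i] small.prems(3)[of l] small.hyps small.prems(7)
    by (auto simp: swap_cells_def)
  show ?case
    by (rule small.IH)
      (use small.prems small.hyps 1 2 in \<open>auto simp: swap_cells_def\<close>)
next
  case (large1 k g A h l s B l' k' g' s')
  have h: "k \<le> h" "h \<le> g" using large1 scan_left_le scan_left_ge by auto
  have h2: "h = k \<or> A h \<le> q" using scan_left_stop[of k g A q] large1 by auto
  have h3: "q < A i" if "h < i" "i \<le> g" for i using scan_left_skipped[of A q k g i] that large1 by auto
  \<comment> \<open>The scan stops at an entry that is at most \<open>q\<close>, whereas a medium
    entry has to lie strictly below \<open>q\<close>.\<close>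
  have "A h \<noteq> q" using large1.prems(5)[of h] large1.prems h by auto
  then have 2: "p \<le> swap_cells A k h i \<and> swap_cells A k h i < q" if "l \<le> i" "i < k + 1" "i \<le> h - 1" for i
    using that large1.prems(3)[of i] h h2 large1.hyps by (auto simp: swap_cells_def)
  have 3: "q \<le> swap_cells A k h i" if "h - 1 < i" "i \<le> R" for i
    using that large1.prems(4)[of i] h h3[of i] large1.hyps by (cases "i \<le> g") (auto simp: swap_cells_def)
  show ?case
    by (rule large1.IH)
      (use large1.prems large1.hyps h 2 3 in \<open>auto simp: swap_cells_def\<close>)
next
  case (large2 k g A h l s B l' k' g' s')
  have h: "k \<le> h" "h \<le> g" using large2 scan_left_le scan_left_ge by auto
  have hk: "h \<noteq> k" using large2 by auto
  have h3: "q < A i" if "h < i" "i \<le> g" for i using scan_left_skipped[of A q k g i] that large2 by auto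
  let ?A = "swap_cells (swap_cells A k h) k l"
  have 1: "?A i < p" if "L \<le> i" "i < l + 1" for i
    using that large2.prems(2)[of i] large2.hyps(5) large2.prems(7) h by (auto simp: swap_cells_def)
  have 2: "p \<le> ?A i \<and> ?A i < q" if "l + 1 \<le> i" "i < k + 1" "i \<le> h - 1" for i
    using that large2.prems(3)[of i] large2.prems(3)[of l] h hk large2.prems(7)
    by (auto simp: swap_cells_def)
  have 3: "q \<le> ?A i" if "h - 1 < i" "i \<le> R" for i
    using that large2.prems(4)[of i] h hk h3[of i] large2.hyps(3) large2.prems(7)
    by (cases "i \<le> g") (auto simp: swap_cells_def)
  show ?case
    by (rule large2.IH)
      (use large2.prems(1,5-) large2.hyps(1) h hk 1 2 3 in \<open>auto simp: swap_cells_def\<close>)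
next
  case (medium k g A l s B l' k' g' s')
  have 2: "p \<le> A i \<and> A i < q" if "l \<le> i" "i < k + 1" "i \<le> g" for i
    using that medium.prems(3)[of i] medium.hyps by (cases "i = k") auto
  show ?case
    by (rule medium.IH) (use medium.prems medium.hyps 2 in auto)
qed

lemma partition_run_k_bounds:
  assumes "partition_run p q A l k g s B l' k' g' s'"
  shows "k \<le> k' \<and> k' \<le> max k (g + 1)"
  using assms
proof (induction rule: partition_run.induct)
  case (large1 k g A h l s B l' k' g' s')
  then show ?case using scan_left_le[of A q k g] scan_left_ge[of k g A q] by auto
next
  case (large2 k g A h l s B l' k' g' s')
  then show ?case using scan_left_le[of A q k g] scan_left_ge[of k g A q] by auto
qed auto

lemma card_insert_left:
  "card (insert k {i \<in> {k + 1..<k'}. P i}) = Suc (card {i \<in> {k + 1..<k' :: int}. P i})"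
  by (rule card_insert_disjoint) (auto intro: finite_subset[of _ "{k + 1..<k'}"])

text \<open>Each advance of \<open>l\<close> costs one swap and so does each large entry met by
  \<open>k\<close>; the branch with two swaps does both. The large entries can be counted in the
  original array: every write goes to a cell that \<open>k\<close> has already reached or to cell
  \<open>h\<close>, and the latter lies beyond all cells that \<open>k\<close> still visits, because
  \<open>g\<close> drops below \<open>h\<close>.\<close>

lemma partition_run_swaps:
  assumes "partition_run p q A l k g s B l' k' g' s'" "p \<le> q" "l \<le> k"
  shows "int s' = int s + (l' - l) + int (card {i \<in> {k..<k'}. q \<le> A i})"
  using assms
proof (induction rule: partition_run.induct)
  case (stop g k A l s)
  then show ?case by auto
next
  case (small k g A l s B l' k' g' s')
  have "{i \<in> {k..<k'}. q \<le> A i} = {i \<in> {k + 1..<k'}. q \<le> swap_cells A k l i}"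
  proof (intro set_eqI iffI)
    fix i assume "i \<in> {i \<in> {k..<k'}. q \<le> A i}"
    then show "i \<in> {i \<in> {k + 1..<k'}. q \<le> swap_cells A k l i}"
      using small.hyps(2) small.prems by (cases "i = k") (auto simp: swap_cells_def)
  qed (use small.prems in \<open>auto simp: swap_cells_def\<close>)
  then show ?case using small by auto
next
  case (large1 k g A h l s B l' k' g' s')
  have h: "k \<le> h" "h \<le> g" using large1 scan_left_le scan_left_ge by auto
  have k': "k + 1 \<le> k'" "k' \<le> max (k + 1) h"
    using partition_run_k_bounds[OF large1.hyps(6)] by auto
  have "{i \<in> {k..<k'}. q \<le> A i} = insert k {i \<in> {k + 1..<k'}. q \<le> swap_cells A k h i}"
  proof (intro set_eqI iffI)
    fix i assume "i \<in> {i \<in> {k..<k'}. q \<le> A i}"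
    then show "i \<in> insert k {i \<in> {k + 1..<k'}. q \<le> swap_cells A k h i}"
      using k' h by (cases "i = k") (auto simp: swap_cells_def)
  next
    fix i assume "i \<in> insert k {i \<in> {k + 1..<k'}. q \<le> swap_cells A k h i}"
    then show "i \<in> {i \<in> {k..<k'}. q \<le> A i}"
      using k' h large1.hyps(3) by (cases "i = k") (auto simp: swap_cells_def split: if_splits)
  qed
  then have "card {i \<in> {k..<k'}. q \<le> A i} = Suc (card {i \<in> {k + 1..<k'}. q \<le> swap_cells A k h i})"
    by (simp only: card_insert_left)
  then show ?case using large1.IH large1.prems by simp
next
  case (large2 k g A h l s B l' k' g' s')
  have h: "k \<le> h" "h \<le> g" using large2 scan_left_le scan_left_ge by auto
  have k': "k + 1 \<le> k'" "k' \<le> max (k + 1) h"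
    using partition_run_k_bounds[OF large2.hyps(6)] by auto
  have "{i \<in> {k..<k'}. q \<le> A i} =
      insert k {i \<in> {k + 1..<k'}. q \<le> swap_cells (swap_cells A k h) k l i}"
  proof (intro set_eqI iffI)
    fix i assume "i \<in> {i \<in> {k..<k'}. q \<le> A i}"
    then show "i \<in> insert k {i \<in> {k + 1..<k'}. q \<le> swap_cells (swap_cells A k h) k l i}"
      using k' h large2.prems by (cases "i = k") (auto simp: swap_cells_def)
  next
    fix i assume "i \<in> insert k {i \<in> {k + 1..<k'}. q \<le> swap_cells (swap_cells A k h) k l i}"
    then show "i \<in> {i \<in> {k..<k'}. q \<le> A i}"
      using k' h large2.hyps(3) large2.prems
      by (cases "i = k") (auto simp: swap_cells_def split: if_splits)
  qed
  then have "card {i \<in> {k..<k'}. q \<le> A i} =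
      Suc (card {i \<in> {k + 1..<k'}. q \<le> swap_cells (swap_cells A k h) k l i})"
    by (simp only: card_insert_left)
  then show ?case using large2.IH large2.prems by simp
next
  case (medium k g A l s B l' k' g' s')
  have "{i \<in> {k..<k'}. q \<le> A i} = {i \<in> {k + 1..<k'}. q \<le> A i}"
  proof (intro set_eqI iffI)
    fix i assume "i \<in> {i \<in> {k..<k'}. q \<le> A i}"
    then show "i \<in> {i \<in> {k + 1..<k'}. q \<le> A i}"
      using medium.hyps(3) by (cases "i = k") auto
  qed auto
  then show ?case using medium by auto
qed

section \<open>One complete partitioning step\<close>

lemma yaroslavskiy_partition_run:
  assumes "yaroslavskiy_partition A left right = (B, l, g, s)" "left < right"
  defines "p \<equiv> min (A left) (A right)" and "q \<equiv> max (A left) (A right)"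
  obtains C k s0 where
    "partition_run p q A (left + 1) (left + 1) (right - 1) 0 C (l + 1) k (g - 1) s0"
    "s = s0 + 2"
    "B = (let B1 = C(left := C l); B2 = B1(l := p); B3 = B2(right := B2 g) in B3(g := q))"
proof -
  have pq: "(if A left > A right then (A right, A left) else (A left, A right)) = (p, q)"
    by (auto simp: p_def q_def)
  obtain C l0 g0 s0 where C: "partition_loop p q A (left + 1) (left + 1) (right - 1) 0 = (C, l0, g0, s0)"
    by (metis prod_cases4)
  obtain k where k: "partition_run p q A (left + 1) (left + 1) (right - 1) 0 C l0 k g0 s0"
    using partition_loop_imp_run[OF C] by blast
  have "l = l0 - 1" "g = g0 + 1" "s = s0 + 2"
    "B = (let B1 = C(left := C l); B2 = B1(l := p); B3 = B2(right := B2 g) in B3(g := q))"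
    using assms(1) unfolding yaroslavskiy_partition_def pq by (auto simp: C Let_def)
  then show thesis using k by (intro that[of C k s0]) auto
qed

lemma yaroslavskiy_partition_simulation:
  assumes "yaroslavskiy_partition A left right = (B, l, g, s)" "left < right"
    and "\<And>i. left \<le> i \<Longrightarrow> i \<le> right \<Longrightarrow> A' (i + d) = f (A i)"
    and "\<And>i. left \<le> i \<Longrightarrow> i \<le> right \<Longrightarrow>
      (f (A i) < f (A left) \<longleftrightarrow> A i < A left) \<and> (f (A left) < f (A i) \<longleftrightarrow> A left < A i) \<and>
      (f (A i) < f (A right) \<longleftrightarrow> A i < A right) \<and> (f (A right) < f (A i) \<longleftrightarrow> A right < A i)"
  shows "\<exists>B'. yaroslavskiy_partition A' (left + d) (right + d) = (B', l + d, g + d, s) \<and>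
    (\<forall>i. left \<le> i \<longrightarrow> i \<le> right \<longrightarrow> B' (i + d) = f (B i))"
proof -
  define p where "p = min (A left) (A right)"
  define q where "q = max (A left) (A right)"
  obtain C k s0 where
    run: "partition_run p q A (left + 1) (left + 1) (right - 1) 0 C (l + 1) k (g - 1) s0"
    and s: "s = s0 + 2"
    and B: "B = (let B1 = C(left := C l); B2 = B1(l := p); B3 = B2(right := B2 g) in B3(g := q))"
    using yaroslavskiy_partition_run[OF assms(1,2)] unfolding p_def q_def by metis
  have cmp: "A right < A left \<longleftrightarrow> f (A right) < f (A left)"
    using assms(4)[of right] assms(2) by auto
  have pq': "(if A' (left + d) > A' (right + d) then (A' (right + d), A' (left + d))
      else (A' (left + d), A' (right + d))) = (f p, f q)"
    using cmp assms(2) assms(3)[of left] assms(3)[of right] by (auto simp: p_def q_def min_def max_def)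
  have "\<exists>C'. partition_run (f p) (f q) A' (left + 1 + d) (left + 1 + d) (right - 1 + d) 0 C'
      (l + 1 + d) (k + d) (g - 1 + d) s0 \<and>
      (\<forall>i. left \<le> i \<longrightarrow> i \<le> right \<longrightarrow> C' (i + d) = f (C i))"
  proof (rule partition_run_simulation[OF run, where V = "A ` {left..right}"])
    fix x assume "x \<in> A ` {left..right}"
    then show "(f x < f p \<longleftrightarrow> x < p) \<and> (f x < f q \<longleftrightarrow> x < q) \<and> (f q < f x \<longleftrightarrow> q < x)"
      using assms(4) by (auto simp: p_def q_def min_def max_def)
  qed (use assms(2,3) in auto)
  then obtain C' where
    C': "partition_run (f p) (f q) A' (left + 1 + d) (left + 1 + d) (right - 1 + d) 0 C'
      (l + 1 + d) (k + d) (g - 1 + d) s0"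
      "\<And>i. left \<le> i \<Longrightarrow> i \<le> right \<Longrightarrow> C' (i + d) = f (C i)" by blast
  have "partition_loop (f p) (f q) A' (left + d + 1) (left + d + 1) (right + d - 1) 0 =
      (C', l + 1 + d, g - 1 + d, s0)"
    using partition_run_imp_loop[OF C'(1)] by (simp add: algebra_simps)
  then have "yaroslavskiy_partition A' (left + d) (right + d) =
     ((let B1 = C'(left + d := C' (l + d)); B2 = B1(l + d := f p); B3 = B2(right + d := B2 (g + d))
       in B3(g + d := f q)), l + d, g + d, s)"
    unfolding yaroslavskiy_partition_def pq' by (simp add: Let_def s algebra_simps)
  moreover have "left \<le> l" "l \<le> right" "left \<le> g" "g \<le> right"
    using yaroslavskiy_partition_bounds[OF assms(1)] assms(2) by auto
  ultimately show ?thesis using C'(2) assms(2) by (auto simp: B Let_def)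
qed

text \<open>The slack of 3 in the swap count consists of the two swaps for the pivots and at most
  one more: the loop index ends at \<open>g\<close> or \<open>g + 1\<close>, so besides the cells up
  to \<open>g - 1\<close> only cell \<open>g\<close> can have contributed. Counting over a range
  fixed by the position of the larger pivot, and not by the final loop index, is what makes the
  count hypergeometric later.\<close>

lemma yaroslavskiy_partition_correct:
  assumes "yaroslavskiy_partition A left right = (B, l, g, s)" "left < right"
    and inj: "inj_on A {left..right}"
  defines "p \<equiv> min (A left) (A right)" and "q \<equiv> max (A left) (A right)"
  shows "\<exists>\<rho>. \<rho> permutes {left..right} \<and> B = A \<circ> \<rho>"
    and "left \<le> l" "l < g" "g \<le> right" "B l = p" "B g = q"
    and "\<And>i. left \<le> i \<Longrightarrow> i < l \<Longrightarrow> B i < p"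
    and "\<And>i. l < i \<Longrightarrow> i < g \<Longrightarrow> p < B i \<and> B i < q"
    and "\<And>i. g < i \<Longrightarrow> i \<le> right \<Longrightarrow> q < B i"
    and "\<bar>real s - (real_of_int (l - left) + real (card {i \<in> {left + 1..g - 1}. q < A i}))\<bar> \<le> 3"
proof -
  obtain C k s0 where
    run: "partition_run p q A (left + 1) (left + 1) (right - 1) 0 C (l + 1) k (g - 1) s0"
    and s: "s = s0 + 2"
    and B: "B = (let B1 = C(left := C l); B2 = B1(l := p); B3 = B2(right := B2 g) in B3(g := q))"
    using yaroslavskiy_partition_run[OF assms(1,2)] unfolding p_def q_def by metis
  have pq: "p < q" using inj assms(2) inj_on_eq_iff[OF inj, of left right]
    by (auto simp: p_def q_def min_def max_def)
  obtain \<rho> where \<rho>: "\<rho> permutes {left + 1..right - 1}" "C = A \<circ> \<rho>"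
    using partition_run_permutes[OF run, of "left + 1" "right - 1"] by auto
  have neq: "A i \<noteq> p \<and> A i \<noteq> q" if "left + 1 \<le> i" "i \<le> right - 1" for i
    using inj_on_eq_iff[OF inj, of i left] inj_on_eq_iff[OF inj, of i right] that
    by (auto simp: p_def q_def min_def max_def)
  have Cneq: "C i \<noteq> p \<and> C i \<noteq> q" if "left + 1 \<le> i" "i \<le> right - 1" for i
    using neq[of "\<rho> i"] that permutes_in_image[OF \<rho>(1), of i] by (auto simp: \<rho>(2))
  have cls: "(\<forall>i. left + 1 \<le> i \<longrightarrow> i < l + 1 \<longrightarrow> C i < p) \<and>
    (\<forall>i. l + 1 \<le> i \<longrightarrow> i \<le> g - 1 \<longrightarrow> p \<le> C i \<and> C i < q) \<and>
    (\<forall>i. g - 1 < i \<longrightarrow> i \<le> right - 1 \<longrightarrow> q \<le> C i) \<and> left + 1 \<le> l + 1 \<and> l + 1 \<le> g - 1 + 1 \<and>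
    g - 1 \<le> right - 1 \<and> g - 1 < k \<and> k \<le> g - 1 + 2"
    by (rule partition_run_sorted_classes[OF run]) (use pq assms(2) neq in auto)
  then show bounds: "left \<le> l" "l < g" "g \<le> right" by auto
  have small: "C i < p" if "left + 1 \<le> i" "i \<le> l" for i using cls that by auto
  have medium: "p < C i \<and> C i < q" if "l < i" "i < g" for i
    using cls that Cneq[of i] bounds by (auto simp: order.strict_iff_order)
  have large: "q < C i" if "g \<le> i" "i < right" for i
    using cls that Cneq[of i] bounds by (auto simp: order.strict_iff_order)
  have B_eq: "B i = (if i = g then q else if i = right then C g else if i = l then p
      else if i = left then C l else C i)" for i
    using bounds by (auto simp: B Let_def)
  show "B l = p" "B g = q" using bounds by (auto simp: B_eq)
  show "B i < p" if "left \<le> i" "i < l" for i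
    using that small[of i] small[of l] bounds by (auto simp: B_eq)
  show "p < B i \<and> B i < q" if "l < i" "i < g" for i
    using that medium[of i] bounds by (auto simp: B_eq)
  show "q < B i" if "g < i" "i \<le> right" for i
    using that large[of i] large[of g] bounds by (auto simp: B_eq)
  have C_ends: "C left = A left" "C right = A right"
    using permutes_not_in[OF \<rho>(1)] by (auto simp: \<rho>(2))
  \<comment> \<open>Placing the pivots is a rearrangement as well: the two ends are exchanged if
    they are out of order, and each pivot is then exchanged with the entry at its final
    cell.\<close>
  define \<tau> where "\<tau> = (if A left > A right then Transposition.transpose left right else id)"
  have \<tau>: "\<tau> permutes {left..right}"
    using assms(2) by (auto simp: \<tau>_def permutes_id intro!: permutes_swap_id)
  have \<rho>': "\<rho> permutes {left..right}" by (rule permutes_subset[OF \<rho>(1)]) auto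
  have "B = C \<circ> (\<tau> \<circ> (Transposition.transpose left l \<circ> Transposition.transpose right g))"
    using bounds assms(2) C_ends
    by (auto simp: B_eq fun_eq_iff \<tau>_def Transposition.transpose_def p_def q_def min_def max_def)
  then have "B = A \<circ> (\<rho> \<circ> (\<tau> \<circ> (Transposition.transpose left l \<circ> Transposition.transpose right g)))"
    by (simp add: \<rho>(2) comp_assoc)
  moreover have "(\<rho> \<circ> (\<tau> \<circ> (Transposition.transpose left l \<circ> Transposition.transpose right g))) permutes {left..right}"
    by (intro permutes_compose \<rho>' \<tau> permutes_swap_id) (use bounds in auto)
  ultimately show "\<exists>\<rho>. \<rho> permutes {left..right} \<and> B = A \<circ> \<rho>" by blast
  have s0: "int s0 = l - left + int (card {i \<in> {left + 1..<k}. q \<le> A i})"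
    using partition_run_swaps[OF run] pq by auto
  let ?S = "{i \<in> {left + 1..g - 1}. q < A i}"
  have "{i \<in> {left + 1..<k}. q \<le> A i} \<subseteq> insert g ?S"
  proof
    fix i assume "i \<in> {i \<in> {left + 1..<k}. q \<le> A i}"
    then show "i \<in> insert g ?S"
      using cls neq[of i] by (cases "i = g") auto
  qed
  then have 1: "card {i \<in> {left + 1..<k}. q \<le> A i} \<le> card (insert g ?S)"
    by (intro card_mono finite.insertI) (auto intro: finite_subset[of _ "{left + 1..g - 1}"])
  have "?S \<subseteq> {i \<in> {left + 1..<k}. q \<le> A i}" using cls by auto
  then have 2: "card ?S \<le> card {i \<in> {left + 1..<k}. q \<le> A i}"
    by (intro card_mono) (auto intro: finite_subset[of _ "{left + 1..<k}"])
  have "card (insert g ?S) \<le> Suc (card ?S)" by (rule card_insert_le_m1) auto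
  then show "\<bar>real s - (real_of_int (l - left) + real (card ?S))\<bar> \<le> 3"
    using 1 2 s0 s by linarith
qed

section \<open>Locality and additivity of the swap count\<close>

lemma shift_insert_frame: "i < left \<or> j + 1 < i \<Longrightarrow> left \<le> j + 1 \<Longrightarrow> shift_insert left x j A i = A i"
proof (induction left x j A rule: shift_insert.induct)
  case (1 left x j A)
  show ?case
  proof (cases "left \<le> j \<and> A j > x")
    case True
    have "shift_insert left x (j - 1) (A(j + 1 := A j)) i = (A(j + 1 := A j)) i"
      by (rule "1.IH") (use True "1.prems" in auto)
    then show ?thesis using True "1.prems" by (subst shift_insert.simps) auto
  next
    case False
    then show ?thesis using "1.prems" by (subst shift_insert.simps) auto
  qed
qed

lemma insertion_sort_frame:
  assumes "i < left \<or> right < i"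
  shows "insertion_sort A left right i = A i"
proof -
  have "\<forall>j\<in>set js. left + 1 \<le> j \<and> j \<le> right \<Longrightarrow>
      fold (\<lambda>i B. shift_insert left (B i) (i - 1) B) js A i = A i" for js
    using assms by (induction js arbitrary: A) (auto simp: shift_insert_frame)
  then show ?thesis unfolding insertion_sort_def by simp
qed

text \<open>The three recursive calls run one after another, each on the array left by its
  predecessor. Since a call leaves the cells outside its range alone, each of them can be viewed as
  acting on the freshly partitioned array.\<close>

lemma dual_pivot_qs_frame:
  "0 < M \<Longrightarrow> inj_on A {left..right} \<Longrightarrow> i < left \<or> right < i \<Longrightarrow>
    fst (dual_pivot_qs M A left right) i = A i"
proof (induction M A left right arbitrary: i rule: dual_pivot_qs.induct)
  case (1 M A left right)
  show ?case
  proof (cases "right - left < int M")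
    case True
    then show ?thesis using "1.prems" by (subst dual_pivot_qs.simps) (simp add: insertion_sort_frame)
  next
    case False
    obtain B l g s where yp: "yaroslavskiy_partition A left right = (B, l, g, s)" by (metis prod_cases4)
    have lr: "left < right" using False \<open>0 < M\<close> by auto
    note correct = yaroslavskiy_partition_correct[OF yp lr "1.prems"(2)]
    obtain \<rho> where \<rho>: "\<rho> permutes {left..right}" "B = A \<circ> \<rho>" using correct(1) by blast
    have injB: "inj_on B {left..right}"
      unfolding \<rho>(2) by (rule comp_inj_on) (use \<rho>(1) "1.prems"(2) in \<open>auto simp: permutes_image intro: permutes_inj_on\<close>)
    obtain B1 s1 where B1: "dual_pivot_qs M B left (l - 1) = (B1, s1)" by fastforce
    obtain B2 s2 where B2: "dual_pivot_qs M B1 (l + 1) (g - 1) = (B2, s2)" by fastforce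
    obtain B3 s3 where B3: "dual_pivot_qs M B2 (g + 1) right = (B3, s3)" by fastforce
    have "fst (dual_pivot_qs M A left right) = B3"
      using False by (subst dual_pivot_qs.simps) (simp add: yp B1 B2 B3)
    have 1: "B1 j = B j" if "j < left \<or> l - 1 < j" for j
    proof -
      have "fst (dual_pivot_qs M B left (l - 1)) j = B j"
        by (rule "1.IH"(1)[OF False yp[symmetric] refl refl refl \<open>0 < M\<close>])
          (use that injB correct in \<open>auto intro: inj_on_subset\<close>)
      then show ?thesis by (simp add: B1)
    qed
    have inj1: "inj_on B1 {l + 1..g - 1}"
      using injB correct(2-4) inj_on_subset[of B "{left..right}" "{l + 1..g - 1}"]
      by (subst inj_on_cong[of _ B1 B]) (auto simp: 1)
    have 2: "B2 j = B1 j" if "j < l + 1 \<or> g - 1 < j" for j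
    proof -
      have "fst (dual_pivot_qs M B1 (l + 1) (g - 1)) j = B1 j"
        by (rule "1.IH"(2)[OF False yp[symmetric] refl refl refl B1[symmetric] refl \<open>0 < M\<close> inj1 that])
      then show ?thesis by (simp add: B2)
    qed
    have inj2: "inj_on B2 {g + 1..right}"
      using injB correct(2-4) inj_on_subset[of B "{left..right}" "{g + 1..right}"]
      by (subst inj_on_cong[of _ B2 B]) (auto simp: 1 2)
    have 3: "B3 j = B2 j" if "j < g + 1 \<or> right < j" for j
    proof -
      have "fst (dual_pivot_qs M B2 (g + 1) right) j = B2 j"
        by (rule "1.IH"(3)[OF False yp[symmetric] refl refl refl B1[symmetric] refl B2[symmetric] refl \<open>0 < M\<close> inj2 that])
      then show ?thesis by (simp add: B3)
    qed
    show ?thesis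
      using permutes_not_in[OF \<rho>(1), of i] "1.prems"(3) correct(2-4)
      by (auto simp: \<open>fst (dual_pivot_qs M A left right) = B3\<close> 1 2 3 \<rho>(2))
  qed
qed

abbreviation qs_swaps :: "nat \<Rightarrow> 'a::linorder array \<Rightarrow> int \<Rightarrow> int \<Rightarrow> nat" where
  "qs_swaps M A left right \<equiv> snd (dual_pivot_qs M A left right)"

text \<open>The count depends only on the relative order of the entries in the range. In contrast to
  a single partitioning step, \<open>f\<close> has to preserve the order of all of them, because any
  entry may become a pivot further down. Together with the translation by \<open>d\<close> this
  reduces a subarray to a permutation of an initial segment of the positive integers.\<close>

lemma qs_swaps_simulation:
  assumes "0 < M" "inj_on A {left..right}"
    and "\<And>i. left \<le> i \<Longrightarrow> i \<le> right \<Longrightarrow> A' (i + d) = f (A i)"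
    and "\<And>i j. left \<le> i \<Longrightarrow> i \<le> right \<Longrightarrow> left \<le> j \<Longrightarrow> j \<le> right \<Longrightarrow>
      f (A i) < f (A j) \<longleftrightarrow> A i < A j"
  shows "qs_swaps M A' (left + d) (right + d) = qs_swaps M A left right"
  using assms
proof (induction M A left right arbitrary: A' rule: dual_pivot_qs.induct)
  case (1 M A left right)
  show ?case
  proof (cases "right - left < int M")
    case True
    then show ?thesis by (subst (1 2) dual_pivot_qs.simps) simp
  next
    case False
    obtain B l g s where yp: "yaroslavskiy_partition A left right = (B, l, g, s)" by (metis prod_cases4)
    have lr: "left < right" using False \<open>0 < M\<close> by auto
    note correct = yaroslavskiy_partition_correct[OF yp lr "1.prems"(2)]
    obtain \<rho> where \<rho>: "\<rho> permutes {left..right}" "B = A \<circ> \<rho>" using correct(1) by blast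
    have injB: "inj_on B {left..right}"
      unfolding \<rho>(2) by (rule comp_inj_on) (use \<rho>(1) "1.prems"(2) in \<open>auto simp: permutes_image intro: permutes_inj_on\<close>)
    have monoB: "f (B i) < f (B j) \<longleftrightarrow> B i < B j"
      if "left \<le> i" "i \<le> right" "left \<le> j" "j \<le> right" for i j
      using "1.prems"(4)[of "\<rho> i" "\<rho> j"] that permutes_in_image[OF \<rho>(1), of i] permutes_in_image[OF \<rho>(1), of j]
      by (auto simp: \<rho>(2))
    have "\<exists>B'. yaroslavskiy_partition A' (left + d) (right + d) = (B', l + d, g + d, s) \<and>
      (\<forall>i. left \<le> i \<longrightarrow> i \<le> right \<longrightarrow> B' (i + d) = f (B i))"
      by (rule yaroslavskiy_partition_simulation[OF yp lr]) (use "1.prems"(3,4) lr in auto)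
    then obtain B' where yp': "yaroslavskiy_partition A' (left + d) (right + d) = (B', l + d, g + d, s)"
      and B': "\<And>i. left \<le> i \<Longrightarrow> i \<le> right \<Longrightarrow> B' (i + d) = f (B i)" by blast
    have inj': "inj_on B' {x + d..y + d}" if "left \<le> x" "y \<le> right" for x y
    proof (rule inj_onI)
      fix i j assume ij: "i \<in> {x + d..y + d}" "j \<in> {x + d..y + d}" "B' i = B' j"
      have eq: "f (B (i - d)) = f (B (j - d))"
        using ij B'[of "i - d"] B'[of "j - d"] that by auto
      have "B (i - d) = B (j - d)"
        using eq monoB[of "i - d" "j - d"] monoB[of "j - d" "i - d"] ij that
        by (auto simp: not_less_iff_gr_or_eq dest: less_imp_neq)
      then show "i = j" using inj_onD[OF injB, of "i - d" "j - d"] ij that by auto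
    qed
    obtain B1 s1 where B1: "dual_pivot_qs M B left (l - 1) = (B1, s1)" by fastforce
    obtain B2 s2 where B2: "dual_pivot_qs M B1 (l + 1) (g - 1) = (B2, s2)" by fastforce
    obtain B3 s3 where B3: "dual_pivot_qs M B2 (g + 1) right = (B3, s3)" by fastforce
    obtain C1 t1 where C1: "dual_pivot_qs M B' (left + d) (l + d - 1) = (C1, t1)" by fastforce
    obtain C2 t2 where C2: "dual_pivot_qs M C1 (l + d + 1) (g + d - 1) = (C2, t2)" by fastforce
    obtain C3 t3 where C3: "dual_pivot_qs M C2 (g + d + 1) (right + d) = (C3, t3)" by fastforce
    have L: "qs_swaps M A left right = s + s1 + s2 + s3"
      using False by (subst dual_pivot_qs.simps) (simp add: yp B1 B2 B3)
    have R: "qs_swaps M A' (left + d) (right + d) = s + t1 + t2 + t3"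
      using False by (subst dual_pivot_qs.simps) (simp add: yp' C1 C2 C3)
    have b1: "B1 j = B j" if "l - 1 < j" for j
      using dual_pivot_qs_frame[OF \<open>0 < M\<close> inj_on_subset[OF injB], of left "l - 1" j] that correct(2-4)
      by (simp add: B1 subset_iff)
    have inj1: "inj_on B1 {l + 1..g - 1}"
      using injB correct(2-4) inj_on_subset[of B "{left..right}" "{l + 1..g - 1}"]
      by (subst inj_on_cong[of _ B1 B]) (auto simp: b1)
    have b2: "B2 j = B j" if "g - 1 < j" for j
      using dual_pivot_qs_frame[OF \<open>0 < M\<close> inj1, of j] that correct(2-4) by (auto simp: B2 b1)
    have inj2: "inj_on B2 {g + 1..right}"
      using injB correct(2-4) inj_on_subset[of B "{left..right}" "{g + 1..right}"]
      by (subst inj_on_cong[of _ B2 B]) (auto simp: b2)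
    have "inj_on B' {left + d..l + d - 1}"
      using inj'[of left "l - 1"] correct(2-4) by (simp add: algebra_simps)
    then have c1: "C1 j = B' j" if "l + d - 1 < j" for j
      using dual_pivot_qs_frame[OF \<open>0 < M\<close>, of B' "left + d" "l + d - 1" j] that by (simp add: C1)
    have "inj_on C1 {l + d + 1..g + d - 1}"
      using inj'[of "l + 1" "g - 1"] correct(2-4)
      by (subst inj_on_cong[of _ C1 B']) (auto simp: c1 algebra_simps)
    then have c2: "C2 j = B' j" if "g + d - 1 < j" for j
      using dual_pivot_qs_frame[OF \<open>0 < M\<close>, of C1 "l + d + 1" "g + d - 1" j] that correct(2-4) by (auto simp: C2 c1)
    have "qs_swaps M B' (left + d) (l - 1 + d) = qs_swaps M B left (l - 1)"
      by (rule "1.IH"(1)[OF False yp[symmetric] refl refl refl \<open>0 < M\<close>])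
        (use injB correct(2-4) B' monoB in \<open>auto intro: inj_on_subset\<close>)
    then have "s1 = t1" using B1 C1 by (simp add: algebra_simps)
    moreover have "qs_swaps M C1 (l + 1 + d) (g - 1 + d) = qs_swaps M B1 (l + 1) (g - 1)"
      by (rule "1.IH"(2)[OF False yp[symmetric] refl refl refl B1[symmetric] refl \<open>0 < M\<close> inj1])
        (use correct(2-4) B' monoB in \<open>auto simp: b1 c1\<close>)
    then have "s2 = t2" using B2 C2 by (simp add: algebra_simps)
    moreover have "qs_swaps M C2 (g + 1 + d) (right + d) = qs_swaps M B2 (g + 1) right"
      by (rule "1.IH"(3)[OF False yp[symmetric] refl refl refl B1[symmetric] refl B2[symmetric] refl \<open>0 < M\<close> inj2])
        (use correct(2-4) B' monoB in \<open>auto simp: b2 c2\<close>)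
    then have "s3 = t3" using B3 C3 by (simp add: algebra_simps)
    ultimately show ?thesis using L R by simp
  qed
qed

lemma qs_swaps_local:
  assumes "0 < M" "inj_on A {left..right}" "\<And>i. left \<le> i \<Longrightarrow> i \<le> right \<Longrightarrow> A' i = A i"
  shows "qs_swaps M A' left right = qs_swaps M A left right"
  using qs_swaps_simulation[of M A left right A' 0 "\<lambda>x. x"] assms by auto

lemma qs_swaps_below_threshold: "right - left < int M \<Longrightarrow> qs_swaps M A left right = 0"
  by (subst dual_pivot_qs.simps) simp

lemma qs_swaps_partition:
  assumes "0 < M" "inj_on A {left..right}" "int M \<le> right - left"
    and yp: "yaroslavskiy_partition A left right = (B, l, g, s)"
  shows "qs_swaps M A left right =
    s + qs_swaps M B left (l - 1) + qs_swaps M B (l + 1) (g - 1) + qs_swaps M B (g + 1) right"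
proof -
  have lr: "left < right" using assms(1,3) by auto
  note correct = yaroslavskiy_partition_correct[OF yp lr assms(2)]
  obtain \<rho> where \<rho>: "\<rho> permutes {left..right}" "B = A \<circ> \<rho>" using correct(1) by blast
  have injB: "inj_on B {left..right}"
    unfolding \<rho>(2) by (rule comp_inj_on) (use \<rho>(1) assms(2) in \<open>auto simp: permutes_image intro: permutes_inj_on\<close>)
  obtain B1 s1 where B1: "dual_pivot_qs M B left (l - 1) = (B1, s1)" by fastforce
  obtain B2 s2 where B2: "dual_pivot_qs M B1 (l + 1) (g - 1) = (B2, s2)" by fastforce
  obtain B3 s3 where B3: "dual_pivot_qs M B2 (g + 1) right = (B3, s3)" by fastforce
  have L: "qs_swaps M A left right = s + s1 + s2 + s3"
    using assms(3) by (subst dual_pivot_qs.simps) (simp add: yp B1 B2 B3)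
  have b1: "B1 j = B j" if "l - 1 < j" for j
    using dual_pivot_qs_frame[OF \<open>0 < M\<close> inj_on_subset[OF injB], of left "l - 1" j] that correct(2-4)
    by (simp add: B1 subset_iff)
  have inj1: "inj_on B {l + 1..g - 1}" "inj_on B {g + 1..right}"
    by (rule inj_on_subset[OF injB]; use correct(2-4) in force)+
  have "inj_on B1 {l + 1..g - 1}"
    using inj1 by (subst inj_on_cong[of _ B1 B]) (auto simp: b1)
  then have b2: "B2 j = B j" if "g - 1 < j" for j
    using dual_pivot_qs_frame[OF \<open>0 < M\<close>, of B1 "l + 1" "g - 1" j] that correct(2-4) by (auto simp: B2 b1)
  have "qs_swaps M B1 (l + 1) (g - 1) = qs_swaps M B (l + 1) (g - 1)"
    by (rule qs_swaps_local) (use assms(1) inj1 b1 in auto)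
  moreover have "qs_swaps M B2 (g + 1) right = qs_swaps M B (g + 1) right"
    by (rule qs_swaps_local) (use assms(1) inj1 b2 in auto)
  ultimately show ?thesis using L B1 B2 B3 by simp
qed

section \<open>Independence of the subarrays\<close>

abbreviation perms :: "nat \<Rightarrow> (int \<Rightarrow> int) set" where
  "perms n \<equiv> {\<pi>. \<pi> permutes {1..int n}}"

lemma finite_perms: "finite (perms n)" and card_perms: "card (perms n) = fact n"
  by (auto intro: finite_permutations simp: card_permutations)

lemma perms_nonempty: "perms n \<noteq> {}"
  by (rule ex_in_conv[THEN iffD1], rule exI[of _ id]) (simp add: permutes_id)

lemma set_pmf_random_perm: "set_pmf (random_perm n) = perms n"
  unfolding random_perm_def by (rule set_pmf_of_set[OF perms_nonempty finite_perms])

abbreviation pavg :: "nat \<Rightarrow> ((int \<Rightarrow> int) \<Rightarrow> 'b::{banach, second_countable_topology}) \<Rightarrow> 'b" where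
  "pavg n f \<equiv> measure_pmf.expectation (random_perm n) f"

lemma pavg_eq_sum: "pavg n f = (\<Sum>\<pi>\<in>perms n. f \<pi>) /\<^sub>R fact n"
proof -
  have "pavg n f = (\<Sum>\<pi>\<in>perms n. pmf (random_perm n) \<pi> *\<^sub>R f \<pi>)"
    by (rule integral_measure_pmf) (auto simp: finite_perms set_pmf_random_perm)
  also have "\<dots> = (\<Sum>\<pi>\<in>perms n. (1 / fact n) *\<^sub>R f \<pi>)"
    by (intro sum.cong) (simp_all add: random_perm_def pmf_of_set[OF perms_nonempty finite_perms] card_perms[simplified])
  finally show ?thesis by (simp add: scaleR_sum_right divide_inverse)
qed

lemma pavg_cong: "(\<And>\<pi>. \<pi> permutes {1..int n} \<Longrightarrow> f \<pi> = g \<pi>) \<Longrightarrow> pavg n f = pavg n g"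
  unfolding pavg_eq_sum by (auto intro!: sum.cong)

lemma integrable_random_perm:
  "integrable (measure_pmf (random_perm n)) (f :: _ \<Rightarrow> 'b::{banach, second_countable_topology})"
  by (rule integrable_measure_pmf_finite) (simp add: set_pmf_random_perm finite_perms)

lemma pavg_comp_right:
  assumes "\<sigma> permutes {1..int n}"
  shows "pavg n (\<lambda>\<pi>. f (\<pi> \<circ> \<sigma>)) = pavg n f"
proof -
  have "(\<Sum>\<pi>\<in>perms n. f (\<pi> \<circ> \<sigma>)) = (\<Sum>\<pi>\<in>perms n. f \<pi>)"
    by (rule sum.reindex_bij_witness[where i = "\<lambda>\<pi>. \<pi> \<circ> inv \<sigma>" and j = "\<lambda>\<pi>. \<pi> \<circ> \<sigma>"])
       (use assms in \<open>auto simp: permutes_compose permutes_inv permutes_inv_o comp_assoc\<close>)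
  then show ?thesis by (simp add: pavg_eq_sum)
qed

text \<open>Embeds a product of three symmetric groups as the Young subgroup of the permutations
  that fix \<open>p\<close> and \<open>q\<close> and preserve the values below, between and above
  them. The outer ends of the range need no test, since the factors are the identity outside their
  blocks.\<close>

definition join_perms ::
  "int \<Rightarrow> int \<Rightarrow> (int \<Rightarrow> int) \<Rightarrow> (int \<Rightarrow> int) \<Rightarrow> (int \<Rightarrow> int) \<Rightarrow> int \<Rightarrow> int" where
  "join_perms p q \<alpha> \<beta> \<gamma> i =
     (if i < p then \<alpha> i else if p < i \<and> i < q then \<beta> (i - p) + p
      else if q < i then \<gamma> (i - q) + q else i)"

context
  fixes n p q i1 i2 i3 :: int
  assumes pq: "1 \<le> p" "p < q" "q \<le> n"
  defines "i1 \<equiv> p - 1" and "i2 \<equiv> q - p - 1" and "i3 \<equiv> n - q"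
begin

lemma join_perms_blocks:
  assumes "\<alpha> permutes {1..i1}" "\<beta> permutes {1..i2}" "\<gamma> permutes {1..i3}"
  shows "i < p \<Longrightarrow> join_perms p q \<alpha> \<beta> \<gamma> i = \<alpha> i" "i < p \<Longrightarrow> \<alpha> i < p"
    "p < i \<Longrightarrow> i < q \<Longrightarrow> join_perms p q \<alpha> \<beta> \<gamma> i = \<beta> (i - p) + p"
    "p < i \<Longrightarrow> i < q \<Longrightarrow> 1 \<le> \<beta> (i - p) \<and> \<beta> (i - p) < q - p"
    "q < i \<Longrightarrow> join_perms p q \<alpha> \<beta> \<gamma> i = \<gamma> (i - q) + q" "q < i \<Longrightarrow> 1 \<le> \<gamma> (i - q)"
    "join_perms p q \<alpha> \<beta> \<gamma> p = p" "join_perms p q \<alpha> \<beta> \<gamma> q = q"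
proof -
  show "i < p \<Longrightarrow> \<alpha> i < p"
    using permutes_in_image[OF assms(1), of i] permutes_not_in[OF assms(1), of i]
    by (cases "1 \<le> i") (auto simp: i1_def)
  show "p < i \<Longrightarrow> i < q \<Longrightarrow> 1 \<le> \<beta> (i - p) \<and> \<beta> (i - p) < q - p"
    using permutes_in_image[OF assms(2), of "i - p"] by (auto simp: i2_def)
  show "q < i \<Longrightarrow> 1 \<le> \<gamma> (i - q)"
    using permutes_in_image[OF assms(3), of "i - q"] permutes_not_in[OF assms(3), of "i - q"]
    by (cases "i \<le> n") (auto simp: i3_def)
qed (use pq in \<open>auto simp: join_perms_def\<close>)

lemma join_perms_comp:
  assumes "\<alpha> permutes {1..i1}" "\<beta> permutes {1..i2}" "\<gamma> permutes {1..i3}"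
    "\<alpha>' permutes {1..i1}" "\<beta>' permutes {1..i2}" "\<gamma>' permutes {1..i3}"
  shows "join_perms p q \<alpha> \<beta> \<gamma> \<circ> join_perms p q \<alpha>' \<beta>' \<gamma>' =
    join_perms p q (\<alpha> \<circ> \<alpha>') (\<beta> \<circ> \<beta>') (\<gamma> \<circ> \<gamma>')"
proof
  fix i
  note J = join_perms_blocks[OF assms(1-3)] and J' = join_perms_blocks[OF assms(4-6)]
  consider "i < p" | "i = p" | "p < i" "i < q" | "i = q" | "q < i" using pq by linarith
  then show "(join_perms p q \<alpha> \<beta> \<gamma> \<circ> join_perms p q \<alpha>' \<beta>' \<gamma>') i =
    join_perms p q (\<alpha> \<circ> \<alpha>') (\<beta> \<circ> \<beta>') (\<gamma> \<circ> \<gamma>') i"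
  proof cases
    case 1
    then show ?thesis using J'(2)[of i] by (simp add: join_perms_def)
  next
    case 3
    then show ?thesis using J'(4)[of i] by (simp add: join_perms_def)
  next
    case 5
    then show ?thesis using J'(6)[of i] pq by (simp add: join_perms_def)
  qed (use pq in \<open>auto simp: join_perms_def\<close>)
qed

lemma join_perms_id: "join_perms p q id id id = id"
  by (auto simp: join_perms_def fun_eq_iff)

lemma join_perms_permutes:
  assumes "\<alpha> permutes {1..i1}" "\<beta> permutes {1..i2}" "\<gamma> permutes {1..i3}"
  shows "join_perms p q \<alpha> \<beta> \<gamma> permutes {1..n}"
proof -
  let ?J = "join_perms p q \<alpha> \<beta> \<gamma>" and ?I = "join_perms p q (inv \<alpha>) (inv \<beta>) (inv \<gamma>)"
  note inv = permutes_inv[OF assms(1)] permutes_inv[OF assms(2)] permutes_inv[OF assms(3)]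
  have "?J \<circ> ?I = id" "?I \<circ> ?J = id"
    using join_perms_comp[OF assms inv] join_perms_comp[OF inv assms] assms
    by (simp_all add: permutes_inv_o join_perms_id)
  then have "bij ?J" by (metis o_bij)
  moreover have "?J i = i" if "i \<notin> {1..n}" for i
    using that
    using pq permutes_not_in[OF assms(1), of i] permutes_not_in[OF assms(3), of "i - q"]
    by (auto simp: join_perms_def i1_def i3_def)
  ultimately show ?thesis by (simp add: permutes_def bij_iff)
qed

text \<open>Serves to recognise the partitioned array as a member of the subgroup. Its restriction
  to a block, translated so that the block starts at 1, is an injective self-map of a finite set and
  hence a permutation.\<close>

lemma block_preserving_imp_join:
  assumes B: "B permutes {1..n}" "B p = p" "B q = q"
    "\<And>i. 1 \<le> i \<Longrightarrow> i < p \<Longrightarrow> B i < p" "\<And>i. p < i \<Longrightarrow> i < q \<Longrightarrow> p < B i \<and> B i < q"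
    "\<And>i. q < i \<Longrightarrow> i \<le> n \<Longrightarrow> q < B i"
  shows "\<exists>\<alpha> \<beta> \<gamma>. \<alpha> permutes {1..i1} \<and> \<beta> permutes {1..i2} \<and> \<gamma> permutes {1..i3} \<and>
    B = join_perms p q \<alpha> \<beta> \<gamma>"
proof -
  define restrict where "restrict d m i = (if i \<in> {1..m} then B (i + d) - d else i)" for d m i
  have restrict: "restrict d m permutes {1..m}"
    if "\<And>i. i \<in> {1..m} \<Longrightarrow> B (i + d) - d \<in> {1..m}" for d m
  proof (rule bij_imp_permutes)
    have "inj_on (restrict d m) {1..m}"
      by (rule inj_onI) (use permutes_inj[OF B(1)] in \<open>auto simp: restrict_def dest!: injD\<close>)
    moreover have "restrict d m ` {1..m} \<subseteq> {1..m}" using that by (auto simp: restrict_def)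
    ultimately show "bij_betw (restrict d m) {1..m} {1..m}"
      by (simp add: bij_betw_def endo_inj_surj)
  qed (auto simp: restrict_def)
  have rng: "1 \<le> B i \<and> B i \<le> n" if "1 \<le> i" "i \<le> n" for i
    using permutes_in_image[OF B(1), of i] that by auto
  have "restrict 0 i1 permutes {1..i1}"
    by (rule restrict) (use B(4) rng pq in \<open>auto simp: i1_def\<close>)
  moreover have "restrict p i2 permutes {1..i2}"
  proof (rule restrict)
    fix i assume "i \<in> {1..i2}"
    then show "B (i + p) - p \<in> {1..i2}" using B(5)[of "i + p"] by (auto simp: i2_def)
  qed
  moreover have "restrict q i3 permutes {1..i3}"
  proof (rule restrict)
    fix i assume "i \<in> {1..i3}"
    then show "B (i + q) - q \<in> {1..i3}" using B(6)[of "i + q"] rng[of "i + q"] pq by (auto simp: i3_def)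
  qed
  moreover have "B = join_perms p q (restrict 0 i1) (restrict p i2) (restrict q i3)"
  proof
    fix i
    show "B i = join_perms p q (restrict 0 i1) (restrict p i2) (restrict q i3) i"
      using B(2,3) permutes_not_in[OF B(1), of i] pq
      by (auto simp: join_perms_def restrict_def i1_def i2_def i3_def)
  qed
  ultimately show ?thesis by blast
qed

lemma qs_swaps_join:
  assumes "0 < M" "\<alpha> permutes {1..i1}" "\<beta> permutes {1..i2}" "\<gamma> permutes {1..i3}"
  defines "J \<equiv> join_perms p q \<alpha> \<beta> \<gamma>"
  shows "qs_swaps M J 1 (p - 1) = qs_swaps M \<alpha> 1 i1"
    "qs_swaps M J (p + 1) (q - 1) = qs_swaps M \<beta> 1 i2"
    "qs_swaps M J (q + 1) n = qs_swaps M \<gamma> 1 i3"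
proof -
  note inj = assms(2-4)[THEN permutes_inj, THEN inj_on_subset]
  have "qs_swaps M J (1 + 0) (i1 + 0) = qs_swaps M \<alpha> 1 i1"
    by (rule qs_swaps_simulation[where f = id]) (use assms(1) inj pq in \<open>auto simp: J_def join_perms_def i1_def\<close>)
  then show "qs_swaps M J 1 (p - 1) = qs_swaps M \<alpha> 1 i1" by (simp add: i1_def)
  have "qs_swaps M J (1 + p) (i2 + p) = qs_swaps M \<beta> 1 i2"
    by (rule qs_swaps_simulation[where f = "\<lambda>x. x + p"]) (use assms(1) inj pq in \<open>auto simp: J_def join_perms_def i2_def\<close>)
  then show "qs_swaps M J (p + 1) (q - 1) = qs_swaps M \<beta> 1 i2" by (simp add: i2_def algebra_simps)
  have "qs_swaps M J (1 + q) (i3 + q) = qs_swaps M \<gamma> 1 i3"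
    by (rule qs_swaps_simulation[where f = "\<lambda>x. x + q"]) (use assms(1) inj pq in \<open>auto simp: J_def join_perms_def i3_def\<close>)
  then show "qs_swaps M J (q + 1) n = qs_swaps M \<gamma> 1 i3" by (simp add: i3_def algebra_simps)
qed

end

section \<open>Pivots and block sizes of a permutation\<close>

definition pivot_lo :: "nat \<Rightarrow> (int \<Rightarrow> int) \<Rightarrow> int" where "pivot_lo n \<pi> = min (\<pi> 1) (\<pi> (int n))"
definition pivot_hi :: "nat \<Rightarrow> (int \<Rightarrow> int) \<Rightarrow> int" where "pivot_hi n \<pi> = max (\<pi> 1) (\<pi> (int n))"
definition part_swaps :: "nat \<Rightarrow> (int \<Rightarrow> int) \<Rightarrow> nat" where
  "part_swaps n \<pi> = snd (snd (snd (yaroslavskiy_partition \<pi> 1 (int n))))"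

abbreviation "block1 n \<pi> \<equiv> nat (pivot_lo n \<pi> - 1)"
abbreviation "block2 n \<pi> \<equiv> nat (pivot_hi n \<pi> - pivot_lo n \<pi> - 1)"
abbreviation "block3 n \<pi> \<equiv> nat (int n - pivot_hi n \<pi>)"

lemma pivot_bounds:
  assumes "\<pi> permutes {1..int n}" "2 \<le> n"
  shows "1 \<le> pivot_lo n \<pi>" "pivot_lo n \<pi> < pivot_hi n \<pi>" "pivot_hi n \<pi> \<le> int n"
    "pivot_lo n \<pi> \<le> int n" "1 \<le> pivot_hi n \<pi>"
proof -
  have "\<pi> 1 \<in> {1..int n}" "\<pi> (int n) \<in> {1..int n}"
    using assms(2) permutes_in_image[OF assms(1)] by auto
  moreover have "\<pi> 1 \<noteq> \<pi> (int n)"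
    using assms(2) permutes_inj[OF assms(1), THEN injD, of 1 "int n"] by auto
  ultimately show "1 \<le> pivot_lo n \<pi>" "pivot_lo n \<pi> < pivot_hi n \<pi>" "pivot_hi n \<pi> \<le> int n"
    "pivot_lo n \<pi> \<le> int n" "1 \<le> pivot_hi n \<pi>"
    by (auto simp: pivot_lo_def pivot_hi_def)
qed

text \<open>On a permutation each pivot ends up in the cell numbered by its own value: the cells
  left of \<open>l\<close> receive exactly the values below the smaller pivot, so comparing
  cardinalities determines \<open>l\<close>, and the cells right of \<open>g\<close> determine
  \<open>g\<close> in the same way. Hence the block sizes are functions of the two end entries
  alone.\<close>

lemma partition_permutation:
  assumes \<pi>: "\<pi> permutes {1..int n}" and n: "2 \<le> n"
  defines "B \<equiv> fst (yaroslavskiy_partition \<pi> 1 (int n))"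
  shows "yaroslavskiy_partition \<pi> 1 (int n) = (B, pivot_lo n \<pi>, pivot_hi n \<pi>, part_swaps n \<pi>)"
    "B permutes {1..int n}" "B (pivot_lo n \<pi>) = pivot_lo n \<pi>" "B (pivot_hi n \<pi>) = pivot_hi n \<pi>"
    "\<And>i. 1 \<le> i \<Longrightarrow> i < pivot_lo n \<pi> \<Longrightarrow> B i < pivot_lo n \<pi>"
    "\<And>i. pivot_lo n \<pi> < i \<Longrightarrow> i < pivot_hi n \<pi> \<Longrightarrow> pivot_lo n \<pi> < B i \<and> B i < pivot_hi n \<pi>"
    "\<And>i. pivot_hi n \<pi> < i \<Longrightarrow> i \<le> int n \<Longrightarrow> pivot_hi n \<pi> < B i"
    "\<bar>real (part_swaps n \<pi>) - (real_of_int (pivot_lo n \<pi> - 1) +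
       real (card {i \<in> {2..pivot_hi n \<pi> - 1}. pivot_hi n \<pi> < \<pi> i}))\<bar> \<le> 3"
proof -
  obtain l g s where yp: "yaroslavskiy_partition \<pi> 1 (int n) = (B, l, g, s)"
    unfolding B_def by (metis prod_cases4 fst_conv)
  have inj: "inj_on \<pi> {1..int n}" using \<pi> by (auto intro: permutes_inj_on)
  note C = yaroslavskiy_partition_correct[OF yp _ inj, folded pivot_lo_def pivot_hi_def]
  have n1: "1 < int n" using n by simp
  obtain \<rho> where \<rho>: "\<rho> permutes {1..int n}" "B = \<pi> \<circ> \<rho>" using C(1)[OF n1] by blast
  have B: "B permutes {1..int n}" unfolding \<rho>(2) using \<rho>(1) \<pi> by (rule permutes_compose)
  have img: "B ` {1..int n} = {1..int n}" using B by (rule permutes_image)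
  note b = pivot_bounds[OF \<pi> n]
  have rng: "1 \<le> B i \<and> B i \<le> int n" if "1 \<le> i" "i \<le> int n" for i
    using permutes_in_image[OF B, of i] that by auto
  have inj_B: "inj_on B X" for X using B by (auto intro: permutes_inj_on)
  have "B ` {1..<l} = {1..<pivot_lo n \<pi>}"
  proof
    show "B ` {1..<l} \<subseteq> {1..<pivot_lo n \<pi>}" using C(7)[OF n1] C(2-4)[OF n1] rng by auto
    show "{1..<pivot_lo n \<pi>} \<subseteq> B ` {1..<l}"
    proof
      fix x assume x: "x \<in> {1..<pivot_lo n \<pi>}"
      then have "x \<in> B ` {1..int n}" using b by (simp only: img) auto
      then obtain i where i: "i \<in> {1..int n}" "x = B i" by blast
      have "i < l"
      proof (rule ccontr)
        assume "\<not> i < l"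
        then consider "i = l" | "l < i" "i < g" | "i = g" | "g < i" by linarith
        then show False using C(5,6)[OF n1] C(8)[OF n1, of i] C(9)[OF n1, of i] i x b
          by cases auto
      qed
      then show "x \<in> B ` {1..<l}" using i by auto
    qed
  qed
  then have "card {1..<l} = card {1..<pivot_lo n \<pi>}" using card_image[OF inj_B, of "{1..<l}"] by simp
  then have l: "l = pivot_lo n \<pi>" using C(2)[OF n1] b by simp
  have "B ` {g<..int n} = {pivot_hi n \<pi><..int n}"
  proof
    show "B ` {g<..int n} \<subseteq> {pivot_hi n \<pi><..int n}" using C(9)[OF n1] C(2-4)[OF n1] rng by auto
    show "{pivot_hi n \<pi><..int n} \<subseteq> B ` {g<..int n}"
    proof
      fix x assume x: "x \<in> {pivot_hi n \<pi><..int n}"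
      then have "x \<in> B ` {1..int n}" using b by (simp only: img) auto
      then obtain i where i: "i \<in> {1..int n}" "x = B i" by blast
      have "g < i"
      proof (rule ccontr)
        assume "\<not> g < i"
        then consider "i = g" | "l < i" "i < g" | "i = l" | "i < l" by linarith
        then show False using C(5,6)[OF n1] C(8)[OF n1, of i] C(7)[OF n1, of i] i x b
          by cases auto
      qed
      then show "x \<in> B ` {g<..int n}" using i by auto
    qed
  qed
  then have "card {g<..int n} = card {pivot_hi n \<pi><..int n}" using card_image[OF inj_B, of "{g<..int n}"] by simp
  then have g: "g = pivot_hi n \<pi>" using C(4)[OF n1] b by simp
  have s: "s = part_swaps n \<pi>" by (simp add: part_swaps_def yp)
  show "yaroslavskiy_partition \<pi> 1 (int n) = (B, pivot_lo n \<pi>, pivot_hi n \<pi>, part_swaps n \<pi>)"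
    "B permutes {1..int n}" "B (pivot_lo n \<pi>) = pivot_lo n \<pi>" "B (pivot_hi n \<pi>) = pivot_hi n \<pi>"
    "\<And>i. 1 \<le> i \<Longrightarrow> i < pivot_lo n \<pi> \<Longrightarrow> B i < pivot_lo n \<pi>"
    "\<And>i. pivot_lo n \<pi> < i \<Longrightarrow> i < pivot_hi n \<pi> \<Longrightarrow> pivot_lo n \<pi> < B i \<and> B i < pivot_hi n \<pi>"
    "\<And>i. pivot_hi n \<pi> < i \<Longrightarrow> i \<le> int n \<Longrightarrow> pivot_hi n \<pi> < B i"
    "\<bar>real (part_swaps n \<pi>) - (real_of_int (pivot_lo n \<pi> - 1) +
       real (card {i \<in> {2..pivot_hi n \<pi> - 1}. pivot_hi n \<pi> < \<pi> i}))\<bar> \<le> 3"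
    using yp B C(5-10)[OF n1] by (simp_all add: l g s)
qed

lemma sum_perms_fiber_comp_left:
  assumes "\<sigma> permutes {1..int n}" "\<And>\<pi>. \<pi> permutes {1..int n} \<Longrightarrow> P (\<sigma> \<circ> \<pi>) \<longleftrightarrow> P \<pi>"
  shows "(\<Sum>\<pi> | \<pi> permutes {1..int n} \<and> P \<pi>. f (\<sigma> \<circ> \<pi>)) = (\<Sum>\<pi> | \<pi> permutes {1..int n} \<and> P \<pi>. f \<pi>)"
proof -
  have "P (inv \<sigma> \<circ> \<pi>) \<longleftrightarrow> P \<pi>" if "\<pi> permutes {1..int n}" for \<pi>
    using assms(2)[of "inv \<sigma> \<circ> \<pi>"] that assms(1)
    by (simp add: permutes_compose permutes_inv permutes_inv_o comp_assoc[symmetric])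
  then show ?thesis
    by (intro sum.reindex_bij_witness[where i = "\<lambda>\<pi>. inv \<sigma> \<circ> \<pi>" and j = "\<lambda>\<pi>. \<sigma> \<circ> \<pi>"])
      (use assms in \<open>auto simp: permutes_compose permutes_inv permutes_inv_o comp_assoc[symmetric]\<close>)
qed

text \<open>Composing \<open>\<pi>\<close> on the left with a block permutation changes no
  comparison with a pivot, so partitioning yields the old result \<open>B\<close> composed with the
  same block permutation. As \<open>B\<close> is itself a join of some \<open>\<alpha>0\<close>,
  \<open>\<beta>0\<close>, \<open>\<gamma>0\<close>, the subarrays become
  \<open>\<alpha> \<circ> \<alpha>0\<close> and so on, and averaging over all
  \<open>\<alpha>\<close>, \<open>\<beta>\<close>, \<open>\<gamma>\<close> absorbs the fixed
  factors.\<close>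

lemma qs_swaps_join_partition:
  fixes F :: "nat \<Rightarrow> 'b::{banach, second_countable_topology}"
  assumes M: "0 < M" and n: "M < n" and \<pi>: "\<pi> permutes {1..int n}"
  defines "p \<equiv> pivot_lo n \<pi>" and "q \<equiv> pivot_hi n \<pi>"
  shows "pavg (block1 n \<pi>) (\<lambda>\<alpha>. pavg (block2 n \<pi>) (\<lambda>\<beta>. pavg (block3 n \<pi>) (\<lambda>\<gamma>.
      F (qs_swaps M (join_perms p q \<alpha> \<beta> \<gamma> \<circ> \<pi>) 1 (int n))))) =
    pavg (block1 n \<pi>) (\<lambda>\<alpha>. pavg (block2 n \<pi>) (\<lambda>\<beta>. pavg (block3 n \<pi>) (\<lambda>\<gamma>.
      F (part_swaps n \<pi> + qs_swaps M \<alpha> 1 (int (block1 n \<pi>)) + qs_swaps M \<beta> 1 (int (block2 n \<pi>))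
         + qs_swaps M \<gamma> 1 (int (block3 n \<pi>))))))"
proof -
  have n2: "2 \<le> n" using M n by simp
  note b = pivot_bounds[OF \<pi> n2, folded p_def q_def]
  define B where "B = fst (yaroslavskiy_partition \<pi> 1 (int n))"
  note B = partition_permutation[OF \<pi> n2, folded p_def q_def B_def]
  obtain \<alpha>0 \<beta>0 \<gamma>0 where J0: "\<alpha>0 permutes {1..p - 1}" "\<beta>0 permutes {1..q - p - 1}"
    "\<gamma>0 permutes {1..int n - q}" "B = join_perms p q \<alpha>0 \<beta>0 \<gamma>0"
    using block_preserving_imp_join[OF b(1-3) B(2-7)] by blast
  have blocks: "int (block1 n \<pi>) = p - 1" "int (block2 n \<pi>) = q - p - 1" "int (block3 n \<pi>) = int n - q"
    using b by (auto simp: p_def q_def)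
  have count: "qs_swaps M (join_perms p q \<alpha> \<beta> \<gamma> \<circ> \<pi>) 1 (int n) =
      part_swaps n \<pi> + qs_swaps M (\<alpha> \<circ> \<alpha>0) 1 (p - 1) + qs_swaps M (\<beta> \<circ> \<beta>0) 1 (q - p - 1)
         + qs_swaps M (\<gamma> \<circ> \<gamma>0) 1 (int n - q)"
    if abc: "\<alpha> permutes {1..p - 1}" "\<beta> permutes {1..q - p - 1}" "\<gamma> permutes {1..int n - q}" for \<alpha> \<beta> \<gamma>
  proof -
    let ?J = "join_perms p q \<alpha> \<beta> \<gamma>"
    note J = join_perms_blocks[OF b(1-3) abc]
    have cls: "?J x = p \<longleftrightarrow> x = p" "?J x = q \<longleftrightarrow> x = q" "?J x < p \<longleftrightarrow> x < p" "q < ?J x \<longleftrightarrow> q < x"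
      "?J x < q \<longleftrightarrow> x < q" "p < ?J x \<longleftrightarrow> p < x" for x
    proof -
      consider "x < p" | "x = p" | "p < x" "x < q" | "x = q" | "q < x" using b by linarith
      then have "(?J x = p \<longleftrightarrow> x = p) \<and> (?J x = q \<longleftrightarrow> x = q) \<and> (?J x < p \<longleftrightarrow> x < p) \<and>
          (q < ?J x \<longleftrightarrow> q < x) \<and> (?J x < q \<longleftrightarrow> x < q) \<and> (p < ?J x \<longleftrightarrow> p < x)"
      proof cases
        case 1
        then show ?thesis using J(1,2)[of x] b by simp
      next
        case 3
        then show ?thesis using J(3,4)[of x] b by simp
      next
        case 5
        then show ?thesis using J(5,6)[of x] b by simp
      qed (use J(7,8) b in simp_all)
      then show "?J x = p \<longleftrightarrow> x = p" "?J x = q \<longleftrightarrow> x = q" "?J x < p \<longleftrightarrow> x < p" "q < ?J x \<longleftrightarrow> q < x"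
        "?J x < q \<longleftrightarrow> x < q" "p < ?J x \<longleftrightarrow> p < x" by auto
    qed
    have ends: "{\<pi> 1, \<pi> (int n)} = {p, q}" by (auto simp: p_def q_def pivot_lo_def pivot_hi_def)
    have "\<exists>B'. yaroslavskiy_partition (?J \<circ> \<pi>) (1 + 0) (int n + 0) = (B', p + 0, q + 0, part_swaps n \<pi>) \<and>
      (\<forall>i. 1 \<le> i \<longrightarrow> i \<le> int n \<longrightarrow> B' (i + 0) = ?J (B i))"
    proof (rule yaroslavskiy_partition_simulation[OF B(1)])
      fix i
      have "\<pi> 1 = p \<and> \<pi> (int n) = q \<or> \<pi> 1 = q \<and> \<pi> (int n) = p" using ends by (auto simp: doubleton_eq_iff)
      then show "(?J (\<pi> i) < ?J (\<pi> 1) \<longleftrightarrow> \<pi> i < \<pi> 1) \<and> (?J (\<pi> 1) < ?J (\<pi> i) \<longleftrightarrow> \<pi> 1 < \<pi> i) \<and>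
        (?J (\<pi> i) < ?J (\<pi> (int n)) \<longleftrightarrow> \<pi> i < \<pi> (int n)) \<and> (?J (\<pi> (int n)) < ?J (\<pi> i) \<longleftrightarrow> \<pi> (int n) < \<pi> i)"
        by (elim disjE conjE) (simp_all add: J(7,8) cls)
    qed (use n2 in auto)
    then obtain B' where B': "yaroslavskiy_partition (?J \<circ> \<pi>) 1 (int n) = (B', p, q, part_swaps n \<pi>)"
      "\<And>i. 1 \<le> i \<Longrightarrow> i \<le> int n \<Longrightarrow> B' i = (?J \<circ> B) i" by auto
    have Jp: "?J permutes {1..int n}" by (rule join_perms_permutes[OF b(1-3) abc])
    have "(?J \<circ> \<pi>) permutes {1..int n}" using \<pi> Jp by (rule permutes_compose)
    then have "inj_on (?J \<circ> \<pi>) {1..int n}" by (rule permutes_inj_on)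
    then have main: "qs_swaps M (?J \<circ> \<pi>) 1 (int n) =
      part_swaps n \<pi> + qs_swaps M B' 1 (p - 1) + qs_swaps M B' (p + 1) (q - 1) + qs_swaps M B' (q + 1) (int n)"
      using n B'(1) by (intro qs_swaps_partition[OF M]) auto
    have "inj_on (?J \<circ> B) X" for X
      using permutes_compose[OF B(2) Jp] by (rule permutes_inj_on)
    then have loc: "qs_swaps M B' x y = qs_swaps M (?J \<circ> B) x y" if "1 \<le> x" "y \<le> int n" for x y
      using that B'(2) by (intro qs_swaps_local[OF M]) auto
    have "qs_swaps M B' 1 (p - 1) = qs_swaps M (\<alpha> \<circ> \<alpha>0) 1 (p - 1)"
      "qs_swaps M B' (p + 1) (q - 1) = qs_swaps M (\<beta> \<circ> \<beta>0) 1 (q - p - 1)"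
      "qs_swaps M B' (q + 1) (int n) = qs_swaps M (\<gamma> \<circ> \<gamma>0) 1 (int n - q)"
      using b qs_swaps_join[OF b(1-3) M permutes_compose[OF J0(1) abc(1)] permutes_compose[OF J0(2) abc(2)]
        permutes_compose[OF J0(3) abc(3)]]
      by (simp_all add: loc J0(4) join_perms_comp[OF b(1-3) abc J0(1-3)])
    with main show ?thesis by simp
  qed
  have g_drop: "pavg (block3 n \<pi>) (\<lambda>\<gamma>. F (x + qs_swaps M (\<gamma> \<circ> \<gamma>0) 1 (int n - q))) =
      pavg (block3 n \<pi>) (\<lambda>\<gamma>. F (x + qs_swaps M \<gamma> 1 (int n - q)))" for x
    using pavg_comp_right[OF J0(3)[folded blocks], of "\<lambda>\<gamma>. F (x + qs_swaps M \<gamma> 1 (int n - q))"] .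
  have b_drop: "pavg (block2 n \<pi>) (\<lambda>\<beta>. pavg (block3 n \<pi>) (\<lambda>\<gamma>.
        F (x + qs_swaps M (\<beta> \<circ> \<beta>0) 1 (q - p - 1) + qs_swaps M \<gamma> 1 (int n - q)))) =
      pavg (block2 n \<pi>) (\<lambda>\<beta>. pavg (block3 n \<pi>) (\<lambda>\<gamma>.
        F (x + qs_swaps M \<beta> 1 (q - p - 1) + qs_swaps M \<gamma> 1 (int n - q))))" for x
    using pavg_comp_right[OF J0(2)[folded blocks], of "\<lambda>\<beta>. pavg (block3 n \<pi>) (\<lambda>\<gamma>.
        F (x + qs_swaps M \<beta> 1 (q - p - 1) + qs_swaps M \<gamma> 1 (int n - q)))"] .
  have a_drop: "pavg (block1 n \<pi>) (\<lambda>\<alpha>. pavg (block2 n \<pi>) (\<lambda>\<beta>. pavg (block3 n \<pi>) (\<lambda>\<gamma>.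
        F (x + qs_swaps M (\<alpha> \<circ> \<alpha>0) 1 (p - 1) + qs_swaps M \<beta> 1 (q - p - 1) + qs_swaps M \<gamma> 1 (int n - q))))) =
      pavg (block1 n \<pi>) (\<lambda>\<alpha>. pavg (block2 n \<pi>) (\<lambda>\<beta>. pavg (block3 n \<pi>) (\<lambda>\<gamma>.
        F (x + qs_swaps M \<alpha> 1 (p - 1) + qs_swaps M \<beta> 1 (q - p - 1) + qs_swaps M \<gamma> 1 (int n - q)))))" for x
    using pavg_comp_right[OF J0(1)[folded blocks], of "\<lambda>\<alpha>. pavg (block2 n \<pi>) (\<lambda>\<beta>. pavg (block3 n \<pi>) (\<lambda>\<gamma>.
        F (x + qs_swaps M \<alpha> 1 (p - 1) + qs_swaps M \<beta> 1 (q - p - 1) + qs_swaps M \<gamma> 1 (int n - q))))"] .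
  have "pavg (block1 n \<pi>) (\<lambda>\<alpha>. pavg (block2 n \<pi>) (\<lambda>\<beta>. pavg (block3 n \<pi>) (\<lambda>\<gamma>.
      F (qs_swaps M (join_perms p q \<alpha> \<beta> \<gamma> \<circ> \<pi>) 1 (int n))))) =
    pavg (block1 n \<pi>) (\<lambda>\<alpha>. pavg (block2 n \<pi>) (\<lambda>\<beta>. pavg (block3 n \<pi>) (\<lambda>\<gamma>.
      F (part_swaps n \<pi> + qs_swaps M (\<alpha> \<circ> \<alpha>0) 1 (p - 1) + qs_swaps M (\<beta> \<circ> \<beta>0) 1 (q - p - 1)
         + qs_swaps M (\<gamma> \<circ> \<gamma>0) 1 (int n - q)))))"
    by (intro pavg_cong, unfold blocks) (simp add: count)
  also have "\<dots> = pavg (block1 n \<pi>) (\<lambda>\<alpha>. pavg (block2 n \<pi>) (\<lambda>\<beta>. pavg (block3 n \<pi>) (\<lambda>\<gamma>.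
      F (part_swaps n \<pi> + qs_swaps M \<alpha> 1 (p - 1) + qs_swaps M \<beta> 1 (q - p - 1)
         + qs_swaps M \<gamma> 1 (int n - q)))))"
    by (simp only: g_drop b_drop a_drop)
  finally show ?thesis by (simp only: blocks)
qed

text \<open>
  Averaging over the permutations that preserve the three blocks of values and fix both pivots
  makes the three subarrays independent and uniform.
\<close>

lemma qs_swaps_recurrence:
  fixes F :: "nat \<Rightarrow> 'b::{banach, second_countable_topology}"
  assumes M: "0 < M" and n: "M < n"
  shows "pavg n (\<lambda>\<pi>. F (qs_swaps M \<pi> 1 (int n))) =
    pavg n (\<lambda>\<pi>. pavg (block1 n \<pi>) (\<lambda>\<alpha>. pavg (block2 n \<pi>) (\<lambda>\<beta>. pavg (block3 n \<pi>) (\<lambda>\<gamma>.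
      F (part_swaps n \<pi> + qs_swaps M \<alpha> 1 (int (block1 n \<pi>)) + qs_swaps M \<beta> 1 (int (block2 n \<pi>))
         + qs_swaps M \<gamma> 1 (int (block3 n \<pi>)))))))"
proof -
  define c where "c \<pi> = F (qs_swaps M \<pi> 1 (int n))" for \<pi> :: "int \<Rightarrow> int"
  define piv where "piv \<pi> = (pivot_lo n \<pi>, pivot_hi n \<pi>)" for \<pi>
  define R where "R = {(p, q). 1 \<le> p \<and> p < q \<and> q \<le> int n}"
  have n2: "2 \<le> n" using M n by simp
  have finR: "finite R" by (rule finite_subset[of _ "{1..int n} \<times> {1..int n}"]) (auto simp: R_def)
  have group: "(\<Sum>\<pi>\<in>perms n. f \<pi>) = (\<Sum>(p, q)\<in>R. \<Sum>\<pi> | \<pi> permutes {1..int n} \<and> piv \<pi> = (p, q). f \<pi>)"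
    for f :: "(int \<Rightarrow> int) \<Rightarrow> 'b"
  proof -
    have "piv ` perms n \<subseteq> R" using pivot_bounds[OF _ n2] by (auto simp: piv_def R_def)
    from sum.group[OF finite_perms finR this, of f] show ?thesis
      by (simp add: case_prod_beta' Collect_conj_eq[symmetric] cong: conj_cong)
  qed
  \<comment> \<open>Left multiplication by a block permutation maps the set of permutations with
    pivots \<open>p\<close> and \<open>q\<close> bijectively onto itself, so the inner averages
    leave the sum over this set unchanged.\<close>
  have "(\<Sum>\<pi> | \<pi> permutes {1..int n} \<and> piv \<pi> = (p, q).
      pavg (block1 n \<pi>) (\<lambda>\<alpha>. pavg (block2 n \<pi>) (\<lambda>\<beta>. pavg (block3 n \<pi>) (\<lambda>\<gamma>.
        c (join_perms (pivot_lo n \<pi>) (pivot_hi n \<pi>) \<alpha> \<beta> \<gamma> \<circ> \<pi>))))) =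
    (\<Sum>\<pi> | \<pi> permutes {1..int n} \<and> piv \<pi> = (p, q). c \<pi>)" (is "?L = ?R")
    if pq: "(p, q) \<in> R" for p q
  proof -
    have b: "1 \<le> p" "p < q" "q \<le> int n" using pq by (auto simp: R_def)
    let ?Q = "{\<pi>. \<pi> permutes {1..int n} \<and> piv \<pi> = (p, q)}"
    have "?L = (\<Sum>\<pi>\<in>?Q. pavg (nat (p - 1)) (\<lambda>\<alpha>. pavg (nat (q - p - 1)) (\<lambda>\<beta>. pavg (nat (int n - q)) (\<lambda>\<gamma>.
        c (join_perms p q \<alpha> \<beta> \<gamma> \<circ> \<pi>)))))"
      by (rule sum.cong) (auto simp: piv_def)
    also have "\<dots> = pavg (nat (p - 1)) (\<lambda>\<alpha>. pavg (nat (q - p - 1)) (\<lambda>\<beta>. pavg (nat (int n - q)) (\<lambda>\<gamma>.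
        \<Sum>\<pi>\<in>?Q. c (join_perms p q \<alpha> \<beta> \<gamma> \<circ> \<pi>))))"
      by (simp add: Bochner_Integration.integral_sum integrable_random_perm)
    also have "\<dots> = pavg (nat (p - 1)) (\<lambda>\<alpha>. pavg (nat (q - p - 1)) (\<lambda>\<beta>. pavg (nat (int n - q)) (\<lambda>\<gamma>. ?R)))"
    proof (intro pavg_cong sum_perms_fiber_comp_left)
      fix \<alpha> \<beta> \<gamma> assume "\<alpha> permutes {1..int (nat (p - 1))}" "\<beta> permutes {1..int (nat (q - p - 1))}"
        "\<gamma> permutes {1..int (nat (int n - q))}"
      then have abc: "\<alpha> permutes {1..p - 1}" "\<beta> permutes {1..q - p - 1}" "\<gamma> permutes {1..int n - q}"
        using b by auto
      show J: "join_perms p q \<alpha> \<beta> \<gamma> permutes {1..int n}" by (rule join_perms_permutes[OF b abc])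
      fix \<pi>
      let ?J = "join_perms p q \<alpha> \<beta> \<gamma>"
      have Jpq: "?J p = p" "?J q = q" using join_perms_blocks[OF b abc] by auto
      have inj: "?J x = p \<longleftrightarrow> x = p" "?J x = q \<longleftrightarrow> x = q" for x
        using permutes_inj[OF J, THEN injD] Jpq by metis+
      have "piv \<sigma> = (p, q) \<longleftrightarrow> (\<sigma> 1 = p \<and> \<sigma> (int n) = q \<or> \<sigma> 1 = q \<and> \<sigma> (int n) = p)" for \<sigma>
        using b by (auto simp: piv_def pivot_lo_def pivot_hi_def min_def max_def)
      then show "piv (?J \<circ> \<pi>) = (p, q) \<longleftrightarrow> piv \<pi> = (p, q)" by (simp add: inj)
    qed
    finally show ?thesis by simp
  qed
  then have "(\<Sum>\<pi>\<in>perms n. c \<pi>) = (\<Sum>\<pi>\<in>perms n. pavg (block1 n \<pi>) (\<lambda>\<alpha>. pavg (block2 n \<pi>) (\<lambda>\<beta>.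
      pavg (block3 n \<pi>) (\<lambda>\<gamma>. c (join_perms (pivot_lo n \<pi>) (pivot_hi n \<pi>) \<alpha> \<beta> \<gamma> \<circ> \<pi>)))))"
    unfolding group by (intro sum.cong) auto
  also have "\<dots> = (\<Sum>\<pi>\<in>perms n. pavg (block1 n \<pi>) (\<lambda>\<alpha>. pavg (block2 n \<pi>) (\<lambda>\<beta>. pavg (block3 n \<pi>) (\<lambda>\<gamma>.
      F (part_swaps n \<pi> + qs_swaps M \<alpha> 1 (int (block1 n \<pi>)) + qs_swaps M \<beta> 1 (int (block2 n \<pi>))
         + qs_swaps M \<gamma> 1 (int (block3 n \<pi>)))))))"
    unfolding c_def by (intro sum.cong refl qs_swaps_join_partition[OF M n]) simp
  finally show ?thesis unfolding pavg_eq_sum[of n] by (simp add: c_def)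
qed

section \<open>Concentration of the number of partitioning swaps\<close>

text \<open>Double transitivity of the symmetric group. One transposition takes \<open>a\<close> to
  \<open>a'\<close>; the other takes the current image of \<open>b\<close> to \<open>b'\<close> and
  does not touch \<open>a'\<close>, because that image and \<open>b'\<close> both differ from
  \<open>a'\<close>.\<close>

lemma exists_perm_moving_pair:
  assumes "a \<in> {1..int n}" "b \<in> {1..int n}" "a' \<in> {1..int n}" "b' \<in> {1..int n}" "a \<noteq> b" "a' \<noteq> b'"
  obtains \<sigma> where "\<sigma> permutes {1..int n}" "\<sigma> a = a'" "\<sigma> b = b'"
proof
  let ?t = "Transposition.transpose a a'"
  have "?t permutes {1..int n}" using assms by (intro permutes_swap_id)
  moreover have "?t b \<in> {1..int n}" using assms by (auto simp: Transposition.transpose_def)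
  then have "Transposition.transpose (?t b) b' permutes {1..int n}" using assms by (intro permutes_swap_id)
  ultimately show "Transposition.transpose (?t b) b' \<circ> ?t permutes {1..int n}" by (rule permutes_compose)
  show "(Transposition.transpose (?t b) b' \<circ> ?t) a = a'" "(Transposition.transpose (?t b) b' \<circ> ?t) b = b'"
    using assms(5,6) by (auto simp: Transposition.transpose_def)
qed

section \<open>Joint law of the two end entries\<close>

abbreviation perms_with_ends :: "nat \<Rightarrow> int \<Rightarrow> int \<Rightarrow> (int \<Rightarrow> int) set" where
  "perms_with_ends n a b \<equiv> {\<pi>. \<pi> permutes {1..int n} \<and> \<pi> 1 = a \<and> \<pi> (int n) = b}"

lemma sum_perms_by_ends:
  assumes "2 \<le> n"
  shows "(\<Sum>\<pi>\<in>perms n. f \<pi>) =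
    (\<Sum>a\<in>{1..int n}. \<Sum>b\<in>{1..int n} - {a}. \<Sum>\<pi>\<in>perms_with_ends n a b. f \<pi>)"
proof -
  let ?R = "SIGMA a:{1..int n}. {1..int n} - {a}"
  have "(\<lambda>\<pi>. (\<pi> 1, \<pi> (int n))) ` perms n \<subseteq> ?R"
  proof safe
    fix \<pi> assume \<pi>: "\<pi> permutes {1..int n}"
    show "\<pi> 1 \<in> {1..int n}" "\<pi> (int n) \<in> {1..int n}"
      using permutes_in_image[OF \<pi>, of 1] permutes_in_image[OF \<pi>, of "int n"] assms by auto
    assume "\<pi> (int n) = \<pi> 1"
    then show False using permutes_inj[OF \<pi>, THEN injD, of "int n" 1] assms by auto
  qed
  from sum.group[OF finite_perms _ this, of f] show ?thesis
    by (simp add: sum.Sigma case_prod_beta' prod_eq_iff)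
qed

text \<open>By double transitivity the \<open>n * (n - 1)\<close> classes of permutations with
  prescribed end entries are in bijection with each other, so they share the factorial
  equally.\<close>

lemma card_perms_with_ends:
  assumes "2 \<le> n" "a \<in> {1..int n}" "b \<in> {1..int n}" "a \<noteq> b"
  shows "real (card (perms_with_ends n a b)) = fact n / (real n * (real n - 1))"
proof -
  have eq: "card (perms_with_ends n a' b') = card (perms_with_ends n a b)"
    if ab': "a' \<in> {1..int n}" "b' \<in> {1..int n} - {a'}" for a' b'
  proof -
    obtain \<sigma> where \<sigma>: "\<sigma> permutes {1..int n}" "\<sigma> a = a'" "\<sigma> b = b'"
      using exists_perm_moving_pair[of a n b a' b'] assms ab' by auto
    have inv: "inv \<sigma> a' = a" "inv \<sigma> b' = b"
      using \<sigma> by (auto simp: permutes_inv_eq[OF \<sigma>(1)])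
    have "bij_betw (\<lambda>\<pi>. \<sigma> \<circ> \<pi>) (perms_with_ends n a b) (perms_with_ends n a' b')"
      by (rule bij_betwI[where g = "\<lambda>\<pi>. inv \<sigma> \<circ> \<pi>"])
        (use \<sigma> inv in \<open>auto simp: permutes_compose permutes_inv permutes_inv_o comp_assoc[symmetric]\<close>)
    then show ?thesis by (simp add: bij_betw_same_card)
  qed
  have "fact n = (\<Sum>\<pi>\<in>perms n. 1::nat)" by (simp add: card_perms[simplified])
  also have "\<dots> = (\<Sum>a'\<in>{1..int n}. \<Sum>b'\<in>{1..int n} - {a'}. card (perms_with_ends n a b))"
    unfolding sum_perms_by_ends[OF assms(1)] by (intro sum.cong refl) (simp add: eq)
  also have "\<dots> = n * (n - 1) * card (perms_with_ends n a b)"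
    by (simp add: card_Diff_singleton)
  finally have "real (fact n) = real (n * (n - 1) * card (perms_with_ends n a b))" by simp
  then have "fact n = real n * (real n - 1) * real (card (perms_with_ends n a b))"
    using assms(1) by (simp add: of_nat_diff)
  then show ?thesis using assms(1) by (simp add: field_simps)
qed

lemma pavg_of_ends:
  fixes g :: "int \<Rightarrow> int \<Rightarrow> 'b::{banach, second_countable_topology}"
  assumes "2 \<le> n"
  shows "pavg n (\<lambda>\<pi>. g (\<pi> 1) (\<pi> (int n))) =
    (\<Sum>a\<in>{1..int n}. \<Sum>b\<in>{1..int n} - {a}. g a b) /\<^sub>R (real n * (real n - 1))"
proof -
  have "(\<Sum>\<pi>\<in>perms n. g (\<pi> 1) (\<pi> (int n))) =
    (\<Sum>a\<in>{1..int n}. \<Sum>b\<in>{1..int n} - {a}. \<Sum>\<pi>\<in>perms_with_ends n a b. g a b)"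
    unfolding sum_perms_by_ends[OF assms] by (intro sum.cong refl) auto
  also have "\<dots> = (\<Sum>a\<in>{1..int n}. \<Sum>b\<in>{1..int n} - {a}. (fact n / (real n * (real n - 1))) *\<^sub>R g a b)"
    using assms
    by (intro sum.cong refl) (simp only: sum_constant_scaleR, subst card_perms_with_ends, auto)
  finally show ?thesis
    unfolding pavg_eq_sum by (simp add: scaleR_sum_right[symmetric] divide_inverse)
qed

text \<open>The end cells hold the pivots, and neither exceeds the larger one, so every value above
  it sits in an inner cell. The number of large inner entries is thus fixed by the pivots, which
  makes the centred indicators sum to zero.\<close>

lemma card_inner_above:
  assumes \<pi>: "\<pi> permutes {1..int n}" and n: "2 \<le> n"
  shows "card {i \<in> {2..int n - 1}. pivot_hi n \<pi> < \<pi> i} = nat (int n - pivot_hi n \<pi>)"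
proof -
  have "bij_betw \<pi> {i \<in> {2..int n - 1}. pivot_hi n \<pi> < \<pi> i} {pivot_hi n \<pi><..int n}"
    unfolding bij_betw_def
  proof
    show "inj_on \<pi> {i \<in> {2..int n - 1}. pivot_hi n \<pi> < \<pi> i}" using \<pi> by (rule permutes_inj_on)
    show "\<pi> ` {i \<in> {2..int n - 1}. pivot_hi n \<pi> < \<pi> i} = {pivot_hi n \<pi><..int n}"
    proof
      show "\<pi> ` {i \<in> {2..int n - 1}. pivot_hi n \<pi> < \<pi> i} \<subseteq> {pivot_hi n \<pi><..int n}"
        using permutes_in_image[OF \<pi>] by fastforce
      show "{pivot_hi n \<pi><..int n} \<subseteq> \<pi> ` {i \<in> {2..int n - 1}. pivot_hi n \<pi> < \<pi> i}"
      proof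
        fix x assume x: "x \<in> {pivot_hi n \<pi><..int n}"
        then have "x \<in> \<pi> ` {1..int n}" using pivot_bounds[OF \<pi> n] by (simp only: permutes_image[OF \<pi>]) auto
        then obtain i where i: "i \<in> {1..int n}" "x = \<pi> i" by blast
        then have "i \<noteq> 1" "i \<noteq> int n" using x by (auto simp: pivot_hi_def)
        then show "x \<in> \<pi> ` {i \<in> {2..int n - 1}. pivot_hi n \<pi> < \<pi> i}" using i x by force
      qed
    qed
  qed
  then show ?thesis using bij_betw_same_card by fastforce
qed

text \<open>
  Given the pivots, the number of large entries to the left of the final position of the larger
  pivot is hypergeometric; exchangeability of the inner cells and the fact that the centred
  indicators sum to zero make them negatively correlated.
\<close>

lemma hypergeometric_second_moment:
  assumes n: "3 \<le> n" and ab: "a \<in> {1..int n}" "b \<in> {1..int n}" "a \<noteq> b"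
  defines "q \<equiv> max a b"
  shows "(\<Sum>\<pi>\<in>perms_with_ends n a b. (real (card {i \<in> {2..q - 1}. q < \<pi> i})
      - real_of_int (q - 2) * real_of_int (int n - q) / (real n - 2))\<^sup>2)
    \<le> real n * real (card (perms_with_ends n a b))"
proof -
  let ?Q = "perms_with_ends n a b" and ?J = "{2..int n - 1}" and ?K = "{2..q - 1}"
  \<comment> \<open>Of the \<open>n - 2\<close> values in the inner cells, \<open>n - q\<close>
    exceed \<open>q\<close>; this is the chance that a given inner cell is large.\<close>
  define \<mu> where "\<mu> = real_of_int (int n - q) / (real n - 2)"
  define U where "U \<pi> j = of_bool (q < \<pi> j) - \<mu>" for \<pi> :: "int \<Rightarrow> int" and j :: int
  have q: "2 \<le> q" "q \<le> int n" using ab by (auto simp: q_def)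
  have \<mu>: "0 \<le> \<mu>" "\<mu> \<le> 1" using q n by (auto simp: \<mu>_def)
  have swap: "(\<Sum>\<pi>\<in>?Q. f (\<pi> \<circ> \<tau>)) = (\<Sum>\<pi>\<in>?Q. f \<pi>)"
    if \<tau>: "\<tau> permutes ?J" for f :: "_ \<Rightarrow> real" and \<tau>
  proof -
    have \<tau>n: "\<tau> permutes {1..int n}" by (rule permutes_subset[OF \<tau>]) auto
    have fix1: "\<tau> 1 = 1" "\<tau> (int n) = int n" "inv \<tau> 1 = 1" "inv \<tau> (int n) = int n"
      using permutes_not_in[OF \<tau>] permutes_not_in[OF permutes_inv[OF \<tau>]] by auto
    show ?thesis
      by (rule sum.reindex_bij_witness[where i = "\<lambda>\<pi>. \<pi> \<circ> inv \<tau>" and j = "\<lambda>\<pi>. \<pi> \<circ> \<tau>"])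
        (use \<tau>n fix1 in \<open>auto simp: permutes_compose permutes_inv permutes_inv_o comp_assoc\<close>)
  qed
  define S2 where "S2 = (\<Sum>\<pi>\<in>?Q. (U \<pi> 2)\<^sup>2)"
  define S11 where "S11 = (\<Sum>\<pi>\<in>?Q. U \<pi> 2 * U \<pi> 3)"
  have S2: "(\<Sum>\<pi>\<in>?Q. (U \<pi> j)\<^sup>2) = S2" if "j \<in> ?J" for j
  proof -
    have "Transposition.transpose 2 j permutes ?J" using that n by (intro permutes_swap_id) auto
    from swap[OF this, of "\<lambda>\<pi>. (U \<pi> j)\<^sup>2"] show ?thesis
      by (simp add: S2_def U_def)
  qed
  have S11: "(\<Sum>\<pi>\<in>?Q. U \<pi> j * U \<pi> k) = S11" if "j \<in> ?J" "k \<in> ?J" "j \<noteq> k" for j k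
  proof -
    have n4: "4 \<le> n" using that by auto
    let ?t = "Transposition.transpose 2 j"
    let ?\<tau> = "?t \<circ> Transposition.transpose 3 (?t k)"
    have "?t k \<in> ?J" "?t k \<noteq> 2" using that by (auto simp: Transposition.transpose_def)
    moreover have "?t permutes ?J" using that n4 by (intro permutes_swap_id) auto
    moreover have "Transposition.transpose 3 (?t k) permutes ?J"
      using calculation(1) n4 by (intro permutes_swap_id) auto
    ultimately have \<tau>: "?\<tau> permutes ?J" by (intro permutes_compose)
    have "?\<tau> 2 = j" "?\<tau> 3 = k" using \<open>?t k \<noteq> 2\<close> that(3) by (auto simp: Transposition.transpose_def)
    then show ?thesis using swap[OF \<tau>, of "\<lambda>\<pi>. U \<pi> 2 * U \<pi> 3"] by (simp add: S11_def U_def)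
  qed
  \<comment> \<open>By exchangeability only two moments occur: \<open>S2\<close> on the diagonal and
    \<open>S11\<close> off it.\<close>
  have square: "(\<Sum>\<pi>\<in>?Q. (\<Sum>j\<in>X. U \<pi> j)\<^sup>2) = real (card X) * S2 + real (card X) * (real (card X) - 1) * S11"
    if X: "X \<subseteq> ?J" for X
  proof -
    have fX: "finite X" using X by (rule finite_subset) simp
    have "(\<Sum>\<pi>\<in>?Q. (\<Sum>j\<in>X. U \<pi> j)\<^sup>2) = (\<Sum>j\<in>X. \<Sum>k\<in>X. \<Sum>\<pi>\<in>?Q. U \<pi> j * U \<pi> k)"
      unfolding power2_eq_square sum_product
      by (subst sum.swap, intro sum.cong refl, rule sum.swap)
    also have "\<dots> = (\<Sum>j\<in>X. S2 + (real (card X) - 1) * S11)"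
    proof (rule sum.cong)
      fix j assume j: "j \<in> X"
      then have "1 \<le> card X" using fX by (auto simp: Suc_le_eq card_gt_0_iff)
      have "(\<Sum>k\<in>X. \<Sum>\<pi>\<in>?Q. U \<pi> j * U \<pi> k) =
        (\<Sum>\<pi>\<in>?Q. U \<pi> j * U \<pi> j) + (\<Sum>k\<in>X - {j}. \<Sum>\<pi>\<in>?Q. U \<pi> j * U \<pi> k)"
        using fX j by (rule sum.remove)
      also have "(\<Sum>\<pi>\<in>?Q. U \<pi> j * U \<pi> j) = S2" using S2[of j] j X by (auto simp: power2_eq_square)
      also have "(\<Sum>k\<in>X - {j}. \<Sum>\<pi>\<in>?Q. U \<pi> j * U \<pi> k) = (\<Sum>k\<in>X - {j}. S11)"
        using j X by (intro sum.cong refl S11) auto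
      finally show "(\<Sum>k\<in>X. \<Sum>\<pi>\<in>?Q. U \<pi> j * U \<pi> k) = S2 + (real (card X) - 1) * S11"
        using j fX \<open>1 \<le> card X\<close> by (simp add: card_Diff_singleton of_nat_diff)
    qed simp
    finally show ?thesis by (simp add: algebra_simps)
  qed
  have sumU: "(\<Sum>j\<in>X. U \<pi> j) = real (card {j \<in> X. q < \<pi> j}) - real (card X) * \<mu>"
    if "finite X" for \<pi> X
    using that by (simp add: U_def sum_subtractf of_bool_def Int_def sum.If_cases)
  have cardJ: "real (card ?J) = real n - 2" using n by (simp add: of_nat_diff nat_diff_distrib)
  have zero: "(\<Sum>j\<in>?J. U \<pi> j) = 0" if "\<pi> \<in> ?Q" for \<pi>
  proof -
    have "pivot_hi n \<pi> = q" using that by (simp add: pivot_hi_def q_def)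
    then have "card {j \<in> ?J. q < \<pi> j} = nat (int n - q)" using card_inner_above[of \<pi> n] that n by auto
    then show ?thesis using n q by (simp add: sumU cardJ[simplified] \<mu>_def)
  qed
  \<comment> \<open>Over all inner cells the centred indicators sum to zero, so the formula for the
    square ties \<open>S11\<close> to \<open>S2\<close> and forces \<open>S11\<close> to be
    nonpositive once \<open>n\<close> exceeds 3.\<close>
  have "0 = (real n - 2) * S2 + (real n - 2) * (real n - 2 - 1) * S11"
    using square[of ?J] zero cardJ by simp
  then have "0 = (real n - 2) * (S2 + (real n - 3) * S11)" by (simp add: algebra_simps)
  then have rel: "S2 + (real n - 3) * S11 = 0" using n by simp
  have S2_pos: "0 \<le> S2" unfolding S2_def by (simp add: sum_nonneg)
  have KJ: "?K \<subseteq> ?J" using q by auto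
  have cardK: "real (card ?K) = real_of_int (q - 2)" using q by simp
  have m: "real_of_int (q - 2) \<le> real n - 2" using q by simp
  \<comment> \<open>For \<open>n = 3\<close> the relation says nothing about \<open>S11\<close>, but
    then \<open>q\<close> is 2 or 3 and one of the two factors in front vanishes.\<close>
  have cross: "real_of_int (q - 2) * (real_of_int (q - 2) - 1) * S11 \<le> 0"
  proof (cases "n = 3")
    case True
    then have "q = 2 \<or> q = 3" using q by auto
    then show ?thesis by auto
  next
    case False
    then have "S11 \<le> 0" using rel S2_pos n
      by (metis add.commute add_nonneg_pos diff_gt_0_iff_gt less_le mult_pos_pos nat_less_le not_le of_nat_less_iff of_nat_numeral order_refl)
    moreover have "0 \<le> real_of_int (q - 2) * (real_of_int (q - 2) - 1)"
      using q by (cases "q = 2") auto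
    ultimately show ?thesis by (rule mult_nonneg_nonpos[rotated])
  qed
  have "(\<Sum>\<pi>\<in>?Q. (real (card {i \<in> ?K. q < \<pi> i})
      - real_of_int (q - 2) * real_of_int (int n - q) / (real n - 2))\<^sup>2) = (\<Sum>\<pi>\<in>?Q. (\<Sum>j\<in>?K. U \<pi> j)\<^sup>2)"
    unfolding sumU[OF finite_atLeastAtMost_int] cardK by (simp add: \<mu>_def)
  also have "\<dots> \<le> real_of_int (q - 2) * S2"
    using square[OF KJ] cross cardK by simp
  also have "S2 \<le> (\<Sum>\<pi>\<in>?Q. 1)"
    unfolding S2_def
  proof (rule sum_mono)
    fix \<pi>
    have "\<bar>U \<pi> 2\<bar> \<le> 1" using \<mu> by (auto simp: U_def)
    then show "(U \<pi> 2)\<^sup>2 \<le> 1" by (simp add: abs_square_le_1)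
  qed
  then have "real_of_int (q - 2) * S2 \<le> real n * real (card ?Q)"
    using S2_pos q m by (intro mult_mono) auto
  finally show ?thesis .
qed

text \<open>The conditional mean of the main part of the swap count given the pivots. The quotient
  is a hypergeometric mean: the cells from 2 up to the one before the larger pivot are a sample of
  size \<open>pivot_hi - 2\<close> from \<open>n - 2\<close> inner cells, of which
  \<open>n - pivot_hi\<close> are large.\<close>

definition toll_approx :: "nat \<Rightarrow> (int \<Rightarrow> int) \<Rightarrow> real" where
  "toll_approx n \<pi> = real_of_int (pivot_lo n \<pi> - 1) +
     real_of_int (pivot_hi n \<pi> - 2) * real_of_int (int n - pivot_hi n \<pi>) / (real n - 2)"

text \<open>Both constants come from bounding the square of a sum by twice the sum of the squares:
  the systematic error is at most 3 and contributes \<open>2 * 9\<close>, and the hypergeometric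
  fluctuation has second moment at most \<open>n\<close> and contributes
  \<open>2 * n\<close>.\<close>

lemma part_swaps_approx:
  assumes n: "3 \<le> n"
  shows "pavg n (\<lambda>\<pi>. (real (part_swaps n \<pi>) - toll_approx n \<pi>)\<^sup>2) \<le> 18 + 2 * real n"
proof -
  have sq: "(x + y)\<^sup>2 \<le> 18 + 2 * y\<^sup>2" if "\<bar>x\<bar> \<le> 3" for x y :: real
  proof -
    have "x\<^sup>2 \<le> 3\<^sup>2" using that abs_le_square_iff[of x 3] by simp
    then show ?thesis using zero_le_power2[of "x - y"] by (simp add: power2_sum power2_diff)
  qed
  have "(\<Sum>\<pi>\<in>perms n. (real (part_swaps n \<pi>) - toll_approx n \<pi>)\<^sup>2) =
    (\<Sum>a\<in>{1..int n}. \<Sum>b\<in>{1..int n} - {a}. \<Sum>\<pi>\<in>perms_with_ends n a b.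
      (real (part_swaps n \<pi>) - toll_approx n \<pi>)\<^sup>2)"
    using n by (intro sum_perms_by_ends) auto
  also have "\<dots> \<le> (\<Sum>a\<in>{1..int n}. \<Sum>b\<in>{1..int n} - {a}. \<Sum>\<pi>\<in>perms_with_ends n a b. 18 + 2 * real n)"
  proof (rule sum_mono, rule sum_mono)
    fix a b assume ab: "a \<in> {1..int n}" "b \<in> {1..int n} - {a}"
    define q where "q = max a b"
    let ?Q = "perms_with_ends n a b"
    define Y where "Y \<pi> = real (card {i \<in> {2..q - 1}. q < \<pi> i})
        - real_of_int (q - 2) * real_of_int (int n - q) / (real n - 2)" for \<pi> :: "int \<Rightarrow> int"
    have "(\<Sum>\<pi>\<in>?Q. (real (part_swaps n \<pi>) - toll_approx n \<pi>)\<^sup>2) \<le> (\<Sum>\<pi>\<in>?Q. 18 + 2 * (Y \<pi>)\<^sup>2)"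
    proof (rule sum_mono)
      fix \<pi> assume \<pi>: "\<pi> \<in> ?Q"
      have qq: "pivot_hi n \<pi> = q" using \<pi> by (simp add: pivot_hi_def q_def)
      have "\<bar>real (part_swaps n \<pi>) - (real_of_int (pivot_lo n \<pi> - 1) + real (card {i \<in> {2..q - 1}. q < \<pi> i}))\<bar> \<le> 3"
        using partition_permutation(8)[of \<pi> n] \<pi> n by (simp add: qq)
      then have "((real (part_swaps n \<pi>) - (real_of_int (pivot_lo n \<pi> - 1) + real (card {i \<in> {2..q - 1}. q < \<pi> i}))) + Y \<pi>)\<^sup>2
          \<le> 18 + 2 * (Y \<pi>)\<^sup>2" by (rule sq)
      then show "(real (part_swaps n \<pi>) - toll_approx n \<pi>)\<^sup>2 \<le> 18 + 2 * (Y \<pi>)\<^sup>2"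
        by (simp add: toll_approx_def qq Y_def algebra_simps)
    qed
    also have "\<dots> = 18 * real (card ?Q) + 2 * (\<Sum>\<pi>\<in>?Q. (Y \<pi>)\<^sup>2)"
      by (simp add: sum.distrib sum_distrib_left)
    also have "(\<Sum>\<pi>\<in>?Q. (Y \<pi>)\<^sup>2) \<le> real n * real (card ?Q)"
      unfolding Y_def q_def using ab by (intro hypergeometric_second_moment[OF n]) auto
    finally show "(\<Sum>\<pi>\<in>?Q. (real (part_swaps n \<pi>) - toll_approx n \<pi>)\<^sup>2) \<le> (\<Sum>\<pi>\<in>?Q. 18 + 2 * real n)"
      by (simp add: algebra_simps)
  qed
  also have "\<dots> = (\<Sum>\<pi>\<in>perms n. 18 + 2 * real n)"
    using n by (intro sum_perms_by_ends[symmetric]) auto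
  finally have "(\<Sum>\<pi>\<in>perms n. (real (part_swaps n \<pi>) - toll_approx n \<pi>)\<^sup>2) \<le> fact n * (18 + 2 * real n)"
    by (simp add: card_perms[simplified])
  then show ?thesis unfolding pavg_eq_sum by (simp add: field_simps)
qed

section \<open>Asymptotics of the mean\<close>

lemma pavg_of_pivots:
  fixes h :: "int \<Rightarrow> int \<Rightarrow> real"
  assumes n: "2 \<le> n"
  shows "pavg n (\<lambda>\<pi>. h (pivot_lo n \<pi>) (pivot_hi n \<pi>)) =
    2 / (real n * (real n - 1)) * (\<Sum>(p, q) | 1 \<le> p \<and> p < q \<and> q \<le> int n. h p q)"
proof -
  let ?R = "{(p, q). 1 \<le> p \<and> p < q \<and> q \<le> int n}" and ?R' = "{(p, q). 1 \<le> q \<and> q < p \<and> p \<le> int n}"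
  have fin: "finite ?R" "finite ?R'"
    by (rule finite_subset[of _ "{1..int n} \<times> {1..int n}"]; auto)+
  have "(\<Sum>a\<in>{1..int n}. \<Sum>b\<in>{1..int n} - {a}. h (min a b) (max a b)) =
    (\<Sum>(a, b)\<in>(SIGMA a:{1..int n}. {1..int n} - {a}). h (min a b) (max a b))"
    by (rule sum.Sigma) auto
  also have "(SIGMA a:{1..int n}. {1..int n} - {a}) = ?R \<union> ?R'" by auto
  also have "(\<Sum>(a, b)\<in>?R \<union> ?R'. h (min a b) (max a b)) =
    (\<Sum>(a, b)\<in>?R. h (min a b) (max a b)) + (\<Sum>(a, b)\<in>?R'. h (min a b) (max a b))"
    by (rule sum.union_disjoint) (use fin in auto)
  also have "(\<Sum>(a, b)\<in>?R. h (min a b) (max a b)) = (\<Sum>(p, q)\<in>?R. h p q)"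
    by (rule sum.cong) auto
  also have "(\<Sum>(a, b)\<in>?R'. h (min a b) (max a b)) = (\<Sum>(p, q)\<in>?R. h p q)"
    by (rule sum.reindex_bij_witness[where i = prod.swap and j = prod.swap]) auto
  finally show ?thesis
    unfolding pivot_lo_def pivot_hi_def
    by (subst pavg_of_ends[OF n, where g = "\<lambda>a b. h (min a b) (max a b)"]) (simp add: divide_inverse)
qed

lemma sum_pivots_first_gap:
  fixes f :: "nat \<Rightarrow> real"
  assumes n: "2 \<le> n"
  shows "(\<Sum>(p, q) | 1 \<le> p \<and> p < q \<and> q \<le> int n. f (nat (p - 1))) = (\<Sum>k<n. (real n - 1 - real k) * f k)"
proof -
  have "{(p, q). 1 \<le> p \<and> p < q \<and> q \<le> int n} = (SIGMA p:{1..int n}. {p + 1..int n})" by auto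
  then have "(\<Sum>(p, q) | 1 \<le> p \<and> p < q \<and> q \<le> int n. f (nat (p - 1))) =
    (\<Sum>p\<in>{1..int n}. \<Sum>q\<in>{p + 1..int n}. f (nat (p - 1)))"
    by (simp only:) (rule sum.Sigma[symmetric], auto)
  also have "\<dots> = (\<Sum>p\<in>{1..int n}. (real n - real_of_int p) * f (nat (p - 1)))"
    by (rule sum.cong) auto
  also have "\<dots> = (\<Sum>k<n. (real n - 1 - real k) * f k)"
    by (rule sum.reindex_bij_witness[where i = "\<lambda>k. int k + 1" and j = "\<lambda>p. nat (p - 1)"]) auto
  finally show ?thesis .
qed

text \<open>The three block sizes are identically distributed: \<open>(p, q)\<close> to
  \<open>(q - p, q)\<close> exchanges the first two, and reflecting both pivots exchanges the first
  and the third. The weight \<open>n - 1 - k\<close> is the number of pivot pairs whose first block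
  has size \<open>k\<close>.\<close>

lemma pavg_of_block:
  fixes f :: "nat \<Rightarrow> real"
  assumes n: "2 \<le> n"
  shows "pavg n (\<lambda>\<pi>. f (block1 n \<pi>)) = 2 / (real n * (real n - 1)) * (\<Sum>k<n. (real n - 1 - real k) * f k)"
    "pavg n (\<lambda>\<pi>. f (block2 n \<pi>)) = 2 / (real n * (real n - 1)) * (\<Sum>k<n. (real n - 1 - real k) * f k)"
    "pavg n (\<lambda>\<pi>. f (block3 n \<pi>)) = 2 / (real n * (real n - 1)) * (\<Sum>k<n. (real n - 1 - real k) * f k)"
proof -
  let ?R = "{(p, q). 1 \<le> p \<and> p < q \<and> q \<le> int n}"
  have 2: "(\<Sum>(p, q)\<in>?R. f (nat (q - p - 1))) = (\<Sum>(p, q)\<in>?R. f (nat (p - 1)))"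
    by (rule sum.reindex_bij_witness[where i = "\<lambda>(p, q). (q - p, q)" and j = "\<lambda>(p, q). (q - p, q)"]) auto
  have 3: "(\<Sum>(p, q)\<in>?R. f (nat (int n - q))) = (\<Sum>(p, q)\<in>?R. f (nat (p - 1)))"
    by (rule sum.reindex_bij_witness[where i = "\<lambda>(p, q). (int n + 1 - q, int n + 1 - p)"
          and j = "\<lambda>(p, q). (int n + 1 - q, int n + 1 - p)"]) (auto simp: algebra_simps)
  show "pavg n (\<lambda>\<pi>. f (block1 n \<pi>)) = 2 / (real n * (real n - 1)) * (\<Sum>k<n. (real n - 1 - real k) * f k)"
    using pavg_of_pivots[OF n, of "\<lambda>p q. f (nat (p - 1))"] by (simp add: sum_pivots_first_gap[OF n])
  show "pavg n (\<lambda>\<pi>. f (block2 n \<pi>)) = 2 / (real n * (real n - 1)) * (\<Sum>k<n. (real n - 1 - real k) * f k)"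
    using pavg_of_pivots[OF n, of "\<lambda>p q. f (nat (q - p - 1))"] by (simp add: 2 sum_pivots_first_gap[OF n])
  show "pavg n (\<lambda>\<pi>. f (block3 n \<pi>)) = 2 / (real n * (real n - 1)) * (\<Sum>k<n. (real n - 1 - real k) * f k)"
    using pavg_of_pivots[OF n, of "\<lambda>p q. f (nat (int n - q))"] by (simp add: 3 sum_pivots_first_gap[OF n])
qed

text \<open>The weight \<open>n - 1 - k\<close> counts the indices \<open>j\<close> with
  \<open>k < j < n\<close>. In this form the recurrence with full history becomes a second order
  difference equation for the double partial sums.\<close>

lemma weighted_sum_eq_double_sum:
  fixes f :: "nat \<Rightarrow> real"
  shows "(\<Sum>k<n. (real n - 1 - real k) * f k) = (\<Sum>j<n. \<Sum>k<j. f k)"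
proof (induction n)
  case (Suc n)
  have "(\<Sum>k<Suc n. (real (Suc n) - 1 - real k) * f k) = (\<Sum>k<n. (real n - 1 - real k) * f k + f k)"
    by (simp add: algebra_simps)
  then show ?case using Suc by (simp add: sum.distrib)
qed simp

lemma double_sum_id: "(\<Sum>j<n. \<Sum>k<j. real k) = real n * (real n - 1) * (real n - 2) / 6"
proof (induction n)
  case (Suc n)
  have "(\<Sum>k<n. real k) = real n * (real n - 1) / 2" by (induction n) (auto simp: field_simps)
  then show ?case using Suc by (simp add: field_simps)
qed simp

lemma double_sum_square: "(\<Sum>j<n. \<Sum>k<j. (real k)\<^sup>2) = real n * (real n - 1)\<^sup>2 * (real n - 2) / 12"
proof (induction n)
  case (Suc n)
  have "(\<Sum>k<n. (real k)\<^sup>2) = real n * (real n - 1) * (2 * real n - 1) / 6"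
    by (induction n) (auto simp: field_simps power2_eq_square)
  then show ?case using Suc by (simp add: field_simps power2_eq_square)
qed simp

text \<open>The constant 5/6 decides the leading term of the mean. Inserted into the recurrence, the
  sequence \<open>n * harm n\<close> requires the toll \<open>2 * harm n + 5/6 * (n - 2)\<close>,
  and matching this with a mean toll of about \<open>n / 2\<close> gives the factor 3/5.\<close>

lemma double_sum_harm:
  "(\<Sum>j<n. \<Sum>k<j. real k * harm k) = real n * (real n - 1) * (real n - 2) / 6 * (harm n - 5/6)"
proof (induction n)
  case (Suc n)
  have h: "harm (Suc n) = harm n + 1 / (real n + 1)" for n :: nat
    by (simp add: harm_Suc inverse_eq_divide add.commute)
  have s: "(\<Sum>k<n. real k * harm k) = real n * (real n - 1) / 2 * (harm n - 1/2)"
  proof (induction n)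
    case (Suc n)
    show ?case unfolding sum.lessThan_Suc Suc.IH h of_nat_Suc by (simp add: field_simps)
  qed (simp add: harm_def)
  show ?case unfolding sum.lessThan_Suc[of _ n] Suc.IH s h of_nat_Suc by (simp add: field_simps)
qed (simp add: harm_def)

text \<open>
  The sequence \<open>n + 1\<close> solves the homogeneous recurrence; its Casoratian with \<open>R\<close> contracts.
\<close>

lemma dual_pivot_recurrence_convergent:
  fixes R r :: "nat \<Rightarrow> real"
  assumes rec: "\<And>n. 2 \<le> n \<Longrightarrow> R n = r n + 6 / (real n * (real n - 1)) * (\<Sum>k<n. (real n - 1 - real k) * R k)"
    and r: "\<And>n. N \<le> n \<Longrightarrow> \<bar>r n\<bar> \<le> C * sqrt (real n)"
  shows "convergent (\<lambda>n. R n / (real n + 1))"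
proof -
  define A where "A n = (\<Sum>k<n. R k)" for n
  define G where "G n = (\<Sum>j<n. A j)" for n
  \<comment> \<open>The double partial sum of the homogeneous solution \<open>k + 1\<close>, hence
    the counterpart of \<open>G\<close>.\<close>
  define h where "h n = (real n + 1) * real n * (real n - 1) / 6" for n :: nat
  define W where "W n = G (Suc n) * h n - G n * h (Suc n)" for n
  have G_Suc: "G (Suc n) = G n + A n" "A (Suc n) = A n + R n" for n by (auto simp: G_def A_def)
  have rec': "R n = r n + 6 / (real n * (real n - 1)) * G n" if "2 \<le> n" for n
    using rec[OF that] by (simp add: weighted_sum_eq_double_sum G_def A_def)
  \<comment> \<open>From 3 on, \<open>6 \<le> n * (n - 1)\<close>, so the factor in the recursion
    for \<open>W\<close> lies between 0 and 1.\<close>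
  define N' where "N' = max N 3"
  have C: "0 \<le> C" using r[of "N + 1"] abs_ge_zero[of "r (N + 1)"]
    by (metis abs_ge_zero le_add1 mult_le_0_iff of_nat_0_less_iff order_trans real_sqrt_gt_0_iff add_gr_0 less_one linorder_not_le zero_le_mult_iff)
  have W_Suc: "W (Suc n) = (1 - 6 / (real n * (real n - 1))) * W n + h (Suc n) * r n" if "2 \<le> n" for n
  proof -
    define x where "x = real n"
    have x: "2 \<le> x" using that by (simp add: x_def)
    have h': "h n = (x + 1) * x * (x - 1) / 6" "h (Suc n) = (x + 2) * (x + 1) * x / 6"
      "h (Suc (Suc n)) = (x + 3) * (x + 2) * (x + 1) / 6"
      by (auto simp: h_def x_def algebra_simps)
    have R: "R n = r n + 6 / (x * (x - 1)) * G n" using rec'[OF that] by (simp add: x_def)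
    have "(1 - 6 / (x * (x - 1))) * W n + h (Suc n) * r n - W (Suc n) = 0"
      unfolding W_def G_Suc R h' using x by (simp add: field_simps)
    then show ?thesis by (simp add: x_def)
  qed
  \<comment> \<open>The inhomogeneous term \<open>h (Suc n) * r n\<close> has order at most
    \<open>n powr (7/2)\<close>, and adding up such terms costs one further power of
    \<open>n\<close>.\<close>
  have W_bound: "\<bar>W n\<bar> \<le> \<bar>W N'\<bar> + C * (real n * (real n + 1) ^ 3 * sqrt (real n))" if "N' \<le> n" for n
    using that
  proof (induction n rule: dec_induct)
    case base
    then show ?case using C by simp
  next
    case (step n)
    have n: "3 \<le> n" "N \<le> n" using step by (auto simp: N'_def)
    define x where "x = real n"
    have x: "3 \<le> x" using n by (simp add: x_def)
    have "6 \<le> x * (x - 1)" using mult_mono[of 3 x 2 "x - 1"] x by simp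
    then have "\<bar>1 - 6 / (x * (x - 1))\<bar> \<le> 1" by (simp add: field_simps)
    then have "\<bar>(1 - 6 / (x * (x - 1))) * W n\<bar> \<le> 1 * \<bar>W n\<bar>"
      unfolding abs_mult by (intro mult_right_mono) auto
    moreover have hs: "0 \<le> h (Suc n)" "h (Suc n) \<le> (x + 2) ^ 3"
    proof -
      have "h (Suc n) = (x + 2) * (x + 1) * x / 6" by (simp add: h_def x_def algebra_simps)
      moreover have "(x + 2) * (x + 1) * x \<le> (x + 2) * (x + 2) * (x + 2)" "0 \<le> (x + 2) * (x + 1) * x"
        using x by (auto intro!: mult_mono)
      ultimately show "0 \<le> h (Suc n)" "h (Suc n) \<le> (x + 2) ^ 3"
        by (auto simp: power3_eq_cube)
    qed
    have "\<bar>h (Suc n) * r n\<bar> \<le> (x + 2) ^ 3 * (C * sqrt (x + 1))"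
      unfolding abs_mult using hs r[OF n(2)] C x
      by (intro mult_mono) (auto simp: x_def intro!: order_trans[OF r[OF n(2)]] mult_left_mono)
    ultimately have "\<bar>W (Suc n)\<bar> \<le> \<bar>W n\<bar> + (x + 2) ^ 3 * (C * sqrt (x + 1))"
      using W_Suc[of n] n by (simp add: x_def)
    also have "\<bar>W n\<bar> \<le> \<bar>W N'\<bar> + C * (x * (x + 1) ^ 3 * sqrt x)"
      using step.IH by (simp add: x_def)
    also have "x * (x + 1) ^ 3 * sqrt x \<le> x * (x + 2) ^ 3 * sqrt (x + 1)"
      using x by (intro mult_mono power_mono) auto
    finally have "\<bar>W (Suc n)\<bar> \<le> \<bar>W N'\<bar> + C * (x * (x + 2) ^ 3 * sqrt (x + 1)) + (x + 2) ^ 3 * (C * sqrt (x + 1))"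
      using C by (simp add: mult_left_mono)
    also have "\<dots> = \<bar>W N'\<bar> + C * ((x + 1) * (x + 2) ^ 3 * sqrt (x + 1))" by (simp add: algebra_simps)
    finally show ?case by (simp add: x_def algebra_simps)
  qed
  define D where "D n = G (Suc n) / h (Suc n) - G n / h n" for n
  \<comment> \<open>\<open>W\<close> has order at most \<open>n powr (9/2)\<close> and
    \<open>h n * h (Suc n)\<close> has order \<open>n ^ 6\<close>; the increments of
    \<open>G n / h n\<close> are therefore summable.\<close>
  have D_bound: "norm (D n) \<le> (\<bar>W N'\<bar> + C) * 72 * real n powr (- 3 / 2)" if n: "N' \<le> n" for n
  proof -
    define x where "x = real n"
    have x: "3 \<le> x" using n by (simp add: x_def N'_def)
    have h': "h n = (x + 1) * x * (x - 1) / 6" "h (Suc n) = (x + 2) * (x + 1) * x / 6"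
      by (auto simp: h_def x_def algebra_simps)
    have hp: "0 < h n" "0 < h (Suc n)" using x by (auto simp: h')
    have D: "D n = W n / (h n * h (Suc n))" using hp by (simp add: D_def W_def field_simps)
    have "1 \<le> x * (x + 1) ^ 3 * sqrt x"
      using x mult_mono[of 1 "x * (x + 1) ^ 3" 1 "sqrt x"] mult_mono[of 1 x 1 "(x + 1) ^ 3"] by (auto simp: one_le_power)
    then have "\<bar>W n\<bar> \<le> (\<bar>W N'\<bar> + C) * (x * (x + 1) ^ 3 * sqrt x)"
      using W_bound[OF n] mult_left_mono[of 1 "x * (x + 1) ^ 3 * sqrt x" "\<bar>W N'\<bar>"]
      by (simp add: x_def distrib_right)
    moreover have "(x + 1) ^ 3 * x ^ 3 / 72 \<le> h n * h (Suc n)"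
    proof -
      have "x ^ 3 * (x + 1) ^ 3 \<le> x ^ 2 * (x + 1) ^ 2 * (2 * (x - 1) * (x + 2))"
      proof -
        have "x * (x + 1) \<le> 2 * (x - 1) * (x + 2)" using x mult_mono[of 3 x 3 x] by (simp add: algebra_simps)
        then have "x ^ 2 * (x + 1) ^ 2 * (x * (x + 1)) \<le> x ^ 2 * (x + 1) ^ 2 * (2 * (x - 1) * (x + 2))"
          using x by (intro mult_left_mono) auto
        then show ?thesis by (simp add: power2_eq_square power3_eq_cube algebra_simps)
      qed
      moreover have "h n * h (Suc n) = x ^ 2 * (x + 1) ^ 2 * (2 * (x - 1) * (x + 2)) / 72"
        by (simp add: h' power2_eq_square field_simps)
      ultimately show ?thesis by (simp add: mult.commute)
    qed
    ultimately have "\<bar>D n\<bar> \<le> (\<bar>W N'\<bar> + C) * (x * (x + 1) ^ 3 * sqrt x) / ((x + 1) ^ 3 * x ^ 3 / 72)"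
      unfolding D abs_divide using hp x C by (intro frac_le) auto
    also have "\<dots> = (\<bar>W N'\<bar> + C) * 72 * (sqrt x / x ^ 2)"
    proof -
      have "K * (x * y * z) / (y * x ^ 3 / 72) = K * 72 * (z / x ^ 2)" if "y \<noteq> 0" for K y z
        using x that by (simp add: field_simps power2_eq_square power3_eq_cube)
      moreover have "(x + 1) ^ 3 \<noteq> 0" using x by simp
      ultimately show ?thesis by blast
    qed
    also have "sqrt x / x ^ 2 = x powr (- 3 / 2)"
      using x powr_diff[of x "1/2" 2] by (simp add: powr_half_sqrt)
    finally show ?thesis by (simp add: x_def)
  qed
  have "summable D"
  proof (rule summable_comparison_test)
    show "\<exists>N. \<forall>n\<ge>N. norm (D n) \<le> (\<bar>W N'\<bar> + C) * 72 * real n powr (- 3 / 2)" using D_bound by blast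
    show "summable (\<lambda>n. (\<bar>W N'\<bar> + C) * 72 * real n powr (- 3 / 2))"
      by (intro summable_mult) (simp add: summable_real_powr_iff)
  qed
  then have "(\<lambda>n. \<Sum>k<n. D k) \<longlonglongrightarrow> suminf D" by (rule summable_LIMSEQ)
  moreover have "(\<Sum>k<n. D k) = G n / h n - G 0 / h 0" for n
    unfolding D_def by (rule sum_lessThan_telescope)
  ultimately have "(\<lambda>n. G n / h n) \<longlonglongrightarrow> suminf D" by (simp add: h_def)
  moreover have "(\<lambda>n. r n / (real n + 1)) \<longlonglongrightarrow> 0"
  proof (rule tendsto_0_le[where K = C])
    show "(\<lambda>n. sqrt (real n) / (real n + 1)) \<longlonglongrightarrow> 0" by real_asymp
    show "\<forall>\<^sub>F n in sequentially. norm (r n / (real n + 1)) \<le> norm (sqrt (real n) / (real n + 1)) * C"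
      using eventually_ge_at_top[of N]
    proof eventually_elim
      case (elim n)
      then show ?case using divide_right_mono[OF r[of n], of "real n + 1"] by (simp add: mult.commute)
    qed
  qed
  ultimately have "(\<lambda>n. r n / (real n + 1) + G n / h n) \<longlonglongrightarrow> 0 + suminf D" by (intro tendsto_add)
  moreover have "\<forall>\<^sub>F n in sequentially. r n / (real n + 1) + G n / h n = R n / (real n + 1)"
    using eventually_ge_at_top[of 2]
  proof eventually_elim
    case (elim n)
    have "a / y + g / (y * x * z / 6) = (a + 6 / (x * z) * g) / y"
      if "x \<noteq> 0" "y \<noteq> 0" "z \<noteq> 0" for a x y z g :: real
      using that by (simp add: field_simps)
    from this[of "real n" "real n + 1" "real n - 1" "r n" "G n"] elim show ?case
      by (simp add: rec' h_def)
  qed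
  ultimately have "(\<lambda>n. R n / (real n + 1)) \<longlonglongrightarrow> 0 + suminf D"
    using filterlim_cong by fastforce
  then show ?thesis by (rule convergentI)
qed

section \<open>The mean number of swaps\<close>

definition mean_swaps :: "nat \<Rightarrow> nat \<Rightarrow> real" where
  "mean_swaps M n = pavg n (swap_count M n)"

lemma swap_count_below_threshold: "n \<le> M \<Longrightarrow> swap_count M n \<pi> = 0"
  by (simp add: swap_count_def qs_swaps_below_threshold)

lemma pavg_const: "pavg n (\<lambda>_. c) = (c :: 'b::{banach, second_countable_topology})"
  by simp

lemma pavg_add: "pavg n (\<lambda>\<pi>. f \<pi> + g \<pi>) = pavg n f + (pavg n g :: 'b::{banach, second_countable_topology})"
  by (intro Bochner_Integration.integral_add integrable_random_perm)

lemma pavg_diff: "pavg n (\<lambda>\<pi>. f \<pi> - g \<pi>) = pavg n f - (pavg n g :: 'b::{banach, second_countable_topology})"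
  by (intro Bochner_Integration.integral_diff integrable_random_perm)

lemma pavg_mono:
  assumes "\<And>\<pi>. \<pi> permutes {1..int n} \<Longrightarrow> f \<pi> \<le> (g \<pi> :: real)"
  shows "pavg n f \<le> pavg n g"
  unfolding pavg_eq_sum using assms by (intro scaleR_left_mono sum_mono) auto

lemma pavg_abs_le: "\<bar>pavg n f\<bar> \<le> pavg n (\<lambda>\<pi>. \<bar>f \<pi> :: real\<bar>)"
  by (rule integral_abs_bound)

lemma pavg_abs_square_le: "(pavg n (\<lambda>\<pi>. \<bar>f \<pi>\<bar>))\<^sup>2 \<le> pavg n (\<lambda>\<pi>. (f \<pi> :: real)\<^sup>2)"
proof -
  define m where "m = pavg n (\<lambda>\<pi>. \<bar>f \<pi>\<bar>)"
  have "0 \<le> pavg n (\<lambda>\<pi>. (\<bar>f \<pi>\<bar> - m)\<^sup>2)" by simp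
  also have "\<dots> = pavg n (\<lambda>\<pi>. (f \<pi>)\<^sup>2 - 2 * m * \<bar>f \<pi>\<bar> + m\<^sup>2)"
    by (simp add: power2_diff algebra_simps)
  also have "\<dots> = pavg n (\<lambda>\<pi>. (f \<pi>)\<^sup>2) - 2 * m * m + m\<^sup>2"
    by (simp add: pavg_add pavg_diff m_def)
  finally show ?thesis by (simp add: m_def power2_eq_square)
qed

lemma swap_count_recurrence:
  fixes F :: "real \<Rightarrow> 'b::{banach, second_countable_topology}"
  assumes M: "0 < M" and n: "M < n"
  shows "pavg n (\<lambda>\<pi>. F (swap_count M n \<pi>)) =
    pavg n (\<lambda>\<pi>. pavg (block1 n \<pi>) (\<lambda>\<alpha>. pavg (block2 n \<pi>) (\<lambda>\<beta>. pavg (block3 n \<pi>) (\<lambda>\<gamma>.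
      F (real (part_swaps n \<pi>) + swap_count M (block1 n \<pi>) \<alpha> + swap_count M (block2 n \<pi>) \<beta>
         + swap_count M (block3 n \<pi>) \<gamma>)))))"
  using qs_swaps_recurrence[OF M n, of "\<lambda>k. F (real k)"] by (simp only: swap_count_def of_nat_add)

lemma mean_swaps_recurrence:
  assumes M: "0 < M" and n: "M < n"
  shows "mean_swaps M n = pavg n (\<lambda>\<pi>. real (part_swaps n \<pi>)) +
    6 / (real n * (real n - 1)) * (\<Sum>k<n. (real n - 1 - real k) * mean_swaps M k)"
proof -
  have n2: "2 \<le> n" using M n by simp
  have "mean_swaps M n = pavg n (\<lambda>\<pi>. pavg (block1 n \<pi>) (\<lambda>\<alpha>. pavg (block2 n \<pi>) (\<lambda>\<beta>. pavg (block3 n \<pi>) (\<lambda>\<gamma>.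
      real (part_swaps n \<pi>) + swap_count M (block1 n \<pi>) \<alpha> + swap_count M (block2 n \<pi>) \<beta>
         + swap_count M (block3 n \<pi>) \<gamma>))))"
    unfolding mean_swaps_def by (rule swap_count_recurrence[OF M n, of "\<lambda>x. x"])
  also have "\<dots> = pavg n (\<lambda>\<pi>. real (part_swaps n \<pi>) + mean_swaps M (block1 n \<pi>) + mean_swaps M (block2 n \<pi>)
      + mean_swaps M (block3 n \<pi>))"
    by (simp add: pavg_add mean_swaps_def)
  also have "\<dots> = pavg n (\<lambda>\<pi>. real (part_swaps n \<pi>)) + 3 * (2 / (real n * (real n - 1)) *
      (\<Sum>k<n. (real n - 1 - real k) * mean_swaps M k))"
    unfolding pavg_add pavg_of_block[OF n2, of "mean_swaps M"] by simp
  finally show ?thesis by simp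
qed

text \<open>Since \<open>q - 2 = (n - 2) - (n - q)\<close>, the approximate toll is the first block
  size plus the third minus the square of the third over \<open>n - 2\<close>. Moments of single
  blocks therefore suffice, and the mean comes out exactly.\<close>

lemma pavg_toll_approx:
  assumes n: "3 \<le> n"
  shows "pavg n (toll_approx n) = real n / 2 - 7 / 6"
proof -
  have n2: "2 \<le> n" using n by simp
  define x where "x = real n"
  have x: "3 \<le> x" using n by (simp add: x_def)
  have "toll_approx n \<pi> = real (block1 n \<pi>) + (real (block3 n \<pi>) - (real (block3 n \<pi>))\<^sup>2 / (x - 2))"
    if "\<pi> permutes {1..int n}" for \<pi>
  proof -
    define q where "q = real_of_int (pivot_hi n \<pi>)"
    have b: "real (block3 n \<pi>) = x - q" "real (block1 n \<pi>) = real_of_int (pivot_lo n \<pi> - 1)"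
      using pivot_bounds[OF that n2] by (auto simp: q_def x_def)
    have "toll_approx n \<pi> = real_of_int (pivot_lo n \<pi> - 1) + (q - 2) * (x - q) / (x - 2)"
      by (simp add: toll_approx_def q_def x_def)
    also have "(q - 2) * (x - q) / (x - 2) = (x - q) - (x - q)\<^sup>2 / (x - 2)"
      using x by (simp add: field_simps power2_eq_square)
    finally show ?thesis unfolding b .
  qed
  then have "pavg n (toll_approx n) =
      pavg n (\<lambda>\<pi>. real (block1 n \<pi>) + (real (block3 n \<pi>) - (real (block3 n \<pi>))\<^sup>2 / (x - 2)))"
    by (rule pavg_cong)
  also have "\<dots> = pavg n (\<lambda>\<pi>. real (block1 n \<pi>)) + (pavg n (\<lambda>\<pi>. real (block3 n \<pi>))
      - pavg n (\<lambda>\<pi>. (real (block3 n \<pi>))\<^sup>2) / (x - 2))"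
    by (simp add: pavg_add pavg_diff)
  also have "\<dots> = 2 / (x * (x - 1)) * (x * (x - 1) * (x - 2) / 6) + (2 / (x * (x - 1)) * (x * (x - 1) * (x - 2) / 6)
     - 2 / (x * (x - 1)) * (x * (x - 1)\<^sup>2 * (x - 2) / 12) / (x - 2))"
    unfolding pavg_of_block(1)[OF n2, of real] pavg_of_block(3)[OF n2, of real]
      pavg_of_block(3)[OF n2, of "\<lambda>k. (real k)\<^sup>2"]
      weighted_sum_eq_double_sum double_sum_id double_sum_square x_def ..
  also have "\<dots> = x / 2 - 7 / 6" using x by (simp add: divide_simps power2_eq_square) (simp add: algebra_simps)
  finally show ?thesis by (simp add: x_def)
qed

lemma pavg_toll_error:
  assumes n: "3 \<le> n"
  shows "pavg n (\<lambda>\<pi>. \<bar>real (part_swaps n \<pi>) - toll_approx n \<pi>\<bar>) \<le> sqrt (18 + 2 * real n)"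
  using pavg_abs_square_le[of n "\<lambda>\<pi>. real (part_swaps n \<pi>) - toll_approx n \<pi>"] part_swaps_approx[OF n]
  by (intro real_le_rsqrt) linarith

text \<open>A crude bound, but enough to absorb the harmonic remainder of the toll into the error of
  order \<open>sqrt n\<close> that the fluctuation of the partitioning swaps causes anyway.\<close>

lemma harm_le_sqrt: "harm n \<le> 2 * sqrt (real n)"
proof (induction n)
  case (Suc n)
  have "sqrt (real n) + 1 / (2 * (real n + 1)) \<le> sqrt (real n + 1)"
  proof (rule real_le_rsqrt)
    define s where "s = sqrt (real n)"
    have s: "s\<^sup>2 = real n" "0 \<le> s" by (auto simp: s_def)
    have e: "a + b + 2 * s * (1 / (2 * y)) = a + s / y + b" for a b y :: real by simp
    have "s \<le> real n + 1" using s zero_le_power2[of "s - 1"] by (simp add: power2_diff)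
    then have "s / (real n + 1) \<le> 1" by simp
    moreover have "(1 / (2 * (real n + 1)))\<^sup>2 \<le> 1 / 4"
      using power_mono[of "1 / (2 * (real n + 1))" "1/2" 2] by (simp add: power2_eq_square field_simps)
    moreover have "(s + 1 / (2 * (real n + 1)))\<^sup>2 = real n + s / (real n + 1) + (1 / (2 * (real n + 1)))\<^sup>2"
      by (simp only: power2_sum s e)
    ultimately have "(s + 1 / (2 * (real n + 1)))\<^sup>2 \<le> real n + s / (real n + 1) + 1 / 4" by linarith
    moreover have "s / (real n + 1) \<le> 1/2"
      using s zero_le_power2[of "s - 1"] by (simp add: power2_diff field_simps)
    ultimately show "(sqrt (real n) + 1 / (2 * (real n + 1)))\<^sup>2 \<le> real n + 1" unfolding s_def by linarith
  qed
  then have "2 * (sqrt (real n) + 1 / (2 * (real n + 1))) \<le> 2 * sqrt (real n + 1)" by simp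
  also have "2 * (sqrt (real n) + 1 / (2 * (real n + 1))) = 2 * sqrt (real n) + 1 / (real n + 1)"
    by (simp add: field_simps)
  finally have "harm n + 1 / (real n + 1) \<le> 2 * sqrt (real n + 1)" using Suc by linarith
  then show ?case by (simp add: harm_Suc inverse_eq_divide add.commute)
qed (simp add: harm_def)

text \<open>Subtracting \<open>3/5 * (n * harm n)\<close> cancels the linear part of the mean toll,
  since \<open>3/5 * 5/6 = 1/2\<close>, and leaves a toll of order \<open>sqrt n\<close>, for which
  the ratio to \<open>n + 1\<close> converges. Replacing \<open>harm n\<close> by
  \<open>ln n\<close> shifts the limit by a multiple of the Euler-Mascheroni constant.\<close>

theorem mean_swaps_asymptotics:
  assumes M: "0 < M"
  obtains c where "(\<lambda>n. mean_swaps M n / real n - 3/5 * ln (real n)) \<longlonglongrightarrow> c"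
proof -
  define R where "R n = mean_swaps M n - 3/5 * (real n * harm n)" for n
  define r where "r n = R n - 6 / (real n * (real n - 1)) * (\<Sum>k<n. (real n - 1 - real k) * R k)" for n
  have "convergent (\<lambda>n. R n / (real n + 1))"
  proof (rule dual_pivot_recurrence_convergent)
    show "R n = r n + 6 / (real n * (real n - 1)) * (\<Sum>k<n. (real n - 1 - real k) * R k)" for n
      by (simp add: r_def)
    show "\<bar>r n\<bar> \<le> 10 * sqrt (real n)" if "max 3 (Suc M) \<le> n" for n
    proof -
      have n: "3 \<le> n" "M < n" using that by auto
      define x where "x = real n"
      have x: "3 \<le> x" using n by (simp add: x_def)
      define S where "S = (\<Sum>k<n. (real n - 1 - real k) * mean_swaps M k)"
      have "(\<Sum>k<n. (real n - 1 - real k) * R k) =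
          S - 3/5 * (\<Sum>k<n. (real n - 1 - real k) * (real k * harm k))"
        by (simp add: R_def S_def right_diff_distrib sum_subtractf sum_distrib_left mult.left_commute)
      also have "\<dots> = S - 3/5 * (x * (x - 1) * (x - 2) / 6 * (harm n - 5/6))"
        unfolding weighted_sum_eq_double_sum double_sum_harm by (simp add: x_def)
      finally have sum_R: "(\<Sum>k<n. (real n - 1 - real k) * R k) =
          S - 3/5 * (x * (x - 1) * (x - 2) / 6 * (harm n - 5/6))" .
      have R_n: "R n = pavg n (\<lambda>\<pi>. real (part_swaps n \<pi>)) + 6 / (x * (x - 1)) * S - 3/5 * (x * harm n)"
        unfolding R_def mean_swaps_recurrence[OF M n(2)] S_def x_def ..
      have r: "r n = pavg n (\<lambda>\<pi>. real (part_swaps n \<pi>)) - 3/5 * (2 * harm n + 5/6 * (x - 2))"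
      proof -
        have e: "6 / d * (S - 3/5 * (d * z / 6 * w)) = 6 / d * S - 3/5 * (z * w)" if "d \<noteq> 0" for d z w
          using that by (simp add: field_simps)
        have "x * (x - 1) \<noteq> 0" using x by simp
        then show ?thesis
          unfolding r_def sum_R R_n unfolding x_def[symmetric] e[OF \<open>x * (x - 1) \<noteq> 0\<close>]
          by (simp add: algebra_simps)
      qed
      have "pavg n (\<lambda>\<pi>. real (part_swaps n \<pi>)) - pavg n (toll_approx n) =
          pavg n (\<lambda>\<pi>. real (part_swaps n \<pi>) - toll_approx n \<pi>)" by (simp add: pavg_diff)
      then have "\<bar>pavg n (\<lambda>\<pi>. real (part_swaps n \<pi>)) - (x / 2 - 7 / 6)\<bar> \<le> sqrt (18 + 2 * x)"
        using order_trans[OF pavg_abs_le pavg_toll_error[OF n(1)]]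
        unfolding pavg_toll_approx[OF n(1)] x_def by simp
      moreover have "0 \<le> (harm n :: real)" by (rule harm_nonneg)
      ultimately have "\<bar>r n\<bar> \<le> sqrt (18 + 2 * x) + 6/5 * harm n + 1/6"
        unfolding abs_le_iff r by (auto simp: field_simps)
      moreover have "sqrt (18 + 2 * x) \<le> sqrt (9 * x)" using x by simp
      moreover have "sqrt (9 * x) = 3 * sqrt x" by (simp add: real_sqrt_mult)
      moreover have "harm n \<le> 2 * sqrt x" using harm_le_sqrt[of n] by (simp add: x_def)
      moreover have "1 \<le> sqrt x" using x by simp
      ultimately show "\<bar>r n\<bar> \<le> 10 * sqrt (real n)" unfolding x_def[symmetric] by linarith
    qed
  qed
  then obtain L where L: "(\<lambda>n. R n / (real n + 1)) \<longlonglongrightarrow> L" by (auto simp: convergent_def)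
  have "(\<lambda>n. R n / (real n + 1) * ((real n + 1) / real n) + 3/5 * (harm n - ln (real n)))
      \<longlonglongrightarrow> L * 1 + 3/5 * euler_mascheroni"
    by (intro tendsto_add tendsto_mult tendsto_const L euler_mascheroni_LIMSEQ) real_asymp
  moreover have "\<forall>\<^sub>F n in sequentially. R n / (real n + 1) * ((real n + 1) / real n) + 3/5 * (harm n - ln (real n)) =
      mean_swaps M n / real n - 3/5 * ln (real n)"
    using eventually_gt_at_top[of 0]
  proof eventually_elim
    case (elim n)
    have "(m - 3/5 * (x * h)) / y * (y / x) + 3/5 * (h - l) = m / x - 3/5 * l"
      if "x \<noteq> 0" "y \<noteq> 0" for m x y h l :: real
      using that by (simp add: field_simps)
    from this[of "real n" "real n + 1"] elim show ?case by (simp add: R_def)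
  qed
  ultimately have "(\<lambda>n. mean_swaps M n / real n - 3/5 * ln (real n)) \<longlonglongrightarrow> L * 1 + 3/5 * euler_mascheroni"
    using filterlim_cong by fastforce
  then show thesis by (rule that)
qed

section \<open>Moments of the limiting toll\<close>

abbreviation unif :: "real measure" where "unif \<equiv> uniform_measure lborel {0..1}"

lemma prob_space_unif: "prob_space unif"
  by (rule prob_space_uniform_measure) auto

interpretation unif: prob_space unif by (rule prob_space_unif)
interpretation unif_pair: pair_prob_space unif unif ..

lemma unif_eq_density: "unif = density lborel (indicator {0..1})"
  unfolding uniform_measure_def by (rule density_cong) (auto simp: indicator_def)

lemma AE_unif: "AE x in unif. 0 < x \<and> x < 1"
proof -
  have "AE x::real in lborel. x \<noteq> 0 \<and> x \<noteq> 1"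
    using AE_lborel_singleton[of "0::real"] AE_lborel_singleton[of "1::real"] by eventually_elim auto
  then show ?thesis unfolding unif_eq_density by (subst AE_density) (auto simp: indicator_def)
qed

lemma integral_unif:
  fixes f :: "real \<Rightarrow> 'b::{banach, second_countable_topology}"
  assumes [measurable]: "f \<in> borel_measurable borel"
  shows "(LINT x|unif. f x) = (LBINT x:{0..1}. f x)"
proof -
  have "unif = density lborel (\<lambda>x. ennreal (indicator {0..1} x))"
    unfolding unif_eq_density by (rule density_cong) (auto simp: indicator_def)
  then show ?thesis
    by (simp add: integral_density set_lebesgue_integral_def)
qed

lemma unif_integrable_bounded:
  fixes f :: "real \<Rightarrow> 'b::{banach, second_countable_topology}"
  assumes "f \<in> borel_measurable borel" "\<And>x. 0 < x \<Longrightarrow> x < 1 \<Longrightarrow> norm (f x) \<le> C"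
  shows "integrable unif f"
  using assms AE_unif by (intro unif.integrable_const_bound[where B = C]) auto

lemma continuous_imp_integrable_unif:
  fixes f :: "real \<Rightarrow> real"
  assumes "f \<in> borel_measurable borel" "continuous_on {0..1} f"
  shows "integrable unif f"
proof -
  have "compact (f ` {0..1})" using assms(2) by (intro compact_continuous_image) auto
  then obtain C where "\<forall>y\<in>f ` {0..1}. norm y \<le> C"
    using compact_imp_bounded bounded_iff by blast
  then show ?thesis by (intro unif_integrable_bounded[OF assms(1)]) auto
qed

text \<open>The derivative is required only in the open interval, because antiderivatives built from
  \<open>x * ln x\<close> are merely known to be continuous at 0.\<close>

lemma integral_unif_FTC:
  fixes f F :: "real \<Rightarrow> real"
  assumes f: "f \<in> borel_measurable borel" "continuous_on {0..1} f" and F: "continuous_on {0..1} F"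
    and deriv: "\<And>x. 0 < x \<Longrightarrow> x < 1 \<Longrightarrow> (F has_real_derivative f x) (at x)"
  shows "(LINT x|unif. f x) = F 1 - F 0"
proof -
  have "(f has_integral F 1 - F 0) {0..1}"
    using F deriv
    by (intro fundamental_theorem_of_calculus_interior)
      (auto simp: has_real_derivative_iff_has_vector_derivative)
  then have "integral {0..1} f = F 1 - F 0" by (rule integral_unique)
  then show ?thesis
    using set_borel_integral_eq_integral(2)[OF borel_integrable_atLeastAtMost'[OF f(2)]]
    by (simp add: integral_unif[OF f(1)])
qed

lemma integral_unif_reflect:
  fixes f :: "real \<Rightarrow> real"
  assumes [measurable]: "f \<in> borel_measurable borel"
  shows "(LINT x|unif. f (1 - x)) = (LINT x|unif. f x)"
proof -
  have "(LBINT x:{0..1}. f x) = (LBINT x. indicator {0..1} (1 - x) *\<^sub>R f (1 - x))"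
    unfolding set_lebesgue_integral_def
    using lborel_integral_real_affine[of "-1" "\<lambda>x. indicator {0..1} x *\<^sub>R f x" 1] by simp
  also have "\<dots> = (LBINT x:{0..1}. f (1 - x))"
    unfolding set_lebesgue_integral_def by (rule Bochner_Integration.integral_cong) (auto simp: indicator_def)
  finally show ?thesis by (simp add: integral_unif)
qed

section \<open>The function x ln x and its integrals\<close>

definition xlnx :: "real \<Rightarrow> real" where "xlnx x = x * ln x"

lemma xlnx_simps [simp]: "xlnx 0 = 0" "xlnx 1 = 0" by (auto simp: xlnx_def)

lemma measurable_xlnx [measurable]: "xlnx \<in> borel_measurable borel"
  unfolding xlnx_def[abs_def] by measurable

lemma continuous_on_xlnx: "continuous_on {0..} xlnx"
proof (clarsimp simp: continuous_on_eq_continuous_within)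
  fix x :: real assume x: "0 \<le> x"
  show "continuous (at x within {0..}) xlnx"
  proof (cases "x = 0")
    case True
    have "(xlnx \<longlongrightarrow> 0) (at_right 0)" unfolding xlnx_def[abs_def] by real_asymp
    moreover have "at 0 within {0..} = at_right (0::real)"
      by (metis at_within_Ici_at_right)
    ultimately show ?thesis using True by (simp add: continuous_within)
  next
    case False
    then have "isCont xlnx x" using x unfolding xlnx_def[abs_def] by (intro continuous_intros) auto
    then show ?thesis by (rule continuous_at_imp_continuous_at_within)
  qed
qed

lemma continuous_on_xlnx_comp [continuous_intros]:
  "continuous_on S f \<Longrightarrow> (\<And>x. x \<in> S \<Longrightarrow> 0 \<le> f x) \<Longrightarrow> continuous_on S (\<lambda>x. xlnx (f x))"
  by (rule continuous_on_compose2[OF continuous_on_xlnx]) auto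

lemma xlnx_bound: "0 \<le> x \<Longrightarrow> x \<le> 1 \<Longrightarrow> \<bar>xlnx x\<bar> \<le> 1"
proof (cases "x = 0")
  case False
  assume x: "0 \<le> x" "x \<le> 1"
  have "- ln x = ln (1 / x)" using False x by (simp add: ln_div)
  also have "\<dots> \<le> 1 / x - 1" using False x by (intro ln_le_minus_one) auto
  finally have "x * (- ln x) \<le> x * (1 / x - 1)" using x by (intro mult_left_mono)
  also have "\<dots> \<le> 1" using x False by (simp add: field_simps)
  moreover have "x * ln x \<le> 0" using x False by (simp add: mult_nonneg_nonpos)
  ultimately show ?thesis by (simp add: xlnx_def abs_le_iff)
qed simp

lemma xlnx_mult: "0 < x \<Longrightarrow> 0 \<le> y \<Longrightarrow> xlnx (x * y) = y * xlnx x + x * xlnx y"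
  by (cases "y = 0") (auto simp: xlnx_def ln_mult algebra_simps)

lemma xlnx_deriv: "0 < x \<Longrightarrow> (xlnx has_real_derivative ln x + 1) (at x)"
  unfolding xlnx_def[abs_def] by (auto intro!: derivative_eq_intros)

lemma integral_unif_power: "(LINT x|unif. x ^ k) = 1 / (real k + 1)"
proof -
  let ?F = "\<lambda>x. 1 / (real k + 1) * x ^ Suc k"
  have "(LINT x|unif. x ^ k) = ?F 1 - ?F (0::real)"
  proof (rule integral_unif_FTC)
    fix x :: real
    have "(?F has_real_derivative 1 / (real k + 1) * (real (Suc k) * x ^ k)) (at x)"
      by (rule DERIV_cmult) (use DERIV_pow[of "Suc k" x] in simp)
    then show "(?F has_real_derivative x ^ k) (at x)" by (simp add: add.commute)
  qed (auto intro!: continuous_intros)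
  then show ?thesis by simp
qed

lemma integral_unif_power_xlnx: "(LINT x|unif. x ^ k * xlnx x) = - 1 / (real k + 2)\<^sup>2"
proof -
  define a where "a = real k + 2"
  have a: "a \<noteq> 0" "real (Suc k) = a - 1" "real (Suc (Suc k)) = a" by (auto simp: a_def)
  let ?F = "\<lambda>x. 1 / a * (x ^ Suc k * xlnx x) - 1 / a\<^sup>2 * x ^ Suc (Suc k)"
  have "(LINT x|unif. x ^ k * xlnx x) = ?F 1 - ?F 0"
  proof (rule integral_unif_FTC)
    fix x :: real assume x: "0 < x" "x < 1"
    have "(?F has_real_derivative
      1 / a * ((a - 1) * x ^ k * xlnx x + (ln x + 1) * x ^ Suc k) - 1 / a\<^sup>2 * (a * x ^ Suc k)) (at x)"
      using DERIV_pow[of "Suc k" x] DERIV_pow[of "Suc (Suc k)" x] a(2,3)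
      by (intro DERIV_diff DERIV_cmult DERIV_mult xlnx_deriv x) (simp_all del: of_nat_Suc power_Suc)
    also have "1 / a * ((a - 1) * x ^ k * xlnx x + (ln x + 1) * x ^ Suc k) - 1 / a\<^sup>2 * (a * x ^ Suc k) = x ^ k * xlnx x"
      using a x by (simp add: xlnx_def field_simps power2_eq_square)
    finally show "(?F has_real_derivative x ^ k * xlnx x) (at x)" .
  qed (auto intro!: continuous_intros simp: a(1))
  then show ?thesis by (simp add: a_def)
qed

lemma integral_unif_xlnx_square: "(LINT x|unif. (xlnx x)\<^sup>2) = 2 / 27"
proof -
  let ?F = "\<lambda>x. (xlnx x)\<^sup>2 * x / 3 - 2/9 * (x\<^sup>2 * xlnx x) + 2/27 * x ^ 3"
  have "(LINT x|unif. (xlnx x)\<^sup>2) = ?F 1 - ?F 0"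
  proof (rule integral_unif_FTC)
    fix x :: real assume x: "0 < x" "x < 1"
    have "(?F has_real_derivative ((2 * xlnx x * (ln x + 1)) * x + (xlnx x)\<^sup>2) / 3
      - 2/9 * (2 * x * xlnx x + x\<^sup>2 * (ln x + 1)) + 2/9 * x\<^sup>2) (at x)"
      by (rule derivative_eq_intros xlnx_deriv[OF x(1)] refl | simp add: algebra_simps)+
    also have "((2 * xlnx x * (ln x + 1)) * x + (xlnx x)\<^sup>2) / 3
      - 2/9 * (2 * x * xlnx x + x\<^sup>2 * (ln x + 1)) + 2/9 * x\<^sup>2 = (xlnx x)\<^sup>2"
      using x by (simp add: xlnx_def field_simps power2_eq_square)
    finally show "(?F has_real_derivative (xlnx x)\<^sup>2) (at x)" .
  qed (auto intro!: continuous_intros)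
  then show ?thesis by simp
qed

text \<open>With \<open>x = k + 1\<close> the terms decompose by
  \<open>1/(x * (x+2)^2) = 1/4 * (1/x - 1/(x+2)) - 1/2 * 1/(x+2)^2\<close> and
  \<open>1/(x * (x+3)^2) = 1/9 * (1/x - 1/(x+3)) - 1/3 * 1/(x+3)^2\<close>. The differences
  telescope and the squares are tails of the series for zeta(2).\<close>

lemma sums_partial_fractions:
  "(\<lambda>k. 1 / real (Suc k) * (1 / (real k + 3)\<^sup>2 - 1 / (real k + 4)\<^sup>2)) sums (37/108 - pi\<^sup>2 / 36)"
proof -
  have sq: "(\<lambda>n. 1 / (real n + 1)\<^sup>2) sums (pi\<^sup>2 / 6)"
    using inverse_squares_sums by (simp add: add.commute)
  have sq3: "(\<lambda>n. 1 / (real n + 3)\<^sup>2) sums (pi\<^sup>2 / 6 - (1 + 1 / 4))"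
    using sums_split_initial_segment[OF sq, of 2] by (simp add: numeral_eq_Suc add.commute add.left_commute)
  have sq4: "(\<lambda>n. 1 / (real n + 4)\<^sup>2) sums (pi\<^sup>2 / 6 - (1 + 1 / 4 + 1 / 9))"
    using sums_split_initial_segment[OF sq, of 3] by (simp add: numeral_eq_Suc add.commute add.left_commute)
  \<comment> \<open>The facts \<open>tel\<close>, \<open>tel2\<close> and \<open>tel3\<close> give
    the sums over \<open>k\<close> of \<open>a k - a (k + j)\<close> for \<open>j = 1, 2, 3\<close>,
    namely the sum of the first \<open>j\<close> reciprocals.\<close>
  define a where "a k = 1 / (real k + 1)" for k :: nat
  have "a \<longlonglongrightarrow> 0" unfolding a_def by real_asymp
  then have tel: "(\<lambda>n. a n - a (Suc n)) sums a 0" using telescope_sums'[of a 0] by simp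
  have tel2: "(\<lambda>n. (a n - a (Suc n)) + (a (Suc n) - a (n + 2))) sums (a 0 + (a 0 - (a 0 - a 1)))"
    using sums_add[OF tel sums_split_initial_segment[OF tel, of 1]] by simp
  have tel3: "(\<lambda>n. ((a n - a (Suc n)) + (a (Suc n) - a (n + 2))) + (a (n + 2) - a (n + 3))) sums
      (a 0 + (a 0 - (a 0 - a 1)) + (a 0 - ((a 0 - a 1) + (a 1 - a 2))))"
    using sums_add[OF tel2 sums_split_initial_segment[OF tel, of 2]] by (simp add: numeral_eq_Suc)
  have "(\<lambda>k. 1/4 * ((a k - a (Suc k)) + (a (Suc k) - a (k + 2))) - 1/2 * (1 / (real k + 3)\<^sup>2)
      - (1/9 * (((a k - a (Suc k)) + (a (Suc k) - a (k + 2))) + (a (k + 2) - a (k + 3))) - 1/3 * (1 / (real k + 4)\<^sup>2)))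
    sums (1/4 * (a 0 + (a 0 - (a 0 - a 1))) - 1/2 * (pi\<^sup>2 / 6 - (1 + 1 / 4))
      - (1/9 * (a 0 + (a 0 - (a 0 - a 1)) + (a 0 - ((a 0 - a 1) + (a 1 - a 2)))) - 1/3 * (pi\<^sup>2 / 6 - (1 + 1 / 4 + 1 / 9))))"
    by (intro sums_diff sums_mult sq3 sq4 tel2 tel3)
  also have "(\<lambda>k. 1/4 * ((a k - a (Suc k)) + (a (Suc k) - a (k + 2))) - 1/2 * (1 / (real k + 3)\<^sup>2)
      - (1/9 * (((a k - a (Suc k)) + (a (Suc k) - a (k + 2))) + (a (k + 2) - a (k + 3))) - 1/3 * (1 / (real k + 4)\<^sup>2))) =
    (\<lambda>k. 1 / real (Suc k) * (1 / (real k + 3)\<^sup>2 - 1 / (real k + 4)\<^sup>2))"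
  proof
    fix k
    define x where "x = real k + 1"
    have x: "x > 0" by (simp add: x_def)
    have e: "a k = 1 / x" "a (k + 2) = 1 / (x + 2)" "a (k + 3) = 1 / (x + 3)" "real (Suc k) = x"
      "real k + 3 = x + 2" "real k + 4 = x + 3" by (auto simp: a_def x_def)
    have "1/4 * (1 / x - 1 / (x + 2)) - 1/2 * (1 / (x + 2)\<^sup>2) = 1 / x * (1 / (x + 2)\<^sup>2)"
      using x by (simp add: divide_simps power2_eq_square; simp add: algebra_simps)
    moreover have "1/9 * (1 / x - 1 / (x + 3)) - 1/3 * (1 / (x + 3)\<^sup>2) = 1 / x * (1 / (x + 3)\<^sup>2)"
      using x by (simp add: divide_simps power2_eq_square; simp add: algebra_simps)
    ultimately show "1/4 * ((a k - a (Suc k)) + (a (Suc k) - a (k + 2))) - 1/2 * (1 / (real k + 3)\<^sup>2)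
      - (1/9 * (((a k - a (Suc k)) + (a (Suc k) - a (k + 2))) + (a (k + 2) - a (k + 3))) - 1/3 * (1 / (real k + 4)\<^sup>2)) =
      1 / real (Suc k) * (1 / (real k + 3)\<^sup>2 - 1 / (real k + 4)\<^sup>2)"
      unfolding e by (simp add: right_diff_distrib)
  qed
  also have "(1/4 * (a 0 + (a 0 - (a 0 - a 1))) - 1/2 * (pi\<^sup>2 / 6 - (1 + 1 / 4))
      - (1/9 * (a 0 + (a 0 - (a 0 - a 1)) + (a 0 - ((a 0 - a 1) + (a 1 - a 2)))) - 1/3 * (pi\<^sup>2 / 6 - (1 + 1 / 4 + 1 / 9))))
     = 37/108 - pi\<^sup>2 / 36"
    by (simp add: a_def field_simps)
  finally show ?thesis .
qed

text \<open>Expanding \<open>ln (1 - x)\<close> reduces the integral to \<open>\<zeta>(2)\<close>.\<close>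

lemma integral_unif_xlnx_xlnx: "(LINT x|unif. xlnx x * xlnx (1 - x)) = 37/108 - pi\<^sup>2 / 36"
proof -
  define t where "t k x = 1 / real (Suc k) * (x ^ Suc (Suc k) * xlnx x - x ^ Suc k * xlnx x)" for k x
  have t_int: "integrable unif (t k)" for k
    unfolding t_def by (intro continuous_imp_integrable_unif) (auto intro!: continuous_intros)
  have t_val: "(LINT x|unif. t k x) = 1 / real (Suc k) * (1 / (real k + 3)\<^sup>2 - 1 / (real k + 4)\<^sup>2)" for k
  proof -
    have i: "integrable unif (\<lambda>x. x ^ j * xlnx x)" for j
      by (intro continuous_imp_integrable_unif) (auto intro!: continuous_intros)
    have "(LINT x|unif. t k x) = 1 / real (Suc k) *
        ((LINT x|unif. x ^ Suc (Suc k) * xlnx x) - (LINT x|unif. x ^ Suc k * xlnx x))"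
      unfolding t_def by (simp only: integral_mult_right_zero Bochner_Integration.integral_diff[OF i i])
    then show ?thesis unfolding integral_unif_power_xlnx by (simp add: algebra_simps)
  qed
  \<comment> \<open>The sign of \<open>xlnx\<close> on the unit interval makes all terms
    nonnegative, so monotone convergence permits integration term by term.\<close>
  have t_nonneg: "0 \<le> t k x" if "0 < x" "x < 1" for k x
  proof -
    have "t k x = 1 / real (Suc k) * (x ^ Suc k * (1 - x) * (- xlnx x))" by (simp add: t_def algebra_simps)
    moreover have "0 \<le> - xlnx x" using that by (simp add: xlnx_def mult_nonneg_nonpos)
    then have "0 \<le> 1 / real (Suc k) * (x ^ Suc k * (1 - x) * (- xlnx x))"
      using that by (intro mult_nonneg_nonneg) auto
    ultimately show ?thesis by simp
  qed
  have t_sums: "(\<lambda>k. t k x) sums (xlnx x * xlnx (1 - x))" if x: "0 < x" "x < 1" for x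
  proof -
    have "(\<lambda>n. - (x ^ n) / real n) sums ln (1 - x)"
      using ln_series'[of "- x"] x by simp
    \<comment> \<open>The term of index 0 is \<open>- 1 / 0 = 0\<close>, so dropping it does not
      change the sum.\<close>
    then have "(\<lambda>n. - (x ^ Suc n) / real (Suc n)) sums ln (1 - x)"
      by (subst sums_Suc_iff) simp
    then have "(\<lambda>n. (xlnx x * (1 - x)) * (- (x ^ Suc n) / real (Suc n))) sums ((xlnx x * (1 - x)) * ln (1 - x))"
      by (rule sums_mult)
    moreover have "(xlnx x * (1 - x)) * (- (x ^ Suc n) / real (Suc n)) = t n x" for n
      unfolding t_def by (simp add: divide_inverse algebra_simps)
    ultimately show ?thesis by (simp add: xlnx_def mult.assoc)
  qed
  have "has_bochner_integral unif (\<lambda>x. xlnx x * xlnx (1 - x)) (37/108 - pi\<^sup>2 / 36)"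
  proof (rule has_bochner_integral_monotone_convergence[where f = "\<lambda>n x. \<Sum>k<n. t k x"])
    show "integrable unif (\<lambda>x. \<Sum>k<n. t k x)" for n using t_int by auto
    show "AE x in unif. incseq (\<lambda>n. \<Sum>k<n. t k x)"
      using AE_unif by eventually_elim (auto intro!: incseq_SucI simp: t_nonneg)
    show "AE x in unif. (\<lambda>n. \<Sum>k<n. t k x) \<longlonglongrightarrow> xlnx x * xlnx (1 - x)"
      using AE_unif by eventually_elim (use t_sums in \<open>auto simp: sums_def\<close>)
    have "(\<lambda>n. \<Sum>k<n. (LINT x|unif. t k x)) \<longlonglongrightarrow> 37/108 - pi\<^sup>2 / 36"
      using sums_partial_fractions unfolding t_val sums_def .
    then show "(\<lambda>n. LINT x|unif. (\<Sum>k<n. t k x)) \<longlonglongrightarrow> 37/108 - pi\<^sup>2 / 36"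
      by (simp add: Bochner_Integration.integral_sum t_int)
  qed simp
  then show ?thesis by (rule has_bochner_integral_integral_eq)
qed

section \<open>The two parts of the limiting toll\<close>

definition hent :: "real \<Rightarrow> real" where "hent s = xlnx s + xlnx (1 - s)"
text \<open>In the coordinates \<open>w\<close> and \<open>s\<close> the spacings are
  \<open>w * s\<close>, \<open>w * (1 - s)\<close> and \<open>1 - w\<close>. The summand
  \<open>w * (1 - w)\<close> is \<open>(D1 + D2) * D3\<close>, the summand \<open>s\<close> of
  \<open>Btoll\<close> is \<open>D1 / w\<close>, and the logarithmic terms split by the chain rule
  for the entropy; \<open>hent\<close> is the negated binary entropy in natural units.\<close>

definition Atoll :: "real \<Rightarrow> real" where "Atoll w = w * (1 - w) + 3/5 * hent w"
definition Btoll :: "real \<Rightarrow> real" where "Btoll s = s + 3/5 * hent s"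

lemma measurable_toll_parts [measurable]:
  "hent \<in> borel_measurable borel" "Atoll \<in> borel_measurable borel" "Btoll \<in> borel_measurable borel"
  unfolding hent_def[abs_def] Atoll_def[abs_def] Btoll_def[abs_def] by measurable

lemma continuous_on_toll_parts [continuous_intros]:
  "continuous_on {0..1} hent" "continuous_on {0..1} Atoll" "continuous_on {0..1} Btoll"
  unfolding hent_def[abs_def] Atoll_def[abs_def] Btoll_def[abs_def]
  by (auto intro!: continuous_intros)

lemma integral_unif_add:
  fixes f g :: "real \<Rightarrow> real"
  assumes "f \<in> borel_measurable borel" "continuous_on {0..1} f" "g \<in> borel_measurable borel" "continuous_on {0..1} g"
  shows "(LINT x|unif. f x + g x) = (LINT x|unif. f x) + (LINT x|unif. g x)"
  using assms by (intro Bochner_Integration.integral_add continuous_imp_integrable_unif)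

lemma integral_unif_diff:
  fixes f g :: "real \<Rightarrow> real"
  assumes "f \<in> borel_measurable borel" "continuous_on {0..1} f" "g \<in> borel_measurable borel" "continuous_on {0..1} g"
  shows "(LINT x|unif. f x - g x) = (LINT x|unif. f x) - (LINT x|unif. g x)"
  using assms by (intro Bochner_Integration.integral_diff continuous_imp_integrable_unif)

lemma hent_reflect: "hent (1 - s) = hent s" by (simp add: hent_def)

text \<open>The reflection of the unit interval folds both halves of the entropy onto
  \<open>xlnx x\<close>, so that power moments of this one function suffice.\<close>

lemma integral_unif_symmetric_hent:
  assumes f: "f \<in> borel_measurable borel" "continuous_on {0..1} f"
  shows "(LINT x|unif. f x * hent x) = (LINT x|unif. (f x + f (1 - x)) * xlnx x)"
proof -
  have [measurable]: "f \<in> borel_measurable borel" by (rule f)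
  have f': "continuous_on {0..1} (\<lambda>x. f (1 - x))"
    by (rule continuous_on_compose2[OF f(2)]) (auto intro!: continuous_intros)
  have "(LINT x|unif. f x * hent x) = (LINT x|unif. f x * xlnx x + f x * xlnx (1 - x))"
    by (simp add: hent_def algebra_simps)
  also have "\<dots> = (LINT x|unif. f x * xlnx x) + (LINT x|unif. f x * xlnx (1 - x))"
    by (rule integral_unif_add) (auto intro!: continuous_intros f)
  also have "(LINT x|unif. f x * xlnx (1 - x)) = (LINT x|unif. f (1 - x) * xlnx x)"
    using integral_unif_reflect[of "\<lambda>x. f (1 - x) * xlnx x"] by simp
  also have "(LINT x|unif. f x * xlnx x) + \<dots> = (LINT x|unif. f x * xlnx x + f (1 - x) * xlnx x)"
    by (rule integral_unif_add[symmetric]) (auto intro!: continuous_intros f f')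
  finally show ?thesis by (simp add: algebra_simps)
qed

lemma integral_unif_hent_square: "(LINT x|unif. (hent x)\<^sup>2) = 5/6 - pi\<^sup>2 / 18"
proof -
  have "(LINT x|unif. (hent x)\<^sup>2) = (LINT x|unif. ((xlnx x)\<^sup>2 + (xlnx (1 - x))\<^sup>2) + 2 * (xlnx x * xlnx (1 - x)))"
    by (simp add: hent_def power2_sum algebra_simps)
  also have "\<dots> = ((LINT x|unif. (xlnx x)\<^sup>2) + (LINT x|unif. (xlnx (1 - x))\<^sup>2)) + (LINT x|unif. 2 * (xlnx x * xlnx (1 - x)))"
    by (subst integral_unif_add; (subst integral_unif_add)?) (auto intro!: continuous_intros)
  also have "(LINT x|unif. (xlnx (1 - x))\<^sup>2) = (LINT x|unif. (xlnx x)\<^sup>2)"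
    using integral_unif_reflect[of "\<lambda>x. (xlnx x)\<^sup>2"] by simp
  finally show ?thesis by (simp add: integral_unif_xlnx_square integral_unif_xlnx_xlnx)
qed

lemma integral_unif_toll_parts:
  "(LINT s|unif. Btoll s) = 1/5"
  "(LINT s|unif. (Btoll s)\<^sup>2) = 1/3 - pi\<^sup>2 / 50"
  "(LINT w|unif. (Atoll w)\<^sup>2) = 13/60 - pi\<^sup>2 / 50"
  "(LINT w|unif. w\<^sup>2 * Atoll w) = - 1/24"
proof -
  note p = integral_unif_power[of 1, simplified] integral_unif_power[of 2, simplified] integral_unif_power[of 3, simplified]
    integral_unif_power[of 4, simplified]
  have p2: "(LINT x|unif. x\<^sup>2) = 1/3" using p by simp
  note px = integral_unif_power_xlnx[of 0, simplified] integral_unif_power_xlnx[of 1, simplified]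
    integral_unif_power_xlnx[of 2, simplified] integral_unif_power_xlnx[of 3, simplified]
  have h0: "(LINT x|unif. hent x) = - 1/2"
    using integral_unif_symmetric_hent[of "\<lambda>_. 1"] px by simp
  have h1: "(LINT x|unif. x * hent x) = - 1/4"
    using integral_unif_symmetric_hent[of "\<lambda>x. x"] px by (simp add: continuous_on_id)
  have h2: "(LINT x|unif. (x * (1 - x)) * hent x) = - 7/72"
  proof -
    have "(LINT x|unif. (x * (1 - x)) * hent x) = (LINT x|unif. 2 * (x * xlnx x) - 2 * (x\<^sup>2 * xlnx x))"
      by (subst integral_unif_symmetric_hent) (auto intro!: continuous_intros simp: algebra_simps power2_eq_square)
    also have "\<dots> = (LINT x|unif. 2 * (x * xlnx x)) - (LINT x|unif. 2 * (x\<^sup>2 * xlnx x))"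
      by (rule integral_unif_diff) (auto intro!: continuous_intros)
    finally show ?thesis using px by simp
  qed
  have h3: "(LINT x|unif. x\<^sup>2 * hent x) = - 11/72"
  proof -
    have "(LINT x|unif. x\<^sup>2 * hent x) = (LINT x|unif. (xlnx x - 2 * (x * xlnx x)) + 2 * (x\<^sup>2 * xlnx x))"
      by (subst integral_unif_symmetric_hent) (auto intro!: continuous_intros simp: algebra_simps power2_eq_square)
    also have "\<dots> = (LINT x|unif. xlnx x - 2 * (x * xlnx x)) + (LINT x|unif. 2 * (x\<^sup>2 * xlnx x))"
      by (rule integral_unif_add) (auto intro!: continuous_intros)
    also have "(LINT x|unif. xlnx x - 2 * (x * xlnx x)) = (LINT x|unif. xlnx x) - (LINT x|unif. 2 * (x * xlnx x))"
      by (rule integral_unif_diff) (auto intro!: continuous_intros)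
    finally show ?thesis using px by simp
  qed
  have "(LINT s|unif. Btoll s) = (LINT s|unif. s) + (LINT s|unif. 3/5 * hent s)"
    unfolding Btoll_def by (rule integral_unif_add) (auto intro!: continuous_intros)
  then show "(LINT s|unif. Btoll s) = 1/5" using p h0 by simp
  have "(LINT s|unif. (Btoll s)\<^sup>2) = (LINT s|unif. (s\<^sup>2 + 6/5 * (s * hent s)) + 9/25 * (hent s)\<^sup>2)"
    by (simp add: Btoll_def power2_eq_square algebra_simps)
  also have "\<dots> = (LINT s|unif. s\<^sup>2 + 6/5 * (s * hent s)) + (LINT s|unif. 9/25 * (hent s)\<^sup>2)"
    by (rule integral_unif_add) (auto intro!: continuous_intros)
  also have "(LINT s|unif. s\<^sup>2 + 6/5 * (s * hent s)) = (LINT s|unif. s\<^sup>2) + (LINT s|unif. 6/5 * (s * hent s))"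
    by (rule integral_unif_add) (auto intro!: continuous_intros)
  finally show "(LINT s|unif. (Btoll s)\<^sup>2) = 1/3 - pi\<^sup>2 / 50" by (simp add: integral_unif_hent_square h1 p2) (simp add: field_simps)
  have poly: "(LINT w|unif. (w\<^sup>2 - 2 * w ^ 3) + w ^ 4) = 1/30"
  proof -
    have "(LINT w|unif. (w\<^sup>2 - 2 * w ^ 3) + w ^ 4) = (LINT w|unif. w\<^sup>2 - 2 * w ^ 3) + (LINT w|unif. w ^ 4)"
      by (rule integral_unif_add) (auto intro!: continuous_intros)
    also have "(LINT w|unif. w\<^sup>2 - 2 * w ^ 3) = (LINT w|unif. w\<^sup>2) - (LINT w|unif. 2 * w ^ 3)"
      by (rule integral_unif_diff) (auto intro!: continuous_intros)
    finally show ?thesis using p by simp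
  qed
  have "(LINT w|unif. (Atoll w)\<^sup>2) = (LINT w|unif. (((w\<^sup>2 - 2 * w ^ 3) + w ^ 4) + 6/5 * ((w * (1 - w)) * hent w)) + 9/25 * (hent w)\<^sup>2)"
    by (rule Bochner_Integration.integral_cong) (simp_all add: Atoll_def power2_eq_square power3_eq_cube power4_eq_xxxx algebra_simps)
  also have "\<dots> = (LINT w|unif. ((w\<^sup>2 - 2 * w ^ 3) + w ^ 4) + 6/5 * ((w * (1 - w)) * hent w)) + (LINT w|unif. 9/25 * (hent w)\<^sup>2)"
    by (rule integral_unif_add) (auto intro!: continuous_intros)
  also have "(LINT w|unif. ((w\<^sup>2 - 2 * w ^ 3) + w ^ 4) + 6/5 * ((w * (1 - w)) * hent w)) =
      (LINT w|unif. (w\<^sup>2 - 2 * w ^ 3) + w ^ 4) + (LINT w|unif. 6/5 * ((w * (1 - w)) * hent w))"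
    by (rule integral_unif_add) (auto intro!: continuous_intros)
  finally show "(LINT w|unif. (Atoll w)\<^sup>2) = 13/60 - pi\<^sup>2 / 50"
    using poly h2 by (simp add: integral_unif_hent_square) (simp add: field_simps)
  have "(LINT w|unif. w\<^sup>2 * Atoll w) = (LINT w|unif. (w ^ 3 - w ^ 4) + 3/5 * (w\<^sup>2 * hent w))"
    by (rule Bochner_Integration.integral_cong) (simp_all add: Atoll_def power2_eq_square power3_eq_cube power4_eq_xxxx algebra_simps)
  also have "\<dots> = (LINT w|unif. w ^ 3 - w ^ 4) + (LINT w|unif. 3/5 * (w\<^sup>2 * hent w))"
    by (rule integral_unif_add) (auto intro!: continuous_intros)
  also have "(LINT w|unif. w ^ 3 - w ^ 4) = (LINT w|unif. w ^ 3) - (LINT w|unif. w ^ 4)"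
    by (rule integral_unif_diff) (auto intro!: continuous_intros)
  finally show "(LINT w|unif. w\<^sup>2 * Atoll w) = - 1/24" using p h3 by simp
qed

section \<open>Two independent uniform variables and their spacings\<close>

abbreviation unif2 :: "(real \<times> real) measure" where "unif2 \<equiv> unif \<Otimes>\<^sub>M unif"

lemma AE_unif_pair:
  "AE z in unif2. 0 < fst z \<and> fst z < 1 \<and> 0 < snd z \<and> snd z < 1 \<and> fst z \<noteq> snd z"
proof (rule unif_pair.AE_pair_measure)
  show "{x \<in> space unif2. 0 < fst x \<and> fst x < 1 \<and> 0 < snd x \<and> snd x < 1 \<and> fst x \<noteq> snd x}
    \<in> sets unif2" by measurable
  have ne: "AE y in unif. y \<noteq> x" for x
    unfolding unif_eq_density using AE_lborel_singleton[of x] by (subst AE_density) auto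
  have inner: "AE y in unif. 0 < y \<and> y < 1 \<and> x \<noteq> y" for x
    using AE_unif ne[of x] by eventually_elim auto
  show "AE x in unif. AE y in unif. 0 < fst (x, y) \<and> fst (x, y) < 1 \<and> 0 < snd (x, y) \<and> snd (x, y) < 1 \<and>
      fst (x, y) \<noteq> snd (x, y)"
    using AE_unif
  proof eventually_elim
    case (elim x)
    show ?case using inner[of x] by eventually_elim (use elim in auto)
  qed
qed

lemma integrable_unif_pair:
  fixes f :: "real \<Rightarrow> real \<Rightarrow> 'b::{banach, second_countable_topology}"
  assumes "(\<lambda>z. f (fst z) (snd z)) \<in> borel_measurable (borel \<Otimes>\<^sub>M borel)"
    and "\<And>u v. 0 < u \<Longrightarrow> u < 1 \<Longrightarrow> 0 < v \<Longrightarrow> v < 1 \<Longrightarrow> u \<noteq> v \<Longrightarrow> norm (f u v) \<le> C"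
  shows "integrable unif2 (\<lambda>z. f (fst z) (snd z))"
proof (rule unif_pair.P.integrable_const_bound[where B = C])
  show "AE z in unif2. norm (f (fst z) (snd z)) \<le> C"
    using AE_unif_pair by eventually_elim (use assms(2) in auto)
  have "sets unif2 = sets (borel \<Otimes>\<^sub>M borel :: (real \<times> real) measure)" by (rule sets_pair_measure_cong) auto
  then show "(\<lambda>z. f (fst z) (snd z)) \<in> borel_measurable unif2"
    using assms(1) by (simp cong: measurable_cong_sets)
qed

lemma integral_unif_scale:
  fixes f :: "real \<Rightarrow> real"
  assumes [measurable]: "f \<in> borel_measurable borel" and v: "0 < v" "v < 1"
  shows "(LINT u|unif. (if u < v then f (u / v) else 0)) = v * (LINT s|unif. f s)"
proof -
  have "(LINT u|unif. (if u < v then f (u / v) else 0)) =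
      (LBINT u. indicator {0..1} u *\<^sub>R (if u < v then f (u / v) else 0))"
    by (subst integral_unif) (auto simp: set_lebesgue_integral_def)
  also have "\<dots> = \<bar>v\<bar> *\<^sub>R (LBINT s. indicator {0..1} (0 + v * s) *\<^sub>R (if 0 + v * s < v then f ((0 + v * s) / v) else 0))"
    using v by (intro lborel_integral_real_affine) auto
  also have "(LBINT s. indicator {0..1} (0 + v * s) *\<^sub>R (if 0 + v * s < v then f ((0 + v * s) / v) else 0)) =
      (LBINT s. indicator {0..1} s *\<^sub>R f s)"
  proof (rule integral_cong_AE)
    show "AE s in lborel. indicator {0..1} (0 + v * s) *\<^sub>R (if 0 + v * s < v then f ((0 + v * s) / v) else 0) =
        indicator {0..1} s *\<^sub>R f s"
      using AE_lborel_singleton[of "1::real"]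
    proof eventually_elim
      case (elim s)
      have "0 \<le> v * s \<longleftrightarrow> 0 \<le> s" "v * s < v \<longleftrightarrow> s < 1" using v by (auto simp: zero_le_mult_iff)
      moreover have "s < 1 \<Longrightarrow> v * s \<le> 1" using mult_left_mono[of s 1 v] v by linarith
      ultimately show ?case using v elim by (auto simp: indicator_def)
    qed
  qed auto
  also have "\<dots> = (LINT s|unif. f s)" by (simp add: integral_unif set_lebesgue_integral_def)
  finally show ?thesis using v by simp
qed

text \<open>
  In the coordinates \<open>w = max u v\<close> and \<open>s = min u v / max u v\<close> the uniform law on the unit
  square becomes the product law with density \<open>2 w\<close>.
\<close>

lemma integral_unif_pair_polar:
  fixes \<Phi> :: "real \<Rightarrow> real \<Rightarrow> real"
  assumes meas: "(\<lambda>z. \<Phi> (fst z) (snd z)) \<in> borel_measurable (borel \<Otimes>\<^sub>M borel)"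
    and bound: "\<And>w s. 0 < w \<Longrightarrow> w < 1 \<Longrightarrow> 0 < s \<Longrightarrow> s < 1 \<Longrightarrow> \<bar>\<Phi> w s\<bar> \<le> C"
  shows "(LINT z|unif2. \<Phi> (max (fst z) (snd z)) (min (fst z) (snd z) / max (fst z) (snd z))) =
    (LINT w|unif. 2 * w * (LINT s|unif. \<Phi> w s))"
proof -
  have [measurable]: "(\<lambda>x. \<Phi> (f x) (g x)) \<in> borel_measurable N"
    if "f \<in> borel_measurable N" "g \<in> borel_measurable N" for f g and N :: "'c measure"
    using measurable_compose[OF measurable_Pair[OF that] meas] by simp
  \<comment> \<open>The square is cut along the diagonal, which is a null set: \<open>K\<close> is
    the integrand on the half where the first coordinate is smaller, and swapping its arguments
    gives the other half.\<close>
  define K where "K u v = (if u < v then \<Phi> v (u / v) else 0)" for u v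
  have C: "0 \<le> C" using bound[of "1/2" "1/2"] by auto
  have K_bound: "norm (K u v) \<le> C" if "0 < u" "0 < v" "v < 1" for u v
    using bound[of v "u / v"] that C by (auto simp: K_def)
  have K_int: "integrable unif2 (\<lambda>z. K (fst z) (snd z))"
    by (rule integrable_unif_pair[where C = C and f = K]) (simp add: K_def[abs_def], rule K_bound)
  have K_int': "integrable unif2 (\<lambda>z. K (snd z) (fst z))"
    by (rule integrable_unif_pair[where C = C and f = "\<lambda>u v. K v u"]) (simp add: K_def[abs_def], rule K_bound)
  have inner: "(LINT u|unif. K u v) = v * (LINT s|unif. \<Phi> v s)" if "0 < v" "v < 1" for v
    using integral_unif_scale[of "\<Phi> v" v] that by (simp add: K_def)
  have "(LINT z|unif2. \<Phi> (max (fst z) (snd z)) (min (fst z) (snd z) / max (fst z) (snd z))) =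
    (LINT z|unif2. K (fst z) (snd z) + K (snd z) (fst z))"
  proof (rule integral_cong_AE)
    show "AE z in unif2. \<Phi> (max (fst z) (snd z)) (min (fst z) (snd z) / max (fst z) (snd z)) =
        K (fst z) (snd z) + K (snd z) (fst z)"
      using AE_unif_pair by eventually_elim (auto simp: K_def max_def min_def)
  qed (auto simp: K_def[abs_def])
  also have "\<dots> = (LINT z|unif2. K (fst z) (snd z)) + (LINT z|unif2. K (snd z) (fst z))"
    using K_int K_int' by (rule Bochner_Integration.integral_add)
  also have "(LINT z|unif2. K (fst z) (snd z)) = (LINT v|unif. LINT u|unif. K u v)"
    using unif_pair.integral_snd[of "\<lambda>u v. K u v"] K_int by (simp add: case_prod_beta')
  also have "(LINT z|unif2. K (snd z) (fst z)) = (LINT v|unif. LINT u|unif. K u v)"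
    using unif_pair.integral_fst'[of "\<lambda>z. K (snd z) (fst z)"] K_int' by simp
  also have "(LINT v|unif. LINT u|unif. K u v) = (LINT v|unif. v * (LINT s|unif. \<Phi> v s))"
  proof (rule integral_cong_AE)
    show "AE v in unif. (LINT u|unif. K u v) = v * (LINT s|unif. \<Phi> v s)"
      using AE_unif by eventually_elim (simp add: inner)
  qed (auto simp: K_def[abs_def])
  finally show ?thesis by (simp add: mult.assoc)
qed

definition toll_limit :: "real \<Rightarrow> real \<Rightarrow> real \<Rightarrow> real" where
  "toll_limit d1 d2 d3 = d1 + (d1 + d2) * d3 + 3/5 * (xlnx d1 + xlnx d2 + xlnx d3)"

abbreviation "gap1 z \<equiv> min (fst z) (snd z)"
abbreviation "gap2 z \<equiv> max (fst z) (snd z) - min (fst z) (snd z)"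
abbreviation "gap3 z \<equiv> 1 - max (fst z) (snd z)"

lemma toll_limit_polar:
  assumes "0 < fst z" "fst z < 1" "0 < snd z" "snd z < 1"
  defines "w \<equiv> max (fst z) (snd z)" and "s \<equiv> min (fst z) (snd z) / max (fst z) (snd z)"
  shows "gap1 z = w * s" "gap2 z = w * (1 - s)" "gap3 z = 1 - w"
    "toll_limit (gap1 z) (gap2 z) (gap3 z) = Atoll w + w * Btoll s"
proof -
  have w: "0 < w" "w < 1" and s: "0 \<le> s" "s \<le> 1" using assms by (auto simp: w_def s_def field_simps)
  show g: "gap1 z = w * s" "gap2 z = w * (1 - s)" "gap3 z = 1 - w"
    using w by (auto simp: w_def s_def field_simps)
  show "toll_limit (gap1 z) (gap2 z) (gap3 z) = Atoll w + w * Btoll s"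
  proof -
    have "toll_limit (gap1 z) (gap2 z) (gap3 z) = toll_limit (w * s) (w * (1 - s)) (1 - w)"
      using g by metis
    also have "\<dots> = Atoll w + w * Btoll s"
      unfolding toll_limit_def xlnx_mult[OF w(1) s(1)] xlnx_mult[OF w(1), of "1 - s", simplified, OF s(2)]
        Atoll_def Btoll_def hent_def by (simp add: algebra_simps add_divide_distrib)
    finally show ?thesis .
  qed
qed

lemma hent_bound: "0 \<le> s \<Longrightarrow> s \<le> 1 \<Longrightarrow> \<bar>hent s\<bar> \<le> 2"
  using xlnx_bound[of s] xlnx_bound[of "1 - s"] by (simp add: hent_def)

lemma Atoll_bound: "0 \<le> w \<Longrightarrow> w \<le> 1 \<Longrightarrow> \<bar>Atoll w\<bar> \<le> 3"
proof -
  assume w: "0 \<le> w" "w \<le> 1"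
  then have "w * (1 - w) \<le> 1" "0 \<le> w * (1 - w)" by (auto intro: mult_le_one)
  then show ?thesis using hent_bound[OF w] by (simp add: Atoll_def abs_le_iff)
qed

lemma Btoll_bound: "0 \<le> s \<Longrightarrow> s \<le> 1 \<Longrightarrow> \<bar>Btoll s\<bar> \<le> 3"
  using hent_bound[of s] by (simp add: Btoll_def abs_le_iff)

lemma toll_limit_second_moment:
  "(LINT z|unif2. (toll_limit (gap1 z) (gap2 z) (gap3 z))\<^sup>2) = 7/20 - 3/100 * pi\<^sup>2"
proof -
  let ?\<Phi> = "\<lambda>w s. (Atoll w + w * Btoll s)\<^sup>2"
  have "(LINT z|unif2. (toll_limit (gap1 z) (gap2 z) (gap3 z))\<^sup>2) =
    (LINT z|unif2. ?\<Phi> (max (fst z) (snd z)) (min (fst z) (snd z) / max (fst z) (snd z)))"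
  proof (rule integral_cong_AE)
    show "AE z in unif2. (toll_limit (gap1 z) (gap2 z) (gap3 z))\<^sup>2 =
      ?\<Phi> (max (fst z) (snd z)) (min (fst z) (snd z) / max (fst z) (snd z))"
      using AE_unif_pair by eventually_elim (simp add: toll_limit_polar(4))
  qed (auto simp: toll_limit_def[abs_def])
  moreover have "\<dots> = (LINT w|unif. 2 * w * (LINT s|unif. ?\<Phi> w s))"
  proof (rule integral_unif_pair_polar[where C = 36])
    fix w s :: real assume "0 < w" "w < 1" "0 < s" "s < 1"
    then have "\<bar>Atoll w\<bar> \<le> 3" "\<bar>w * Btoll s\<bar> \<le> 1 * 3"
      using Atoll_bound[of w] Btoll_bound[of s] mult_mono[of w 1 "\<bar>Btoll s\<bar>" 3]
      unfolding abs_mult by auto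
    then have "\<bar>Atoll w + w * Btoll s\<bar> \<le> 6" by linarith
    then show "\<bar>?\<Phi> w s\<bar> \<le> 36" using abs_le_square_iff[of "Atoll w + w * Btoll s" 6] by simp
  qed measurable
  moreover have inner: "(LINT s|unif. ?\<Phi> w s) = (Atoll w)\<^sup>2 + 2/5 * (w * Atoll w) + w\<^sup>2 * (1/3 - pi\<^sup>2 / 50)" for w
  proof -
    have "(LINT s|unif. ?\<Phi> w s) = (LINT s|unif. ((Atoll w)\<^sup>2 + (2 * w * Atoll w) * Btoll s) + w\<^sup>2 * (Btoll s)\<^sup>2)"
      by (simp add: power2_sum power_mult_distrib algebra_simps)
    also have "\<dots> = (LINT s|unif. (Atoll w)\<^sup>2 + (2 * w * Atoll w) * Btoll s) + (LINT s|unif. w\<^sup>2 * (Btoll s)\<^sup>2)"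
      by (rule integral_unif_add) (auto intro!: continuous_intros)
    also have "(LINT s|unif. (Atoll w)\<^sup>2 + (2 * w * Atoll w) * Btoll s) =
        (LINT s|unif. (Atoll w)\<^sup>2) + (LINT s|unif. (2 * w * Atoll w) * Btoll s)"
      by (rule integral_unif_add) (auto intro!: continuous_intros)
    finally show ?thesis by (simp add: integral_unif_toll_parts unif.prob_space)
  qed
  ultimately have "(LINT z|unif2. (toll_limit (gap1 z) (gap2 z) (gap3 z))\<^sup>2) =
    (LINT w|unif. 2 * w * ((Atoll w)\<^sup>2 + 2/5 * (w * Atoll w) + w\<^sup>2 * (1/3 - pi\<^sup>2 / 50)))"
    by (simp only: inner)
  also have "(LINT w|unif. 2 * w * ((Atoll w)\<^sup>2 + 2/5 * (w * Atoll w) + w\<^sup>2 * (1/3 - pi\<^sup>2 / 50))) =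
    (LINT w|unif. (2 * (w * (Atoll w)\<^sup>2) + 4/5 * (w\<^sup>2 * Atoll w)) + (2/3 - pi\<^sup>2 / 25) * w ^ 3)"
    by (rule Bochner_Integration.integral_cong) (simp_all add: power2_eq_square power3_eq_cube field_simps)
  also have "\<dots> = (LINT w|unif. 2 * (w * (Atoll w)\<^sup>2) + 4/5 * (w\<^sup>2 * Atoll w)) + (LINT w|unif. (2/3 - pi\<^sup>2 / 25) * w ^ 3)"
    by (rule integral_unif_add) (auto intro!: continuous_intros)
  also have "(LINT w|unif. 2 * (w * (Atoll w)\<^sup>2) + 4/5 * (w\<^sup>2 * Atoll w)) =
      (LINT w|unif. 2 * (w * (Atoll w)\<^sup>2)) + (LINT w|unif. 4/5 * (w\<^sup>2 * Atoll w))"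
    by (rule integral_unif_add) (auto intro!: continuous_intros)
  \<comment> \<open>\<open>Atoll\<close> is symmetric about 1/2, so the weight \<open>2 * w\<close>
    can be replaced by its average 1 under the reflection.\<close>
  also have "(LINT w|unif. 2 * (w * (Atoll w)\<^sup>2)) = (LINT w|unif. (Atoll w)\<^sup>2)"
  proof -
    have r: "Atoll (1 - w) = Atoll w" for w by (simp add: Atoll_def hent_reflect algebra_simps)
    have "(LINT w|unif. (Atoll w)\<^sup>2) = (LINT w|unif. w * (Atoll w)\<^sup>2 + (1 - w) * (Atoll w)\<^sup>2)"
      by (simp add: algebra_simps)
    also have "\<dots> = (LINT w|unif. w * (Atoll w)\<^sup>2) + (LINT w|unif. (1 - w) * (Atoll w)\<^sup>2)"
      by (rule integral_unif_add) (auto intro!: continuous_intros)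
    also have "(LINT w|unif. (1 - w) * (Atoll w)\<^sup>2) = (LINT w|unif. w * (Atoll w)\<^sup>2)"
      using integral_unif_reflect[of "\<lambda>w. w * (Atoll w)\<^sup>2"] by (simp add: r)
    finally show ?thesis by simp
  qed
  moreover have p3: "(LINT w|unif. w ^ 3) = 1/4" using integral_unif_power[of 3] by simp
  ultimately show ?thesis
    by (simp add: integral_unif_toll_parts) (simp add: field_simps)
qed

lemma gaps_second_moment:
  "(LINT z|unif2. (gap1 z)\<^sup>2 + (gap2 z)\<^sup>2 + (gap3 z)\<^sup>2) = 1/2"
proof -
  let ?\<Phi> = "\<lambda>w s. (w * s)\<^sup>2 + (w * (1 - s))\<^sup>2 + (1 - w)\<^sup>2 :: real"
  have "(LINT z|unif2. (gap1 z)\<^sup>2 + (gap2 z)\<^sup>2 + (gap3 z)\<^sup>2) =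
    (LINT z|unif2. ?\<Phi> (max (fst z) (snd z)) (min (fst z) (snd z) / max (fst z) (snd z)))"
  proof (rule integral_cong_AE)
    show "AE z in unif2. (gap1 z)\<^sup>2 + (gap2 z)\<^sup>2 + (gap3 z)\<^sup>2 =
      ?\<Phi> (max (fst z) (snd z)) (min (fst z) (snd z) / max (fst z) (snd z))"
      using AE_unif_pair
    proof eventually_elim
      case (elim z)
      then show ?case using toll_limit_polar(1-3)[of z] by metis
    qed
  qed auto
  moreover have "\<dots> = (LINT w|unif. 2 * w * (LINT s|unif. ?\<Phi> w s))"
  proof (rule integral_unif_pair_polar[where C = 3])
    fix w s :: real assume ws: "0 < w" "w < 1" "0 < s" "s < 1"
    have "x\<^sup>2 \<le> 1" if "0 \<le> x" "x \<le> 1" for x :: real using that by (simp add: power_le_one)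
    moreover have "w * s \<le> 1" "w * (1 - s) \<le> 1" using ws by (auto intro!: mult_le_one)
    ultimately have "(w * s)\<^sup>2 \<le> 1" "(w * (1 - s))\<^sup>2 \<le> 1" "(1 - w)\<^sup>2 \<le> 1" using ws by auto
    then show "\<bar>?\<Phi> w s\<bar> \<le> 3" by simp
  qed measurable
  moreover have inner: "(LINT s|unif. ?\<Phi> w s) = 2/3 * w\<^sup>2 + (1 - w)\<^sup>2" for w
  proof -
    have "(LINT s|unif. ?\<Phi> w s) = (LINT s|unif. w\<^sup>2 * s\<^sup>2 + w\<^sup>2 * (1 - s)\<^sup>2) + (LINT s|unif. (1 - w)\<^sup>2)"
      unfolding power_mult_distrib by (rule integral_unif_add) (auto intro!: continuous_intros)
    also have "(LINT s|unif. w\<^sup>2 * s\<^sup>2 + w\<^sup>2 * (1 - s)\<^sup>2) = (LINT s|unif. w\<^sup>2 * s\<^sup>2) + (LINT s|unif. w\<^sup>2 * (1 - s)\<^sup>2)"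
      by (rule integral_unif_add) (auto intro!: continuous_intros)
    also have "(LINT s|unif. w\<^sup>2 * (1 - s)\<^sup>2) = (LINT s|unif. w\<^sup>2 * s\<^sup>2)"
      using integral_unif_reflect[of "\<lambda>s. w\<^sup>2 * s\<^sup>2"] by simp
    finally show ?thesis using integral_unif_power[of 2] by (simp add: unif.prob_space)
  qed
  ultimately have "(LINT z|unif2. (gap1 z)\<^sup>2 + (gap2 z)\<^sup>2 + (gap3 z)\<^sup>2) =
    (LINT w|unif. 2 * w * (2/3 * w\<^sup>2 + (1 - w)\<^sup>2))"
    by (simp only: inner)
  also have "(LINT w|unif. 2 * w * (2/3 * w\<^sup>2 + (1 - w)\<^sup>2)) = (LINT w|unif. (10/3 * w ^ 3 - 4 * w ^ 2) + 2 * w ^ 1)"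
    by (rule Bochner_Integration.integral_cong) (simp_all add: power2_eq_square power3_eq_cube algebra_simps)
  also have "\<dots> = (LINT w|unif. 10/3 * w ^ 3 - 4 * w ^ 2) + (LINT w|unif. 2 * w ^ 1)"
    by (rule integral_unif_add) (auto intro!: continuous_intros)
  also have "(LINT w|unif. 10/3 * w ^ 3 - 4 * w ^ 2) = (LINT w|unif. 10/3 * w ^ 3) - (LINT w|unif. 4 * w ^ 2)"
    by (rule integral_unif_diff) (auto intro!: continuous_intros)
  finally show ?thesis by (simp only: integral_mult_right_zero integral_unif_power) simp
qed

section \<open>Coupling of the pivots with two uniform variables\<close>

text \<open>
  For independent uniform \<open>u\<close> and \<open>v\<close>, the pair \<open>(cell n u, cell n v)\<close> conditioned on the two cells
  being distinct has the law of the first and last entry of a random permutation.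
\<close>

definition cell :: "nat \<Rightarrow> real \<Rightarrow> int" where "cell n u = \<lfloor>real n * u\<rfloor> + 1"

lemma measurable_cell [measurable]: "cell n \<in> measurable borel (count_space UNIV)"
  unfolding cell_def[abs_def] by measurable

lemma cell_range: "0 < n \<Longrightarrow> 0 < u \<Longrightarrow> u < 1 \<Longrightarrow> 1 \<le> cell n u \<and> cell n u \<le> int n"
proof -
  assume n: "0 < n" and u: "0 < u" "u < 1"
  have "0 \<le> \<lfloor>real n * u\<rfloor>" "\<lfloor>real n * u\<rfloor> < int n"
    using n u by (simp_all add: floor_less_iff)
  then show ?thesis unfolding cell_def by linarith
qed

lemma cell_prob:
  assumes n: "0 < n" and a: "1 \<le> a" "a \<le> int n"
  shows "(LINT u|unif. of_bool (cell n u = a)) = 1 / real n"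
proof -
  have eq: "cell n u = a \<longleftrightarrow> (real_of_int a - 1) / real n \<le> u \<and> u < real_of_int a / real n" for u
  proof -
    have "cell n u = a \<longleftrightarrow> \<lfloor>real n * u\<rfloor> = a - 1" by (auto simp: cell_def)
    also have "\<dots> \<longleftrightarrow> real_of_int a - 1 \<le> u * real n \<and> u * real n < real_of_int a"
      by (simp add: floor_eq_iff mult.commute)
    finally show ?thesis using n by (simp add: pos_divide_le_eq pos_less_divide_eq)
  qed
  have "(LINT u|unif. of_bool (cell n u = a)) = (LBINT u. indicator {(real_of_int a - 1) / real n..<real_of_int a / real n} u :: real)"
    unfolding integral_unif[of "\<lambda>u. of_bool (cell n u = a)", simplified] set_lebesgue_integral_def
  proof (rule Bochner_Integration.integral_cong)
    fix u :: real
    have "u \<in> {0..1}" if "(real_of_int a - 1) / real n \<le> u" "u < real_of_int a / real n"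
    proof -
      have "0 \<le> (real_of_int a - 1) / real n" "real_of_int a / real n \<le> 1" using n a by (auto simp: field_simps)
      then show ?thesis using that by auto
    qed
    then show "indicator {0..1} u *\<^sub>R (of_bool (cell n u = a) :: real) =
        indicator {(real_of_int a - 1) / real n..<real_of_int a / real n} u"
      unfolding eq by (auto simp: indicator_def)
  qed simp
  also have "\<dots> = 1 / real n" using n by (simp add: field_simps measure_def[symmetric] diff_divide_distrib[symmetric])
  finally show ?thesis .
qed

text \<open>The pair of cells is uniform on an \<open>n\<close> by \<open>n\<close> grid, so
  averages over end entries become integrals on one fixed probability space. Limits can then be
  taken by dominated convergence.\<close>

lemma integral_cells:
  fixes g :: "int \<Rightarrow> int \<Rightarrow> 'b::{banach, second_countable_topology}"
  assumes n: "0 < n"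
  shows "integrable unif2 (\<lambda>z. g (cell n (fst z)) (cell n (snd z)))"
    and "(LINT z|unif2. g (cell n (fst z)) (cell n (snd z))) =
      (\<Sum>a\<in>{1..int n}. \<Sum>b\<in>{1..int n}. g a b) /\<^sub>R (real n)\<^sup>2"
proof -
  let ?I = "\<lambda>a b z. (of_bool (cell n (fst z) = a) * of_bool (cell n (snd z) = b)) *\<^sub>R g a b"
  have meas: "(\<lambda>z. g (cell n (fst z)) (cell n (snd z))) \<in> borel_measurable unif2"
  proof -
    have "(\<lambda>z. (cell n (fst z), cell n (snd z))) \<in> measurable unif2 (count_space UNIV \<Otimes>\<^sub>M count_space UNIV)" by measurable
    also have "count_space UNIV \<Otimes>\<^sub>M count_space UNIV = count_space (UNIV :: (int \<times> int) set)"
      by (simp add: pair_measure_countable)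
    finally have "(\<lambda>z. case_prod g (cell n (fst z), cell n (snd z))) \<in> borel_measurable unif2"
      by (rule measurable_compose) simp
    then show ?thesis by simp
  qed
  have AE: "AE z in unif2. g (cell n (fst z)) (cell n (snd z)) = (\<Sum>a\<in>{1..int n}. \<Sum>b\<in>{1..int n}. ?I a b z)"
    using AE_unif_pair
  proof eventually_elim
    case (elim z)
    then have r: "cell n (fst z) \<in> {1..int n}" "cell n (snd z) \<in> {1..int n}"
      using cell_range[OF n] by auto
    have "(\<Sum>b\<in>{1..int n}. ?I a b z) = (\<Sum>b\<in>{cell n (snd z)}. ?I a b z)" for a
      by (rule sum.mono_neutral_right) (use r in auto)
    moreover have "(\<Sum>a\<in>{1..int n}. ?I a (cell n (snd z)) z) = (\<Sum>a\<in>{cell n (fst z)}. ?I a (cell n (snd z)) z)"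
      by (rule sum.mono_neutral_right) (use r in auto)
    ultimately show ?case by simp
  qed
  have ind_int: "integrable unif2 (\<lambda>z. of_bool (cell n (fst z) = a) * of_bool (cell n (snd z) = b) :: real)" for a b
    by (rule integrable_unif_pair[where C = 1 and f = "\<lambda>u v. of_bool (cell n u = a) * of_bool (cell n v = b)"]) auto
  have ind_val: "(LINT z|unif2. of_bool (cell n (fst z) = a) * of_bool (cell n (snd z) = b)) = 1 / (real n)\<^sup>2"
    if "a \<in> {1..int n}" "b \<in> {1..int n}" for a b
  proof -
    have "(LINT z|unif2. of_bool (cell n (fst z) = a) * of_bool (cell n (snd z) = b)) =
      (LINT u|unif. LINT v|unif. of_bool (cell n u = a) * of_bool (cell n v = b) :: real)"
      using unif_pair.integral_fst'[OF ind_int[of a b]] by simp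
    then show ?thesis using that n by (simp add: cell_prob power2_eq_square)
  qed
  have sum_int: "integrable unif2 (\<lambda>z. \<Sum>a\<in>{1..int n}. \<Sum>b\<in>{1..int n}. ?I a b z)"
    using ind_int by auto
  have meas2: "(\<lambda>z. \<Sum>a\<in>{1..int n}. \<Sum>b\<in>{1..int n}. ?I a b z) \<in> borel_measurable unif2"
    using sum_int by (rule borel_measurable_integrable)
  show "integrable unif2 (\<lambda>z. g (cell n (fst z)) (cell n (snd z)))"
    using integrable_cong_AE[OF meas meas2 AE] sum_int by simp
  have "(LINT z|unif2. g (cell n (fst z)) (cell n (snd z))) = (LINT z|unif2. (\<Sum>a\<in>{1..int n}. \<Sum>b\<in>{1..int n}. ?I a b z))"
    using meas meas2 AE by (rule integral_cong_AE)
  also have "\<dots> = (\<Sum>a\<in>{1..int n}. \<Sum>b\<in>{1..int n}. (LINT z|unif2. ?I a b z))"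
    using ind_int by (simp add: Bochner_Integration.integral_sum)
  also have "\<dots> = (\<Sum>a\<in>{1..int n}. \<Sum>b\<in>{1..int n}. (1 / (real n)\<^sup>2) *\<^sub>R g a b)"
    using ind_int by (intro sum.cong refl) (simp add: ind_val)
  finally show "(LINT z|unif2. g (cell n (fst z)) (cell n (snd z))) =
      (\<Sum>a\<in>{1..int n}. \<Sum>b\<in>{1..int n}. g a b) /\<^sub>R (real n)\<^sup>2"
    by (simp add: scaleR_sum_right divide_inverse)
qed

text \<open>The factor \<open>n / (n - 1)\<close> is the reciprocal of the probability that the two
  cells differ.\<close>

lemma pavg_eq_integral_cells:
  fixes g :: "int \<Rightarrow> int \<Rightarrow> 'b::{banach, second_countable_topology}"
  assumes n: "2 \<le> n"
  shows "pavg n (\<lambda>\<pi>. g (\<pi> 1) (\<pi> (int n))) =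
    (real n / (real n - 1)) *\<^sub>R (LINT z|unif2. of_bool (cell n (fst z) \<noteq> cell n (snd z)) *\<^sub>R g (cell n (fst z)) (cell n (snd z)))"
proof -
  have "(LINT z|unif2. of_bool (cell n (fst z) \<noteq> cell n (snd z)) *\<^sub>R g (cell n (fst z)) (cell n (snd z))) =
      (\<Sum>a\<in>{1..int n}. \<Sum>b\<in>{1..int n}. of_bool (a \<noteq> b) *\<^sub>R g a b) /\<^sub>R (real n)\<^sup>2"
    using n by (intro integral_cells(2)) simp
  also have "(\<Sum>a\<in>{1..int n}. \<Sum>b\<in>{1..int n}. of_bool (a \<noteq> b) *\<^sub>R g a b) =
      (\<Sum>a\<in>{1..int n}. \<Sum>b\<in>{1..int n} - {a}. g a b)"
    by (intro sum.cong refl sum.mono_neutral_cong_right) auto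
  finally show ?thesis
    using n by (simp add: pavg_of_ends[OF n] power2_eq_square field_simps)
qed

lemma cell_coincidence: "0 < n \<Longrightarrow> (LINT z|unif2. of_bool (cell n (fst z) = cell n (snd z))) = 1 / real n"
proof -
  assume n: "0 < n"
  have "(\<Sum>b\<in>{1..int n}. of_bool (a = b)) = (1::real)" if "a \<in> {1..int n}" for a
    using that by (simp add: of_bool_def sum.delta)
  then show ?thesis
    using n integral_cells(2)[OF n, of "\<lambda>a b. of_bool (a = b) :: real"] by (simp add: power2_eq_square field_simps)
qed

section \<open>Block sizes under the coupling\<close>

definition cblock1 :: "nat \<Rightarrow> real \<times> real \<Rightarrow> nat" where
  "cblock1 n z = nat (min (cell n (fst z)) (cell n (snd z)) - 1)"
definition cblock2 :: "nat \<Rightarrow> real \<times> real \<Rightarrow> nat" where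
  "cblock2 n z = nat (max (cell n (fst z)) (cell n (snd z)) - min (cell n (fst z)) (cell n (snd z)) - 1)"
definition cblock3 :: "nat \<Rightarrow> real \<times> real \<Rightarrow> nat" where
  "cblock3 n z = nat (int n - max (cell n (fst z)) (cell n (snd z)))"

lemma measurable_cblocks [measurable]:
  "cblock1 n \<in> measurable (borel \<Otimes>\<^sub>M borel) (count_space UNIV)"
  "cblock2 n \<in> measurable (borel \<Otimes>\<^sub>M borel) (count_space UNIV)"
  "cblock3 n \<in> measurable (borel \<Otimes>\<^sub>M borel) (count_space UNIV)"
  unfolding cblock1_def[abs_def] cblock2_def[abs_def] cblock3_def[abs_def] by measurable

lemma cell_over_n_tendsto: "(\<lambda>n. real_of_int (cell n u) / real n) \<longlonglongrightarrow> u"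
proof -
  have "(\<lambda>n. real_of_int \<lfloor>real n * u\<rfloor> / real n) \<longlonglongrightarrow> u"
  proof (rule tendsto_sandwich)
    show "\<forall>\<^sub>F n in sequentially. u - 1 / real n \<le> real_of_int \<lfloor>real n * u\<rfloor> / real n"
      using eventually_gt_at_top[of 0]
    proof eventually_elim
      case (elim n)
      have "real n * u - 1 \<le> real_of_int \<lfloor>real n * u\<rfloor>" by linarith
      then have "(real n * u - 1) / real n \<le> real_of_int \<lfloor>real n * u\<rfloor> / real n" by (rule divide_right_mono) simp
      then show ?case using elim by (simp add: diff_divide_distrib)
    qed
    show "\<forall>\<^sub>F n in sequentially. real_of_int \<lfloor>real n * u\<rfloor> / real n \<le> u"
      using eventually_gt_at_top[of 0]
    proof eventually_elim
      case (elim n)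
      have "real_of_int \<lfloor>real n * u\<rfloor> \<le> real n * u" by linarith
      then have "real_of_int \<lfloor>real n * u\<rfloor> / real n \<le> real n * u / real n" by (rule divide_right_mono) simp
      then show ?case using elim by simp
    qed
    show "(\<lambda>n. u - 1 / real n) \<longlonglongrightarrow> u" by real_asymp
  qed simp
  then have "(\<lambda>n. real_of_int \<lfloor>real n * u\<rfloor> / real n + 1 / real n) \<longlonglongrightarrow> u + 0"
    by (intro tendsto_add) (auto, real_asymp)
  then show ?thesis by (simp add: cell_def add_divide_distrib)
qed

lemma real_nat_max: "real (nat k) = max (real_of_int k) 0" by simp

lemma max_divide_nonneg: "0 \<le> c \<Longrightarrow> max a b / c = max (a / c) (b / (c::real))"
  by (simp add: max_divide_distrib_right)

lemma min_divide_nonneg: "0 \<le> c \<Longrightarrow> min a b / c = min (a / c) (b / (c::real))"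
  by (simp add: min_divide_distrib_right)

lemma cblocks_over_n_tendsto:
  assumes "0 < fst z" "fst z < 1" "0 < snd z" "snd z < 1"
  shows "(\<lambda>n. real (cblock1 n z) / real n) \<longlonglongrightarrow> gap1 z"
    "(\<lambda>n. real (cblock2 n z) / real n) \<longlonglongrightarrow> gap2 z"
    "(\<lambda>n. real (cblock3 n z) / real n) \<longlonglongrightarrow> gap3 z"
proof -
  let ?mn = "\<lambda>n. min (real_of_int (cell n (fst z)) / real n) (real_of_int (cell n (snd z)) / real n)"
  let ?mx = "\<lambda>n. max (real_of_int (cell n (fst z)) / real n) (real_of_int (cell n (snd z)) / real n)"
  have mn: "?mn \<longlonglongrightarrow> min (fst z) (snd z)" and mx: "?mx \<longlonglongrightarrow> max (fst z) (snd z)"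
    by (intro tendsto_min tendsto_max cell_over_n_tendsto)+
  have z0: "(\<lambda>n. 1 / real n) \<longlonglongrightarrow> 0" by real_asymp
  have one: "(\<lambda>n. real n / real n) \<longlonglongrightarrow> 1" by real_asymp
  have "real (cblock1 n z) / real n = max (?mn n - 1 / real n) 0" for n
    unfolding cblock1_def real_nat_max
    by (simp add: max_divide_nonneg min_divide_nonneg diff_divide_distrib of_int_min of_int_max)
  moreover have "(\<lambda>n. max (?mn n - 1 / real n) 0) \<longlonglongrightarrow> max (gap1 z - 0) 0"
    by (intro tendsto_max tendsto_diff mn z0 tendsto_const)
  ultimately show "(\<lambda>n. real (cblock1 n z) / real n) \<longlonglongrightarrow> gap1 z"
    using max_absorb1[of 0 "gap1 z - 0"] assms by simp
  have "real (cblock2 n z) / real n = max (?mx n - ?mn n - 1 / real n) 0" for n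
    unfolding cblock2_def real_nat_max
    by (simp add: max_divide_nonneg min_divide_nonneg diff_divide_distrib of_int_min of_int_max)
  moreover have "(\<lambda>n. max (?mx n - ?mn n - 1 / real n) 0) \<longlonglongrightarrow> max (gap2 z - 0) 0"
    by (intro tendsto_max tendsto_diff mn mx z0 tendsto_const)
  ultimately show "(\<lambda>n. real (cblock2 n z) / real n) \<longlonglongrightarrow> gap2 z"
    using max_absorb1[of 0 "gap2 z - 0"] by simp
  have "real (cblock3 n z) / real n = max (real n / real n - ?mx n) 0" for n
    unfolding cblock3_def real_nat_max
    by (simp add: max_divide_nonneg min_divide_nonneg diff_divide_distrib of_int_min of_int_max)
  moreover have "(\<lambda>n. max (real n / real n - ?mx n) 0) \<longlonglongrightarrow> max (gap3 z) 0"
    by (intro tendsto_max tendsto_diff mx one tendsto_const)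
  ultimately show "(\<lambda>n. real (cblock3 n z) / real n) \<longlonglongrightarrow> gap3 z"
    using max_absorb1[of 0 "gap3 z"] assms by simp
qed

lemma filterlim_at_top_of_ratio:
  fixes f :: "nat \<Rightarrow> nat"
  assumes "(\<lambda>n. real (f n) / real n) \<longlonglongrightarrow> c" "0 < c"
  shows "filterlim f at_top sequentially"
proof -
  have "filterlim (\<lambda>n. (real (f n) / real n) * real n) at_top sequentially"
    using assms by (intro filterlim_tendsto_pos_mult_at_top filterlim_real_sequentially)
  moreover have "\<forall>\<^sub>F n in sequentially. (real (f n) / real n) * real n = real (f n)"
    using eventually_gt_at_top[of 0] by eventually_elim simp
  ultimately have "filterlim (\<lambda>n. real (f n)) at_top sequentially"
    by (simp add: filterlim_cong[OF refl refl])
  then have "\<forall>\<^sub>F n in sequentially. real Z \<le> real (f n)" for Z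
    unfolding filterlim_at_top by blast
  then show ?thesis unfolding filterlim_at_top by simp
qed

lemma cblocks_at_top:
  assumes "0 < fst z" "fst z < 1" "0 < snd z" "snd z < 1" "fst z \<noteq> snd z"
  shows "filterlim (\<lambda>n. cblock1 n z) at_top sequentially" "filterlim (\<lambda>n. cblock2 n z) at_top sequentially"
    "filterlim (\<lambda>n. cblock3 n z) at_top sequentially"
  by (rule filterlim_at_top_of_ratio[OF cblocks_over_n_tendsto(1)[OF assms(1-4)]]
        filterlim_at_top_of_ratio[OF cblocks_over_n_tendsto(2)[OF assms(1-4)]]
        filterlim_at_top_of_ratio[OF cblocks_over_n_tendsto(3)[OF assms(1-4)]]; use assms in auto)+

text \<open>The sizes add up to \<open>n - 2\<close> for distinct cells and to \<open>n - 1\<close>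
  for coinciding ones, where truncation sets the middle block to 0. The later bounds are stated for
  this whole range of totals, so they apply without excluding coincidences.\<close>

lemma cblocks_sum:
  assumes n: "0 < n" and z: "0 < fst z" "fst z < 1" "0 < snd z" "snd z < 1"
  shows "cblock1 n z + cblock2 n z + cblock3 n z \<le> n" "n \<le> cblock1 n z + cblock2 n z + cblock3 n z + 2"
  using cell_range[OF n, of "fst z"] cell_range[OF n, of "snd z"] z
  by (auto simp: cblock1_def cblock2_def cblock3_def)

text \<open>
  The number of partitioning swaps is replaced here by its conditional mean given the pivots,
  up to a bounded error.
\<close>

definition block_toll :: "nat \<Rightarrow> nat \<Rightarrow> nat \<Rightarrow> nat \<Rightarrow> nat \<Rightarrow> real" where
  "block_toll M n i1 i2 i3 = (real i1 + (real i1 + real i2) * real i3 / (real n - 2)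
     + mean_swaps M i1 + mean_swaps M i2 + mean_swaps M i3 - mean_swaps M n) / real n"

section \<open>Uniform bound and limit of the scaled toll\<close>

definition mean_remainder :: "nat \<Rightarrow> nat \<Rightarrow> real" where
  "mean_remainder M k = mean_swaps M k / real k - 3/5 * ln (real k)"

lemma mean_swaps_0 [simp]: "mean_swaps M 0 = 0"
proof -
  have "swap_count M 0 = (\<lambda>_. 0)" by (rule ext) (simp add: swap_count_below_threshold)
  then show ?thesis by (simp add: mean_swaps_def)
qed

lemma mean_swaps_decomp: "mean_swaps M k = real k * (3/5 * ln (real k) + mean_remainder M k)"
  by (cases "k = 0") (auto simp: mean_remainder_def)

lemma mean_swaps_scaled:
  assumes "0 < n"
  shows "mean_swaps M k / real n = 3/5 * xlnx (real k / real n) + real k / real n * (3/5 * ln (real n) + mean_remainder M k)"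
proof (cases "k = 0")
  case False
  then have "xlnx (real k / real n) = real k / real n * (ln (real k) - ln (real n))"
    using assms by (simp add: xlnx_def ln_div)
  moreover have "mean_swaps M k / real n = real k / real n * (3/5 * ln (real k) + mean_remainder M k)"
    by (subst mean_swaps_decomp) simp
  ultimately show ?thesis by (simp only:) (simp only: right_diff_distrib distrib_left, simp)
qed simp

text \<open>Writing \<open>ln k = ln (k / n) + ln n\<close> in the mean turns the main terms into
  entropies of the proportions. The terms with \<open>ln n\<close> combine into a multiple of
  \<open>(n - i1 - i2 - i3) * ln n / n\<close>, which is negligible because the block sizes miss
  \<open>n\<close> by at most 2.\<close>

lemma block_toll_alt:
  assumes "0 < n"
  shows "block_toll M n i1 i2 i3 =
    real i1 / real n + (real i1 / real n + real i2 / real n) * (real i3 / real n) * (real n / (real n - 2))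
    + 3/5 * (xlnx (real i1 / real n) + xlnx (real i2 / real n) + xlnx (real i3 / real n))
    - 3/5 * ((real n - real i1 - real i2 - real i3) * (ln (real n) / real n))
    + (real i1 / real n * mean_remainder M i1 + real i2 / real n * mean_remainder M i2
       + real i3 / real n * mean_remainder M i3 - mean_remainder M n)"
proof -
  have "block_toll M n i1 i2 i3 = real i1 / real n + (real i1 + real i2) * real i3 / (real n - 2) / real n
     + mean_swaps M i1 / real n + mean_swaps M i2 / real n + mean_swaps M i3 / real n - mean_swaps M n / real n"
    by (simp add: block_toll_def add_divide_distrib diff_divide_distrib)
  also have "(real i1 + real i2) * real i3 / (real n - 2) / real n =
      (real i1 / real n + real i2 / real n) * (real i3 / real n) * (real n / (real n - 2))"
  proof -
    have "s * t / d / x = s / x * (t / x) * (x / d)" if "x \<noteq> 0" for s t d x :: real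
      using that by (cases "d = 0") (simp_all add: field_simps)
    then show ?thesis using assms by (simp add: add_divide_distrib[symmetric])
  qed
  finally show ?thesis
    unfolding mean_swaps_scaled[OF assms] using assms by (simp add: algebra_simps diff_divide_distrib add_divide_distrib)
qed

lemma mean_remainder_bounded:
  assumes M: "0 < M"
  obtains K where "0 \<le> K" "\<And>k. \<bar>mean_remainder M k\<bar> \<le> K"
proof -
  obtain c where "(mean_remainder M) \<longlonglongrightarrow> c"
    unfolding mean_remainder_def[abs_def] using mean_swaps_asymptotics[OF M] by blast
  then have "Bseq (mean_remainder M)" by (intro convergent_imp_Bseq convergentI)
  then obtain K where "0 < K" "\<And>k. norm (mean_remainder M k) \<le> K" by (auto elim: BseqE)
  then show thesis by (intro that[of K]) auto
qed

text \<open>Supplies the dominating constant for the passages to the limit. The four remainders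
  account for \<open>4 * K\<close>; everything else is at most 10, where \<open>4 \<le> n\<close>
  gives \<open>n / (n - 2) \<le> 2\<close>.\<close>

lemma block_toll_bounded:
  assumes M: "0 < M"
  obtains C where "0 \<le> C" "\<And>n i1 i2 i3. 4 \<le> n \<Longrightarrow> i1 + i2 + i3 \<le> n \<Longrightarrow> n \<le> i1 + i2 + i3 + 2 \<Longrightarrow>
    \<bar>block_toll M n i1 i2 i3\<bar> \<le> C"
proof -
  obtain K where K: "0 \<le> K" "\<And>k. \<bar>mean_remainder M k\<bar> \<le> K"
    using mean_remainder_bounded[OF M] by blast
  have "\<bar>block_toll M n i1 i2 i3\<bar> \<le> 10 + 4 * K"
    if n: "4 \<le> n" and s: "i1 + i2 + i3 \<le> n" "n \<le> i1 + i2 + i3 + 2" for n i1 i2 i3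
  proof -
    define x1 x2 x3 where "x1 = real i1 / real n" and "x2 = real i2 / real n" and "x3 = real i3 / real n"
    have n0: "0 < n" using n by simp
    have "real i1 + real i2 + real i3 \<le> real n" using s by linarith
    then have "(real i1 + real i2 + real i3) / real n \<le> 1" using n0 by simp
    then have xs: "x1 + x2 + x3 \<le> 1" by (simp add: x1_def x2_def x3_def add_divide_distrib)
    have x: "0 \<le> x1" "0 \<le> x2" "0 \<le> x3" by (auto simp: x1_def x2_def x3_def)
    then have x': "x1 \<le> 1" "x2 \<le> 1" "x3 \<le> 1" "x1 + x2 \<le> 1" using xs by auto
    have rest: "\<bar>x * mean_remainder M k\<bar> \<le> K" if "0 \<le> x" "x \<le> 1" for x k
      using mult_mono[of "\<bar>x\<bar>" 1 "\<bar>mean_remainder M k\<bar>" K] that K by (simp add: abs_mult)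
    have fac: "0 \<le> real n / (real n - 2)" "real n / (real n - 2) \<le> 2" using n by (auto simp: field_simps)
    have p: "0 \<le> (x1 + x2) * x3" "(x1 + x2) * x3 \<le> 1" using x x' by (auto intro: mult_le_one)
    have prod: "0 \<le> (x1 + x2) * x3 * (real n / (real n - 2))" "(x1 + x2) * x3 * (real n / (real n - 2)) \<le> 2"
      using mult_nonneg_nonneg[OF p(1) fac(1)] mult_mono[OF p(2) fac(2) _ fac(1)] by simp_all
    have l: "0 \<le> ln (real n) / real n" "ln (real n) / real n \<le> 1"
      using n ln_le_minus_one[of "real n"] by (auto simp: field_simps)
    have d: "0 \<le> real n - real i1 - real i2 - real i3" "real n - real i1 - real i2 - real i3 \<le> 2" using s by auto
    have lp: "0 \<le> (real n - real i1 - real i2 - real i3) * (ln (real n) / real n)"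
      "(real n - real i1 - real i2 - real i3) * (ln (real n) / real n) \<le> 2"
      using l d mult_mono[of "real n - real i1 - real i2 - real i3" 2 "ln (real n) / real n" 1] by (auto simp del: times_divide_eq_right)
    have "\<bar>x + P + 3/5 * (a + b + c) - 3/5 * L + (r1 + r2 + r3 - r4)\<bar> \<le> 10 + 4 * K"
      if "0 \<le> x" "x \<le> 1" "0 \<le> P" "P \<le> 2" "\<bar>a\<bar> \<le> 1" "\<bar>b\<bar> \<le> 1" "\<bar>c\<bar> \<le> 1" "0 \<le> L" "L \<le> 2"
        "\<bar>r1\<bar> \<le> K" "\<bar>r2\<bar> \<le> K" "\<bar>r3\<bar> \<le> K" "\<bar>r4\<bar> \<le> K" for x P a b c L r1 r2 r3 r4
    proof -
      have "\<bar>r1 + r2 + r3 - r4\<bar> \<le> 4 * K" using that(10-13) by linarith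
      moreover have "\<bar>a + b + c\<bar> \<le> 3" using that(5-7) by linarith
      then have "\<bar>3/5 * (a + b + c)\<bar> \<le> 2" by (subst abs_mult) simp
      moreover have "\<bar>x + P - 3/5 * L\<bar> \<le> 8" using that(1-4,8,9) by linarith
      ultimately show ?thesis by linarith
    qed
    then show ?thesis
      unfolding block_toll_alt[OF n0] x1_def[symmetric] x2_def[symmetric] x3_def[symmetric]
      by this (fact x(1) x'(1) prod lp xlnx_bound[OF x(1) x'(1)] xlnx_bound[OF x(2) x'(2)] xlnx_bound[OF x(3) x'(3)]
        rest[OF x(1) x'(1), of i1] rest[OF x(2) x'(2), of i2] rest[OF x(3) x'(3), of i3] K(2)[of n])+
  qed
  then show thesis using K by (intro that[of "10 + 4 * K"]) auto
qed

text \<open>The unknown limit \<open>c\<close> of the mean remainder enters with total weight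
  \<open>gap1 z + gap2 z + gap3 z - 1 = 0\<close>. The limit is therefore free of \<open>c\<close>
  and does not depend on the threshold \<open>M\<close>.\<close>

lemma block_toll_tendsto:
  assumes M: "0 < M" and z: "0 < fst z" "fst z < 1" "0 < snd z" "snd z < 1" "fst z \<noteq> snd z"
  shows "(\<lambda>n. block_toll M n (cblock1 n z) (cblock2 n z) (cblock3 n z)) \<longlonglongrightarrow>
    toll_limit (gap1 z) (gap2 z) (gap3 z)"
proof -
  obtain c where c: "(mean_remainder M) \<longlonglongrightarrow> c"
    unfolding mean_remainder_def[abs_def] using mean_swaps_asymptotics[OF M] by blast
  note x = cblocks_over_n_tendsto[OF z(1-4)]
  note top = cblocks_at_top[OF z]
  have rem: "(\<lambda>n. mean_remainder M (cblock1 n z)) \<longlonglongrightarrow> c" "(\<lambda>n. mean_remainder M (cblock2 n z)) \<longlonglongrightarrow> c"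
    "(\<lambda>n. mean_remainder M (cblock3 n z)) \<longlonglongrightarrow> c"
    by (rule filterlim_compose[OF c] top)+
  have xl: "(\<lambda>n. xlnx (f n)) \<longlonglongrightarrow> xlnx l" if "f \<longlonglongrightarrow> l" "0 < l" for f l
    using isCont_tendsto_compose[of l xlnx f] that DERIV_isCont[OF xlnx_deriv[of l]] by auto
  have g: "0 < gap1 z" "0 < gap2 z" "0 < gap3 z" using z by auto
  have fac: "(\<lambda>n. real n / (real n - 2)) \<longlonglongrightarrow> 1" by real_asymp
  have lnn: "(\<lambda>n. (real n - real (cblock1 n z) - real (cblock2 n z) - real (cblock3 n z)) * (ln (real n) / real n)) \<longlonglongrightarrow> 0"
  proof (rule tendsto_0_le[where K = 2])
    show "(\<lambda>n. ln (real n) / real n) \<longlonglongrightarrow> 0" by real_asymp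
    show "\<forall>\<^sub>F n in sequentially. norm ((real n - real (cblock1 n z) - real (cblock2 n z) - real (cblock3 n z)) * (ln (real n) / real n))
        \<le> norm (ln (real n) / real n) * 2"
      using eventually_gt_at_top[of 0]
    proof eventually_elim
      case (elim n)
      have "real (cblock1 n z + cblock2 n z + cblock3 n z) \<le> real n"
        "real n \<le> real (cblock1 n z + cblock2 n z + cblock3 n z + 2)"
        using cblocks_sum[OF elim z(1-4)] by (simp_all only: of_nat_le_iff)
      then have "\<bar>real n - real (cblock1 n z) - real (cblock2 n z) - real (cblock3 n z)\<bar> \<le> 2" by simp
      then show ?case unfolding real_norm_def abs_mult by (subst mult.commute) (rule mult_left_mono, auto)
    qed
  qed
  have "(\<lambda>n. real (cblock1 n z) / real n + (real (cblock1 n z) / real n + real (cblock2 n z) / real n) *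
        (real (cblock3 n z) / real n) * (real n / (real n - 2))
    + 3/5 * (xlnx (real (cblock1 n z) / real n) + xlnx (real (cblock2 n z) / real n) + xlnx (real (cblock3 n z) / real n))
    - 3/5 * ((real n - real (cblock1 n z) - real (cblock2 n z) - real (cblock3 n z)) * (ln (real n) / real n))
    + (real (cblock1 n z) / real n * mean_remainder M (cblock1 n z) + real (cblock2 n z) / real n * mean_remainder M (cblock2 n z)
       + real (cblock3 n z) / real n * mean_remainder M (cblock3 n z) - mean_remainder M n)) \<longlonglongrightarrow>
    gap1 z + (gap1 z + gap2 z) * gap3 z * 1 + 3/5 * (xlnx (gap1 z) + xlnx (gap2 z) + xlnx (gap3 z)) - 3/5 * 0
    + (gap1 z * c + gap2 z * c + gap3 z * c - c)"
    by (intro tendsto_add tendsto_diff tendsto_mult tendsto_const x rem xl g fac lnn c)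
  also have "gap1 z + (gap1 z + gap2 z) * gap3 z * 1 + 3/5 * (xlnx (gap1 z) + xlnx (gap2 z) + xlnx (gap3 z)) - 3/5 * 0
    + (gap1 z * c + gap2 z * c + gap3 z * c - c) = toll_limit (gap1 z) (gap2 z) (gap3 z)"
    by (simp add: toll_limit_def algebra_simps)
  finally show ?thesis
    by (rule Lim_transform_eventually) (use eventually_gt_at_top[of 0] in eventually_elim, simp add: block_toll_alt)
qed

section \<open>Convergence of the variance\<close>

lemma pavg_blocks_eq_integral:
  fixes h :: "nat \<Rightarrow> nat \<Rightarrow> nat \<Rightarrow> 'b::{banach, second_countable_topology}"
  assumes n: "2 \<le> n"
  shows "pavg n (\<lambda>\<pi>. h (block1 n \<pi>) (block2 n \<pi>) (block3 n \<pi>)) =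
    (real n / (real n - 1)) *\<^sub>R (LINT z|unif2. of_bool (cell n (fst z) \<noteq> cell n (snd z)) *\<^sub>R
      h (cblock1 n z) (cblock2 n z) (cblock3 n z))"
  unfolding pivot_lo_def pivot_hi_def cblock1_def cblock2_def cblock3_def
  by (rule pavg_eq_integral_cells[OF n, where g = "\<lambda>a b. h (nat (min a b - 1)) (nat (max a b - min a b - 1)) (nat (int n - max a b))"])

lemma integrable_of_cblocks:
  fixes h :: "nat \<Rightarrow> nat \<Rightarrow> nat \<Rightarrow> 'b::{banach, second_countable_topology}"
  assumes n: "0 < n"
  shows "integrable unif2 (\<lambda>z. of_bool (cell n (fst z) \<noteq> cell n (snd z)) *\<^sub>R h (cblock1 n z) (cblock2 n z) (cblock3 n z))"
    "integrable unif2 (\<lambda>z. h (cblock1 n z) (cblock2 n z) (cblock3 n z))"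
  unfolding cblock1_def cblock2_def cblock3_def
  using integral_cells(1)[OF n, where g = "\<lambda>a b. of_bool (a \<noteq> b) *\<^sub>R h (nat (min a b - 1)) (nat (max a b - min a b - 1)) (nat (int n - max a b))"]
    integral_cells(1)[OF n, where g = "\<lambda>a b. h (nat (min a b - 1)) (nat (max a b - min a b - 1)) (nat (int n - max a b))"]
  by simp_all

lemma cells_eventually_distinct:
  assumes "u \<noteq> v"
  shows "\<forall>\<^sub>F n in sequentially. cell n u \<noteq> cell n v"
proof -
  have "(\<lambda>n. real_of_int (cell n u) / real n - real_of_int (cell n v) / real n) \<longlonglongrightarrow> u - v"
    by (intro tendsto_diff cell_over_n_tendsto)
  then have "\<forall>\<^sub>F n in sequentially. real_of_int (cell n u) / real n - real_of_int (cell n v) / real n \<noteq> 0"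
    using assms by (intro tendsto_imp_eventually_ne) auto
  then show ?thesis by eventually_elim auto
qed

text \<open>Dominated convergence on the coupled space, applied from index 4 on because the bound
  starts there. Conditioning on distinct cells is harmless: the normalising factor tends to 1, and
  off the diagonal the two cells are eventually distinct.\<close>

lemma pavg_blocks_tendsto:
  fixes h :: "nat \<Rightarrow> nat \<Rightarrow> nat \<Rightarrow> nat \<Rightarrow> real"
  assumes lim: "\<And>z. 0 < fst z \<Longrightarrow> fst z < 1 \<Longrightarrow> 0 < snd z \<Longrightarrow> snd z < 1 \<Longrightarrow> fst z \<noteq> snd z \<Longrightarrow>
      (\<lambda>n. h n (cblock1 n z) (cblock2 n z) (cblock3 n z)) \<longlonglongrightarrow> l z"
    and bound: "\<And>n i1 i2 i3. 4 \<le> n \<Longrightarrow> i1 + i2 + i3 \<le> n \<Longrightarrow> n \<le> i1 + i2 + i3 + 2 \<Longrightarrow> \<bar>h n i1 i2 i3\<bar> \<le> C"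
    and meas: "l \<in> borel_measurable unif2"
  shows "(\<lambda>n. pavg n (\<lambda>\<pi>. h n (block1 n \<pi>) (block2 n \<pi>) (block3 n \<pi>))) \<longlonglongrightarrow> (LINT z|unif2. l z)"
    and "(\<lambda>n. LINT z|unif2. h n (cblock1 n z) (cblock2 n z) (cblock3 n z)) \<longlonglongrightarrow> (LINT z|unif2. l z)"
proof -
  have C: "0 \<le> C" using bound[of 4 4 0 0] by simp
  let ?f = "\<lambda>n z. h n (cblock1 n z) (cblock2 n z) (cblock3 n z)"
  let ?g = "\<lambda>n z. of_bool (cell n (fst z) \<noteq> cell n (snd z)) *\<^sub>R ?f n z"
  have AE_bound: "AE z in unif2. \<bar>?f (n + 4) z\<bar> \<le> C" for n
    using AE_unif_pair
  proof eventually_elim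
    case (elim z)
    show ?case using cblocks_sum[of "n + 4" z] elim by (intro bound) auto
  qed
  have 1: "(\<lambda>n. LINT z|unif2. ?f (n + 4) z) \<longlonglongrightarrow> (LINT z|unif2. l z)"
  proof (rule integral_dominated_convergence[where w = "\<lambda>_. C"])
    show "AE z in unif2. (\<lambda>n. ?f (n + 4) z) \<longlonglongrightarrow> l z"
      using AE_unif_pair
    proof eventually_elim
      case (elim z)
      then have "(\<lambda>n. ?f n z) \<longlonglongrightarrow> l z" using lim by blast
      then show ?case by (rule LIMSEQ_ignore_initial_segment[where k = 4])
    qed
    show "?f (n + 4) \<in> borel_measurable unif2" for n
      using integrable_of_cblocks(2)[of "n + 4" "h (n + 4)"] by auto
  qed (use meas AE_bound in auto)
  then show "(\<lambda>n. LINT z|unif2. ?f n z) \<longlonglongrightarrow> (LINT z|unif2. l z)"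
    by (rule LIMSEQ_offset[where k = 4 and f = "\<lambda>n. LINT z|unif2. ?f n z"])
  have "(\<lambda>n. LINT z|unif2. ?g (n + 4) z) \<longlonglongrightarrow> (LINT z|unif2. l z)"
  proof (rule integral_dominated_convergence[where w = "\<lambda>_. C"])
    show "AE z in unif2. (\<lambda>n. ?g (n + 4) z) \<longlonglongrightarrow> l z"
      using AE_unif_pair
    proof eventually_elim
      case (elim z)
      have "(\<lambda>n. ?f n z) \<longlonglongrightarrow> l z" using lim elim by auto
      moreover have "\<forall>\<^sub>F n in sequentially. ?f n z = ?g n z"
        using cells_eventually_distinct[of "fst z" "snd z"] elim by (auto elim!: eventually_mono)
      ultimately have "(\<lambda>n. ?g n z) \<longlonglongrightarrow> l z" by (rule Lim_transform_eventually)
      then show ?case by (rule LIMSEQ_ignore_initial_segment[where k = 4])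
    qed
    show "?g (n + 4) \<in> borel_measurable unif2" for n
      using integrable_of_cblocks(1)[of "n + 4" "h (n + 4)"] by auto
    show "AE z in unif2. norm (?g (n + 4) z) \<le> C" for n
      using AE_bound[of n] by eventually_elim (use C in auto)
  qed (use meas in auto)
  then have "(\<lambda>n. LINT z|unif2. ?g n z) \<longlonglongrightarrow> (LINT z|unif2. l z)"
    by (rule LIMSEQ_offset[where k = 4 and f = "\<lambda>n. LINT z|unif2. ?g n z"])
  moreover have "(\<lambda>n. real n / (real n - 1)) \<longlonglongrightarrow> 1" by real_asymp
  ultimately have "(\<lambda>n. (real n / (real n - 1)) *\<^sub>R (LINT z|unif2. ?g n z)) \<longlonglongrightarrow> 1 *\<^sub>R (LINT z|unif2. l z)"
    by (intro tendsto_scaleR)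
  then have lim: "(\<lambda>n. (real n / (real n - 1)) *\<^sub>R (LINT z|unif2. ?g n z)) \<longlonglongrightarrow> (LINT z|unif2. l z)"
    by simp
  show "(\<lambda>n. pavg n (\<lambda>\<pi>. h n (block1 n \<pi>) (block2 n \<pi>) (block3 n \<pi>))) \<longlonglongrightarrow> (LINT z|unif2. l z)"
    by (rule Lim_transform_eventually[OF lim])
      (use eventually_ge_at_top[of 2] in eventually_elim, simp add: pavg_blocks_eq_integral)
qed

section \<open>The toll of the exact recurrence\<close>

definition part_toll :: "nat \<Rightarrow> nat \<Rightarrow> (int \<Rightarrow> int) \<Rightarrow> real" where
  "part_toll M n \<pi> = (real (part_swaps n \<pi>) + mean_swaps M (block1 n \<pi>) + mean_swaps M (block2 n \<pi>)
     + mean_swaps M (block3 n \<pi>) - mean_swaps M n) / real n"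

lemma part_toll_diff:
  assumes n: "3 \<le> n" and \<pi>: "\<pi> permutes {1..int n}"
  shows "part_toll M n \<pi> - block_toll M n (block1 n \<pi>) (block2 n \<pi>) (block3 n \<pi>) =
    (real (part_swaps n \<pi>) - toll_approx n \<pi>) / real n"
proof -
  have "2 \<le> n" using n by simp
  note b = pivot_bounds[OF \<pi> this]
  have "real (block1 n \<pi>) + real (block2 n \<pi>) = real_of_int (pivot_hi n \<pi> - 2)"
    "real (block3 n \<pi>) = real_of_int (int n - pivot_hi n \<pi>)" "real (block1 n \<pi>) = real_of_int (pivot_lo n \<pi> - 1)"
    using b by auto
  then show ?thesis
    unfolding part_toll_def block_toll_def toll_approx_def by (simp add: diff_divide_distrib add_divide_distrib)
qed

lemma part_toll_error:
  fixes M :: nat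
  assumes n: "3 \<le> n"
  defines "\<Delta> \<equiv> \<lambda>\<pi>. part_toll M n \<pi> - block_toll M n (block1 n \<pi>) (block2 n \<pi>) (block3 n \<pi>)"
  shows "pavg n (\<lambda>\<pi>. (\<Delta> \<pi>)\<^sup>2) \<le> 8 / real n" "pavg n (\<lambda>\<pi>. \<bar>\<Delta> \<pi>\<bar>) \<le> sqrt (8 / real n)"
proof -
  have "pavg n (\<lambda>\<pi>. (\<Delta> \<pi>)\<^sup>2) = pavg n (\<lambda>\<pi>. (real (part_swaps n \<pi>) - toll_approx n \<pi>)\<^sup>2 / (real n)\<^sup>2)"
    by (rule pavg_cong) (simp add: \<Delta>_def part_toll_diff[OF n] power_divide)
  also have "\<dots> = pavg n (\<lambda>\<pi>. (real (part_swaps n \<pi>) - toll_approx n \<pi>)\<^sup>2) / (real n)\<^sup>2" by simp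
  also have "\<dots> \<le> (18 + 2 * real n) / (real n)\<^sup>2" by (intro divide_right_mono part_swaps_approx n) simp
  also have "\<dots> \<le> (8 * real n) / (real n)\<^sup>2" using n by (intro divide_right_mono) auto
  also have "\<dots> = 8 / real n" by (simp add: power2_eq_square)
  finally show 1: "pavg n (\<lambda>\<pi>. (\<Delta> \<pi>)\<^sup>2) \<le> 8 / real n" .
  show "pavg n (\<lambda>\<pi>. \<bar>\<Delta> \<pi>\<bar>) \<le> sqrt (8 / real n)"
    using pavg_abs_square_le[of n \<Delta>] 1 by (intro real_le_rsqrt) linarith
qed

lemma blocks_sum:
  assumes "2 \<le> n" "\<pi> permutes {1..int n}"
  shows "block1 n \<pi> + block2 n \<pi> + block3 n \<pi> + 2 = n"
  using pivot_bounds[OF assms(2,1)] by simp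

lemma measurable_toll_limit [measurable]:
  assumes [measurable]: "f \<in> borel_measurable N" "g \<in> borel_measurable N" "h \<in> borel_measurable N"
  shows "(\<lambda>z. toll_limit (f z) (g z) (h z)) \<in> borel_measurable N"
  unfolding toll_limit_def by measurable

text \<open>The exact toll differs from its block version by some \<open>\<Delta>\<close> whose
  second moment is \<open>O(1 / n)\<close>. Since the block version \<open>b\<close> is bounded, the
  difference of squares \<open>\<Delta>\<^sup>2 + 2 * b * \<Delta>\<close> is small in mean.\<close>

lemma part_toll_second_moment_tendsto:
  assumes M: "0 < M"
  shows "(\<lambda>n. pavg n (\<lambda>\<pi>. (part_toll M n \<pi>)\<^sup>2)) \<longlonglongrightarrow> 7/20 - 3/100 * pi\<^sup>2"
proof -
  obtain C where C: "0 \<le> C" "\<And>n i1 i2 i3. 4 \<le> n \<Longrightarrow> i1 + i2 + i3 \<le> n \<Longrightarrow> n \<le> i1 + i2 + i3 + 2 \<Longrightarrow>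
    \<bar>block_toll M n i1 i2 i3\<bar> \<le> C" using block_toll_bounded[OF M] by blast
  let ?b = "\<lambda>n \<pi>. block_toll M n (block1 n \<pi>) (block2 n \<pi>) (block3 n \<pi>)"
  let ?\<Delta> = "\<lambda>n \<pi>. part_toll M n \<pi> - ?b n \<pi>"
  have "(\<lambda>n. pavg n (\<lambda>\<pi>. (?b n \<pi>)\<^sup>2)) \<longlonglongrightarrow> (LINT z|unif2. (toll_limit (gap1 z) (gap2 z) (gap3 z))\<^sup>2)"
  proof (rule pavg_blocks_tendsto(1)[where h = "\<lambda>n i1 i2 i3. (block_toll M n i1 i2 i3)\<^sup>2"])
    fix n i1 i2 i3 :: nat assume "4 \<le> n" "i1 + i2 + i3 \<le> n" "n \<le> i1 + i2 + i3 + 2"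
    from C(2)[OF this] show "\<bar>(block_toll M n i1 i2 i3)\<^sup>2\<bar> \<le> C\<^sup>2"
      using power_mono[of "\<bar>block_toll M n i1 i2 i3\<bar>" C 2] by simp
  qed (auto intro!: tendsto_power block_toll_tendsto[OF M])
  then have lim: "(\<lambda>n. pavg n (\<lambda>\<pi>. (?b n \<pi>)\<^sup>2)) \<longlonglongrightarrow> 7/20 - 3/100 * pi\<^sup>2"
    by (simp add: toll_limit_second_moment)
  have "(\<lambda>n. pavg n (\<lambda>\<pi>. (part_toll M n \<pi>)\<^sup>2) - pavg n (\<lambda>\<pi>. (?b n \<pi>)\<^sup>2)) \<longlonglongrightarrow> 0"
  proof (rule Lim_null_comparison)
    show "\<forall>\<^sub>F n in sequentially. norm (pavg n (\<lambda>\<pi>. (part_toll M n \<pi>)\<^sup>2) - pavg n (\<lambda>\<pi>. (?b n \<pi>)\<^sup>2))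
        \<le> 8 / real n + 2 * C * sqrt (8 / real n)"
      using eventually_ge_at_top[of 4]
    proof eventually_elim
      case (elim n)
      have n3: "3 \<le> n" using elim by simp
      have "norm (pavg n (\<lambda>\<pi>. (part_toll M n \<pi>)\<^sup>2) - pavg n (\<lambda>\<pi>. (?b n \<pi>)\<^sup>2)) =
          \<bar>pavg n (\<lambda>\<pi>. (part_toll M n \<pi>)\<^sup>2 - (?b n \<pi>)\<^sup>2)\<bar>"
        by (simp only: pavg_diff real_norm_def)
      also have "\<dots> \<le> pavg n (\<lambda>\<pi>. \<bar>(part_toll M n \<pi>)\<^sup>2 - (?b n \<pi>)\<^sup>2\<bar>)" by (rule pavg_abs_le)
      also have "\<dots> \<le> pavg n (\<lambda>\<pi>. (?\<Delta> n \<pi>)\<^sup>2 + 2 * C * \<bar>?\<Delta> n \<pi>\<bar>)"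
      proof (rule pavg_mono)
        fix \<pi> assume \<pi>: "\<pi> permutes {1..int n}"
        have b: "\<bar>?b n \<pi>\<bar> \<le> C" using blocks_sum[OF _ \<pi>] elim by (intro C) auto
        have "(part_toll M n \<pi>)\<^sup>2 - (?b n \<pi>)\<^sup>2 = (?\<Delta> n \<pi>)\<^sup>2 + 2 * ?b n \<pi> * ?\<Delta> n \<pi>"
          by (simp add: power2_eq_square algebra_simps)
        moreover have "\<bar>2 * ?b n \<pi> * ?\<Delta> n \<pi>\<bar> \<le> 2 * C * \<bar>?\<Delta> n \<pi>\<bar>"
          unfolding abs_mult using b by (intro mult_right_mono) auto
        ultimately show "\<bar>(part_toll M n \<pi>)\<^sup>2 - (?b n \<pi>)\<^sup>2\<bar> \<le> (?\<Delta> n \<pi>)\<^sup>2 + 2 * C * \<bar>?\<Delta> n \<pi>\<bar>"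
          using abs_triangle_ineq[of "(?\<Delta> n \<pi>)\<^sup>2" "2 * ?b n \<pi> * ?\<Delta> n \<pi>"] by simp
      qed
      also have "\<dots> = pavg n (\<lambda>\<pi>. (?\<Delta> n \<pi>)\<^sup>2) + 2 * C * pavg n (\<lambda>\<pi>. \<bar>?\<Delta> n \<pi>\<bar>)"
        by (simp only: pavg_add integral_mult_right_zero)
      also have "\<dots> \<le> 8 / real n + 2 * C * sqrt (8 / real n)"
        using part_toll_error[OF n3, of M] C(1) by (intro add_mono mult_left_mono) auto
      finally show ?case .
    qed
    have "(\<lambda>n. 8 / real n) \<longlonglongrightarrow> 0" "(\<lambda>n. sqrt (8 / real n)) \<longlonglongrightarrow> 0" by real_asymp+
    then have "(\<lambda>n. 8 / real n + 2 * C * sqrt (8 / real n)) \<longlonglongrightarrow> 0 + 2 * C * 0"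
      by (intro tendsto_add tendsto_mult tendsto_const)
    then show "(\<lambda>n. 8 / real n + 2 * C * sqrt (8 / real n)) \<longlonglongrightarrow> 0" by simp
  qed
  from tendsto_add[OF this lim] show ?thesis by simp
qed

section \<open>The centred and scaled count, and its variance\<close>

definition Zn :: "nat \<Rightarrow> nat \<Rightarrow> (int \<Rightarrow> int) \<Rightarrow> real" where
  "Zn M n \<pi> = (swap_count M n \<pi> - mean_swaps M n) / real n"

definition Zvar :: "nat \<Rightarrow> nat \<Rightarrow> real" where "Zvar M n = pavg n (\<lambda>\<pi>. (Zn M n \<pi>)\<^sup>2)"

lemma swap_count_eq_Zn: "swap_count M n \<pi> = mean_swaps M n + real n * Zn M n \<pi>"
  by (cases "n = 0") (simp_all add: Zn_def swap_count_below_threshold)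

lemma pavg_Zn: "pavg n (Zn M n) = 0"
proof -
  have "pavg n (Zn M n) = (pavg n (swap_count M n) - mean_swaps M n) / real n"
    unfolding Zn_def[abs_def] by (simp add: pavg_diff)
  then show ?thesis by (simp add: mean_swaps_def)
qed

lemma pavg_affine_square: "pavg n (\<lambda>\<pi>. (x + y * Zn M n \<pi>)\<^sup>2) = x\<^sup>2 + y\<^sup>2 * Zvar M n"
proof -
  have "pavg n (\<lambda>\<pi>. (x + y * Zn M n \<pi>)\<^sup>2) = pavg n (\<lambda>\<pi>. (x\<^sup>2 + 2 * x * y * Zn M n \<pi>) + y\<^sup>2 * (Zn M n \<pi>)\<^sup>2)"
    by (simp add: power2_eq_square algebra_simps)
  also have "\<dots> = x\<^sup>2 + 2 * x * y * pavg n (Zn M n) + y\<^sup>2 * Zvar M n"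
    unfolding pavg_add Zvar_def by simp
  finally show ?thesis by (simp add: pavg_Zn)
qed

lemma Zn_recurrence:
  fixes F :: "real \<Rightarrow> 'b::{banach, second_countable_topology}"
  assumes M: "0 < M" and n: "M < n"
  shows "pavg n (\<lambda>\<pi>. F (Zn M n \<pi>)) = pavg n (\<lambda>\<pi>. pavg (block1 n \<pi>) (\<lambda>\<alpha>. pavg (block2 n \<pi>) (\<lambda>\<beta>.
    pavg (block3 n \<pi>) (\<lambda>\<gamma>. F (part_toll M n \<pi> + real (block1 n \<pi>) / real n * Zn M (block1 n \<pi>) \<alpha>
      + real (block2 n \<pi>) / real n * Zn M (block2 n \<pi>) \<beta> + real (block3 n \<pi>) / real n * Zn M (block3 n \<pi>) \<gamma>)))))"
proof -
  have eq: "(t + (m1 + x1 * z1) + (m2 + x2 * z2) + (m3 + x3 * z3) - m) / N =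
    (t + m1 + m2 + m3 - m) / N + x1 / N * z1 + x2 / N * z2 + x3 / N * z3" for t m1 m2 m3 x1 x2 x3 z1 z2 z3 m N :: real
    by (simp add: add_divide_distrib diff_divide_distrib)
  have "pavg n (\<lambda>\<pi>. F (Zn M n \<pi>)) = pavg n (\<lambda>\<pi>. F ((swap_count M n \<pi> - mean_swaps M n) / real n))"
    by (simp only: Zn_def)
  also have "\<dots> = pavg n (\<lambda>\<pi>. pavg (block1 n \<pi>) (\<lambda>\<alpha>. pavg (block2 n \<pi>) (\<lambda>\<beta>. pavg (block3 n \<pi>) (\<lambda>\<gamma>.
      F ((real (part_swaps n \<pi>) + swap_count M (block1 n \<pi>) \<alpha> + swap_count M (block2 n \<pi>) \<beta>
         + swap_count M (block3 n \<pi>) \<gamma> - mean_swaps M n) / real n)))))"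
    by (rule swap_count_recurrence[OF M n])
  finally show ?thesis unfolding swap_count_eq_Zn eq part_toll_def .
qed

text \<open>Expanding the square leaves no cross terms: given the partition, the three centred
  counts are independent, so each inner average removes the mixed products with its own
  count.\<close>

lemma Zvar_recurrence:
  assumes M: "0 < M" and n: "M < n"
  shows "Zvar M n = pavg n (\<lambda>\<pi>. (part_toll M n \<pi>)\<^sup>2) +
    6 / (real n * (real n - 1)) * (\<Sum>k<n. (real n - 1 - real k) * ((real k / real n)\<^sup>2 * Zvar M k))"
proof -
  have n2: "2 \<le> n" using M n by simp
  have a1: "pavg k (\<lambda>\<pi>. (x + y * Zn M k \<pi> + u + v)\<^sup>2) = (x + u + v)\<^sup>2 + y\<^sup>2 * Zvar M k" for x y u v k
    using pavg_affine_square[of k "x + u + v" y M] by (simp add: algebra_simps)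
  have a2: "pavg k (\<lambda>\<pi>. (x + y * Zn M k \<pi> + u)\<^sup>2) = (x + u)\<^sup>2 + y\<^sup>2 * Zvar M k" for x y u k
    using a1[of k x y u 0] by simp
  have "Zvar M n = pavg n (\<lambda>\<pi>. pavg (block1 n \<pi>) (\<lambda>\<alpha>. pavg (block2 n \<pi>) (\<lambda>\<beta>.
    pavg (block3 n \<pi>) (\<lambda>\<gamma>. (part_toll M n \<pi> + real (block1 n \<pi>) / real n * Zn M (block1 n \<pi>) \<alpha>
      + real (block2 n \<pi>) / real n * Zn M (block2 n \<pi>) \<beta> + real (block3 n \<pi>) / real n * Zn M (block3 n \<pi>) \<gamma>)\<^sup>2))))"
    unfolding Zvar_def by (rule Zn_recurrence[OF M n])
  also have "\<dots> = pavg n (\<lambda>\<pi>. (part_toll M n \<pi>)\<^sup>2 + (real (block1 n \<pi>) / real n)\<^sup>2 * Zvar M (block1 n \<pi>)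
      + (real (block2 n \<pi>) / real n)\<^sup>2 * Zvar M (block2 n \<pi>) + (real (block3 n \<pi>) / real n)\<^sup>2 * Zvar M (block3 n \<pi>))"
    by (simp only: pavg_affine_square pavg_add pavg_const)
  also have "\<dots> = pavg n (\<lambda>\<pi>. (part_toll M n \<pi>)\<^sup>2) + 3 * (2 / (real n * (real n - 1)) *
      (\<Sum>k<n. (real n - 1 - real k) * ((real k / real n)\<^sup>2 * Zvar M k)))"
    unfolding pavg_add pavg_of_block[OF n2, of "\<lambda>k. (real k / real n)\<^sup>2 * Zvar M k"] by simp
  finally show ?thesis by simp
qed

text \<open>The total weight \<open>6 / (n (n - 1)) \<Sum>k<n. (n - 1 - k) (k / n)\<^sup>2\<close> tends to \<open>1/2\<close>.\<close>

lemma contraction_recurrence_tendsto: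
  fixes x a :: "nat \<Rightarrow> real"
  assumes rec: "\<And>n. N \<le> n \<Longrightarrow> x n = a n + 6 / (real n * (real n - 1)) * (\<Sum>k<n. (real n - 1 - real k) * ((real k / real n)\<^sup>2 * x k))"
    and a: "a \<longlonglongrightarrow> A"
  shows "x \<longlonglongrightarrow> 2 * A"
proof -
  define w where "w n k = 6 / (real n * (real n - 1)) * ((real n - 1 - real k) * (real k / real n)\<^sup>2)" for n k :: nat
  \<comment> \<open>As the total weight tends to 1/2, the limit has to satisfy
    \<open>x = A + x / 2\<close>; \<open>y\<close> is the deviation from that value, and
    \<open>e\<close> collects the deviations of the toll and of the total weight from their
    limits.\<close>
  define y where "y n = x n - 2 * A" for n
  define e where "e n = a n - A + 2 * A * ((\<Sum>k<n. w n k) - 1/2)" for n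
  have w_nonneg: "0 \<le> w n k" if "2 \<le> n" "k < n" for n k
    using that by (auto simp: w_def intro!: mult_nonneg_nonneg divide_nonneg_nonneg)
  have w_sum: "(\<Sum>k<n. w n k) = (real n - 1) * (real n - 2) / (2 * (real n)\<^sup>2)" if "2 \<le> n" for n
  proof -
    define s where "s = real n"
    have s: "2 \<le> s" using that by (simp add: s_def)
    have "(\<Sum>k<n. w n k) = 6 / (s * (s - 1)) / s\<^sup>2 * (\<Sum>k<n. (real n - 1 - real k) * (real k)\<^sup>2)"
      by (simp add: w_def sum_distrib_left power_divide s_def mult.assoc)
    also have "\<dots> = 6 / (s * (s - 1)) / s\<^sup>2 * (s * (s - 1)\<^sup>2 * (s - 2) / 12)"
      by (simp add: weighted_sum_eq_double_sum double_sum_square s_def)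
    also have "\<dots> = (s - 1) * (s - 2) / (2 * s\<^sup>2)" using s by (simp add: field_simps power2_eq_square)
    finally show ?thesis by (simp add: s_def)
  qed
  have w_le: "(\<Sum>k<n. w n k) \<le> 1/2" if "2 \<le> n" for n
    using that unfolding w_sum[OF that] by (simp add: divide_simps power2_eq_square) (simp add: algebra_simps)
  \<comment> \<open>For fixed \<open>k\<close> the weight is \<open>O(1 / n\<^sup>2)\<close>, so any
    finite initial segment of the history loses its influence.\<close>
  have w_small: "w n k \<le> 6 * (real k)\<^sup>2 / (real n)\<^sup>2" if "2 \<le> n" "k < n" for n k
  proof -
    have "(real n - 1 - real k) / (real n * (real n - 1)) \<le> 1"
    proof -
      have "real n - 1 \<le> real n * (real n - 1)" using that by (simp add: mult_le_cancel_right1)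
      then have "real n - 1 - real k \<le> real n * (real n - 1)" by linarith
      then show ?thesis using that by (simp add: divide_le_eq)
    qed
    then have "6 * (real k / real n)\<^sup>2 * ((real n - 1 - real k) / (real n * (real n - 1))) \<le> 6 * (real k / real n)\<^sup>2 * 1"
      by (intro mult_left_mono) auto
    moreover have "w n k = 6 * (real k / real n)\<^sup>2 * ((real n - 1 - real k) / (real n * (real n - 1)))"
      by (simp add: w_def)
    ultimately show ?thesis by (simp add: power_divide)
  qed
  have w_lim: "(\<lambda>n. (\<Sum>k<n. w n k) - 1/2) \<longlonglongrightarrow> 0"
  proof -
    have "(\<lambda>n. (real n - 1) * (real n - 2) / (2 * (real n)\<^sup>2) - 1/2) \<longlonglongrightarrow> 0" by real_asymp
    then show ?thesis
      by (rule Lim_transform_eventually) (use eventually_ge_at_top[of 2] in eventually_elim, simp add: w_sum)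
  qed
  have e_lim: "e \<longlonglongrightarrow> 0"
  proof -
    have "e \<longlonglongrightarrow> A - A + 2 * A * 0"
      unfolding e_def[abs_def] by (intro tendsto_add tendsto_diff tendsto_mult tendsto_const a w_lim)
    then show ?thesis by simp
  qed
  have y_rec: "y n = e n + (\<Sum>k<n. w n k * y k)" if "N \<le> n" for n
  proof -
    have "(\<Sum>k<n. w n k * y k) = (\<Sum>k<n. w n k * x k) - 2 * A * (\<Sum>k<n. w n k)"
      by (simp add: y_def right_diff_distrib sum_subtractf sum_distrib_left mult_ac)
    moreover have "x n = a n + (\<Sum>k<n. w n k * x k)"
      unfolding rec[OF that] w_def by (simp add: sum_distrib_left mult_ac)
    ultimately show ?thesis by (simp add: e_def y_def algebra_simps)
  qed
  define N' where "N' = max N 2"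
  have "Bseq e" using e_lim by (intro convergent_imp_Bseq convergentI)
  then obtain E where E: "\<And>n. \<bar>e n\<bar> \<le> E" by (auto simp: Bseq_def)
  \<comment> \<open>The bound propagates because \<open>E + B / 2 \<le> B\<close>; the second entry
    of the maximum covers the indices before the recurrence applies.\<close>
  define B where "B = max (2 * E) (\<Sum>k<N'. \<bar>y k\<bar>)"
  have B: "\<bar>y n\<bar> \<le> B" for n
  proof (induction n rule: less_induct)
    case (less n)
    show ?case
    proof (cases "n < N'")
      case True
      then have "\<bar>y n\<bar> \<le> (\<Sum>k<N'. \<bar>y k\<bar>)" by (intro member_le_sum) auto
      then show ?thesis by (simp add: B_def)
    next
      case False
      then have n: "N \<le> n" "2 \<le> n" by (auto simp: N'_def)
      have B0: "0 \<le> B" using E[of 0] by (auto simp: B_def)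
      have "\<bar>\<Sum>k<n. w n k * y k\<bar> \<le> (\<Sum>k<n. \<bar>w n k * y k\<bar>)" by (rule sum_abs)
      also have "\<dots> \<le> (\<Sum>k<n. w n k * B)"
        using less w_nonneg[OF n(2)] by (intro sum_mono) (auto simp: abs_mult intro!: mult_mono)
      also have "\<dots> = B * (\<Sum>k<n. w n k)" by (simp add: sum_distrib_left mult.commute)
      also have "\<dots> \<le> B * (1/2)" using w_le[OF n(2)] B0 by (rule mult_left_mono)
      finally have "\<bar>y n\<bar> \<le> E + B / 2" using y_rec[OF n(1)] E[of n] by simp
      moreover have "E \<le> B / 2" by (simp add: B_def)
      ultimately show ?thesis by linarith
    qed
  qed
  have B0: "0 \<le> B" using B[of 0] by linarith
  \<comment> \<open>Each round halves the asymptotic bound: beyond some \<open>K\<close> the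
    previous bound enters with total weight at most 1/2, and the indices below \<open>K\<close>
    contribute a vanishing amount.\<close>
  have step: "\<forall>\<eta>>0. \<forall>\<^sub>F n in sequentially. \<bar>y n\<bar> \<le> B / 2 ^ m + \<eta>" for m
  proof (induction m)
    case 0
    then show ?case using B by (auto intro!: always_eventually simp: add_increasing2)
  next
    case (Suc m)
    show ?case
    proof (intro allI impI)
      fix \<eta> :: real assume \<eta>: "0 < \<eta>"
      obtain K where K: "\<And>n. K \<le> n \<Longrightarrow> \<bar>y n\<bar> \<le> B / 2 ^ m + \<eta> / 2"
        using Suc.IH[rule_format, of "\<eta> / 2"] \<eta> unfolding eventually_sequentially by auto
      have "(\<lambda>n. 1 / (real n)\<^sup>2) \<longlonglongrightarrow> 0" by real_asymp
      then have "(\<lambda>n. B * (\<Sum>k<K. 6 * (real k)\<^sup>2) / (real n)\<^sup>2) \<longlonglongrightarrow> 0"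
        using tendsto_mult_right_zero[of "\<lambda>n. 1 / (real n)\<^sup>2" sequentially "B * (\<Sum>k<K. 6 * (real k)\<^sup>2)"] by simp
      then have "\<forall>\<^sub>F n in sequentially. B * (\<Sum>k<K. 6 * (real k)\<^sup>2) / (real n)\<^sup>2 < \<eta> / 4"
        by (rule order_tendstoD) (use \<eta> in simp)
      moreover have "\<forall>\<^sub>F n in sequentially. \<bar>e n\<bar> < \<eta> / 4"
        using order_tendstoD(2)[OF tendsto_rabs_zero[OF e_lim], of "\<eta> / 4"] \<eta> by simp
      ultimately show "\<forall>\<^sub>F n in sequentially. \<bar>y n\<bar> \<le> B / 2 ^ Suc m + \<eta>"
        using eventually_ge_at_top[of N'] eventually_ge_at_top[of K]
      proof eventually_elim
        case (elim n)
        have n: "N \<le> n" "2 \<le> n" using elim by (auto simp: N'_def)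
        define c where "c = B / 2 ^ m + \<eta> / 2"
        have c: "0 \<le> c" using B0 \<eta> by (simp add: c_def)
        have "\<bar>\<Sum>k<n. w n k * y k\<bar> \<le> (\<Sum>k<n. \<bar>w n k * y k\<bar>)" by (rule sum_abs)
        also have "\<dots> \<le> (\<Sum>k<n. w n k * c + (if k < K then w n k * B else 0))"
        proof (rule sum_mono)
          fix k assume k: "k \<in> {..<n}"
          have "\<bar>w n k * y k\<bar> = w n k * \<bar>y k\<bar>" using w_nonneg[OF n(2)] k by (simp add: abs_mult)
          also have "\<dots> \<le> w n k * (c + (if k < K then B else 0))"
            using w_nonneg[OF n(2)] k B[of k] K[of k] c by (intro mult_left_mono) (auto simp: c_def)
          finally show "\<bar>w n k * y k\<bar> \<le> w n k * c + (if k < K then w n k * B else 0)"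
            by (auto simp: algebra_simps split: if_splits)
        qed
        also have "\<dots> = c * (\<Sum>k<n. w n k) + (\<Sum>k<K. w n k * B)"
        proof -
          have "(\<Sum>k<n. if k < K then w n k * B else 0) = (\<Sum>k<K. w n k * B)"
            by (rule sum.mono_neutral_cong_right) (use elim in auto)
          then show ?thesis by (simp add: sum.distrib sum_distrib_left mult.commute)
        qed
        also have "c * (\<Sum>k<n. w n k) \<le> c * (1/2)" using w_le[OF n(2)] c by (rule mult_left_mono)
        also have "(\<Sum>k<K. w n k * B) \<le> (\<Sum>k<K. 6 * (real k)\<^sup>2 / (real n)\<^sup>2 * B)"
          using elim B0 by (intro sum_mono mult_right_mono w_small n) auto
        also have "\<dots> = B * (\<Sum>k<K. 6 * (real k)\<^sup>2) / (real n)\<^sup>2"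
          by (simp add: sum_distrib_left sum_divide_distrib mult_ac)
        finally have "\<bar>\<Sum>k<n. w n k * y k\<bar> \<le> c * (1/2) + \<eta> / 4" using elim by linarith
        then have "\<bar>y n\<bar> \<le> \<eta> / 4 + (c * (1/2) + \<eta> / 4)" using y_rec[OF n(1)] elim by linarith
        also have "\<dots> \<le> B / 2 ^ Suc m + \<eta>" using \<eta> by (simp add: c_def add_divide_distrib)
        finally show ?case .
      qed
    qed
  qed
  have "y \<longlonglongrightarrow> 0"
  proof (rule tendstoI)
    fix \<epsilon> :: real assume \<epsilon>: "0 < \<epsilon>"
    have "(\<lambda>m. B / 2 ^ m) \<longlonglongrightarrow> 0" by (rule LIMSEQ_divide_realpow_zero) simp
    then have "\<forall>\<^sub>F m in sequentially. B / 2 ^ m < \<epsilon> / 2" by (rule order_tendstoD) (use \<epsilon> in simp)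
    then obtain m where m: "B / 2 ^ m < \<epsilon> / 2" by (auto simp: eventually_sequentially)
    have "\<forall>\<^sub>F n in sequentially. \<bar>y n\<bar> \<le> B / 2 ^ m + \<epsilon> / 4" using step[of m] \<epsilon> by simp
    then show "\<forall>\<^sub>F n in sequentially. dist (y n) 0 < \<epsilon>" by eventually_elim (use m \<epsilon> in simp)
  qed
  then have "(\<lambda>n. y n + 2 * A) \<longlonglongrightarrow> 0 + 2 * A" by (intro tendsto_add tendsto_const)
  then show ?thesis by (simp add: y_def)
qed

theorem Zvar_tendsto:
  assumes M: "0 < M"
  shows "Zvar M \<longlonglongrightarrow> 7/10 - 3/50 * pi\<^sup>2"
proof -
  have "Zvar M \<longlonglongrightarrow> 2 * (7/20 - 3/100 * pi\<^sup>2)"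
    by (rule contraction_recurrence_tendsto[OF _ part_toll_second_moment_tendsto[OF M], where N = "Suc M"])
      (rule Zvar_recurrence[OF M], simp)
  then show ?thesis by simp
qed

section \<open>Convergence of the characteristic functions\<close>

abbreviation Zlaw :: "nat \<Rightarrow> nat \<Rightarrow> real measure" where
  "Zlaw M n \<equiv> distr (measure_pmf (random_perm n)) borel (Zn M n)"

abbreviation Zchar :: "nat \<Rightarrow> nat \<Rightarrow> real \<Rightarrow> complex" where "Zchar M n \<equiv> char (Zlaw M n)"

lemma real_distribution_Zlaw: "real_distribution (Zlaw M n)"
  by (rule prob_space.real_distribution_distr[OF measure_pmf.prob_space_axioms]) simp

lemma Zchar_eq: "Zchar M n t = pavg n (\<lambda>\<pi>. iexp (t * Zn M n \<pi>))"
  unfolding char_def by (simp add: integral_distr)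

section \<open>Elementary bounds for characteristic functions\<close>

lemma cmod_iexp_diff: "cmod (iexp x - iexp y) \<le> \<bar>x - y\<bar>"
proof -
  have "iexp x - iexp y = iexp y * (iexp (x - y) - 1)"
    by (simp add: algebra_simps exp_add[symmetric])
  then show ?thesis using iexp_approx1[of "x - y" 0] by (simp add: norm_mult)
qed

text \<open>Telescoping by exchanging one factor at a time; all other factors have norm at most 1.
  The fourth factor is the exponential of the toll.\<close>

lemma norm_prod3_diff:
  fixes a b c d a' b' c' d' :: complex
  assumes "norm a \<le> 1" "norm b \<le> 1" "norm c \<le> 1" "norm d \<le> 1" "norm a' \<le> 1" "norm b' \<le> 1" "norm c' \<le> 1" "norm d' \<le> 1"
  shows "norm (a * b * c * d - a' * b' * c' * d') \<le> norm (a - a') + norm (b - b') + norm (c - c') + norm (d - d')"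
proof -
  have two: "norm (x * y - x' * y') \<le> norm (x - x') + norm (y - y')"
    if "norm y \<le> 1" "norm x' \<le> 1" for x y x' y' :: complex
  proof -
    have "x * y - x' * y' = (x - x') * y + x' * (y - y')" by (simp add: algebra_simps)
    then have "norm (x * y - x' * y') \<le> norm (x - x') * norm y + norm x' * norm (y - y')"
      by (metis norm_triangle_ineq norm_mult)
    also have "\<dots> \<le> norm (x - x') * 1 + 1 * norm (y - y')"
      using that by (intro add_mono mult_left_mono mult_right_mono) auto
    finally show ?thesis by simp
  qed
  have "norm (a' * b') \<le> 1" "norm (a' * b' * c') \<le> 1"
    using assms by (auto simp: norm_mult intro!: mult_le_one)
  then show ?thesis
    using two[of d "a' * b' * c'" "a * b * c" d'] two[of c "a' * b'" "a * b" c'] two[of b a' a b'] assms by linarith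
qed

lemma Zvar_nonneg: "0 \<le> Zvar M n" by (simp add: Zvar_def)

text \<open>Centring removes the linear term of the Taylor expansion, and the remainder is quadratic
  in \<open>t\<close>. This provides the finite initial constant for both contraction arguments, for
  convergence and for uniqueness.\<close>

lemma char_near_one:
  assumes "real_distribution \<mu>" and sq: "integrable \<mu> (\<lambda>x. x\<^sup>2)" and mean: "(LINT x|\<mu>. x) = 0"
  shows "cmod (char \<mu> t - 1) \<le> (LINT x|\<mu>. x\<^sup>2) / 2 * t\<^sup>2"
proof -
  interpret real_distribution \<mu> by fact
  have int: "integrable \<mu> (\<lambda>x. x ^ k)" if "k \<le> 1" for k
  proof (rule Bochner_Integration.integrable_bound)
    show "integrable \<mu> (\<lambda>x. 1 + x\<^sup>2)" using sq by simp
    have "\<bar>x\<bar> ^ k \<le> 1 + x\<^sup>2" for x :: real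
      using that zero_le_power2[of "\<bar>x\<bar> - 1"] by (cases "k = 0") (auto simp: power2_diff le_Suc_eq)
    then show "AE x in \<mu>. norm (x ^ k) \<le> norm (1 + x\<^sup>2)" by (auto simp: power_abs)
  qed simp
  let ?m = "\<lambda>x::real. min (2 * \<bar>x\<bar>^1 * Suc 1) (\<bar>t\<bar> * \<bar>x\<bar>^Suc 1)"
  have "cmod (char \<mu> t - (\<Sum>k \<le> 1. ((\<i> * t)^k / fact k) * expectation (\<lambda>x. x^k))) \<le>
    (\<bar>t\<bar>^1 / fact (Suc 1)) * expectation ?m"
    by (rule char_approx2) (rule int)
  then have main: "cmod (char \<mu> t - 1) \<le> \<bar>t\<bar> / 2 * expectation ?m"
    using prob_space by (simp add: mean)
  have "expectation ?m \<le> expectation (\<lambda>x. \<bar>t\<bar> * x\<^sup>2)"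
  proof (rule integral_mono)
    show "integrable \<mu> (\<lambda>x. \<bar>t\<bar> * x\<^sup>2)" using sq by simp
    then show "integrable \<mu> ?m"
      by (rule Bochner_Integration.integrable_bound) (auto simp: power2_eq_square)
  qed (simp add: power2_eq_square)
  then have "\<bar>t\<bar> / 2 * expectation ?m \<le> \<bar>t\<bar> / 2 * (\<bar>t\<bar> * expectation (\<lambda>x. x\<^sup>2))"
    by (intro mult_left_mono) auto
  also have "\<dots> = expectation (\<lambda>x. x\<^sup>2) / 2 * t\<^sup>2"
    by (simp add: power2_eq_square abs_mult_self_eq[of t, symmetric] del: abs_mult_self_eq)
  finally show ?thesis using main by linarith
qed

lemma Zlaw_moments:
  "(LINT x|Zlaw M n. x) = 0" "(LINT x|Zlaw M n. x\<^sup>2) = Zvar M n"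
  by (simp_all add: integral_distr pavg_Zn Zvar_def)

lemma integrable_Zlaw: "f \<in> borel_measurable borel \<Longrightarrow> integrable (Zlaw M n) (f :: real \<Rightarrow> real)"
  by (simp add: integrable_distr_eq integrable_random_perm)

lemma Zchar_near_one: "cmod (Zchar M n t - 1) \<le> Zvar M n / 2 * t\<^sup>2"
  using char_near_one[OF real_distribution_Zlaw[of n M], of t] by (simp add: Zlaw_moments integrable_Zlaw)

text \<open>The Lipschitz constant is the mean absolute value, which the root of the second moment
  dominates. Bounded variances thus give equicontinuity uniformly in \<open>n\<close>, as needed
  when block proportions in the argument are replaced by spacings.\<close>

lemma Zchar_lipschitz: "cmod (Zchar M n s - Zchar M n t) \<le> sqrt (Zvar M n) * \<bar>s - t\<bar>"
proof -
  have "cmod (Zchar M n s - Zchar M n t) = cmod (pavg n (\<lambda>\<pi>. iexp (s * Zn M n \<pi>) - iexp (t * Zn M n \<pi>)))"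
    by (simp only: Zchar_eq pavg_diff)
  also have "\<dots> \<le> pavg n (\<lambda>\<pi>. cmod (iexp (s * Zn M n \<pi>) - iexp (t * Zn M n \<pi>)))"
    by (rule integral_norm_bound)
  also have "\<dots> \<le> pavg n (\<lambda>\<pi>. \<bar>s - t\<bar> * \<bar>Zn M n \<pi>\<bar>)"
  proof (rule pavg_mono)
    fix \<pi>
    show "cmod (iexp (s * Zn M n \<pi>) - iexp (t * Zn M n \<pi>)) \<le> \<bar>s - t\<bar> * \<bar>Zn M n \<pi>\<bar>"
      using cmod_iexp_diff[of "s * Zn M n \<pi>" "t * Zn M n \<pi>"] by (simp add: abs_mult[symmetric] left_diff_distrib)
  qed
  also have "\<dots> = \<bar>s - t\<bar> * pavg n (\<lambda>\<pi>. \<bar>Zn M n \<pi>\<bar>)" by simp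
  also have "\<dots> \<le> \<bar>s - t\<bar> * sqrt (Zvar M n)"
    using pavg_abs_square_le[of n "Zn M n"] by (intro mult_left_mono real_le_rsqrt) (auto simp: Zvar_def)
  finally show ?thesis by (simp add: mult.commute)
qed

lemma Zchar_le_1: "cmod (Zchar M n t) \<le> 1"
  by (rule real_distribution.cmod_char_le_1[OF real_distribution_Zlaw])

lemma Zchar_recurrence:
  assumes M: "0 < M" and n: "M < n"
  shows "Zchar M n t = pavg n (\<lambda>\<pi>. iexp (t * part_toll M n \<pi>) * Zchar M (block1 n \<pi>) (t * (real (block1 n \<pi>) / real n))
    * Zchar M (block2 n \<pi>) (t * (real (block2 n \<pi>) / real n)) * Zchar M (block3 n \<pi>) (t * (real (block3 n \<pi>) / real n)))"
proof -
  have e: "iexp (t * (b + x1 * z1 + x2 * z2 + x3 * z3)) =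
      iexp (t * b) * (iexp (t * x1 * z1) * (iexp (t * x2 * z2) * iexp (t * x3 * z3)))" for b x1 x2 x3 z1 z2 z3
    by (simp add: exp_add[symmetric] algebra_simps)
  have "Zchar M n t = pavg n (\<lambda>\<pi>. pavg (block1 n \<pi>) (\<lambda>\<alpha>. pavg (block2 n \<pi>) (\<lambda>\<beta>.
    pavg (block3 n \<pi>) (\<lambda>\<gamma>. iexp (t * (part_toll M n \<pi> + real (block1 n \<pi>) / real n * Zn M (block1 n \<pi>) \<alpha>
      + real (block2 n \<pi>) / real n * Zn M (block2 n \<pi>) \<beta> + real (block3 n \<pi>) / real n * Zn M (block3 n \<pi>) \<gamma>))))))"
    unfolding Zchar_eq by (rule Zn_recurrence[OF M n])
  also have "\<dots> = pavg n (\<lambda>\<pi>. iexp (t * part_toll M n \<pi>) * (Zchar M (block1 n \<pi>) (t * (real (block1 n \<pi>) / real n))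
    * (Zchar M (block2 n \<pi>) (t * (real (block2 n \<pi>) / real n)) * Zchar M (block3 n \<pi>) (t * (real (block3 n \<pi>) / real n)))))"
    unfolding e Zchar_eq by (simp only: integral_mult_right_zero integral_mult_left_zero)
  finally show ?thesis by (simp only: mult.assoc)
qed

text \<open>
  The characteristic functions may depend on the spacings, so that the recurrence at finite \<open>n\<close>
  and the limit equation have the same shape.
\<close>

definition rde_char :: "(real \<times> real \<Rightarrow> real \<Rightarrow> complex) \<Rightarrow> (real \<times> real \<Rightarrow> real \<Rightarrow> complex) \<Rightarrow>
    (real \<times> real \<Rightarrow> real \<Rightarrow> complex) \<Rightarrow> real \<Rightarrow> complex" where
  "rde_char f1 f2 f3 t = (LINT z|unif2. iexp (t * toll_limit (gap1 z) (gap2 z) (gap3 z)) *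
     f1 z (t * gap1 z) * f2 z (t * gap2 z) * f3 z (t * gap3 z))"

lemma measurable_Zchar_random:
  assumes [measurable]: "k \<in> measurable (borel \<Otimes>\<^sub>M borel) (count_space UNIV)" "g \<in> borel_measurable (borel \<Otimes>\<^sub>M borel)"
  shows "(\<lambda>z. Zchar M (k z) (g z)) \<in> borel_measurable (borel \<Otimes>\<^sub>M borel)"
proof -
  have "(\<lambda>z. Zchar M i (g z)) \<in> borel_measurable (borel \<Otimes>\<^sub>M borel)" for i
    using measurable_compose[OF assms(2) real_distribution.char_measurable[OF real_distribution_Zlaw]] .
  then show ?thesis by (rule measurable_compose_countable[OF _ assms(1)])
qed

lemma borel_measurable_unif2: "f \<in> borel_measurable (borel \<Otimes>\<^sub>M borel) \<Longrightarrow> f \<in> borel_measurable unif2"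
proof -
  have "sets unif2 = sets (borel \<Otimes>\<^sub>M borel :: (real \<times> real) measure)" by (rule sets_pair_measure_cong) auto
  then show "f \<in> borel_measurable (borel \<Otimes>\<^sub>M borel) \<Longrightarrow> f \<in> borel_measurable unif2"
    by (simp cong: measurable_cong_sets)
qed

lemma integrable_rde_char:
  assumes "(\<lambda>z. f1 z (t * gap1 z)) \<in> borel_measurable (borel \<Otimes>\<^sub>M borel)"
    "(\<lambda>z. f2 z (t * gap2 z)) \<in> borel_measurable (borel \<Otimes>\<^sub>M borel)"
    "(\<lambda>z. f3 z (t * gap3 z)) \<in> borel_measurable (borel \<Otimes>\<^sub>M borel)"
    and "\<And>z s. cmod (f1 z s) \<le> 1" "\<And>z s. cmod (f2 z s) \<le> 1" "\<And>z s. cmod (f3 z s) \<le> 1"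
  shows "integrable unif2 (\<lambda>z. iexp (t * toll_limit (gap1 z) (gap2 z) (gap3 z)) *
     f1 z (t * gap1 z) * f2 z (t * gap2 z) * f3 z (t * gap3 z))"
proof (rule unif_pair.P.integrable_const_bound[where B = 1])
  note [measurable] = assms(1-3)
  show "(\<lambda>z. iexp (t * toll_limit (gap1 z) (gap2 z) (gap3 z)) *
     f1 z (t * gap1 z) * f2 z (t * gap2 z) * f3 z (t * gap3 z)) \<in> borel_measurable unif2"
    by (rule borel_measurable_unif2) measurable
  show "AE z in unif2. cmod (iexp (t * toll_limit (gap1 z) (gap2 z) (gap3 z)) *
     f1 z (t * gap1 z) * f2 z (t * gap2 z) * f3 z (t * gap3 z)) \<le> 1"
    using assms(4-6) by (auto simp: norm_mult intro!: mult_le_one)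
qed

text \<open>Both products share the exponential of the toll, so only the differences of the three
  remaining factors survive. A dominating \<open>h\<close> is used so that the same estimate serves
  the exact contraction as well as the version with additional error terms.\<close>

lemma rde_char_diff:
  assumes meas: "\<And>f. f \<in> {f1, f2, f3, g1, g2, g3} \<Longrightarrow> (\<lambda>z. f z (t * gap1 z)) \<in> borel_measurable (borel \<Otimes>\<^sub>M borel) \<and>
      (\<lambda>z. f z (t * gap2 z)) \<in> borel_measurable (borel \<Otimes>\<^sub>M borel) \<and> (\<lambda>z. f z (t * gap3 z)) \<in> borel_measurable (borel \<Otimes>\<^sub>M borel)"
    and le1: "\<And>f z s. f \<in> {f1, f2, f3, g1, g2, g3} \<Longrightarrow> cmod (f z s) \<le> 1"
    and bound: "AE z in unif2. cmod (f1 z (t * gap1 z) - g1 z (t * gap1 z)) + cmod (f2 z (t * gap2 z) - g2 z (t * gap2 z))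
      + cmod (f3 z (t * gap3 z) - g3 z (t * gap3 z)) \<le> h z"
    and h: "integrable unif2 h"
  shows "cmod (rde_char f1 f2 f3 t - rde_char g1 g2 g3 t) \<le> (LINT z|unif2. h z)"
proof -
  let ?F = "\<lambda>f1 f2 f3 z. iexp (t * toll_limit (gap1 z) (gap2 z) (gap3 z)) * f1 z (t * gap1 z) * f2 z (t * gap2 z) * f3 z (t * gap3 z)"
  have int: "integrable unif2 (?F f1 f2 f3)" "integrable unif2 (?F g1 g2 g3)"
    by (rule integrable_rde_char; use meas le1 in auto)+
  have "rde_char f1 f2 f3 t - rde_char g1 g2 g3 t = (LINT z|unif2. ?F f1 f2 f3 z - ?F g1 g2 g3 z)"
    unfolding rde_char_def by (rule Bochner_Integration.integral_diff[OF int, symmetric])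
  then have "cmod (rde_char f1 f2 f3 t - rde_char g1 g2 g3 t) \<le> (LINT z|unif2. cmod (?F f1 f2 f3 z - ?F g1 g2 g3 z))"
    by (simp only: integral_norm_bound)
  also have "\<dots> \<le> (LINT z|unif2. h z)"
  proof (rule integral_mono_AE)
    show "integrable unif2 (\<lambda>z. cmod (?F f1 f2 f3 z - ?F g1 g2 g3 z))"
      using int by (intro integrable_norm Bochner_Integration.integrable_diff)
    show "AE z in unif2. cmod (?F f1 f2 f3 z - ?F g1 g2 g3 z) \<le> h z"
      using bound
    proof eventually_elim
      case (elim z)
      have "cmod (?F f1 f2 f3 z - ?F g1 g2 g3 z) \<le> cmod (iexp (t * toll_limit (gap1 z) (gap2 z) (gap3 z)) - iexp (t * toll_limit (gap1 z) (gap2 z) (gap3 z)))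
        + cmod (f1 z (t * gap1 z) - g1 z (t * gap1 z)) + cmod (f2 z (t * gap2 z) - g2 z (t * gap2 z))
        + cmod (f3 z (t * gap3 z) - g3 z (t * gap3 z))"
        by (rule norm_prod3_diff) (use le1 in auto)
      then show ?case using elim by simp
    qed
  qed (rule h)
  finally show ?thesis .
qed

section \<open>Replacing block proportions by spacings\<close>

lemma Zvar_bounded:
  assumes M: "0 < M"
  obtains K where "0 \<le> K" "\<And>n. Zvar M n \<le> K"
proof -
  have "Bseq (Zvar M)" using Zvar_tendsto[OF M] by (intro convergent_imp_Bseq convergentI)
  then obtain K where "0 < K" "\<And>n. norm (Zvar M n) \<le> K" by (auto elim: BseqE)
  then show thesis by (intro that[of K]) (auto simp: abs_le_iff)
qed

lemma toll_limit_bound: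
  assumes "0 < fst z" "fst z < 1" "0 < snd z" "snd z < 1"
  shows "\<bar>toll_limit (gap1 z) (gap2 z) (gap3 z)\<bar> \<le> 6"
proof -
  define w where "w = max (fst z) (snd z)"
  define s where "s = min (fst z) (snd z) / max (fst z) (snd z)"
  have "0 \<le> w" "w \<le> 1" "0 \<le> s" "s \<le> 1" using assms by (auto simp: w_def s_def field_simps)
  then have "\<bar>Atoll w\<bar> \<le> 3" "\<bar>w * Btoll s\<bar> \<le> 3"
    using Atoll_bound[of w] Btoll_bound[of s] mult_mono[of w 1 "\<bar>Btoll s\<bar>" 3] by (auto simp: abs_mult)
  then show ?thesis
    using toll_limit_polar(4)[OF assms] abs_triangle_ineq[of "Atoll w" "w * Btoll s"] by (simp add: w_def s_def)
qed

text \<open>The pointwise cost, per unit of \<open>\<bar>t\<bar>\<close>, of replacing block toll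
  and block proportions by their limits; \<open>L\<close> stands for a common Lipschitz constant of
  the characteristic functions.\<close>

definition coupling_error :: "nat \<Rightarrow> real \<Rightarrow> nat \<Rightarrow> real \<times> real \<Rightarrow> real" where
  "coupling_error M L n z =
     \<bar>block_toll M n (cblock1 n z) (cblock2 n z) (cblock3 n z) - toll_limit (gap1 z) (gap2 z) (gap3 z)\<bar>
     + L * (\<bar>real (cblock1 n z) / real n - gap1 z\<bar> + \<bar>real (cblock2 n z) / real n - gap2 z\<bar>
       + \<bar>real (cblock3 n z) / real n - gap3 z\<bar>)"

lemma integrable_coupling_error:
  assumes n: "0 < n"
  shows "integrable unif2 (coupling_error M L n)"
proof -
  have bt: "integrable unif2 (\<lambda>z. block_toll M n (cblock1 n z) (cblock2 n z) (cblock3 n z))"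
    by (rule integrable_of_cblocks(2)[OF n])
  have c: "integrable unif2 (\<lambda>z. real (cblock1 n z) / real n)" "integrable unif2 (\<lambda>z. real (cblock2 n z) / real n)"
    "integrable unif2 (\<lambda>z. real (cblock3 n z) / real n)"
    using integrable_of_cblocks(2)[OF n, of "\<lambda>i1 i2 i3. real i1 / real n"]
      integrable_of_cblocks(2)[OF n, of "\<lambda>i1 i2 i3. real i2 / real n"]
      integrable_of_cblocks(2)[OF n, of "\<lambda>i1 i2 i3. real i3 / real n"] by auto
  have t: "integrable unif2 (\<lambda>z. toll_limit (gap1 z) (gap2 z) (gap3 z))"
  proof (rule unif_pair.P.integrable_const_bound[where B = 6])
    show "AE z in unif2. norm (toll_limit (gap1 z) (gap2 z) (gap3 z)) \<le> 6"
      using AE_unif_pair by eventually_elim (simp add: toll_limit_bound)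
  qed measurable
  have g: "integrable unif2 gap1" "integrable unif2 gap2" "integrable unif2 gap3"
  proof -
    have "AE z in unif2. norm (gap1 z) \<le> 1" using AE_unif_pair by eventually_elim (auto simp: min_def max_def)
    moreover have "AE z in unif2. norm (gap2 z) \<le> 1" using AE_unif_pair by eventually_elim (auto simp: min_def max_def)
    moreover have "AE z in unif2. norm (gap3 z) \<le> 1" using AE_unif_pair by eventually_elim (auto simp: min_def max_def)
    ultimately show "integrable unif2 gap1" "integrable unif2 gap2" "integrable unif2 gap3"
      by (auto intro!: unif_pair.P.integrable_const_bound[where B = 1])
  qed
  show ?thesis unfolding coupling_error_def[abs_def]
    by (intro Bochner_Integration.integrable_add integrable_abs Bochner_Integration.integrable_diff
        integrable_mult_right bt c t g)
qed

lemma coupling_error_tendsto: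
  assumes M: "0 < M" and L: "0 \<le> L"
  shows "(\<lambda>n. LINT z|unif2. coupling_error M L n z) \<longlonglongrightarrow> 0"
proof -
  obtain C where C: "0 \<le> C" "\<And>n i1 i2 i3. 4 \<le> n \<Longrightarrow> i1 + i2 + i3 \<le> n \<Longrightarrow> n \<le> i1 + i2 + i3 + 2 \<Longrightarrow>
    \<bar>block_toll M n i1 i2 i3\<bar> \<le> C" using block_toll_bounded[OF M] by blast
  have "(\<lambda>n. LINT z|unif2. coupling_error M L (n + 4) z) \<longlonglongrightarrow> (LINT z|unif2. 0)"
  proof (rule integral_dominated_convergence[where w = "\<lambda>_. C + 6 + L * 3"])
    show "coupling_error M L (n + 4) \<in> borel_measurable unif2" for n
      using integrable_coupling_error[of "n + 4" M L] by auto
    show "AE z in unif2. (\<lambda>n. coupling_error M L (n + 4) z) \<longlonglongrightarrow> 0"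
      using AE_unif_pair
    proof eventually_elim
      case (elim z)
      have "(\<lambda>n. coupling_error M L n z) \<longlonglongrightarrow> \<bar>toll_limit (gap1 z) (gap2 z) (gap3 z) - toll_limit (gap1 z) (gap2 z) (gap3 z)\<bar>
        + L * (\<bar>gap1 z - gap1 z\<bar> + \<bar>gap2 z - gap2 z\<bar> + \<bar>gap3 z - gap3 z\<bar>)"
        unfolding coupling_error_def using elim
        by (intro tendsto_add tendsto_mult tendsto_rabs tendsto_diff tendsto_const cblocks_over_n_tendsto block_toll_tendsto[OF M]) auto
      then have "(\<lambda>n. coupling_error M L n z) \<longlonglongrightarrow> 0" by simp
      then show ?case by (rule LIMSEQ_ignore_initial_segment[where k = 4])
    qed
    show "AE z in unif2. norm (coupling_error M L (n + 4) z) \<le> C + 6 + L * 3" for n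
      using AE_unif_pair
    proof eventually_elim
      case (elim z)
      define m where "m = n + 4"
      have m: "4 \<le> m" "0 < m" by (auto simp: m_def)
      have s: "cblock1 m z + cblock2 m z + cblock3 m z \<le> m" "m \<le> cblock1 m z + cblock2 m z + cblock3 m z + 2"
        using cblocks_sum[OF m(2)] elim by auto
      have t: "\<bar>block_toll M m (cblock1 m z) (cblock2 m z) (cblock3 m z) - toll_limit (gap1 z) (gap2 z) (gap3 z)\<bar> \<le> C + 6"
      proof -
        have "\<bar>block_toll M m (cblock1 m z) (cblock2 m z) (cblock3 m z)\<bar> \<le> C" by (rule C(2)[OF m(1) s])
        moreover have "\<bar>toll_limit (gap1 z) (gap2 z) (gap3 z)\<bar> \<le> 6" using elim by (intro toll_limit_bound) auto
        ultimately show ?thesis by linarith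
      qed
      have r: "\<bar>real k / real m - g\<bar> \<le> 1" if "k \<le> m" "0 \<le> g" "g \<le> 1" for k g
      proof -
        have "0 \<le> real k / real m" "real k / real m \<le> 1" using that m by auto
        then show ?thesis using that by linarith
      qed
      have "\<bar>real (cblock1 m z) / real m - gap1 z\<bar> + \<bar>real (cblock2 m z) / real m - gap2 z\<bar>
       + \<bar>real (cblock3 m z) / real m - gap3 z\<bar> \<le> 1 + 1 + 1"
        using s elim by (intro add_mono r) auto
      then have "L * (\<bar>real (cblock1 m z) / real m - gap1 z\<bar> + \<bar>real (cblock2 m z) / real m - gap2 z\<bar>
       + \<bar>real (cblock3 m z) / real m - gap3 z\<bar>) \<le> L * 3" using L by (intro mult_left_mono) auto
      moreover have "0 \<le> L * (\<bar>real (cblock1 m z) / real m - gap1 z\<bar> + \<bar>real (cblock2 m z) / real m - gap2 z\<bar>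
       + \<bar>real (cblock3 m z) / real m - gap3 z\<bar>)" using L by (intro mult_nonneg_nonneg) auto
      moreover have "norm (\<bar>a\<bar> + b) \<le> C + 6 + L * 3" if "\<bar>a\<bar> \<le> C + 6" "b \<le> L * 3" "0 \<le> b" for a b
        using that by simp
      ultimately show ?case using t unfolding m_def[symmetric] coupling_error_def by blast
    qed
  qed auto
  then have "(\<lambda>n. LINT z|unif2. coupling_error M L (n + 4) z) \<longlonglongrightarrow> 0" by simp
  then show ?thesis by (rule LIMSEQ_offset[where k = 4 and f = "\<lambda>n. LINT z|unif2. coupling_error M L n z"])
qed

abbreviation rde_char_blocks :: "nat \<Rightarrow> nat \<Rightarrow> real \<Rightarrow> complex" where
  "rde_char_blocks M n \<equiv> rde_char (\<lambda>z. Zchar M (cblock1 n z)) (\<lambda>z. Zchar M (cblock2 n z)) (\<lambda>z. Zchar M (cblock3 n z))"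

text \<open>Three errors add up: exchanging the exact toll for the block toll, dropping the
  condition that the cells differ, and passing to the limiting toll and spacings. The middle one is
  not proportional to \<open>\<bar>t\<bar>\<close>, which explains the factor
  \<open>1 + \<bar>t\<bar>\<close>. The indices of the characteristic functions stay random; only
  their arguments are replaced.\<close>

lemma Zchar_approx:
  assumes M: "0 < M"
  obtains \<epsilon> where "\<epsilon> \<longlonglongrightarrow> 0" "\<And>n t. max 4 (Suc M) \<le> n \<Longrightarrow> cmod (Zchar M n t - rde_char_blocks M n t) \<le> (1 + \<bar>t\<bar>) * \<epsilon> n"
proof -
  obtain K where K: "0 \<le> K" "\<And>n. Zvar M n \<le> K" using Zvar_bounded[OF M] by blast
  define L where "L = sqrt K"
  have L: "0 \<le> L" using K by (simp add: L_def)
  define \<epsilon> where "\<epsilon> n = sqrt (8 / real n) + (1 / (real n - 1) + 1 / real n) + (LINT z|unif2. coupling_error M L n z)" for n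
  have "\<epsilon> \<longlonglongrightarrow> 0 + 0 + 0"
    unfolding \<epsilon>_def[abs_def]
  proof (intro tendsto_add[of _ _ _ _ "0::real"] coupling_error_tendsto M L)
    show "(\<lambda>n. sqrt (8 / real n)) \<longlonglongrightarrow> 0" by real_asymp
    show "(\<lambda>n. 1 / (real n - 1) + 1 / real n) \<longlonglongrightarrow> 0" by real_asymp
  qed
  then have lim: "\<epsilon> \<longlonglongrightarrow> 0" by simp
  have "cmod (Zchar M n t - rde_char_blocks M n t) \<le> (1 + \<bar>t\<bar>) * \<epsilon> n" if n': "max 4 (Suc M) \<le> n" for n t
  proof -
    have n: "4 \<le> n" "M < n" "3 \<le> n" "2 \<le> n" "0 < n" using n' by auto
    define X where "X i1 i2 i3 = Zchar M i1 (t * (real i1 / real n)) * Zchar M i2 (t * (real i2 / real n)) * Zchar M i3 (t * (real i3 / real n))" for i1 i2 i3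
    define H where "H i1 i2 i3 = iexp (t * block_toll M n i1 i2 i3) * Zchar M i1 (t * (real i1 / real n))
      * Zchar M i2 (t * (real i2 / real n)) * Zchar M i3 (t * (real i3 / real n))" for i1 i2 i3
    have H1: "cmod (H i1 i2 i3) \<le> 1" for i1 i2 i3
      unfolding H_def by (auto simp: norm_mult Zchar_le_1 intro!: mult_le_one)
    let ?A = "pavg n (\<lambda>\<pi>. H (block1 n \<pi>) (block2 n \<pi>) (block3 n \<pi>))"
    have step1: "cmod (Zchar M n t - ?A) \<le> \<bar>t\<bar> * sqrt (8 / real n)"
    proof -
      have "Zchar M n t - ?A = pavg n (\<lambda>\<pi>. iexp (t * part_toll M n \<pi>) * Zchar M (block1 n \<pi>) (t * (real (block1 n \<pi>) / real n))
        * Zchar M (block2 n \<pi>) (t * (real (block2 n \<pi>) / real n)) * Zchar M (block3 n \<pi>) (t * (real (block3 n \<pi>) / real n))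
        - H (block1 n \<pi>) (block2 n \<pi>) (block3 n \<pi>))"
        unfolding Zchar_recurrence[OF M n(2), of t] pavg_diff ..
      then have "cmod (Zchar M n t - ?A) \<le> pavg n (\<lambda>\<pi>. cmod (iexp (t * part_toll M n \<pi>) * Zchar M (block1 n \<pi>) (t * (real (block1 n \<pi>) / real n))
        * Zchar M (block2 n \<pi>) (t * (real (block2 n \<pi>) / real n)) * Zchar M (block3 n \<pi>) (t * (real (block3 n \<pi>) / real n))
        - H (block1 n \<pi>) (block2 n \<pi>) (block3 n \<pi>)))" by (simp only: integral_norm_bound)
      also have "\<dots> \<le> pavg n (\<lambda>\<pi>. \<bar>t\<bar> * \<bar>part_toll M n \<pi> - block_toll M n (block1 n \<pi>) (block2 n \<pi>) (block3 n \<pi>)\<bar>)"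
      proof (rule pavg_mono)
        fix \<pi>
        let ?b = "block_toll M n (block1 n \<pi>) (block2 n \<pi>) (block3 n \<pi>)"
        have "cmod (iexp (t * part_toll M n \<pi>) * Zchar M (block1 n \<pi>) (t * (real (block1 n \<pi>) / real n))
          * Zchar M (block2 n \<pi>) (t * (real (block2 n \<pi>) / real n)) * Zchar M (block3 n \<pi>) (t * (real (block3 n \<pi>) / real n))
          - H (block1 n \<pi>) (block2 n \<pi>) (block3 n \<pi>)) \<le> cmod (iexp (t * part_toll M n \<pi>) - iexp (t * ?b)) +
            cmod (Zchar M (block1 n \<pi>) (t * (real (block1 n \<pi>) / real n)) - Zchar M (block1 n \<pi>) (t * (real (block1 n \<pi>) / real n))) +
            cmod (Zchar M (block2 n \<pi>) (t * (real (block2 n \<pi>) / real n)) - Zchar M (block2 n \<pi>) (t * (real (block2 n \<pi>) / real n))) +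
            cmod (Zchar M (block3 n \<pi>) (t * (real (block3 n \<pi>) / real n)) - Zchar M (block3 n \<pi>) (t * (real (block3 n \<pi>) / real n)))"
          unfolding H_def by (rule norm_prod3_diff) (simp_all add: Zchar_le_1)
        also have "\<dots> \<le> \<bar>t * part_toll M n \<pi> - t * ?b\<bar>" using cmod_iexp_diff[of "t * part_toll M n \<pi>" "t * ?b"] by simp
        also have "\<dots> = \<bar>t\<bar> * \<bar>part_toll M n \<pi> - ?b\<bar>" by (simp only: right_diff_distrib[symmetric] abs_mult)
        finally show "cmod (iexp (t * part_toll M n \<pi>) * Zchar M (block1 n \<pi>) (t * (real (block1 n \<pi>) / real n))
          * Zchar M (block2 n \<pi>) (t * (real (block2 n \<pi>) / real n)) * Zchar M (block3 n \<pi>) (t * (real (block3 n \<pi>) / real n))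
          - H (block1 n \<pi>) (block2 n \<pi>) (block3 n \<pi>)) \<le> \<bar>t\<bar> * \<bar>part_toll M n \<pi> - ?b\<bar>" .
      qed
      also have "\<dots> = \<bar>t\<bar> * pavg n (\<lambda>\<pi>. \<bar>part_toll M n \<pi> - block_toll M n (block1 n \<pi>) (block2 n \<pi>) (block3 n \<pi>)\<bar>)"
        by (rule integral_mult_right_zero)
      also have "\<dots> \<le> \<bar>t\<bar> * sqrt (8 / real n)" by (intro mult_left_mono part_toll_error n) simp
      finally show ?thesis .
    qed
    let ?G = "\<lambda>z. H (cblock1 n z) (cblock2 n z) (cblock3 n z)"
    let ?ne = "\<lambda>z. of_bool (cell n (fst z) \<noteq> cell n (snd z)) :: real"
    define Xn where "Xn = (LINT z|unif2. ?ne z *\<^sub>R ?G z)"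
    have G_int: "integrable unif2 ?G" "integrable unif2 (\<lambda>z. ?ne z *\<^sub>R ?G z)"
      using integrable_of_cblocks[OF n(5), of H] by auto
    \<comment> \<open>The normalising factor exceeds 1 by \<open>1 / (n - 1)\<close>, and coinciding
      cells have probability \<open>1 / n\<close>; the integrand has norm at most 1.\<close>
    have step2: "cmod (?A - (LINT z|unif2. ?G z)) \<le> 1 / (real n - 1) + 1 / real n"
    proof -
      have "cmod Xn \<le> (LINT z|unif2. cmod (?ne z *\<^sub>R ?G z))" unfolding Xn_def by (rule integral_norm_bound)
      also have "\<dots> \<le> (LINT z|unif2. 1)"
        using G_int(2) by (intro integral_mono integrable_norm) (auto simp: H1)
      finally have X1: "cmod Xn \<le> 1" by (simp add: unif_pair.P.prob_space)
      have eq_int: "integrable unif2 (\<lambda>z. of_bool (cell n (fst z) = cell n (snd z)) :: real)"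
        using integral_cells(1)[OF n(5), of "\<lambda>a b. of_bool (a = b) :: real"] by simp
      have "Xn - (LINT z|unif2. ?G z) = (LINT z|unif2. ?ne z *\<^sub>R ?G z - ?G z)"
        unfolding Xn_def by (rule Bochner_Integration.integral_diff[OF G_int(2,1), symmetric])
      then have "cmod (Xn - (LINT z|unif2. ?G z)) \<le> (LINT z|unif2. cmod (?ne z *\<^sub>R ?G z - ?G z))"
        by (simp only: integral_norm_bound)
      also have "\<dots> \<le> (LINT z|unif2. of_bool (cell n (fst z) = cell n (snd z)))"
        using G_int eq_int by (intro integral_mono integrable_norm Bochner_Integration.integrable_diff) (auto simp: H1)
      also have "\<dots> = 1 / real n" by (rule cell_coincidence[OF n(5)])
      finally have 2: "cmod (Xn - (LINT z|unif2. ?G z)) \<le> 1 / real n" .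
      have A: "?A = (real n / (real n - 1)) *\<^sub>R Xn" unfolding Xn_def by (rule pavg_blocks_eq_integral[OF n(4)])
      have "real n / (real n - 1) = 1 + 1 / (real n - 1)" using n by (simp add: field_simps)
      then have "?A - Xn = (1 / (real n - 1)) *\<^sub>R Xn" unfolding A by (simp add: scaleR_add_left)
      then have "cmod (?A - Xn) \<le> 1 / (real n - 1) * 1"
        using X1 n by (simp only: norm_scaleR) (intro mult_mono, auto)
      then show ?thesis using 2 norm_triangle_ineq[of "?A - Xn" "Xn - (LINT z|unif2. ?G z)"] by simp
    qed
    have step3: "cmod ((LINT z|unif2. ?G z) - rde_char_blocks M n t) \<le> \<bar>t\<bar> * (LINT z|unif2. coupling_error M L n z)"
    proof -
      let ?R = "\<lambda>z. iexp (t * toll_limit (gap1 z) (gap2 z) (gap3 z)) * Zchar M (cblock1 n z) (t * gap1 z)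
        * Zchar M (cblock2 n z) (t * gap2 z) * Zchar M (cblock3 n z) (t * gap3 z)"
      have R_int: "integrable unif2 ?R"
        by (rule integrable_rde_char) (auto intro!: measurable_Zchar_random simp: Zchar_le_1)
      have "(LINT z|unif2. ?G z) - rde_char_blocks M n t = (LINT z|unif2. ?G z - ?R z)"
        unfolding rde_char_def by (rule Bochner_Integration.integral_diff[OF G_int(1) R_int, symmetric])
      then have "cmod ((LINT z|unif2. ?G z) - rde_char_blocks M n t) \<le> (LINT z|unif2. cmod (?G z - ?R z))"
        by (simp only: integral_norm_bound)
      also have "\<dots> \<le> (LINT z|unif2. \<bar>t\<bar> * coupling_error M L n z)"
      proof (rule integral_mono)
        show "integrable unif2 (\<lambda>z. \<bar>t\<bar> * coupling_error M L n z)"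
          by (intro integrable_mult_right integrable_coupling_error n)
        show "integrable unif2 (\<lambda>z. cmod (?G z - ?R z))"
          using G_int R_int by (intro integrable_norm Bochner_Integration.integrable_diff)
        fix z
        let ?b = "block_toll M n (cblock1 n z) (cblock2 n z) (cblock3 n z)" and ?l = "toll_limit (gap1 z) (gap2 z) (gap3 z)"
        have lip: "cmod (Zchar M k (t * x) - Zchar M k (t * y)) \<le> \<bar>t\<bar> * (L * \<bar>x - y\<bar>)" for k x y
        proof -
          have "cmod (Zchar M k (t * x) - Zchar M k (t * y)) \<le> sqrt (Zvar M k) * \<bar>t * x - t * y\<bar>" by (rule Zchar_lipschitz)
          also have "\<dots> \<le> L * \<bar>t * x - t * y\<bar>" using K(2)[of k] by (intro mult_right_mono) (auto simp: L_def)
          also have "\<dots> = \<bar>t\<bar> * (L * \<bar>x - y\<bar>)" by (simp add: right_diff_distrib[symmetric] abs_mult)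
          finally show ?thesis .
        qed
        have e1: "cmod (iexp (t * ?b) - iexp (t * ?l)) \<le> \<bar>t\<bar> * \<bar>?b - ?l\<bar>"
          using cmod_iexp_diff[of "t * ?b" "t * ?l"] by (simp only: right_diff_distrib[symmetric] abs_mult)
        have "cmod (?G z - ?R z) \<le> cmod (iexp (t * ?b) - iexp (t * ?l)) +
          cmod (Zchar M (cblock1 n z) (t * (real (cblock1 n z) / real n)) - Zchar M (cblock1 n z) (t * gap1 z)) +
          cmod (Zchar M (cblock2 n z) (t * (real (cblock2 n z) / real n)) - Zchar M (cblock2 n z) (t * gap2 z)) +
          cmod (Zchar M (cblock3 n z) (t * (real (cblock3 n z) / real n)) - Zchar M (cblock3 n z) (t * gap3 z))"
          unfolding H_def by (rule norm_prod3_diff) (simp_all add: Zchar_le_1)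
        also have "\<dots> \<le> \<bar>t\<bar> * \<bar>?b - ?l\<bar> + \<bar>t\<bar> * (L * \<bar>real (cblock1 n z) / real n - gap1 z\<bar>)
          + \<bar>t\<bar> * (L * \<bar>real (cblock2 n z) / real n - gap2 z\<bar>) + \<bar>t\<bar> * (L * \<bar>real (cblock3 n z) / real n - gap3 z\<bar>)"
          by (intro add_mono lip e1)
        also have "\<dots> = \<bar>t\<bar> * coupling_error M L n z"
          by (simp only: coupling_error_def distrib_left add.assoc)
        finally show "cmod (?G z - ?R z) \<le> \<bar>t\<bar> * coupling_error M L n z" .
      qed
      finally show ?thesis by simp
    qed
    have "cmod (Zchar M n t - rde_char_blocks M n t) \<le> \<bar>t\<bar> * sqrt (8 / real n) + (1 / (real n - 1) + 1 / real n)
        + \<bar>t\<bar> * (LINT z|unif2. coupling_error M L n z)"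
      by (rule norm_diff_triangle_le[OF norm_diff_triangle_le[OF step1 step2] step3])
    also have "\<dots> \<le> (1 + \<bar>t\<bar>) * sqrt (8 / real n) + (1 + \<bar>t\<bar>) * (1 / (real n - 1) + 1 / real n)
        + (1 + \<bar>t\<bar>) * (LINT z|unif2. coupling_error M L n z)"
    proof (intro add_mono mult_right_mono)
      show "0 \<le> (LINT z|unif2. coupling_error M L n z)" using L by (intro integral_nonneg_AE) (auto simp: coupling_error_def)
      have "0 \<le> 1 / (real n - 1) + 1 / real n" using n by simp
      then show "1 / (real n - 1) + 1 / real n \<le> (1 + \<bar>t\<bar>) * (1 / (real n - 1) + 1 / real n)"
        using mult_right_mono[of 1 "1 + \<bar>t\<bar>" "1 / (real n - 1) + 1 / real n"] by simp
    qed auto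
    also have "\<dots> = (1 + \<bar>t\<bar>) * \<epsilon> n" by (simp add: \<epsilon>_def distrib_left)
    finally show ?thesis .
  qed
  then show thesis using lim by (intro that[of \<epsilon>]) auto
qed

section \<open>Contraction for the characteristic functions\<close>

lemma gap_le_1:
  assumes "0 < fst z" "fst z < 1" "0 < snd z" "snd z < 1"
  shows "0 \<le> gap1 z" "gap1 z \<le> 1" "0 \<le> gap2 z" "gap2 z \<le> 1" "0 \<le> gap3 z" "gap3 z \<le> (1::real)"
  using assms by auto

lemma gap_squares:
  "integrable unif2 (\<lambda>z. (gap1 z)\<^sup>2 + (gap2 z)\<^sup>2 + (gap3 z)\<^sup>2)"
proof (rule unif_pair.P.integrable_const_bound[where B = 3])
  show "AE z in unif2. norm ((gap1 z)\<^sup>2 + (gap2 z)\<^sup>2 + (gap3 z)\<^sup>2) \<le> 3"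
    using AE_unif_pair
  proof eventually_elim
    case (elim z)
    have "x\<^sup>2 \<le> 1" if "0 \<le> x" "x \<le> 1" for x :: real using that by (simp add: power_le_one)
    then have "(gap1 z)\<^sup>2 \<le> 1" "(gap2 z)\<^sup>2 \<le> 1" "(gap3 z)\<^sup>2 \<le> 1" using gap_le_1[of z] elim by blast+
    then show ?case by (simp del: min_def max_def)
  qed
qed measurable

lemma rde_char_contract:
  fixes f g :: "real \<Rightarrow> complex"
  assumes [measurable]: "f \<in> borel_measurable borel" "g \<in> borel_measurable borel"
    and le1: "\<And>s. cmod (f s) \<le> 1" "\<And>s. cmod (g s) \<le> 1"
    and bound: "\<And>s. cmod (f s - g s) \<le> C * s\<^sup>2"
  shows "cmod (rde_char (\<lambda>_. f) (\<lambda>_. f) (\<lambda>_. f) t - rde_char (\<lambda>_. g) (\<lambda>_. g) (\<lambda>_. g) t) \<le> C / 2 * t\<^sup>2"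
proof -
  have "cmod (rde_char (\<lambda>_. f) (\<lambda>_. f) (\<lambda>_. f) t - rde_char (\<lambda>_. g) (\<lambda>_. g) (\<lambda>_. g) t) \<le>
    (LINT z|unif2. C * t\<^sup>2 * ((gap1 z)\<^sup>2 + (gap2 z)\<^sup>2 + (gap3 z)\<^sup>2))"
  proof (rule rde_char_diff)
    show "AE z in unif2. cmod (f (t * gap1 z) - g (t * gap1 z)) + cmod (f (t * gap2 z) - g (t * gap2 z))
      + cmod (f (t * gap3 z) - g (t * gap3 z)) \<le> C * t\<^sup>2 * ((gap1 z)\<^sup>2 + (gap2 z)\<^sup>2 + (gap3 z)\<^sup>2)"
    proof (rule AE_I2)
      fix z
      have "cmod (f (t * gap1 z) - g (t * gap1 z)) + cmod (f (t * gap2 z) - g (t * gap2 z))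
        + cmod (f (t * gap3 z) - g (t * gap3 z)) \<le> C * (t * gap1 z)\<^sup>2 + C * (t * gap2 z)\<^sup>2 + C * (t * gap3 z)\<^sup>2"
        by (intro add_mono bound)
      also have "\<dots> = C * t\<^sup>2 * ((gap1 z)\<^sup>2 + (gap2 z)\<^sup>2 + (gap3 z)\<^sup>2)"
        by (simp only: power_mult_distrib distrib_left mult.assoc)
      finally show "cmod (f (t * gap1 z) - g (t * gap1 z)) + cmod (f (t * gap2 z) - g (t * gap2 z))
      + cmod (f (t * gap3 z) - g (t * gap3 z)) \<le> C * t\<^sup>2 * ((gap1 z)\<^sup>2 + (gap2 z)\<^sup>2 + (gap3 z)\<^sup>2)" .
    qed
    show "integrable unif2 (\<lambda>z. C * t\<^sup>2 * ((gap1 z)\<^sup>2 + (gap2 z)\<^sup>2 + (gap3 z)\<^sup>2))"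
      by (intro integrable_mult_right gap_squares)
  next
    fix h assume "h \<in> {\<lambda>_. f, \<lambda>_. f, \<lambda>_. f, \<lambda>_. g, \<lambda>_. g, \<lambda>_::real \<times> real. g}"
    then show "(\<lambda>z. h z (t * gap1 z)) \<in> borel_measurable (borel \<Otimes>\<^sub>M borel) \<and>
      (\<lambda>z. h z (t * gap2 z)) \<in> borel_measurable (borel \<Otimes>\<^sub>M borel) \<and> (\<lambda>z. h z (t * gap3 z)) \<in> borel_measurable (borel \<Otimes>\<^sub>M borel)"
      by auto
  next
    fix h z s assume "h \<in> {\<lambda>_. f, \<lambda>_. f, \<lambda>_. f, \<lambda>_. g, \<lambda>_. g, \<lambda>_::real \<times> real. g}"
    then show "cmod (h z s) \<le> 1" using le1 by auto
  qed
  also have "\<dots> = C / 2 * t\<^sup>2" unfolding integral_mult_right_zero gaps_second_moment by simp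
  finally show ?thesis .
qed

text \<open>The inductive bound on differences of characteristic functions holds only for indices
  beyond some \<open>N\<close>. This shows that the exceptional event, a block shorter than
  \<open>N\<close>, becomes negligible.\<close>

lemma small_block_prob_tendsto:
  fixes N :: nat
  defines "B \<equiv> \<lambda>n z. of_bool (cblock1 n z < N) + of_bool (cblock2 n z < N) + (of_bool (cblock3 n z < N) :: real)"
  shows "(\<lambda>n. LINT z|unif2. B n z) \<longlonglongrightarrow> 0"
proof -
  have "(\<lambda>n. LINT z|unif2. B n z) \<longlonglongrightarrow> (LINT z|unif2. 0)"
    unfolding B_def
  proof (rule pavg_blocks_tendsto(2)[where h = "\<lambda>n i1 i2 i3. of_bool (i1 < N) + of_bool (i2 < N) + of_bool (i3 < N)" and C = 3])
    fix z :: "real \<times> real" assume z: "0 < fst z" "fst z < 1" "0 < snd z" "snd z < 1" "fst z \<noteq> snd z"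
    have "\<forall>\<^sub>F n in sequentially. N \<le> cblock1 n z" "\<forall>\<^sub>F n in sequentially. N \<le> cblock2 n z"
      "\<forall>\<^sub>F n in sequentially. N \<le> cblock3 n z"
      using cblocks_at_top[OF z] by (auto simp: filterlim_at_top)
    then have "\<forall>\<^sub>F n in sequentially. of_bool (cblock1 n z < N) + of_bool (cblock2 n z < N) + of_bool (cblock3 n z < N) = (0::real)"
      by eventually_elim auto
    then show "(\<lambda>n. of_bool (cblock1 n z < N) + of_bool (cblock2 n z < N) + of_bool (cblock3 n z < N) :: real) \<longlonglongrightarrow> 0"
      by (rule tendsto_eventually)
  qed auto
  then show ?thesis by simp
qed

text \<open>If both indices of a factor reach \<open>N\<close>, the hypothesis applies, since
  spacings are at most 1 and keep the argument within \<open>T\<close>; otherwise the trivial bound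
  2 is charged to the event that a block is short. The main term is halved by the expected sum of
  squared spacings, and the three factors contribute \<open>\<eta>\<close> each.\<close>

lemma rde_char_blocks_diff:
  assumes n: "0 < n" "0 < k" and t: "\<bar>t\<bar> \<le> T" and c: "0 \<le> c" "0 \<le> \<eta>"
    and bound: "\<And>i j s. N \<le> i \<Longrightarrow> N \<le> j \<Longrightarrow> \<bar>s\<bar> \<le> T \<Longrightarrow> cmod (Zchar M i s - Zchar M j s) \<le> c * s\<^sup>2 + \<eta>"
  defines "B \<equiv> \<lambda>n z. of_bool (cblock1 n z < N) + of_bool (cblock2 n z < N) + (of_bool (cblock3 n z < N) :: real)"
  shows "cmod (rde_char_blocks M n t - rde_char_blocks M k t) \<le>
    c / 2 * t\<^sup>2 + 3 * \<eta> + 2 * (LINT z|unif2. B n z) + 2 * (LINT z|unif2. B k z)"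
proof -
  let ?g = "\<lambda>z. (gap1 z)\<^sup>2 + (gap2 z)\<^sup>2 + (gap3 z)\<^sup>2 :: real"
  let ?h = "\<lambda>z. ((c * t\<^sup>2 * ?g z + 3 * \<eta>) + 2 * B n z) + 2 * B k z"
  have B_int: "integrable unif2 (B m)" if "0 < m" for m
    unfolding B_def
    by (rule integrable_of_cblocks(2)[OF that, of "\<lambda>i1 i2 i3. of_bool (i1 < N) + of_bool (i2 < N) + of_bool (i3 < N)"])
  have i1: "integrable unif2 (\<lambda>z. c * t\<^sup>2 * ?g z)" by (intro integrable_mult_right gap_squares)
  have i2: "integrable unif2 (\<lambda>z. c * t\<^sup>2 * ?g z + 3 * \<eta>)"
    by (intro Bochner_Integration.integrable_add i1) simp
  have i3: "integrable unif2 (\<lambda>z. (c * t\<^sup>2 * ?g z + 3 * \<eta>) + 2 * B n z)"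
    by (intro Bochner_Integration.integrable_add i2 integrable_mult_right B_int n)
  have i4: "integrable unif2 ?h"
    by (intro Bochner_Integration.integrable_add i3 integrable_mult_right B_int n)
  have "cmod (rde_char_blocks M n t - rde_char_blocks M k t) \<le> (LINT z|unif2. ?h z)"
  proof (rule rde_char_diff)
    show "AE z in unif2. cmod (Zchar M (cblock1 n z) (t * gap1 z) - Zchar M (cblock1 k z) (t * gap1 z))
      + cmod (Zchar M (cblock2 n z) (t * gap2 z) - Zchar M (cblock2 k z) (t * gap2 z))
      + cmod (Zchar M (cblock3 n z) (t * gap3 z) - Zchar M (cblock3 k z) (t * gap3 z)) \<le> ?h z"
      using AE_unif_pair
    proof eventually_elim
      case (elim z)
      have one: "cmod (Zchar M i (t * x) - Zchar M j (t * x)) \<le> c * t\<^sup>2 * x\<^sup>2 + \<eta> + 2 * of_bool (i < N) + 2 * of_bool (j < N)"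
        if "0 \<le> x" "x \<le> 1" for i j x
      proof (cases "N \<le> i \<and> N \<le> j")
        case True
        have "\<bar>t * x\<bar> \<le> T * 1" unfolding abs_mult using t that by (intro mult_mono) auto
        then have "cmod (Zchar M i (t * x) - Zchar M j (t * x)) \<le> c * (t * x)\<^sup>2 + \<eta>" using True by (intro bound) auto
        then show ?thesis using True by (simp add: power_mult_distrib mult.assoc)
      next
        case False
        have "cmod (Zchar M i (t * x) - Zchar M j (t * x)) \<le> 1 + 1"
          by (intro order_trans[OF norm_triangle_ineq4] add_mono Zchar_le_1)
        moreover have "0 \<le> c * t\<^sup>2 * x\<^sup>2" using c by simp
        moreover have "1 \<le> of_bool (i < N) + (of_bool (j < N) :: real)" using False by auto
        ultimately show ?thesis using c(2) by linarith
      qed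
      have g: "0 \<le> gap1 z" "gap1 z \<le> 1" "0 \<le> gap2 z" "gap2 z \<le> 1" "0 \<le> gap3 z" "gap3 z \<le> 1"
        using gap_le_1[of z] elim by auto
      show ?case
        using add_mono[OF add_mono[OF one[OF g(1,2), of "cblock1 n z" "cblock1 k z"] one[OF g(3,4), of "cblock2 n z" "cblock2 k z"]]
          one[OF g(5,6), of "cblock3 n z" "cblock3 k z"]]
        unfolding B_def distrib_left by linarith
    qed
    show "integrable unif2 ?h" by (rule i4)
  next
    fix f assume "f \<in> {\<lambda>z. Zchar M (cblock1 n z), \<lambda>z. Zchar M (cblock2 n z), \<lambda>z. Zchar M (cblock3 n z),
      \<lambda>z. Zchar M (cblock1 k z), \<lambda>z. Zchar M (cblock2 k z), \<lambda>z. Zchar M (cblock3 k z)}"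
    then show "(\<lambda>z. f z (t * gap1 z)) \<in> borel_measurable (borel \<Otimes>\<^sub>M borel) \<and>
      (\<lambda>z. f z (t * gap2 z)) \<in> borel_measurable (borel \<Otimes>\<^sub>M borel) \<and> (\<lambda>z. f z (t * gap3 z)) \<in> borel_measurable (borel \<Otimes>\<^sub>M borel)"
      by (auto intro!: measurable_Zchar_random)
  next
    fix f z s assume "f \<in> {\<lambda>z. Zchar M (cblock1 n z), \<lambda>z. Zchar M (cblock2 n z), \<lambda>z. Zchar M (cblock3 n z),
      \<lambda>z. Zchar M (cblock1 k z), \<lambda>z. Zchar M (cblock2 k z), \<lambda>z. Zchar M (cblock3 k z)}"
    then show "cmod (f z s) \<le> 1" by (auto simp: Zchar_le_1)
  qed
  also have "(LINT z|unif2. ?h z) = (LINT z|unif2. (c * t\<^sup>2 * ?g z + 3 * \<eta>) + 2 * B n z) + (LINT z|unif2. 2 * B k z)"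
    by (intro Bochner_Integration.integral_add i3 integrable_mult_right B_int n)
  also have "(LINT z|unif2. (c * t\<^sup>2 * ?g z + 3 * \<eta>) + 2 * B n z) = (LINT z|unif2. c * t\<^sup>2 * ?g z + 3 * \<eta>) + (LINT z|unif2. 2 * B n z)"
    by (intro Bochner_Integration.integral_add i2 integrable_mult_right B_int n)
  also have "(LINT z|unif2. c * t\<^sup>2 * ?g z + 3 * \<eta>) = (LINT z|unif2. c * t\<^sup>2 * ?g z) + (LINT z|unif2. 3 * \<eta>)"
    by (intro Bochner_Integration.integral_add i1) simp
  finally show ?thesis
    unfolding integral_mult_right_zero gaps_second_moment by (simp add: unif_pair.P.prob_space)
qed

text \<open>
  Each application of the recurrence halves the constant of \<open>t\<^sup>2\<close>, because the spacings satisfy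
  \<open>E (D\<^sub>1\<^sup>2 + D\<^sub>2\<^sup>2 + D\<^sub>3\<^sup>2) = 1/2\<close>; the bound on the second moments starts the induction.
\<close>

lemma Zchar_contraction:
  assumes M: "0 < M" and K: "\<And>n. Zvar M n \<le> K" and "0 < T" "0 < \<eta>"
  shows "\<exists>N. \<forall>n\<ge>N. \<forall>k\<ge>N. \<forall>t. \<bar>t\<bar> \<le> T \<longrightarrow> cmod (Zchar M n t - Zchar M k t) \<le> K / 2 ^ m * t\<^sup>2 + \<eta>"
  using \<open>0 < \<eta>\<close>
proof (induction m arbitrary: \<eta>)
  case 0
  have "cmod (Zchar M n t - Zchar M k t) \<le> K * t\<^sup>2" for n k t
  proof -
    have "cmod (Zchar M n t - 1) \<le> K / 2 * t\<^sup>2" for n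
      using K[of n] by (intro order_trans[OF Zchar_near_one] mult_right_mono) auto
    then have "cmod (Zchar M n t - 1) + cmod (1 - Zchar M k t) \<le> K / 2 * t\<^sup>2 + K / 2 * t\<^sup>2"
      by (metis add_mono norm_minus_commute)
    then show ?thesis using norm_triangle_ineq[of "Zchar M n t - 1" "1 - Zchar M k t"] by simp
  qed
  then show ?case using 0 by (auto intro!: exI[of _ 0] simp: add_increasing2)
next
  case (Suc m)
  have K0: "0 \<le> K" using K[of 0] Zvar_nonneg[of M 0] by linarith
  \<comment> \<open>Nine shares are spent: two for the approximations of the two characteristic
    functions, three for the factors, and two for the short blocks of each of \<open>n\<close> and
    \<open>k\<close>.\<close>
  define \<delta> where "\<delta> = \<eta> / 9"
  have \<delta>: "0 < \<delta>" using Suc.prems by (simp add: \<delta>_def)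
  obtain N where N: "\<And>i j s. N \<le> i \<Longrightarrow> N \<le> j \<Longrightarrow> \<bar>s\<bar> \<le> T \<Longrightarrow> cmod (Zchar M i s - Zchar M j s) \<le> K / 2 ^ m * s\<^sup>2 + \<delta>"
    using Suc.IH[OF \<delta>] by blast
  let ?B = "\<lambda>n z. of_bool (cblock1 n z < N) + of_bool (cblock2 n z < N) + (of_bool (cblock3 n z < N) :: real)"
  obtain \<epsilon> where \<epsilon>: "\<epsilon> \<longlonglongrightarrow> 0" "\<And>n t. max 4 (Suc M) \<le> n \<Longrightarrow> cmod (Zchar M n t - rde_char_blocks M n t) \<le> (1 + \<bar>t\<bar>) * \<epsilon> n"
    using Zchar_approx[OF M] by blast
  have "(\<lambda>n. (1 + T) * \<epsilon> n) \<longlonglongrightarrow> (1 + T) * 0" by (intro tendsto_mult tendsto_const \<epsilon>)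
  then have "\<forall>\<^sub>F n in sequentially. (1 + T) * \<epsilon> n < \<delta>" by (rule order_tendstoD) (use \<delta> in simp)
  moreover have "\<forall>\<^sub>F n in sequentially. (LINT z|unif2. ?B n z) < \<delta>"
    by (rule order_tendstoD(2)[OF small_block_prob_tendsto \<delta>])
  ultimately have "\<forall>\<^sub>F n in sequentially. (1 + T) * \<epsilon> n < \<delta> \<and> (LINT z|unif2. ?B n z) < \<delta> \<and> max 4 (Suc M) \<le> n"
    using eventually_ge_at_top[of "max 4 (Suc M)"] by eventually_elim auto
  then obtain N' where N': "\<And>n. N' \<le> n \<Longrightarrow> (1 + T) * \<epsilon> n < \<delta>" "\<And>n. N' \<le> n \<Longrightarrow> (LINT z|unif2. ?B n z) < \<delta>"
    "\<And>n. N' \<le> n \<Longrightarrow> max 4 (Suc M) \<le> n"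
    unfolding eventually_sequentially by blast
  have "cmod (Zchar M n t - Zchar M k t) \<le> K / 2 ^ Suc m * t\<^sup>2 + \<eta>" if nk: "N' \<le> n" "N' \<le> k" and t: "\<bar>t\<bar> \<le> T" for n k t
  proof -
    have app: "cmod (Zchar M i t - rde_char_blocks M i t) \<le> \<delta>" if "N' \<le> i" for i
    proof -
      have e: "cmod (Zchar M i t - rde_char_blocks M i t) \<le> (1 + \<bar>t\<bar>) * \<epsilon> i" by (rule \<epsilon>(2)[OF N'(3)[OF that]])
      \<comment> \<open>\<open>\<epsilon> i\<close> is nonnegative because a positive multiple of it
        bounds a norm; this permits enlarging \<open>\<bar>t\<bar>\<close> to
        \<open>T\<close>.\<close>
      then have "0 \<le> (1 + \<bar>t\<bar>) * \<epsilon> i" by (rule order_trans[OF norm_ge_zero])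
      then have "0 \<le> \<epsilon> i" using abs_ge_zero[of t] by (auto simp: zero_le_mult_iff)
      then have "(1 + \<bar>t\<bar>) * \<epsilon> i \<le> (1 + T) * \<epsilon> i" using t by (intro mult_right_mono) auto
      then show ?thesis using e N'(1)[OF that] by linarith
    qed
    have "0 < n" "0 < k" using N'(3)[OF nk(1)] N'(3)[OF nk(2)] by auto
    then have mid: "cmod (rde_char_blocks M n t - rde_char_blocks M k t) \<le>
      K / 2 ^ m / 2 * t\<^sup>2 + 3 * \<delta> + 2 * (LINT z|unif2. ?B n z) + 2 * (LINT z|unif2. ?B k z)"
      using K0 \<delta> by (intro rde_char_blocks_diff[OF _ _ t _ _ N]) auto
    have "cmod (rde_char_blocks M k t - Zchar M k t) \<le> \<delta>" using app[OF nk(2)] by (simp only: norm_minus_commute)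
    then have "cmod (Zchar M n t - Zchar M k t) \<le> \<delta> +
      (K / 2 ^ m / 2 * t\<^sup>2 + 3 * \<delta> + 2 * (LINT z|unif2. ?B n z) + 2 * (LINT z|unif2. ?B k z)) + \<delta>"
      by (rule norm_diff_triangle_le[OF norm_diff_triangle_le[OF app[OF nk(1)] mid]])
    also have "\<dots> \<le> K / 2 ^ m / 2 * t\<^sup>2 + 9 * \<delta>" using N'(2)[OF nk(1)] N'(2)[OF nk(2)] by linarith
    finally show ?thesis by (simp add: \<delta>_def mult.commute)
  qed
  then show ?case by blast
qed

text \<open>No candidate for the limit is available yet, so terms of the sequence are compared with
  each other. The coefficient \<open>K / 2 ^ m\<close> and the additive error can both be made
  arbitrarily small.\<close>

lemma Zchar_convergent:
  assumes M: "0 < M"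
  shows "convergent (\<lambda>n. Zchar M n t)"
proof -
  obtain K where K: "0 \<le> K" "\<And>n. Zvar M n \<le> K" using Zvar_bounded[OF M] by blast
  have "Cauchy (\<lambda>n. Zchar M n t)"
  proof (rule metric_CauchyI)
    fix e :: real assume e: "0 < e"
    have "(\<lambda>m. K * t\<^sup>2 / 2 ^ m) \<longlonglongrightarrow> 0" by (rule LIMSEQ_divide_realpow_zero) simp
    then have "\<forall>\<^sub>F m in sequentially. K * t\<^sup>2 / 2 ^ m < e / 2" by (rule order_tendstoD) (use e in simp)
    then obtain m where m: "K * t\<^sup>2 / 2 ^ m < e / 2" by (auto simp: eventually_sequentially)
    obtain N where "\<forall>n\<ge>N. \<forall>k\<ge>N. \<forall>s. \<bar>s\<bar> \<le> \<bar>t\<bar> + 1 \<longrightarrow> cmod (Zchar M n s - Zchar M k s) \<le> K / 2 ^ m * s\<^sup>2 + e / 4"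
      using Zchar_contraction[OF M K(2), of "\<bar>t\<bar> + 1" "e / 4" m] e by (auto simp: add_pos_nonneg add.commute)
    then have "\<forall>n\<ge>N. \<forall>k\<ge>N. cmod (Zchar M n t - Zchar M k t) \<le> K / 2 ^ m * t\<^sup>2 + e / 4" by simp
    then show "\<exists>N. \<forall>n\<ge>N. \<forall>k\<ge>N. dist (Zchar M n t) (Zchar M k t) < e"
      using m e by (intro exI[of _ N]) (fastforce simp: dist_norm)
  qed
  then show ?thesis by (rule Cauchy_convergent)
qed

section \<open>Tightness and existence of the limit law\<close>

lemma tight_Zlaw:
  assumes M: "0 < M"
  shows "tight (Zlaw M)"
proof -
  obtain K where K: "0 \<le> K" "\<And>n. Zvar M n \<le> K" using Zvar_bounded[OF M] by blast
  show ?thesis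
    unfolding tight_def
  proof (intro conjI allI impI real_distribution_Zlaw)
    fix \<epsilon> :: real assume \<epsilon>: "0 < \<epsilon>"
    define a where "a = sqrt (K / \<epsilon>) + 1"
    have a: "0 < a" using K \<epsilon> by (simp add: a_def add_nonneg_pos)
    have "K / \<epsilon> < a\<^sup>2"
    proof -
      have "(sqrt (K / \<epsilon>))\<^sup>2 < a\<^sup>2" using K \<epsilon> by (intro power_strict_mono) (auto simp: a_def)
      then show ?thesis using K \<epsilon> by simp
    qed
    then have Ka: "K / a\<^sup>2 < \<epsilon>" using \<epsilon> a by (simp add: field_simps)
    have "1 - \<epsilon> < measure (Zlaw M n) {- a<..a}" for n
    proof -
      interpret Z: real_distribution "Zlaw M n" by (rule real_distribution_Zlaw)
      have "Z.prob {x \<in> space (Zlaw M n). a \<le> \<bar>x - Z.expectation (\<lambda>x. x)\<bar>} \<le> Z.variance (\<lambda>x. x) / a\<^sup>2"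
        by (rule Z.Chebyshev_inequality) (use a in \<open>auto intro!: integrable_Zlaw\<close>)
      then have "Z.prob {x. a \<le> \<bar>x\<bar>} \<le> Zvar M n / a\<^sup>2" by (simp add: Zlaw_moments)
      also have "\<dots> \<le> K / a\<^sup>2" using K by (intro divide_right_mono) auto
      finally have "Z.prob {x. a \<le> \<bar>x\<bar>} < \<epsilon>" using Ka by simp
      moreover have "1 - Z.prob {- a<..a} = Z.prob (UNIV - {- a<..a})"
        using Z.prob_compl[of "{- a<..a}"] by simp
      moreover have "Z.prob (UNIV - {- a<..a}) \<le> Z.prob {x. a \<le> \<bar>x\<bar>}"
        by (rule Z.finite_measure_mono) auto
      ultimately show ?thesis by linarith
    qed
    then show "\<exists>a b. a < b \<and> (\<forall>n. 1 - \<epsilon> < measure (Zlaw M n) {a<..b})"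
      using a by (intro exI[of _ "- a"] exI[of _ a]) auto
  qed
qed

text \<open>Pointwise convergence alone does not show that the limit is a characteristic function.
  Tightness yields a weakly convergent subsequence, whose limit law has the pointwise limit as its
  characteristic function; the continuity theorem then extends the convergence to the whole
  sequence.\<close>

lemma Zlaw_limit:
  assumes M: "0 < M"
  obtains \<mu> where "real_distribution \<mu>" "weak_conv_m (Zlaw M) \<mu>"
proof -
  obtain r \<mu> where r: "strict_mono (r :: nat \<Rightarrow> nat)" and \<mu>: "real_distribution \<mu>" and w: "weak_conv_m (Zlaw M \<circ> id \<circ> r) \<mu>"
    using tight_imp_convergent_subsubsequence[OF tight_Zlaw[OF M] strict_mono_id] by blast
  have "(\<lambda>n. Zchar M n t) \<longlonglongrightarrow> char \<mu> t" for t
  proof -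
    obtain l where l: "(\<lambda>n. Zchar M n t) \<longlonglongrightarrow> l" using Zchar_convergent[OF M] by (auto simp: convergent_def)
    have "(\<lambda>n. Zchar M (r n) t) \<longlonglongrightarrow> char \<mu> t"
      using levy_continuity1[OF _ \<mu> w] real_distribution_Zlaw by (simp add: comp_def)
    moreover have "(\<lambda>n. Zchar M (r n) t) \<longlonglongrightarrow> l" using LIMSEQ_subseq_LIMSEQ[OF l r] by (simp add: comp_def)
    ultimately show ?thesis using l LIMSEQ_unique by blast
  qed
  then have "weak_conv_m (Zlaw M) \<mu>" by (intro levy_continuity real_distribution_Zlaw \<mu>)
  then show thesis using \<mu> by (rule that[rotated])
qed

section \<open>The fixed-point equation\<close>

text \<open>Weak convergence controls only bounded continuous functions. Truncating the square at
  \<open>R\<close> keeps its integral below the common variance bound, and monotone convergence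
  removes the truncation. Clipping the identity at \<open>R\<close> changes means by at most a
  second moment over \<open>R\<close>, which carries centring over to the limit.\<close>

lemma weak_limit_moments:
  assumes M: "0 < M" and \<mu>: "real_distribution \<mu>" and w: "weak_conv_m (Zlaw M) \<mu>"
  shows "integrable \<mu> (\<lambda>x. x\<^sup>2)" "(LINT x|\<mu>. x) = 0"
proof -
  interpret real_distribution \<mu> by fact
  obtain K where K: "0 \<le> K" "\<And>n. Zvar M n \<le> K" using Zvar_bounded[OF M] by blast
  have trunc_conv: "(\<lambda>n. LINT x|Zlaw M n. f x) \<longlonglongrightarrow> (LINT x|\<mu>. f x)"
    if "\<And>x. isCont f x" "\<And>x. norm (f x) \<le> Q" for f :: "real \<Rightarrow> real" and Q :: real
    by (rule weak_conv_imp_integral_bdd_continuous_conv[OF real_distribution_Zlaw \<mu> w that])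
  have trunc_int: "integrable \<mu> (\<lambda>x. min (x\<^sup>2) R)" if "0 \<le> R" for R
    by (rule integrable_const_bound[where B = R]) (use that in auto)
  have trunc_le: "(LINT x|\<mu>. min (x\<^sup>2) R) \<le> K" if R: "0 \<le> R" for R
  proof (rule LIMSEQ_le_const2)
    show "(\<lambda>n. LINT x|Zlaw M n. min (x\<^sup>2) R) \<longlonglongrightarrow> (LINT x|\<mu>. min (x\<^sup>2) R)"
      by (rule trunc_conv[of _ R]) (use R in \<open>auto intro!: continuous_intros\<close>)
    have "(LINT x|Zlaw M n. min (x\<^sup>2) R) \<le> (LINT x|Zlaw M n. x\<^sup>2)" for n
      by (intro integral_mono integrable_Zlaw) auto
    then show "\<exists>N. \<forall>n\<ge>N. (LINT x|Zlaw M n. min (x\<^sup>2) R) \<le> K"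
      using K(2) by (auto simp: Zlaw_moments intro: order_trans)
  qed
  define I where "I k = (LINT x|\<mu>. min (x\<^sup>2) (real k))" for k :: nat
  have "incseq I"
    unfolding I_def by (intro incseq_SucI integral_mono trunc_int) auto
  then obtain l where l: "I \<longlonglongrightarrow> l"
    using incseq_convergent[of I K] trunc_le unfolding I_def by (metis of_nat_0_le_iff)
  show sq: "integrable \<mu> (\<lambda>x. x\<^sup>2)"
  proof (rule integrable_monotone_convergence)
    show "integrable \<mu> (\<lambda>x. min (x\<^sup>2) (real k))" for k by (rule trunc_int) simp
    show "AE x in \<mu>. mono (\<lambda>k. min (x\<^sup>2) (real k))" by (auto simp: mono_def)
    show "AE x in \<mu>. (\<lambda>k. min (x\<^sup>2) (real k)) \<longlonglongrightarrow> x\<^sup>2"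
    proof (rule AE_I2)
      fix x :: real
      have "\<forall>\<^sub>F k in sequentially. x\<^sup>2 \<le> real k"
        using filterlim_real_sequentially unfolding filterlim_at_top by blast
      then have "\<forall>\<^sub>F k in sequentially. min (x\<^sup>2) (real k) = x\<^sup>2" by eventually_elim simp
      then show "(\<lambda>k. min (x\<^sup>2) (real k)) \<longlonglongrightarrow> x\<^sup>2" by (rule tendsto_eventually)
    qed
    show "(\<lambda>k. LINT x|\<mu>. min (x\<^sup>2) (real k)) \<longlonglongrightarrow> l" using l by (simp add: I_def[abs_def])
  qed simp
  have int_id: "integrable \<mu> (\<lambda>x. x)"
    by (rule square_integrable_imp_integrable) (use sq in auto)
  define clip where "clip R x = max (- R) (min x R)" for R x :: real
  have clip_diff: "\<bar>x - clip R x\<bar> \<le> x\<^sup>2 / R" if R: "0 < R" for R x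
  proof (cases "\<bar>x\<bar> \<le> R")
    case True
    then show ?thesis using R by (auto simp: clip_def)
  next
    case False
    have "\<bar>x\<bar> * R \<le> x\<^sup>2" using False R mult_left_mono[of R "\<bar>x\<bar>" "\<bar>x\<bar>"] by (simp add: power2_eq_square)
    then have "\<bar>x\<bar> \<le> x\<^sup>2 / R" using R by (simp add: field_simps)
    moreover have "\<bar>x - clip R x\<bar> \<le> \<bar>x\<bar>" using R False by (auto simp: clip_def)
    ultimately show ?thesis by linarith
  qed
  have clip_cont: "isCont (clip R) x" for R x unfolding clip_def by (intro continuous_intros)
  have clip_bdd: "norm (clip R x) \<le> R" if "0 < R" for R x using that by (auto simp: clip_def)
  have clip_meas [measurable]: "clip R \<in> borel_measurable borel" for R unfolding clip_def[abs_def] by measurable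
  have mean_bound: "\<bar>LINT x|\<mu>. x\<bar> \<le> (K + (LINT x|\<mu>. x\<^sup>2)) / R" if R: "0 < R" for R
  proof -
    have "\<bar>LINT x|\<mu>. clip R x\<bar> \<le> K / R"
    proof (rule LIMSEQ_le_const2)
      show "(\<lambda>n. \<bar>LINT x|Zlaw M n. clip R x\<bar>) \<longlonglongrightarrow> \<bar>LINT x|\<mu>. clip R x\<bar>"
        by (intro tendsto_rabs trunc_conv[of _ R] clip_cont clip_bdd R)
      have "\<bar>LINT x|Zlaw M n. clip R x\<bar> \<le> K / R" for n
      proof -
        have "(LINT x|Zlaw M n. clip R x) = - (LINT x|Zlaw M n. x - clip R x)"
          by (subst Bochner_Integration.integral_diff) (auto intro!: integrable_Zlaw simp: Zlaw_moments)
        then have "\<bar>LINT x|Zlaw M n. clip R x\<bar> \<le> (LINT x|Zlaw M n. \<bar>x - clip R x\<bar>)"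
          using integral_abs_bound[of "Zlaw M n" "\<lambda>x. x - clip R x"] by simp
        also have "\<dots> \<le> (LINT x|Zlaw M n. x\<^sup>2 / R)"
          by (intro integral_mono integrable_Zlaw clip_diff R) auto
        also have "\<dots> = Zvar M n / R" by (simp add: Zlaw_moments)
        also have "\<dots> \<le> K / R" using K R by (intro divide_right_mono) auto
        finally show ?thesis .
      qed
      then show "\<exists>N. \<forall>n\<ge>N. \<bar>LINT x|Zlaw M n. clip R x\<bar> \<le> K / R" by blast
    qed
    moreover have "\<bar>(LINT x|\<mu>. x) - (LINT x|\<mu>. clip R x)\<bar> \<le> (LINT x|\<mu>. x\<^sup>2) / R"
    proof -
      have ci: "integrable \<mu> (clip R)"
        by (rule integrable_const_bound[where B = R]) (use clip_bdd[OF R] in auto)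
      have "(LINT x|\<mu>. x) - (LINT x|\<mu>. clip R x) = (LINT x|\<mu>. x - clip R x)"
        by (rule Bochner_Integration.integral_diff[OF int_id ci, symmetric])
      then have "\<bar>(LINT x|\<mu>. x) - (LINT x|\<mu>. clip R x)\<bar> \<le> (LINT x|\<mu>. \<bar>x - clip R x\<bar>)"
        by (simp only: integral_abs_bound)
      also have "\<dots> \<le> (LINT x|\<mu>. x\<^sup>2 / R)"
        by (intro integral_mono integrable_abs Bochner_Integration.integrable_diff int_id ci integrable_divide sq clip_diff R)
      finally show ?thesis by simp
    qed
    ultimately show ?thesis by (simp add: add_divide_distrib)
  qed
  have "(\<lambda>k. (K + (LINT x|\<mu>. x\<^sup>2)) / real k) \<longlonglongrightarrow> 0" by (rule lim_const_over_n)
  moreover have "\<forall>\<^sub>F k in sequentially. \<bar>LINT x|\<mu>. x\<bar> \<le> (K + (LINT x|\<mu>. x\<^sup>2)) / real k"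
    using eventually_gt_at_top[of 0] by eventually_elim (rule mean_bound, simp)
  ultimately have "\<bar>LINT x|\<mu>. x\<bar> \<le> 0"
    by (intro tendsto_lowerbound[OF _ _ sequentially_bot]) auto
  then show "(LINT x|\<mu>. x) = 0" by simp
qed

lemma rde_char_blocks_tendsto:
  assumes \<mu>: "real_distribution \<mu>" and lim: "\<And>s. (\<lambda>n. Zchar M n s) \<longlonglongrightarrow> char \<mu> s"
  shows "(\<lambda>n. rde_char_blocks M n t) \<longlonglongrightarrow> rde_char (\<lambda>_. char \<mu>) (\<lambda>_. char \<mu>) (\<lambda>_. char \<mu>) t"
proof -
  interpret real_distribution \<mu> by fact
  let ?G = "\<lambda>n z. iexp (t * toll_limit (gap1 z) (gap2 z) (gap3 z)) * Zchar M (cblock1 n z) (t * gap1 z)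
    * Zchar M (cblock2 n z) (t * gap2 z) * Zchar M (cblock3 n z) (t * gap3 z)"
  let ?l = "\<lambda>z. iexp (t * toll_limit (gap1 z) (gap2 z) (gap3 z)) * char \<mu> (t * gap1 z)
    * char \<mu> (t * gap2 z) * char \<mu> (t * gap3 z)"
  have "integrable unif2 (?G n)" for n
    by (rule integrable_rde_char) (auto intro!: measurable_Zchar_random simp: Zchar_le_1)
  then have G_meas: "?G n \<in> borel_measurable unif2" for n by auto
  have [measurable]: "char \<mu> \<in> borel_measurable borel" by (rule char_measurable)
  have "(\<lambda>n. LINT z|unif2. ?G n z) \<longlonglongrightarrow> (LINT z|unif2. ?l z)"
  proof (rule integral_dominated_convergence[where w = "\<lambda>_. 1"])
    show "?l \<in> borel_measurable unif2" by (rule borel_measurable_unif2) measurable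
    show "AE z in unif2. (\<lambda>n. ?G n z) \<longlonglongrightarrow> ?l z"
      using AE_unif_pair
    proof eventually_elim
      case (elim z)
      then have top: "filterlim (\<lambda>n. cblock1 n z) at_top sequentially" "filterlim (\<lambda>n. cblock2 n z) at_top sequentially"
        "filterlim (\<lambda>n. cblock3 n z) at_top sequentially"
        using cblocks_at_top[of z] by auto
      show ?case
        by (intro tendsto_mult tendsto_const filterlim_compose[OF lim] top)
    qed
    show "AE z in unif2. norm (?G n z) \<le> 1" for n
      by (auto simp: norm_mult Zchar_le_1 intro!: mult_le_one)
    show "?G n \<in> borel_measurable unif2" for n by (rule G_meas)
  qed simp
  then show ?thesis by (simp add: rde_char_def)
qed

section \<open>The law of the right-hand side of the fixed-point equation\<close>

abbreviation spacings :: "real \<times> real \<Rightarrow> real \<times> real \<times> real" where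
  "spacings z \<equiv> (gap1 z, gap2 z, gap3 z)"

lemma spacings_measurable [measurable]: "spacings \<in> measurable unif2 borel"
  by (subst borel_prod[symmetric])+ (rule measurable_Pair, rule borel_measurable_unif2, measurable)+

lemma spacings_law_eq: "spacings_law = distr unif2 borel spacings"
  unfolding spacings_law_def by (simp add: case_prod_beta')

lemma sets_spacings_law [measurable_cong]: "sets spacings_law = sets borel"
  by (simp add: spacings_law_eq)

lemma prob_space_spacings_law: "prob_space spacings_law"
  unfolding spacings_law_eq by (rule unif_pair.P.prob_space_distr) measurable

definition rde_sum :: "real \<times> real \<times> real \<Rightarrow> real \<times> real \<times> real \<Rightarrow> real" where
  "rde_sum d x = toll_limit (fst d) (fst (snd d)) (snd (snd d)) +
     (fst d * fst x + (fst (snd d) * fst (snd x) + snd (snd d) * snd (snd x)))"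

lemma rde_rhs_law_eq:
  "rde_rhs_law \<mu> = distr (spacings_law \<Otimes>\<^sub>M (\<mu> \<Otimes>\<^sub>M (\<mu> \<Otimes>\<^sub>M \<mu>))) borel (\<lambda>p. rde_sum (fst p) (snd p))"
  unfolding rde_rhs_law_def
  by (rule arg_cong[where f = "distr _ _"])
    (auto simp: fun_eq_iff rde_sum_def toll_limit_def xlnx_def algebra_simps)

context
  fixes \<mu> :: "real measure"
  assumes \<mu>: "real_distribution \<mu>"
begin

interpretation real_distribution \<mu> by (rule \<mu>)
interpretation sp: prob_space spacings_law by (rule prob_space_spacings_law)
interpretation P2: pair_prob_space \<mu> \<mu> ..
interpretation P3: pair_prob_space \<mu> "\<mu> \<Otimes>\<^sub>M \<mu>" ..
interpretation P4: pair_prob_space spacings_law "\<mu> \<Otimes>\<^sub>M (\<mu> \<Otimes>\<^sub>M \<mu>)" ..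

lemma sets_mu3: "sets (\<mu> \<Otimes>\<^sub>M (\<mu> \<Otimes>\<^sub>M \<mu>)) = sets (borel \<Otimes>\<^sub>M (borel \<Otimes>\<^sub>M borel))"
  by (intro sets_pair_measure_cong) auto

lemma rde_sum_measurable [measurable]:
  "(\<lambda>p. rde_sum (fst p) (snd p)) \<in> borel_measurable (spacings_law \<Otimes>\<^sub>M (\<mu> \<Otimes>\<^sub>M (\<mu> \<Otimes>\<^sub>M \<mu>)))"
proof -
  have "sets (spacings_law \<Otimes>\<^sub>M (\<mu> \<Otimes>\<^sub>M (\<mu> \<Otimes>\<^sub>M \<mu>))) =
      sets ((borel \<Otimes>\<^sub>M (borel \<Otimes>\<^sub>M borel)) \<Otimes>\<^sub>M (borel \<Otimes>\<^sub>M (borel \<Otimes>\<^sub>M borel)) :: ((real \<times> real \<times> real) \<times> (real \<times> real \<times> real)) measure)"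
    by (intro sets_pair_measure_cong sets_mu3) (simp only: sets_spacings_law borel_prod)
  moreover have "(\<lambda>p. rde_sum (fst p) (snd p)) \<in> borel_measurable ((borel \<Otimes>\<^sub>M (borel \<Otimes>\<^sub>M borel)) \<Otimes>\<^sub>M (borel \<Otimes>\<^sub>M (borel \<Otimes>\<^sub>M borel)))"
    unfolding rde_sum_def by measurable
  ultimately show ?thesis by (simp cong: measurable_cong_sets)
qed

lemma real_distribution_rde_rhs_law: "real_distribution (rde_rhs_law \<mu>)"
  unfolding rde_rhs_law_eq by (rule P4.P.real_distribution_distr) measurable

lemma integral_over_spacings:
  fixes g :: "real \<times> real \<times> real \<Rightarrow> real \<times> real \<times> real \<Rightarrow> 'b::{banach, second_countable_topology}"
  assumes int: "integrable (spacings_law \<Otimes>\<^sub>M (\<mu> \<Otimes>\<^sub>M (\<mu> \<Otimes>\<^sub>M \<mu>))) (\<lambda>p. g (fst p) (snd p))"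
  shows "(LINT p|(spacings_law \<Otimes>\<^sub>M (\<mu> \<Otimes>\<^sub>M (\<mu> \<Otimes>\<^sub>M \<mu>))). g (fst p) (snd p)) =
    (LINT z|unif2. LINT y|(\<mu> \<Otimes>\<^sub>M (\<mu> \<Otimes>\<^sub>M \<mu>)). g (spacings z) y)"
proof -
  have meas: "(\<lambda>d. LINT y|(\<mu> \<Otimes>\<^sub>M (\<mu> \<Otimes>\<^sub>M \<mu>)). g d y) \<in> borel_measurable borel"
    using borel_measurable_integrable[OF P4.integrable_fst'[OF int]] by (simp cong: measurable_cong_sets add: sets_spacings_law)
  have "(LINT p|(spacings_law \<Otimes>\<^sub>M (\<mu> \<Otimes>\<^sub>M (\<mu> \<Otimes>\<^sub>M \<mu>))). g (fst p) (snd p)) =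
      (LINT d|spacings_law. LINT y|(\<mu> \<Otimes>\<^sub>M (\<mu> \<Otimes>\<^sub>M \<mu>)). g d y)"
    using P4.integral_fst'[OF int] by simp
  also have "\<dots> = (LINT z|unif2. LINT y|(\<mu> \<Otimes>\<^sub>M (\<mu> \<Otimes>\<^sub>M \<mu>)). g (spacings z) y)"
    unfolding spacings_law_eq by (rule integral_distr[OF spacings_measurable meas])
  finally show ?thesis .
qed

lemma integral_mu3_iexp:
  "(LINT y|(\<mu> \<Otimes>\<^sub>M (\<mu> \<Otimes>\<^sub>M \<mu>)). iexp (a * fst y) * (iexp (b * fst (snd y)) * iexp (c * snd (snd y)))) =
    char \<mu> a * (char \<mu> b * char \<mu> c)"
proof -
  have "integrable (\<mu> \<Otimes>\<^sub>M (\<mu> \<Otimes>\<^sub>M \<mu>)) (\<lambda>y. iexp (a * fst y) * (iexp (b * fst (snd y)) * iexp (c * snd (snd y))))"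
    by (rule P3.P.integrable_const_bound[where B = 1]) (auto simp: norm_mult)
  from P3.integral_fst'[OF this] have
    "(LINT y|(\<mu> \<Otimes>\<^sub>M (\<mu> \<Otimes>\<^sub>M \<mu>)). iexp (a * fst y) * (iexp (b * fst (snd y)) * iexp (c * snd (snd y)))) =
     (LINT x|\<mu>. LINT y|(\<mu> \<Otimes>\<^sub>M \<mu>). iexp (a * x) * (iexp (b * fst y) * iexp (c * snd y)))" by simp
  also have "\<dots> = char \<mu> a * (LINT y|(\<mu> \<Otimes>\<^sub>M \<mu>). iexp (b * fst y) * iexp (c * snd y))"
    unfolding char_def by (simp only: integral_mult_right_zero integral_mult_left_zero)
  also have "(LINT y|(\<mu> \<Otimes>\<^sub>M \<mu>). iexp (b * fst y) * iexp (c * snd y)) = char \<mu> b * char \<mu> c"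
  proof -
    have "integrable (\<mu> \<Otimes>\<^sub>M \<mu>) (\<lambda>y. iexp (b * fst y) * iexp (c * snd y))"
      by (rule P2.P.integrable_const_bound[where B = 1]) (auto simp: norm_mult)
    from P2.integral_fst'[OF this] have
      "(LINT y|(\<mu> \<Otimes>\<^sub>M \<mu>). iexp (b * fst y) * iexp (c * snd y)) = (LINT x|\<mu>. LINT y|\<mu>. iexp (b * x) * iexp (c * y))" by simp
    then show ?thesis unfolding char_def by (simp only: integral_mult_right_zero integral_mult_left_zero)
  qed
  finally show ?thesis .
qed

text \<open>Given the spacings, the exponential of the sum is a product of functions of independent
  variables, so the inner integral factorises and only the integral over the spacings
  remains.\<close>

lemma char_rde_rhs_law:
  "char (rde_rhs_law \<mu>) t = rde_char (\<lambda>_. char \<mu>) (\<lambda>_. char \<mu>) (\<lambda>_. char \<mu>) t"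
proof -
  let ?g = "\<lambda>d y. iexp (t * rde_sum d y)"
  have split: "?g d y = iexp (t * toll_limit (fst d) (fst (snd d)) (snd (snd d))) *
      (iexp (t * fst d * fst y) * (iexp (t * fst (snd d) * fst (snd y)) * iexp (t * snd (snd d) * snd (snd y))))" for d y
    by (simp only: rde_sum_def distrib_left of_real_add exp_add mult.assoc)
  have "integrable (spacings_law \<Otimes>\<^sub>M (\<mu> \<Otimes>\<^sub>M (\<mu> \<Otimes>\<^sub>M \<mu>))) (\<lambda>p. ?g (fst p) (snd p))"
    by (rule P4.P.integrable_const_bound[where B = 1]) auto
  then have "(LINT p|(spacings_law \<Otimes>\<^sub>M (\<mu> \<Otimes>\<^sub>M (\<mu> \<Otimes>\<^sub>M \<mu>))). ?g (fst p) (snd p)) =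
    (LINT z|unif2. LINT y|(\<mu> \<Otimes>\<^sub>M (\<mu> \<Otimes>\<^sub>M \<mu>)). ?g (spacings z) y)"
    by (rule integral_over_spacings)
  also have "\<dots> = rde_char (\<lambda>_. char \<mu>) (\<lambda>_. char \<mu>) (\<lambda>_. char \<mu>) t"
    unfolding rde_char_def split integral_mult_right_zero integral_mu3_iexp by (simp add: mult.assoc)
  finally show ?thesis
    unfolding char_def rde_rhs_law_eq by (subst integral_distr) (auto simp del: of_real_mult)
qed

section \<open>Second moment of a centred fixed point\<close>

context
  assumes sq: "integrable \<mu> (\<lambda>x. x\<^sup>2)" and mean: "(LINT x|\<mu>. x) = 0"
begin

lemma mu_integrable_id: "integrable \<mu> (\<lambda>x. x)"
  by (rule square_integrable_imp_integrable) (use sq in auto)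

lemma prob_UNIV [simp]: "prob UNIV = 1"
  using prob_space by simp

lemma mu_affine_square: "(LINT x|\<mu>. (a + b * x)\<^sup>2) = a\<^sup>2 + b\<^sup>2 * (LINT x|\<mu>. x\<^sup>2)"
proof -
  have "(LINT x|\<mu>. (a + b * x)\<^sup>2) = (LINT x|\<mu>. (a\<^sup>2 + 2 * a * b * x) + b\<^sup>2 * x\<^sup>2)"
    by (simp add: power2_eq_square algebra_simps)
  also have "\<dots> = (LINT x|\<mu>. a\<^sup>2 + 2 * a * b * x) + (LINT x|\<mu>. b\<^sup>2 * x\<^sup>2)"
    by (intro Bochner_Integration.integral_add Bochner_Integration.integrable_add integrable_mult_right sq mu_integrable_id integrable_const)
  also have "(LINT x|\<mu>. a\<^sup>2 + 2 * a * b * x) = (LINT x|\<mu>. a\<^sup>2) + (LINT x|\<mu>. 2 * a * b * x)"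
    by (intro Bochner_Integration.integral_add integrable_mult_right mu_integrable_id integrable_const)
  finally show ?thesis by (simp add: mean prob_space)
qed

lemma mu2_fst_snd_square: "integrable (\<mu> \<Otimes>\<^sub>M \<mu>) (\<lambda>y. (fst y)\<^sup>2)" "integrable (\<mu> \<Otimes>\<^sub>M \<mu>) (\<lambda>y. (snd y)\<^sup>2)"
proof -
  have "integrable (distr (\<mu> \<Otimes>\<^sub>M \<mu>) \<mu> fst) (\<lambda>x. x\<^sup>2)" using sq by (simp add: distr_pair_fst)
  then show 1: "integrable (\<mu> \<Otimes>\<^sub>M \<mu>) (\<lambda>y. (fst y)\<^sup>2)" by (subst (asm) integrable_distr_eq) auto
  from P2.integrable_product_swap[OF this] show "integrable (\<mu> \<Otimes>\<^sub>M \<mu>) (\<lambda>y. (snd y)\<^sup>2)"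
    by (simp add: case_prod_beta')
qed

lemma mu2_square_integrable: "integrable (\<mu> \<Otimes>\<^sub>M \<mu>) (\<lambda>y. (a + (b * fst y + c * snd y))\<^sup>2)"
proof (rule Bochner_Integration.integrable_bound)
  show "integrable (\<mu> \<Otimes>\<^sub>M \<mu>) (\<lambda>y. 3 * (a\<^sup>2 + (b\<^sup>2 * (fst y)\<^sup>2 + c\<^sup>2 * (snd y)\<^sup>2)))"
    by (intro integrable_mult_right Bochner_Integration.integrable_add mu2_fst_snd_square) simp
  have "(x + (y + z))\<^sup>2 \<le> 3 * (x\<^sup>2 + (y\<^sup>2 + z\<^sup>2))" for x y z :: real
    using zero_le_power2[of "x - y"] zero_le_power2[of "x - z"] zero_le_power2[of "y - z"]
    by (simp add: power2_eq_square algebra_simps)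
  then show "AE y in \<mu> \<Otimes>\<^sub>M \<mu>. norm ((a + (b * fst y + c * snd y))\<^sup>2) \<le> norm (3 * (a\<^sup>2 + (b\<^sup>2 * (fst y)\<^sup>2 + c\<^sup>2 * (snd y)\<^sup>2)))"
    by (intro AE_I2) (simp add: power_mult_distrib[symmetric])
qed measurable

lemma mu3_square_integrable:
  "integrable (\<mu> \<Otimes>\<^sub>M (\<mu> \<Otimes>\<^sub>M \<mu>)) (\<lambda>y. (a + (b * fst y + (c * fst (snd y) + d * snd (snd y))))\<^sup>2)"
proof (rule Bochner_Integration.integrable_bound)
  \<comment> \<open>A function of the last two coordinates is integrated over the pair as the first
    marginal of \<open>(\<mu> \<Otimes>\<^sub>M \<mu>) \<Otimes>\<^sub>M \<mu>\<close>, followed by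
    an exchange of the two factors.\<close>
  interpret P3': pair_prob_space "\<mu> \<Otimes>\<^sub>M \<mu>" \<mu> ..
  have "integrable (distr (\<mu> \<Otimes>\<^sub>M (\<mu> \<Otimes>\<^sub>M \<mu>)) \<mu> fst) (\<lambda>x. x\<^sup>2)" using sq by (simp add: P2.P.distr_pair_fst)
  then have 1: "integrable (\<mu> \<Otimes>\<^sub>M (\<mu> \<Otimes>\<^sub>M \<mu>)) (\<lambda>y. (fst y)\<^sup>2)" by (subst (asm) integrable_distr_eq) auto
  have "integrable (distr ((\<mu> \<Otimes>\<^sub>M \<mu>) \<Otimes>\<^sub>M \<mu>) (\<mu> \<Otimes>\<^sub>M \<mu>) fst) (\<lambda>y. (c * fst y + d * snd y)\<^sup>2)"
    using mu2_square_integrable[of 0 c d] by (simp add: distr_pair_fst)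
  then have "integrable ((\<mu> \<Otimes>\<^sub>M \<mu>) \<Otimes>\<^sub>M \<mu>) (\<lambda>y. (c * fst (fst y) + d * snd (fst y))\<^sup>2)" by (subst (asm) integrable_distr_eq) auto
  from P3'.integrable_product_swap[OF this]
  have 2: "integrable (\<mu> \<Otimes>\<^sub>M (\<mu> \<Otimes>\<^sub>M \<mu>)) (\<lambda>y. (c * fst (snd y) + d * snd (snd y))\<^sup>2)"
    by (simp add: case_prod_beta')
  show "integrable (\<mu> \<Otimes>\<^sub>M (\<mu> \<Otimes>\<^sub>M \<mu>)) (\<lambda>y. 3 * (a\<^sup>2 + (b\<^sup>2 * (fst y)\<^sup>2 + (c * fst (snd y) + d * snd (snd y))\<^sup>2)))"
    by (intro integrable_mult_right Bochner_Integration.integrable_add 1 2) simp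
  have "(x + (y + z))\<^sup>2 \<le> 3 * (x\<^sup>2 + (y\<^sup>2 + z\<^sup>2))" for x y z :: real
    using zero_le_power2[of "x - y"] zero_le_power2[of "x - z"] zero_le_power2[of "y - z"]
    by (simp add: power2_eq_square algebra_simps)
  then show "AE y in \<mu> \<Otimes>\<^sub>M (\<mu> \<Otimes>\<^sub>M \<mu>). norm ((a + (b * fst y + (c * fst (snd y) + d * snd (snd y))))\<^sup>2)
      \<le> norm (3 * (a\<^sup>2 + (b\<^sup>2 * (fst y)\<^sup>2 + (c * fst (snd y) + d * snd (snd y))\<^sup>2)))"
    by (intro AE_I2) (simp add: power_mult_distrib[symmetric])
qed measurable

lemma mu3_square_integral:
  "(LINT y|(\<mu> \<Otimes>\<^sub>M (\<mu> \<Otimes>\<^sub>M \<mu>)). (a + (b * fst y + (c * fst (snd y) + d * snd (snd y))))\<^sup>2) =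
    a\<^sup>2 + (b\<^sup>2 + c\<^sup>2 + d\<^sup>2) * (LINT x|\<mu>. x\<^sup>2)"
proof -
  let ?v = "LINT x|\<mu>. x\<^sup>2"
  have two: "(LINT y|(\<mu> \<Otimes>\<^sub>M \<mu>). (a + (c * fst y + d * snd y))\<^sup>2) = a\<^sup>2 + c\<^sup>2 * ?v + d\<^sup>2 * ?v" for a
  proof -
    have "(LINT y|(\<mu> \<Otimes>\<^sub>M \<mu>). (a + (c * fst y + d * snd y))\<^sup>2) = (LINT x|\<mu>. LINT y|\<mu>. ((a + c * x) + d * y)\<^sup>2)"
      using P2.integral_fst'[OF mu2_square_integrable[of a c d]] by (simp add: add.assoc)
    also have "\<dots> = (LINT x|\<mu>. (a + c * x)\<^sup>2 + d\<^sup>2 * ?v)" by (simp only: mu_affine_square)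
    also have "\<dots> = (LINT x|\<mu>. (a + c * x)\<^sup>2) + (LINT x|\<mu>. d\<^sup>2 * ?v)"
    proof (rule Bochner_Integration.integral_add)
      have "integrable \<mu> (\<lambda>x. (a\<^sup>2 + 2 * a * c * x) + c\<^sup>2 * x\<^sup>2)"
        by (intro Bochner_Integration.integrable_add integrable_mult_right sq mu_integrable_id integrable_const)
      then show "integrable \<mu> (\<lambda>x. (a + c * x)\<^sup>2)" by (simp add: power2_eq_square algebra_simps)
    qed simp
    finally show ?thesis by (simp add: mu_affine_square prob_space)
  qed
  have "(LINT y|(\<mu> \<Otimes>\<^sub>M (\<mu> \<Otimes>\<^sub>M \<mu>)). (a + (b * fst y + (c * fst (snd y) + d * snd (snd y))))\<^sup>2) =
    (LINT x|\<mu>. LINT y|(\<mu> \<Otimes>\<^sub>M \<mu>). ((a + b * x) + (c * fst y + d * snd y))\<^sup>2)"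
    using P3.integral_fst'[OF mu3_square_integrable[of a b c d]] by (simp add: add.assoc)
  also have "\<dots> = (LINT x|\<mu>. (a + b * x)\<^sup>2 + (c\<^sup>2 * ?v + d\<^sup>2 * ?v))" by (simp only: two) (simp only: add.assoc)
  also have "\<dots> = (LINT x|\<mu>. (a + b * x)\<^sup>2) + (LINT x|\<mu>. c\<^sup>2 * ?v + d\<^sup>2 * ?v)"
  proof (rule Bochner_Integration.integral_add)
    have "integrable \<mu> (\<lambda>x. (a\<^sup>2 + 2 * a * b * x) + b\<^sup>2 * x\<^sup>2)"
      by (intro Bochner_Integration.integrable_add integrable_mult_right sq mu_integrable_id integrable_const)
    then show "integrable \<mu> (\<lambda>x. (a + b * x)\<^sup>2)" by (simp add: power2_eq_square algebra_simps)
  qed simp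
  finally show ?thesis by (simp add: mu_affine_square prob_space) (simp add: algebra_simps)
qed

text \<open>Centring and independence remove the mixed terms, so the second moment \<open>v\<close>
  satisfies \<open>v = 7/20 - 3/100 * pi\<^sup>2 + v / 2\<close>. This is the equation that
  determines the limit of the variances, hence second moments converge to that of the limit
  law.\<close>

lemma fixed_point_second_moment:
  assumes fp: "\<mu> = rde_rhs_law \<mu>"
  shows "(LINT x|\<mu>. x\<^sup>2) = 7/10 - 3/50 * pi\<^sup>2"
proof -
  let ?v = "LINT x|\<mu>. x\<^sup>2"
  have "integrable (rde_rhs_law \<mu>) (\<lambda>x. x\<^sup>2)" using sq fp by simp
  then have int: "integrable (spacings_law \<Otimes>\<^sub>M (\<mu> \<Otimes>\<^sub>M (\<mu> \<Otimes>\<^sub>M \<mu>))) (\<lambda>p. (rde_sum (fst p) (snd p))\<^sup>2)"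
    unfolding rde_rhs_law_eq by (subst (asm) integrable_distr_eq) auto
  have "?v = (LINT x|rde_rhs_law \<mu>. x\<^sup>2)" using fp by simp
  also have "\<dots> = (LINT p|(spacings_law \<Otimes>\<^sub>M (\<mu> \<Otimes>\<^sub>M (\<mu> \<Otimes>\<^sub>M \<mu>))). (rde_sum (fst p) (snd p))\<^sup>2)"
    unfolding rde_rhs_law_eq by (subst integral_distr) auto
  also have "\<dots> = (LINT z|unif2. LINT y|(\<mu> \<Otimes>\<^sub>M (\<mu> \<Otimes>\<^sub>M \<mu>)). (rde_sum (spacings z) y)\<^sup>2)"
    using int by (rule integral_over_spacings)
  also have "\<dots> = (LINT z|unif2. (toll_limit (gap1 z) (gap2 z) (gap3 z))\<^sup>2 + ((gap1 z)\<^sup>2 + (gap2 z)\<^sup>2 + (gap3 z)\<^sup>2) * ?v)"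
    unfolding rde_sum_def mu3_square_integral fst_conv snd_conv ..
  also have "\<dots> = (LINT z|unif2. (toll_limit (gap1 z) (gap2 z) (gap3 z))\<^sup>2) +
      (LINT z|unif2. ((gap1 z)\<^sup>2 + (gap2 z)\<^sup>2 + (gap3 z)\<^sup>2) * ?v)"
  proof (rule Bochner_Integration.integral_add)
    show "integrable unif2 (\<lambda>z. (toll_limit (gap1 z) (gap2 z) (gap3 z))\<^sup>2)"
    proof (rule unif_pair.P.integrable_const_bound[where B = "6\<^sup>2"])
      show "AE z in unif2. norm ((toll_limit (gap1 z) (gap2 z) (gap3 z))\<^sup>2) \<le> 6\<^sup>2"
        using AE_unif_pair
      proof eventually_elim
        case (elim z)
        then have "\<bar>toll_limit (gap1 z) (gap2 z) (gap3 z)\<bar> \<le> 6" by (intro toll_limit_bound) auto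
        from power_mono[OF this, of 2] show ?case by simp
      qed
    qed measurable
    show "integrable unif2 (\<lambda>z. ((gap1 z)\<^sup>2 + (gap2 z)\<^sup>2 + (gap3 z)\<^sup>2) * ?v)"
      by (intro integrable_mult_left gap_squares)
  qed
  also have "\<dots> = 7/20 - 3/100 * pi\<^sup>2 + 1/2 * ?v"
    unfolding integral_mult_left_zero gaps_second_moment toll_limit_second_moment ..
  finally show ?thesis by simp
qed

end

end

section \<open>Uniqueness and existence of the fixed point\<close>

lemma rde_solution_unique:
  assumes "rde_solution \<mu>" "rde_solution \<nu>"
  shows "\<mu> = \<nu>"
proof -
  have rd: "real_distribution \<mu>" "real_distribution \<nu>"
    and sq: "integrable \<mu> (\<lambda>x. x\<^sup>2)" "integrable \<nu> (\<lambda>x. x\<^sup>2)"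
    and mean: "(LINT x|\<mu>. x) = 0" "(LINT x|\<nu>. x) = 0"
    and fp: "\<mu> = rde_rhs_law \<mu>" "\<nu> = rde_rhs_law \<nu>"
    using assms by (auto simp: rde_solution_def)
  \<comment> \<open>The starting constant compares both characteristic functions with 1; it is
    finite because both laws are centred with finite second moments.\<close>
  define C where "C = (LINT x|\<mu>. x\<^sup>2) / 2 + (LINT x|\<nu>. x\<^sup>2) / 2"
  have bound: "cmod (char \<mu> t - char \<nu> t) \<le> C / 2 ^ m * t\<^sup>2" for m t
  proof (induction m arbitrary: t)
    case 0
    have "cmod (1 - char \<nu> t) \<le> (LINT x|\<nu>. x\<^sup>2) / 2 * t\<^sup>2"
      using char_near_one[OF rd(2) sq(2) mean(2), of t] by (simp only: norm_minus_commute)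
    then have "cmod (char \<mu> t - char \<nu> t) \<le> (LINT x|\<mu>. x\<^sup>2) / 2 * t\<^sup>2 + (LINT x|\<nu>. x\<^sup>2) / 2 * t\<^sup>2"
      by (rule norm_diff_triangle_le[OF char_near_one[OF rd(1) sq(1) mean(1)]])
    then show ?case by (simp add: C_def distrib_right)
  next
    case (Suc m)
    have "cmod (rde_char (\<lambda>_. char \<mu>) (\<lambda>_. char \<mu>) (\<lambda>_. char \<mu>) t - rde_char (\<lambda>_. char \<nu>) (\<lambda>_. char \<nu>) (\<lambda>_. char \<nu>) t)
        \<le> C / 2 ^ m / 2 * t\<^sup>2"
      by (rule rde_char_contract)
        (use Suc.IH rd in \<open>auto intro: real_distribution.char_measurable real_distribution.cmod_char_le_1\<close>)
    then show ?case
      using char_rde_rhs_law[OF rd(1), of t] char_rde_rhs_law[OF rd(2), of t] fp by (simp add: mult.commute)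
  qed
  have "char \<mu> t = char \<nu> t" for t
  proof -
    have "(\<lambda>m. C * t\<^sup>2 / 2 ^ m) \<longlonglongrightarrow> 0" by (rule LIMSEQ_divide_realpow_zero) simp
    then have "cmod (char \<mu> t - char \<nu> t) \<le> 0"
      by (rule LIMSEQ_le_const) (use bound[of t] in \<open>auto simp: mult.commute\<close>)
    then show ?thesis by simp
  qed
  then show ?thesis by (intro Levy_uniqueness rd) auto
qed

text \<open>The weak limit of the scaled counts is itself the solution: letting \<open>n\<close>
  grow in the approximate recurrence gives the equation for characteristic functions, which
  determine the law. Its mean and square integrability come from the uniform variance bound.\<close>

lemma rde_solution_exists:
  assumes M: "0 < M"
  obtains \<mu> where "rde_solution \<mu>" "weak_conv_m (Zlaw M) \<mu>"
proof -
  obtain \<mu> where \<mu>: "real_distribution \<mu>" and w: "weak_conv_m (Zlaw M) \<mu>" using Zlaw_limit[OF M] by blast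
  have lim: "(\<lambda>n. Zchar M n t) \<longlonglongrightarrow> char \<mu> t" for t
    by (rule levy_continuity1[OF real_distribution_Zlaw \<mu> w])
  obtain \<epsilon> where \<epsilon>: "\<epsilon> \<longlonglongrightarrow> 0" "\<And>n t. max 4 (Suc M) \<le> n \<Longrightarrow> cmod (Zchar M n t - rde_char_blocks M n t) \<le> (1 + \<bar>t\<bar>) * \<epsilon> n"
    using Zchar_approx[OF M] by blast
  have "char \<mu> t = char (rde_rhs_law \<mu>) t" for t
  proof -
    have "(\<lambda>n. Zchar M n t - rde_char_blocks M n t) \<longlonglongrightarrow> 0"
    proof (rule Lim_null_comparison)
      show "\<forall>\<^sub>F n in sequentially. norm (Zchar M n t - rde_char_blocks M n t) \<le> (1 + \<bar>t\<bar>) * \<epsilon> n"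
        using eventually_ge_at_top[of "max 4 (Suc M)"] by eventually_elim (rule \<epsilon>(2))
      show "(\<lambda>n. (1 + \<bar>t\<bar>) * \<epsilon> n) \<longlonglongrightarrow> 0" using \<epsilon>(1) by (rule tendsto_mult_right_zero)
    qed
    moreover have "(\<lambda>n. Zchar M n t - rde_char_blocks M n t) \<longlonglongrightarrow>
        char \<mu> t - rde_char (\<lambda>_. char \<mu>) (\<lambda>_. char \<mu>) (\<lambda>_. char \<mu>) t"
      by (intro tendsto_diff lim rde_char_blocks_tendsto[OF \<mu>])
    ultimately have "char \<mu> t - rde_char (\<lambda>_. char \<mu>) (\<lambda>_. char \<mu>) (\<lambda>_. char \<mu>) t = 0"
      by (rule LIMSEQ_unique[symmetric])
    then show ?thesis by (simp add: char_rde_rhs_law[OF \<mu>])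
  qed
  then have "\<mu> = rde_rhs_law \<mu>"
    by (intro Levy_uniqueness \<mu> real_distribution_rde_rhs_law ext)
  then have "rde_solution \<mu>"
    using \<mu> weak_limit_moments[OF M \<mu> w] by (simp add: rde_solution_def)
  then show thesis using w by (rule that)
qed

theorem theorem4p4:
  fixes M :: nat
    and S :: "nat \<Rightarrow> (int \<Rightarrow> int) \<Rightarrow> real"
    and ES :: "nat \<Rightarrow> real"
    and VarS :: "nat \<Rightarrow> real"
    and Z :: "nat \<Rightarrow> (int \<Rightarrow> int) \<Rightarrow> real"
    and \<sigma>2 :: real
  assumes M: "M \<ge> 1"
  defines "S \<equiv> swap_count M"
    and "ES \<equiv> (\<lambda>n. measure_pmf.expectation (random_perm n) (S n))"
    and "VarS \<equiv> (\<lambda>n. measure_pmf.variance (random_perm n) (S n))"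
    and "Z \<equiv> (\<lambda>n \<pi>. (S n \<pi> - ES n) / real n)"
    and "\<sigma>2 \<equiv> 7/10 - 3/50 * pi\<^sup>2"
  shows "(\<exists>!\<mu>. rde_solution \<mu>) \<and>
         (\<forall>\<mu>. rde_solution \<mu> \<longrightarrow>
            weak_conv_m (\<lambda>n. distr (measure_pmf (random_perm n)) borel (Z n)) \<mu> \<and>
            (\<lambda>n. measure_pmf.expectation (random_perm n) (\<lambda>\<pi>. (Z n \<pi>)\<^sup>2))
              \<longlonglongrightarrow> (LINT x|\<mu>. x\<^sup>2)) \<and>
         VarS \<sim>[at_top] (\<lambda>n. \<sigma>2 * (real n)\<^sup>2) \<and>
         0.10782 \<le> \<sigma>2 \<and> \<sigma>2 < 0.10783"
proof -
  have M0: "0 < M" using M by simp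
  have Z: "Z n = Zn M n" for n
    by (simp add: fun_eq_iff Z_def ES_def S_def Zn_def mean_swaps_def)
  obtain \<mu>0 where \<mu>0: "rde_solution \<mu>0" "weak_conv_m (Zlaw M) \<mu>0" using rde_solution_exists[OF M0] by blast
  \<comment> \<open>Uniqueness transfers the weak convergence, known for the limit law
    \<open>\<mu>0\<close>, to every solution.\<close>
  have uniq: "\<mu> = \<mu>0" if "rde_solution \<mu>" for \<mu> using rde_solution_unique[OF that \<mu>0(1)] .
  have moment: "(LINT x|\<mu>0. x\<^sup>2) = \<sigma>2"
    using \<mu>0(1) fixed_point_second_moment[of \<mu>0] by (auto simp: rde_solution_def \<sigma>2_def)
  have second: "(\<lambda>n. pavg n (\<lambda>\<pi>. (Zn M n \<pi>)\<^sup>2)) \<longlonglongrightarrow> \<sigma>2"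
    using Zvar_tendsto[OF M0] by (simp add: Zvar_def[abs_def] \<sigma>2_def)
  have pi: "pi\<^sup>2 \<le> (31415927 / 10 ^ 7)\<^sup>2" "(314159 / 10 ^ 5)\<^sup>2 \<le> pi\<^sup>2"
    using pi_approx by (auto intro!: power_mono)
  have \<sigma>2: "0.10782 \<le> \<sigma>2" "\<sigma>2 < 0.10783"
    using pi unfolding \<sigma>2_def by (simp_all add: power2_eq_square)
  have "VarS \<sim>[at_top] (\<lambda>n. \<sigma>2 * (real n)\<^sup>2)"
  proof (rule asymp_equivI')
    have "(\<lambda>n. Zvar M n / \<sigma>2) \<longlonglongrightarrow> \<sigma>2 / \<sigma>2"
      using Zvar_tendsto[OF M0] \<sigma>2 by (intro tendsto_divide tendsto_const) (auto simp: \<sigma>2_def)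
    then have "(\<lambda>n. Zvar M n / \<sigma>2) \<longlonglongrightarrow> 1" using \<sigma>2 by simp
    moreover have "\<forall>\<^sub>F n in sequentially. Zvar M n / \<sigma>2 = VarS n / (\<sigma>2 * (real n)\<^sup>2)"
      using eventually_gt_at_top[of 0]
    proof eventually_elim
      case (elim n)
      have "VarS n = pavg n (\<lambda>\<pi>. (real n)\<^sup>2 * (Zn M n \<pi>)\<^sup>2)"
        unfolding VarS_def S_def using elim by (simp add: Zn_def mean_swaps_def power_divide)
      then have "VarS n = (real n)\<^sup>2 * Zvar M n" by (simp add: Zvar_def)
      then show ?case using elim by simp
    qed
    ultimately show "(\<lambda>n. VarS n / (\<sigma>2 * (real n)\<^sup>2)) \<longlonglongrightarrow> 1" by (rule Lim_transform_eventually)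
  qed
  then show ?thesis
    using \<mu>0 uniq moment second \<sigma>2 unfolding Z by blast
qed

end
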